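(* For all positive integers $a$, we have $$\mathrm{grFrob}(R(\Pi_{(2^a)});q)=\sum_{\substack{\lambda\vdash 2a\\ \lambda\text{ is even}}} q^{\frac{2a-\lambda_1}{2}}\cdot s_\lambda ,$$ and the defining ideal $\mathrm{gr}\,\mathbf{I}(\Pi_{(2^a)})\subseteq \mathbb{C}\big[\mathbf{x}_{\binom{[2a]}{2}}\big]$ of $R(\Pi_{(2^a)})$ is generated by - all products $x_S\cdot x_T$ for $S,T\in\binom{[2a]}{2}$ with $S\cap T\neq\varnothing$ ($S$ may equal $T$), and - all sums $\sum_{j\in[2a],\, j\neq i} x_{\{i,j\}}$ for $i\in[2a]$.
   Context: Let $[n]=\{1,\dots,n\}$ and let $\binom{[n]}{2}$ be the set of 2-element subsets of $[n]$. Let $\mathbb{C}\big[\mathbf{x}_{\binom{[n]}{2}}\big]$ be the polynomial ring in the variables $x_{\{i,j\}}=x_{\{j,i\}}$ indexed by $\binom{[n]}{2}$; it is the coordinate ring of $\mathbb{C}^{\binom{[n]}{2}}$. The symmetric group $\mathfrak{S}_n$ acts on it by the graded algebra automorphisms determined by $w\cdot x_{\{i,j\}}=x_{\{w(i),w(j)\}}$. An unordered set partition $\pi$ of $[n]$ is identified with the point $\mathbf{z}\in\mathbb{C}^{\binom{[n]}{2}}$ with $z_{\{i,j\}}=1$ if $i,j$ lie in the same block of $\pi$, and $z_{\{i,j\}}=0$ otherwise. For $\lambda\vdash n$, $\Pi_\lambda\subseteq\mathbb{C}^{\binom{[n]}{2}}$ is the finite set of (points identified with) unordered set partitions of $[n]$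 whose multiset of block sizes is given by the parts of $\lambda$. The partition $(b^a)$ is $(b,b,\dots,b)$ with $a$ copies of $b$; so $\Pi_{(2^a)}$ consists of set partitions of $[2a]$ into $a$ blocks of size $2$. Orbit harmonics: for a finite set $\mathcal{Z}\subseteq\mathbb{C}^{\binom{[n]}{2}}$, $\mathbf{I}(\mathcal{Z})$ is the ideal of polynomials vanishing on $\mathcal{Z}$; for a nonzero polynomial $f$, $\tau(f)$ is its top-degree homogeneous component; $\mathrm{gr}\,\mathbf{I}(\mathcal{Z})=\langle\tau(f): 0\ne f\in\mathbf{I}(\mathcal{Z})\rangle$; and $R(\mathcal{Z})=\mathbb{C}\big[\mathbf{x}_{\binom{[n]}{2}}\big]/\mathrm{gr}\,\mathbf{I}(\mathcal{Z})$. If $\mathcal{Z}$ is $\mathfrak{S}_n$-stable, $R(\mathcal{Z})$ is a graded $\mathfrak{S}_n$-module. If an $\mathfrak{S}_n$-module $V\cong\bigoplus_{\lambda\vdash n}(V^\lambda)^{\oplus c_\lambda}$, with $V^\lambda$ the Specht modules (irreducibles), then $\mathrm{Frob}(V)=\sum_\lambda c_\lambda s_\lambda$ ($s_\lambda$ the Schur function). For graded $V=\bigoplus_d V_d$, $\mathrm{grFrob}(V;q)=\sum_d q^d\,\mathrm{Frob}(V_d)$. A partition is even if all of its parts are even. *)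

theory Defs
  imports
    "HOL-Library.Poly_Mapping"
    "HOL-Library.Function_Algebras"
    "HOL-Library.FuncSet"
    "HOL-Library.Disjoint_Sets"
    "HOL-Library.Multiset"
    "HOL-Library.Ramsey"
    "HOL-Combinatorics.Permutations"
    "HOL-Computational_Algebra.Polynomial"
    "HOL-Algebra.Module"
    "HOL-Algebra.QuotRing"
begin

section \<open>Polynomials in the variables indexed by 2-subsets\<close>

text \<open>A monomial is a finitely supported exponent vector. The variable of the pair \<open>{i, j}\<close> is
  indexed by the set \<open>{i, j}\<close> itself, so that the two orders of \<open>i\<close> and \<open>j\<close> are not distinguished.\<close>

type_synonym mono = "nat set \<Rightarrow>\<^sub>0 nat"
type_synonym cpoly = "mono \<Rightarrow>\<^sub>0 complex"

abbreviation pairs :: "nat \<Rightarrow> nat set set" where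
  "pairs n \<equiv> nsets {1..n} 2"

definition Var :: "nat set \<Rightarrow> cpoly" where
  "Var S = Poly_Mapping.single (Poly_Mapping.single S 1) 1"

definition Const :: "complex \<Rightarrow> cpoly" where
  "Const c = Poly_Mapping.single 0 c"

definition pair_poly_ring :: "nat \<Rightarrow> cpoly ring" where
  "pair_poly_ring n =
     \<lparr> carrier = {f. \<forall>m \<in> Poly_Mapping.keys f. Poly_Mapping.keys m \<subseteq> pairs n},
       mult = (*), one = 1, zero = 0, add = (+) \<rparr>"

text \<open>The ring homomorphism that is \<open>h\<close> on the coefficients and sends the variable \<open>S\<close> to \<open>g S\<close>.\<close>

definition poly_hom :: "(complex \<Rightarrow> 'r) \<Rightarrow> (nat set \<Rightarrow> 'r) \<Rightarrow> cpoly \<Rightarrow> 'r::comm_semiring_1" where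
  "poly_hom h g f =
     (\<Sum>m \<in> Poly_Mapping.keys f. h (Poly_Mapping.lookup f m) *
        (\<Prod>S \<in> Poly_Mapping.keys m. g S ^ Poly_Mapping.lookup m S))"

definition eval_at :: "(nat set \<Rightarrow> complex) \<Rightarrow> cpoly \<Rightarrow> complex" where
  "eval_at z = poly_hom (\<lambda>c. c) z"

definition perm_poly :: "(nat \<Rightarrow> nat) \<Rightarrow> cpoly \<Rightarrow> cpoly" where
  "perm_poly w = poly_hom Const (\<lambda>S. Var (w ` S))"

definition mono_degree :: "mono \<Rightarrow> nat" where
  "mono_degree m = (\<Sum>S \<in> Poly_Mapping.keys m. Poly_Mapping.lookup m S)"

definition hom_component :: "nat \<Rightarrow> cpoly \<Rightarrow> cpoly" where
  "hom_component d f =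
     (\<Sum>m \<in> {m \<in> Poly_Mapping.keys f. mono_degree m = d}.
        Poly_Mapping.single m (Poly_Mapping.lookup f m))"

definition homogeneous :: "nat \<Rightarrow> cpoly \<Rightarrow> bool" where
  "homogeneous d f \<longleftrightarrow> (\<forall>m \<in> Poly_Mapping.keys f. mono_degree m = d)"

text \<open>Only meaningful for \<open>f \<noteq> 0\<close>.\<close>

definition top_component :: "cpoly \<Rightarrow> cpoly" where
  "top_component f = hom_component (Max (mono_degree ` Poly_Mapping.keys f)) f"

section \<open>Orbit harmonics\<close>

text \<open>Points of the affine space are functions in \<open>pairs n \<rightarrow>\<^sub>E UNIV\<close>.\<close>

definition vanishing_ideal :: "nat \<Rightarrow> (nat set \<Rightarrow> complex) set \<Rightarrow> cpoly set" where
  "vanishing_ideal n Z = {f \<in> carrier (pair_poly_ring n). \<forall>z \<in> Z. eval_at z f = 0}"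

definition gr_ideal :: "nat \<Rightarrow> (nat set \<Rightarrow> complex) set \<Rightarrow> cpoly set" where
  "gr_ideal n Z =
     Idl\<^bsub>pair_poly_ring n\<^esub> {top_component f | f. f \<in> vanishing_ideal n Z \<and> f \<noteq> 0}"

definition is_partition :: "nat list \<Rightarrow> nat \<Rightarrow> bool" where
  "is_partition \<mu> n \<longleftrightarrow> sorted_wrt (\<ge>) \<mu> \<and> 0 \<notin> set \<mu> \<and> sum_list \<mu> = n"

definition set_partition_point :: "nat \<Rightarrow> nat set set \<Rightarrow> nat set \<Rightarrow> complex" where
  "set_partition_point n \<pi> = (\<lambda>S \<in> pairs n. if \<exists>B \<in> \<pi>. S \<subseteq> B then 1 else 0)"

definition partition_locus :: "nat \<Rightarrow> nat list \<Rightarrow> (nat set \<Rightarrow> complex) set" where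
  "partition_locus n \<mu> =
     {set_partition_point n \<pi> | \<pi>.
        partition_on {1..n} \<pi> \<and> image_mset card (mset_set \<pi>) = mset \<mu>}"

section \<open>Modules over the symmetric group\<close>

text \<open>A complex vector space together with the action of the permutations of \<open>{1..n}\<close>. The fields
  \<open>mult\<close> and \<open>one\<close>, which every module record inherits from rings, play no role.\<close>

record 'b sym_module = "(complex, 'b) module" +
  act :: "(nat \<Rightarrow> nat) \<Rightarrow> 'b \<Rightarrow> 'b"

definition sym_module_iso :: "nat \<Rightarrow> 'b sym_module \<Rightarrow> 'c sym_module \<Rightarrow> bool" where
  "sym_module_iso n V W \<longleftrightarrow>
     (\<exists>\<phi>. bij_betw \<phi> (carrier V) (carrier W) \<and>
        (\<forall>x \<in> carrier V. \<forall>y \<in> carrier V. \<phi> (x \<oplus>\<^bsub>V\<^esub> y) = \<phi> x \<oplus>\<^bsub>W\<^esub> \<phi> y) \<and>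
        (\<forall>c. \<forall>x \<in> carrier V. \<phi> (c \<odot>\<^bsub>V\<^esub> x) = c \<odot>\<^bsub>W\<^esub> \<phi> x) \<and>
        (\<forall>w. w permutes {1..n} \<longrightarrow> (\<forall>x \<in> carrier V. \<phi> (act V w x) = act W w (\<phi> x))))"

text \<open>Finite direct sums, for a finite index set \<open>I\<close>.\<close>

definition direct_sum :: "'i set \<Rightarrow> ('i \<Rightarrow> 'b sym_module) \<Rightarrow> ('i \<Rightarrow> 'b) sym_module" where
  "direct_sum I V =
     \<lparr> carrier = (\<Pi>\<^sub>E i \<in> I. carrier (V i)),
       mult = undefined, one = undefined,
       zero = (\<lambda>i \<in> I. \<zero>\<^bsub>V i\<^esub>),
       add = (\<lambda>x y. \<lambda>i \<in> I. x i \<oplus>\<^bsub>V i\<^esub> y i),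
       smult = (\<lambda>c x. \<lambda>i \<in> I. c \<odot>\<^bsub>V i\<^esub> x i),
       act = (\<lambda>w x. \<lambda>i \<in> I. act (V i) w (x i)) \<rparr>"

section \<open>Specht modules\<close>

definition cells :: "nat list \<Rightarrow> (nat \<times> nat) set" where
  "cells \<mu> = {(i, j). i < length \<mu> \<and> j < \<mu> ! i}"

definition is_tableau :: "nat list \<Rightarrow> (nat \<times> nat \<Rightarrow> nat) \<Rightarrow> bool" where
  "is_tableau \<mu> t \<longleftrightarrow> bij_betw t (cells \<mu>) {1..sum_list \<mu>}"

text \<open>A tabloid (row equivalence class of a tableau) is encoded by the map sending \<open>i\<close> to the set of
  entries of the \<open>i\<close>-th row.\<close>

type_synonym tabloid = "nat \<Rightarrow> nat set"

definition tabloid_of :: "nat list \<Rightarrow> (nat \<times> nat \<Rightarrow> nat) \<Rightarrow> tabloid" where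
  "tabloid_of \<mu> t = (\<lambda>i. t ` {(i', j) \<in> cells \<mu>. i' = i})"

definition column_stabilizer :: "nat list \<Rightarrow> (nat \<times> nat \<Rightarrow> nat) \<Rightarrow> (nat \<Rightarrow> nat) set" where
  "column_stabilizer \<mu> t =
     {q. q permutes {1..sum_list \<mu>} \<and>
         (\<forall>j. q ` t ` {(i, j') \<in> cells \<mu>. j' = j} = t ` {(i, j') \<in> cells \<mu>. j' = j})}"

definition polytabloid :: "nat list \<Rightarrow> (nat \<times> nat \<Rightarrow> nat) \<Rightarrow> tabloid \<Rightarrow>\<^sub>0 complex" where
  "polytabloid \<mu> t =
     (\<Sum>q \<in> column_stabilizer \<mu> t.
        Poly_Mapping.single (tabloid_of \<mu> (q \<circ> t)) (of_int (sign q)))"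

definition scale_tabloids :: "complex \<Rightarrow> (tabloid \<Rightarrow>\<^sub>0 complex) \<Rightarrow> tabloid \<Rightarrow>\<^sub>0 complex" where
  "scale_tabloids c = Poly_Mapping.map ((*) c)"

definition perm_tabloids :: "(nat \<Rightarrow> nat) \<Rightarrow> (tabloid \<Rightarrow>\<^sub>0 complex) \<Rightarrow> tabloid \<Rightarrow>\<^sub>0 complex" where
  "perm_tabloids w v =
     (\<Sum>T \<in> Poly_Mapping.keys v. Poly_Mapping.single (\<lambda>i. w ` T i) (Poly_Mapping.lookup v T))"

definition specht :: "nat list \<Rightarrow> (tabloid \<Rightarrow>\<^sub>0 complex) sym_module" where
  "specht \<mu> =
     \<lparr> carrier = Modules.module.span scale_tabloids {polytabloid \<mu> t | t. is_tableau \<mu> t},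
       mult = undefined, one = undefined, zero = 0, add = (+),
       smult = scale_tabloids, act = perm_tabloids \<rparr>"

section \<open>Schur functions and the Frobenius image\<close>

text \<open>A symmetric function is given by its coefficients on the monomials in the variables
  \<open>x\<^sub>0, x\<^sub>1, x\<^sub>2, \<dots>\<close>. Only the additive structure on this type is used (the pointwise
  multiplication it carries as a function type is not the product of symmetric functions).\<close>

type_synonym symfun = "(nat \<Rightarrow>\<^sub>0 nat) \<Rightarrow> int"

definition semistandard :: "nat list \<Rightarrow> (nat \<times> nat \<Rightarrow> nat) \<Rightarrow> bool" where
  "semistandard \<mu> T \<longleftrightarrow>
     T \<in> extensional (cells \<mu>) \<and>
     (\<forall>i j. (i, Suc j) \<in> cells \<mu> \<longrightarrow> T (i, j) \<le> T (i, Suc j)) \<and>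
     (\<forall>i j. (Suc i, j) \<in> cells \<mu> \<longrightarrow> T (i, j) < T (Suc i, j))"

definition schur :: "nat list \<Rightarrow> symfun" where
  "schur \<mu> =
     (\<lambda>\<alpha>. int (card {T. semistandard \<mu> T \<and> (\<Sum>c \<in> cells \<mu>. Poly_Mapping.single (T c) 1) = \<alpha>}))"

definition Frob :: "nat \<Rightarrow> 'b sym_module \<Rightarrow> symfun" where
  "Frob n V =
     (THE F. \<exists>c :: nat list \<Rightarrow> nat.
        sym_module_iso n V
          (direct_sum {(\<mu>, k). is_partition \<mu> n \<and> k < c \<mu>} (\<lambda>(\<mu>, k). specht \<mu>)) \<and>
        F = (\<Sum>\<mu> | is_partition \<mu> n. (\<lambda>\<alpha>. int (c \<mu>) * schur \<mu> \<alpha>)))"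

text \<open>A graded module is given by its homogeneous components; the result is a polynomial in \<open>q\<close> with
  symmetric function coefficients. All but finitely many components must be zero.\<close>

definition grFrob :: "nat \<Rightarrow> (nat \<Rightarrow> 'b sym_module) \<Rightarrow> symfun poly" where
  "grFrob n V = (\<Sum>d | carrier (V d) \<noteq> {\<zero>\<^bsub>V d\<^esub>}. monom (Frob n (V d)) d)"

section \<open>The graded module of a locus\<close>

definition orbit_ring :: "nat \<Rightarrow> (nat set \<Rightarrow> complex) set \<Rightarrow> cpoly set ring" where
  "orbit_ring n Z = pair_poly_ring n Quot gr_ideal n Z"

text \<open>The degree \<open>d\<close> part of the quotient ring as a module over the symmetric group. If \<open>Z\<close> is stable
  under permutations, then so is \<open>gr_ideal n Z\<close>, and the elementwise image of the coset of \<open>f\<close> under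
  \<open>perm_poly w\<close> is the coset of \<open>perm_poly w f\<close>.\<close>

definition orbit_component :: "nat \<Rightarrow> (nat set \<Rightarrow> complex) set \<Rightarrow> nat \<Rightarrow> cpoly set sym_module" where
  "orbit_component n Z d =
     \<lparr> carrier = {gr_ideal n Z +>\<^bsub>pair_poly_ring n\<^esub> f | f.
                    f \<in> carrier (pair_poly_ring n) \<and> homogeneous d f},
       mult = mult (orbit_ring n Z), one = one (orbit_ring n Z),
       zero = zero (orbit_ring n Z), add = add (orbit_ring n Z),
       smult = (\<lambda>c X. (gr_ideal n Z +>\<^bsub>pair_poly_ring n\<^esub> Const c) \<otimes>\<^bsub>orbit_ring n Z\<^esub> X),
       act = (\<lambda>w X. perm_poly w ` X) \<rparr>"

section \<open>Well-formedness\<close>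

text \<open>The generated ideals above are genuine ideals only because \<open>pair_poly_ring n\<close> is a ring
  (\<open>Idl\<close> would be the universal set otherwise).\<close>

lemma cring_pair_poly_ring: "cring (pair_poly_ring n)"
proof -
  let ?P = "pair_poly_ring n"
  have mult_closed: "f * g \<in> carrier ?P" if "f \<in> carrier ?P" "g \<in> carrier ?P" for f g
  proof -
    have "Poly_Mapping.keys m \<subseteq> pairs n" if m: "m \<in> Poly_Mapping.keys (f * g)" for m
    proof -
      obtain a b where ab: "m = a + b" "a \<in> Poly_Mapping.keys f" "b \<in> Poly_Mapping.keys g"
        using keys_mult[of f g] m by blast
      have "Poly_Mapping.keys a \<subseteq> pairs n" "Poly_Mapping.keys b \<subseteq> pairs n"
        using \<open>f \<in> carrier ?P\<close> \<open>g \<in> carrier ?P\<close> ab by (simp_all add: pair_poly_ring_def)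
      then show ?thesis
        unfolding ab(1) by (meson Poly_Mapping.keys_add Un_least subset_trans)
    qed
    then show ?thesis
      by (simp add: pair_poly_ring_def)
  qed
  have add_closed: "f + g \<in> carrier ?P" if "f \<in> carrier ?P" "g \<in> carrier ?P" for f g
    using that Poly_Mapping.keys_add[of f g] by (fastforce simp: pair_poly_ring_def)
  have uminus_closed: "- f \<in> carrier ?P" if "f \<in> carrier ?P" for f
    using that by (simp add: pair_poly_ring_def)
  have zero_closed: "0 \<in> carrier ?P" and one_closed: "1 \<in> carrier ?P"
    by (simp_all add: pair_poly_ring_def)
  have ops: "add ?P = (+)" "mult ?P = (*)" "zero ?P = 0" "one ?P = 1"
    by (simp_all add: pair_poly_ring_def)
  have "abelian_group ?P"
  proof (rule abelian_groupI)
    show "\<exists>y \<in> carrier ?P. y \<oplus>\<^bsub>?P\<^esub> x = \<zero>\<^bsub>?P\<^esub>" if "x \<in> carrier ?P" for x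
      using uminus_closed[OF that] unfolding ops by (metis add.left_inverse)
  qed (simp_all add: ops add_closed zero_closed add.assoc add.commute)
  moreover have "Group.comm_monoid ?P"
    by (rule comm_monoidI) (simp_all add: ops mult_closed one_closed mult.assoc mult.commute)
  ultimately show ?thesis
    by (rule cringI) (simp add: ops distrib_right)
qed

end

theory Submission
  imports Defs
begin

text \<open>Let \<open>n = 2a\<close>, let \<open>J\<close> be the ideal generated by the listed products and sums, and write \<open>x\<^sub>M\<close> for the
product of the variables of the edges of a matching \<open>M\<close>. Modulo the products only the \<open>x\<^sub>M\<close> survive,
so the degree \<open>d\<close> part of the quotient by \<open>J\<close> is the space of functions on the matchings with \<open>d\<close>
edges modulo the star relations, the coefficient vectors of \<open>x\<^sub>M \<Sum>\<^sub>j x_{ij}\<close>. Each class has exactly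
one representative orthogonal to the star relations; such functions are called harmonic. Both halves
of the theorem come from the study of harmonic functions.

\<^bold>\<open>The ideal.\<close> A polynomial with coefficients \<open>g M\<close> at the \<open>x\<^sub>M\<close> takes at the perfect matching \<open>P\<close> the
value \<open>spread g P\<close>, the sum of \<open>g\<close> over the matchings contained in \<open>P\<close>. If \<open>h\<close> is harmonic of degree
\<open>d\<close>, then \<open>spread h\<close> is orthogonal to \<open>spread g\<close> for all \<open>g\<close> that live on fewer than \<open>d\<close> edges, and the
square norm of \<open>spread h\<close> is a combination of squares with nonnegative coefficients, those of the
\<open>|h M|\<^sup>2\<close> being positive (\<open>harmonics_gram\<close>). The reason is that the sums of \<open>h\<close> over the perfect matchings of a vertex set \<open>B\<close>
form a function of \<open>B\<close> killed by the lowering operator of the Boolean lattice, and inclusion-exclusion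
computes its sums over all \<open>B\<close> that avoid a given set (\<open>sum_avoiding_lowered\<close>). Hence the top component
of a polynomial that vanishes on the locus has no harmonic part, which means that it lies in \<open>J\<close>
(\<open>harmonic_top_part_eq_0\<close>, \<open>top_component_in_relation_ideal\<close>).

\<^bold>\<open>The module.\<close> Send a tabloid to the formal sum of all matchings that pair up the entries of every row
but the first inside that row. Let \<open>\<mu>\<close> be even with \<open>\<mu>\<^sub>1 = n - 2d\<close>. On the Specht module of \<open>\<mu>\<close> the values of
this map are harmonic of degree \<open>d\<close>: a star sum leaves \<open>\<mu>\<^sub>1 + 1\<close> points free, two of them lie in the same
column, and the antisymmetrization cancels. The map is nonzero because the column permutations that
contribute to a suitable coefficient act in the same way on the columns \<open>2j\<close> and \<open>2j + 1\<close>, hence are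
even. The dominance lemma of James makes the sum of these maps over all even shapes injective
(\<open>sum_row_pairings_eq_0\<close>). By the commutation relation of Young's lattice the standard tableaux of even
shapes are as many as the perfect matchings, so the spreads of the images of the standard polytabloids
form a basis of all functions on perfect matchings, and the injectivity of \<open>spread\<close> on harmonic functions
shows that no harmonic function is missed (\<open>harmonics_eq_specht_sum\<close>).

The Frobenius image is determined by an isomorphism class, since column antisymmetrizers detect the
multiplicity of each Specht module (\<open>specht_multiplicity_le\<close>).\<close>

section \<open>Matchings\<close>

definition matchings :: "'a set \<Rightarrow> nat \<Rightarrow> 'a set set set" where
  "matchings X d = {M. M \<subseteq> nsets X 2 \<and> disjoint M \<and> card M = d}"

definition perfect_matchings :: "'a set \<Rightarrow> 'a set set set" where
  "perfect_matchings B = {M. M \<subseteq> nsets B 2 \<and> disjoint M \<and> \<Union>M = B}"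

lemma finite_pairs_subset: "finite X \<Longrightarrow> M \<subseteq> nsets X 2 \<Longrightarrow> finite M"
  by (meson finite_imp_finite_nsets finite_subset)

lemma finite_matchings [simp]: "finite X \<Longrightarrow> finite (matchings X d)"
  unfolding matchings_def
  by (rule finite_subset[of _ "Pow (nsets X 2)"]) (auto simp: finite_imp_finite_nsets)

lemma finite_perfect_matchings [simp]: "finite X \<Longrightarrow> finite (perfect_matchings X)"
  unfolding perfect_matchings_def
  by (rule finite_subset[of _ "Pow (nsets X 2)"]) (auto simp: finite_imp_finite_nsets)

lemma matchings_finite: "finite X \<Longrightarrow> M \<in> matchings X d \<Longrightarrow> finite M"
  unfolding matchings_def using finite_pairs_subset by blast

lemma matchings_card: "M \<in> matchings X d \<Longrightarrow> card M = d"
  by (simp add: matchings_def)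

lemma matchings_Union_subset: "M \<in> matchings X d \<Longrightarrow> \<Union>M \<subseteq> X"
  unfolding matchings_def nsets_def by blast

lemma card_Union_pairs:
  assumes "M \<subseteq> nsets X 2" "disjoint M"
  shows "card (\<Union>M) = 2 * card M"
proof -
  have "card (\<Union>M) = sum card M"
    using assms by (intro card_Union_disjoint) (auto simp: nsets_def)
  also have "\<dots> = sum (\<lambda>_. 2) M"
    using assms by (intro sum.cong) (auto simp: nsets_def)
  finally show ?thesis by simp
qed

lemma card_Union_matching: "M \<in> matchings X d \<Longrightarrow> card (\<Union>M) = 2 * d"
  unfolding matchings_def using card_Union_pairs by blast

lemma perfect_matching_card: "M \<in> perfect_matchings B \<Longrightarrow> card B = 2 * card M"
  unfolding perfect_matchings_def using card_Union_pairs by blast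

lemma perfect_matching_in_matchings: "M \<in> perfect_matchings B \<Longrightarrow> B \<subseteq> X \<Longrightarrow> M \<in> matchings X (card M)"
  unfolding perfect_matchings_def matchings_def using nsets_mono[of B X 2] by blast

lemma matching_perfect: "M \<in> matchings X d \<Longrightarrow> M \<in> perfect_matchings (\<Union>M)"
  unfolding perfect_matchings_def matchings_def nsets_def by auto

lemma matchings_eq_UN_perfect:
  assumes "finite X"
  shows "matchings X d = (\<Union>B\<in>nsets X (2 * d). perfect_matchings B)"
proof (intro equalityI subsetI)
  fix M assume M: "M \<in> matchings X d"
  have "\<Union>M \<in> nsets X (2 * d)"
    using matchings_Union_subset[OF M] card_Union_matching[OF M] assms finite_subset
    by (auto simp: nsets_def)
  then show "M \<in> (\<Union>B\<in>nsets X (2 * d). perfect_matchings B)"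
    using matching_perfect[OF M] by blast
next
  fix M assume "M \<in> (\<Union>B\<in>nsets X (2 * d). perfect_matchings B)"
  then obtain B where B: "B \<in> nsets X (2 * d)" "M \<in> perfect_matchings B" by blast
  then show "M \<in> matchings X d"
    using perfect_matching_card[OF B(2)] perfect_matching_in_matchings[OF B(2), of X]
    by (auto simp: nsets_def)
qed

lemma sum_matchings_perfect:
  assumes "finite X"
  shows "(\<Sum>M\<in>matchings X d. g M) = (\<Sum>B\<in>nsets X (2 * d). \<Sum>M\<in>perfect_matchings B. g M)"
  unfolding matchings_eq_UN_perfect[OF assms]
proof (rule sum.UNION_disjoint)
  show "finite (nsets X (2 * d))" using assms by (rule finite_imp_finite_nsets)
  show "\<forall>B\<in>nsets X (2 * d). finite (perfect_matchings B)"
    by (auto simp: nsets_def)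
  show "\<forall>A\<in>nsets X (2 * d). \<forall>B\<in>nsets X (2 * d). A \<noteq> B \<longrightarrow> perfect_matchings A \<inter> perfect_matchings B = {}"
    by (auto simp: perfect_matchings_def)
qed

lemma perfect_matchings_insert_bij:
  assumes "j \<notin> B"
  shows "bij_betw (\<lambda>(i, L). insert {i, j} L) (SIGMA i:B. perfect_matchings (B - {i}))
    (perfect_matchings (insert j B))"
proof (rule bij_betwI')
  fix p q
  assume p: "p \<in> (SIGMA i:B. perfect_matchings (B - {i}))"
    and q: "q \<in> (SIGMA i:B. perfect_matchings (B - {i}))"
  obtain i L where pi: "p = (i, L)" by fastforce
  obtain k N where qi: "q = (k, N)" by fastforce
  have L: "i \<in> B" "\<Union>L = B - {i}" and N: "k \<in> B" "\<Union>N = B - {k}"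
    using p q pi qi by (auto simp: perfect_matchings_def)
  have jL: "{i', j} \<notin> L" "{i', j} \<notin> N" for i' using L N assms by blast+
  show "((case p of (i, L) \<Rightarrow> insert {i, j} L) = (case q of (i, L) \<Rightarrow> insert {i, j} L)) = (p = q)"
  proof
    assume "(case p of (i, L) \<Rightarrow> insert {i, j} L) = (case q of (i, L) \<Rightarrow> insert {i, j} L)"
    then have eq: "insert {i, j} L = insert {k, j} N" by (simp add: pi qi)
    then have "{i, j} \<in> insert {k, j} N" by blast
    then have "{i, j} = {k, j}" using jL by blast
    then have "i = k" using L N assms by (auto simp: doubleton_eq_iff)
    moreover have "L = N" using eq jL \<open>i = k\<close> by (metis insert_ident)
    ultimately show "p = q" by (simp add: pi qi)
  qed auto
next
  fix p assume "p \<in> (SIGMA i:B. perfect_matchings (B - {i}))"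
  then obtain i L where p: "p = (i, L)" "i \<in> B" "L \<in> perfect_matchings (B - {i})" by fastforce
  have "insert {i, j} L \<in> perfect_matchings (insert j B)"
    using p(2,3) assms nsets_mono[of "B - {i}" "insert j B" 2]
    unfolding perfect_matchings_def disjoint_def by auto
  then show "(case p of (i, L) \<Rightarrow> insert {i, j} L) \<in> perfect_matchings (insert j B)"
    by (simp add: p)
next
  fix M assume M: "M \<in> perfect_matchings (insert j B)"
  then obtain e where e: "e \<in> M" "j \<in> e" by (auto simp: perfect_matchings_def)
  then have "e \<in> nsets (insert j B) 2" using M by (auto simp: perfect_matchings_def)
  then obtain i where i: "e = {i, j}" "i \<noteq> j" "i \<in> B"
    using e(2) by (auto simp: nsets_def card_2_iff)
  have disj: "f \<inter> e = {}" if "f \<in> M - {e}" for f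
    using that e(1) M unfolding perfect_matchings_def disjoint_def by blast
  have "M - {e} \<in> perfect_matchings (B - {i})"
    unfolding perfect_matchings_def
  proof (intro CollectI conjI)
    show "M - {e} \<subseteq> nsets (B - {i}) 2"
    proof
      fix f assume f: "f \<in> M - {e}"
      then have "f \<in> nsets (insert j B) 2" using M by (auto simp: perfect_matchings_def)
      then show "f \<in> nsets (B - {i}) 2" using disj[OF f] i by (auto simp: nsets_def)
    qed
    show "disjoint (M - {e})" using M by (auto simp: perfect_matchings_def disjoint_def)
    have "\<Union>(M - {e}) = insert j B - e" 
    proof -
      have "\<Union>(M - {e}) \<subseteq> - e" using disj by blast
      moreover have "\<Union>M = \<Union>(M - {e}) \<union> e" using e by blast
      ultimately show ?thesis using M unfolding perfect_matchings_def by blast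
    qed
    then show "\<Union>(M - {e}) = B - {i}" using i assms by auto
  qed
  then show "\<exists>p\<in>(SIGMA i:B. perfect_matchings (B - {i})). M = (case p of (i, L) \<Rightarrow> insert {i, j} L)"
    using i e by (intro bexI[of _ "(i, M - {e})"]) auto
qed

lemma sum_perfect_matchings_insert:
  assumes "finite B" "j \<notin> B"
  shows "(\<Sum>L\<in>perfect_matchings (insert j B). g L) =
         (\<Sum>i\<in>B. \<Sum>L\<in>perfect_matchings (B - {i}). g (insert {i, j} L))"
proof -
  have "(\<Sum>L\<in>perfect_matchings (insert j B). g L) =
      (\<Sum>p\<in>(SIGMA i:B. perfect_matchings (B - {i})). g (case p of (i, L) \<Rightarrow> insert {i, j} L))"
    by (rule sum.reindex_bij_betw[OF perfect_matchings_insert_bij[OF assms(2)], symmetric])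
  also have "\<dots> = (\<Sum>i\<in>B. \<Sum>L\<in>perfect_matchings (B - {i}). g (insert {i, j} L))"
    using assms by (subst sum.Sigma) (auto intro!: sum.cong)
  finally show ?thesis .
qed

text \<open>The double factorial \<open>(k - 1)!!\<close> for even \<open>k\<close>, and \<open>0\<close> for odd \<open>k\<close>.\<close>

fun num_perfect :: "nat \<Rightarrow> nat" where
  "num_perfect 0 = 1"
| "num_perfect (Suc 0) = 0"
| "num_perfect (Suc (Suc k)) = Suc k * num_perfect k"

lemma perfect_matchings_empty [simp]: "perfect_matchings {} = {{}}"
  by (auto simp: perfect_matchings_def nsets_def)

lemma card_perfect_matchings:
  assumes "finite B"
  shows "card (perfect_matchings B) = num_perfect (card B)"
proof -
  have "card (perfect_matchings B) = num_perfect k" if "card B = k" "finite B" for k and B :: "'a set"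
    using that
  proof (induction k arbitrary: B rule: num_perfect.induct)
    case 1
    then have "B = {}" by simp
    then show ?case by simp
  next
    case 2
    have "perfect_matchings B = {}"
    proof (rule ccontr)
      assume "perfect_matchings B \<noteq> {}"
      then obtain M where "M \<in> perfect_matchings B" by blast
      then have "Suc 0 = 2 * card M" using perfect_matching_card 2(1) by metis
      then show False by presburger
    qed
    then show ?case by simp
  next
    case (3 k)
    obtain j A where B: "B = insert j A" "j \<notin> A" "card A = Suc k"
      using 3(2) card_Suc_eq[of B "Suc k"] by blast
    have fin: "finite A" using B(1) 3(3) by simp
    have "card (perfect_matchings B) = (\<Sum>L\<in>perfect_matchings (insert j A). 1)" by (simp add: B(1))
    also have "\<dots> = (\<Sum>i\<in>A. \<Sum>L\<in>perfect_matchings (A - {i}). 1)"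
      by (rule sum_perfect_matchings_insert[OF fin B(2)])
    also have "\<dots> = (\<Sum>i\<in>A. num_perfect k)"
    proof (rule sum.cong[OF refl])
      fix i assume "i \<in> A"
      then have "card (A - {i}) = k" "finite (A - {i})" using fin B(3) by (auto simp: card_Diff_singleton)
      from 3(1)[OF this] show "(\<Sum>L\<in>perfect_matchings (A - {i}). 1) = num_perfect k" by simp
    qed
    also have "\<dots> = Suc k * num_perfect k" using B(3) by simp
    finally show ?case by simp
  qed
  then show ?thesis using assms by blast
qed

lemma num_perfect_pos: "even k \<Longrightarrow> num_perfect k > 0"
  by (induction k rule: num_perfect.induct) auto

lemma perfect_matchings_superset_bij:
  assumes "Q \<subseteq> nsets X 2" "disjoint Q"
  shows "bij_betw (\<lambda>P. P \<union> Q) (perfect_matchings (X - \<Union>Q)) {P \<in> perfect_matchings X. Q \<subseteq> P}"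
proof (rule bij_betw_byWitness[where f' = "\<lambda>P. P - Q"])
  have QX: "\<Union>Q \<subseteq> X" using assms by (auto simp: nsets_def)
  have ne: "e \<noteq> {}" if "e \<in> nsets Y 2" for e and Y :: "'a set" using that by (auto simp: nsets_def)
  show "\<forall>P\<in>perfect_matchings (X - \<Union>Q). P \<union> Q - Q = P"
  proof
    fix P assume P: "P \<in> perfect_matchings (X - \<Union>Q)"
    have "P \<inter> Q = {}"
    proof (rule ccontr)
      assume "P \<inter> Q \<noteq> {}"
      then obtain e where e: "e \<in> P" "e \<in> Q" by blast
      then have "e \<noteq> {}" "e \<subseteq> X - \<Union>Q" using P ne by (auto simp: perfect_matchings_def nsets_def)
      then show False using e by blast
    qed
    then show "P \<union> Q - Q = P" by blast
  qed
  show "\<forall>P\<in>{P \<in> perfect_matchings X. Q \<subseteq> P}. P - Q \<union> Q = P" by auto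
  show "(\<lambda>P. P \<union> Q) ` perfect_matchings (X - \<Union>Q) \<subseteq> {P \<in> perfect_matchings X. Q \<subseteq> P}"
  proof safe
    fix P assume P: "P \<in> perfect_matchings (X - \<Union>Q)"
    show "P \<union> Q \<in> perfect_matchings X"
      unfolding perfect_matchings_def
    proof (intro CollectI conjI)
      show "P \<union> Q \<subseteq> nsets X 2" using P assms nsets_mono[of "X - \<Union>Q" X 2] by (auto simp: perfect_matchings_def)
      show "disjoint (P \<union> Q)"
        by (rule disjoint_union) (use P assms(2) in \<open>auto simp: perfect_matchings_def\<close>)
      show "\<Union>(P \<union> Q) = X" using P QX by (auto simp: perfect_matchings_def)
    qed
  qed
  show "(\<lambda>P. P - Q) ` {P \<in> perfect_matchings X. Q \<subseteq> P} \<subseteq> perfect_matchings (X - \<Union>Q)"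
  proof safe
    fix P assume P: "P \<in> perfect_matchings X" "Q \<subseteq> P"
    have disj: "f \<inter> \<Union>Q = {}" if "f \<in> P - Q" for f
    proof -
      have "disjoint P" "Q \<subseteq> P" using P by (auto simp: perfect_matchings_def)
      then show ?thesis using that disjointD[of P f] by blast
    qed
    show "P - Q \<in> perfect_matchings (X - \<Union>Q)"
      unfolding perfect_matchings_def
    proof (intro CollectI conjI)
      have P': "P \<subseteq> nsets X 2" "disjoint P" "\<Union>P = X" using P by (auto simp: perfect_matchings_def)
      show "P - Q \<subseteq> nsets (X - \<Union>Q) 2"
      proof
        fix f assume f: "f \<in> P - Q"
        then have "f \<in> nsets X 2" using P' by auto
        then show "f \<in> nsets (X - \<Union>Q) 2" using disj[OF f] by (auto simp: nsets_def)
      qed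
      show "disjoint (P - Q)" using P'(2) by (rule pairwise_subset) auto
      have "\<Union>P = \<Union>(P - Q) \<union> \<Union>Q" using P(2) by blast
      moreover have "\<Union>(P - Q) \<inter> \<Union>Q = {}" using disj by blast
      ultimately show "\<Union>(P - Q) = X - \<Union>Q" using P'(3) by blast
    qed
  qed
qed

lemma card_perfect_matchings_superset:
  assumes "finite X" "Q \<in> matchings X q"
  shows "card {P \<in> perfect_matchings X. Q \<subseteq> P} = num_perfect (card X - 2 * q)"
proof -
  have Q: "Q \<subseteq> nsets X 2" "disjoint Q" using assms by (auto simp: matchings_def)
  have "card {P \<in> perfect_matchings X. Q \<subseteq> P} = card (perfect_matchings (X - \<Union>Q))"
    using bij_betw_same_card[OF perfect_matchings_superset_bij[OF Q]] by simp
  also have "\<dots> = num_perfect (card X - 2 * q)"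
    using assms card_Union_matching[OF assms(2)] matchings_Union_subset[OF assms(2)]
    by (subst card_perfect_matchings) (auto simp: card_Diff_subset finite_subset)
  finally show ?thesis .
qed

section \<open>Functions on subsets\<close>

text \<open>Descending induction on the size of \<open>A\<close>: adding to \<open>A\<close> each further point in turn counts every set \<open>B\<close>
above \<open>A\<close> exactly \<open>r - card A\<close> times.\<close>

lemma sum_supersets_eq_0:
  fixes s :: "'a set \<Rightarrow> complex"
  assumes "finite X"
    and lower: "\<And>B. B \<subseteq> X \<Longrightarrow> Suc (card B) = r \<Longrightarrow> (\<Sum>j\<in>X - B. s (insert j B)) = 0"
    and "A \<subseteq> X" "card A < r"
  shows "(\<Sum>B\<in>{B \<in> nsets X r. A \<subseteq> B}. s B) = 0"
  using assms(3,4)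
proof (induction "r - card A" arbitrary: A)
  case 0
  then show ?case by simp
next
  case (Suc k)
  have finA: "finite A" using Suc.prems assms(1) finite_subset by blast
  show ?case
  proof (cases "Suc (card A) = r")
    case True
    have "(\<Sum>B\<in>{B \<in> nsets X r. A \<subseteq> B}. s B) = (\<Sum>j\<in>X - A. s (insert j A))"
    proof (rule sum.reindex_bij_betw[symmetric], rule bij_betw_imageI)
      show "inj_on (\<lambda>j. insert j A) (X - A)" by (auto simp: inj_on_def)
      show "(\<lambda>j. insert j A) ` (X - A) = {B \<in> nsets X r. A \<subseteq> B}"
      proof (intro equalityI subsetI)
        fix B assume "B \<in> (\<lambda>j. insert j A) ` (X - A)"
        then show "B \<in> {B \<in> nsets X r. A \<subseteq> B}"
          using True finA Suc.prems by (auto simp: nsets_def)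
      next
        fix B assume B: "B \<in> {B \<in> nsets X r. A \<subseteq> B}"
        then have "card (B - A) = 1" using True finA 
          by (auto simp: nsets_def card_Diff_subset)
        then obtain j where j: "B - A = {j}" by (auto simp: card_1_singleton_iff)
        then have "j \<in> X - A" "B = insert j A" using B by (auto simp: nsets_def)
        then show "B \<in> (\<lambda>j. insert j A) ` (X - A)" by blast
      qed
    qed
    then show ?thesis using lower[OF Suc.prems(1) True] by simp
  next
    case False
    let ?S = "{B \<in> nsets X r. A \<subseteq> B}"
    have "0 = (\<Sum>j\<in>X - A. \<Sum>B\<in>{B \<in> nsets X r. insert j A \<subseteq> B}. s B)"
    proof (rule sum.neutral[symmetric], rule ballI)
      fix j assume j: "j \<in> X - A"
      show "(\<Sum>B\<in>{B \<in> nsets X r. insert j A \<subseteq> B}. s B) = 0"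
        by (rule Suc.hyps(1)) (use j finA False Suc in auto)
    qed
    also have "\<dots> = (\<Sum>j\<in>X - A. \<Sum>B\<in>{B \<in> ?S. j \<in> B}. s B)"
      by (intro sum.cong) auto
    also have "\<dots> = (\<Sum>B\<in>?S. \<Sum>j\<in>{j \<in> X - A. j \<in> B}. s B)"
      by (rule sum.swap_restrict) (use assms(1) in \<open>auto simp: finite_imp_finite_nsets\<close>)
    also have "\<dots> = (\<Sum>B\<in>?S. of_nat (r - card A) * s B)"
    proof (rule sum.cong[OF refl])
      fix B assume B: "B \<in> ?S"
      then have "{j \<in> X - A. j \<in> B} = B - A" by (auto simp: nsets_def)
      moreover have "card (B - A) = r - card A" using B finA by (auto simp: nsets_def card_Diff_subset)
      ultimately show "(\<Sum>j\<in>{j \<in> X - A. j \<in> B}. s B) = of_nat (r - card A) * s B" by simp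
    qed
    also have "\<dots> = of_nat (r - card A) * (\<Sum>B\<in>?S. s B)" by (simp add: sum_distrib_left)
    finally show ?thesis using Suc.hyps(2) by auto
  qed
qed

lemma sum_Pow_alternating:
  assumes "finite A"
  shows "(\<Sum>B\<in>Pow A. (-1) ^ card B :: complex) = (if A = {} then 1 else 0)"
proof (cases "A = {}")
  case False
  have "(\<Prod>x\<in>A. (1::complex) - 1) = (\<Sum>X\<in>Pow A. (-1) ^ card X * (\<Prod>x\<in>X. 1) * (\<Prod>x\<in>A-X. 1))"
    by (rule prod_diff_conv_sum[OF assms]) 
  moreover have "(0::complex) ^ card A = 0" using False assms by (simp add: card_gt_0_iff)
  ultimately show ?thesis using False by simp
qed auto

text \<open>Inclusion-exclusion over the part of \<open>W\<close> that is met by \<open>B\<close>.\<close>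

lemma sum_avoiding:
  fixes s :: "'a set \<Rightarrow> complex"
  assumes "finite X" "W \<subseteq> X"
  shows "(\<Sum>B\<in>nsets (X - W) r. s B) = (\<Sum>A\<in>Pow W. (-1) ^ card A * (\<Sum>B\<in>{B \<in> nsets X r. A \<subseteq> B}. s B))"
proof -
  have finW: "finite W" using assms finite_subset by blast
  have "(\<Sum>A\<in>Pow W. (-1) ^ card A * (\<Sum>B\<in>{B \<in> nsets X r. A \<subseteq> B}. s B)) =
      (\<Sum>A\<in>Pow W. \<Sum>B\<in>{B \<in> nsets X r. A \<subseteq> B}. (-1) ^ card A * s B)"
    by (simp add: sum_distrib_left)
  also have "\<dots> = (\<Sum>B\<in>nsets X r. \<Sum>A\<in>{A \<in> Pow W. A \<subseteq> B}. (-1) ^ card A * s B)"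
    by (rule sum.swap_restrict) (use assms finW in \<open>auto simp: finite_imp_finite_nsets\<close>)
  also have "\<dots> = (\<Sum>B\<in>nsets X r. if B \<inter> W = {} then s B else 0)"
  proof (rule sum.cong[OF refl])
    fix B :: "'a set"
    have "{A \<in> Pow W. A \<subseteq> B} = Pow (B \<inter> W)" by auto
    then have "(\<Sum>A\<in>{A \<in> Pow W. A \<subseteq> B}. (-1) ^ card A * s B) = (\<Sum>A\<in>Pow (B \<inter> W). (-1) ^ card A) * s B"
      by (simp add: sum_distrib_right)
    then show "(\<Sum>A\<in>{A \<in> Pow W. A \<subseteq> B}. (-1) ^ card A * s B) = (if B \<inter> W = {} then s B else 0)"
      using sum_Pow_alternating[of "B \<inter> W"] finW by auto
  qed
  also have "\<dots> = (\<Sum>B\<in>{B \<in> nsets X r. B \<inter> W = {}}. s B)"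
    by (rule sum.inter_filter[symmetric]) (use assms in \<open>auto simp: finite_imp_finite_nsets\<close>)
  also have "{B \<in> nsets X r. B \<inter> W = {}} = nsets (X - W) r" by (auto simp: nsets_def)
  finally show ?thesis by simp
qed

text \<open>In the inclusion-exclusion formula the subsets of \<open>W\<close> with fewer than \<open>r\<close> elements contribute nothing, so
at most the term of \<open>W\<close> itself remains.\<close>

lemma sum_avoiding_lowered:
  fixes s :: "'a set \<Rightarrow> complex"
  assumes "finite X" "W \<subseteq> X" 
    and lower: "\<And>B. B \<subseteq> X \<Longrightarrow> Suc (card B) = r \<Longrightarrow> (\<Sum>j\<in>X - B. s (insert j B)) = 0"
  shows "card W < r \<Longrightarrow> (\<Sum>B\<in>nsets (X - W) r. s B) = 0"
    and "card W = r \<Longrightarrow> (\<Sum>B\<in>nsets (X - W) r. s B) = (-1) ^ r * s W"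
proof -
  have finW: "finite W" using assms finite_subset by blast
  have zero: "(\<Sum>B\<in>{B \<in> nsets X r. A \<subseteq> B}. s B) = 0" if "A \<subseteq> W" "card A < r" for A
    by (rule sum_supersets_eq_0[OF assms(1) lower]) (use that assms in auto)
  show "(\<Sum>B\<in>nsets (X - W) r. s B) = 0" if "card W < r"
    unfolding sum_avoiding[OF assms(1,2)]
  proof (rule sum.neutral, rule ballI)
    fix A assume "A \<in> Pow W"
    then have "A \<subseteq> W" "card A < r" using card_mono[OF finW, of A] that by auto
    then show "(- 1) ^ card A * (\<Sum>B\<in>{B \<in> nsets X r. A \<subseteq> B}. s B) = 0" using zero by simp
  qed
  show "(\<Sum>B\<in>nsets (X - W) r. s B) = (-1) ^ r * s W" if W: "card W = r"
  proof -
    have "(\<Sum>B\<in>nsets (X - W) r. s B) = (\<Sum>A\<in>Pow W. if A = W then (-1) ^ r * s W else 0)"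
      unfolding sum_avoiding[OF assms(1,2)]
    proof (rule sum.cong[OF refl])
      fix A assume A: "A \<in> Pow W"
      show "(- 1) ^ card A * (\<Sum>B\<in>{B \<in> nsets X r. A \<subseteq> B}. s B) = (if A = W then (- 1) ^ r * s W else 0)"
      proof (cases "A = W")
        case True
        have "{B \<in> nsets X r. W \<subseteq> B} = {W}"
        proof -
          have "B = W" if "finite B" "W \<subseteq> B" "card B = r" for B
            using card_subset_eq[OF that(1,2)] that(3) W by simp
          then show ?thesis using W assms(2) finW by (auto simp: nsets_def)
        qed
        then show ?thesis using True W by simp
      next
        case False
        then have "card A < r" using A W finW by (auto intro!: psubset_card_mono)
        then show ?thesis using zero[of A] A False by simp
      qed
    qed
    then show ?thesis using finW by simp
  qed
qed

section \<open>Harmonic functions on matchings\<close>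

text \<open>Orthogonality of \<open>h\<close> to the coefficient vectors of \<open>x\<^sub>M \<Sum>\<^sub>j x_{ij}\<close> for the matchings \<open>M\<close> with one edge less.\<close>

definition harmonic :: "'a set \<Rightarrow> nat \<Rightarrow> ('a set set \<Rightarrow> complex) \<Rightarrow> bool" where
  "harmonic X d h \<longleftrightarrow> (\<forall>M i. Suc (card M) = d \<longrightarrow> M \<in> matchings X (card M) \<longrightarrow> i \<in> X - \<Union>M \<longrightarrow>
     (\<Sum>j\<in>X - \<Union>M - {i}. h (insert {i, j} M)) = 0)"

lemma harmonicD:
  "harmonic X d h \<Longrightarrow> M \<in> matchings X m \<Longrightarrow> Suc m = d \<Longrightarrow> i \<in> X - \<Union>M \<Longrightarrow>
     (\<Sum>j\<in>X - \<Union>M - {i}. h (insert {i, j} M)) = 0"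
  unfolding harmonic_def using matchings_card by metis

lemma harmonic_cnj: "harmonic X d h \<Longrightarrow> harmonic X d (\<lambda>M. cnj (h M))"
  unfolding harmonic_def by (metis (no_types, lifting) cnj_sum complex_cnj_zero sum.cong)

lemma matchings_Un:
  assumes "finite X" "K \<in> matchings X k" "L \<in> matchings (X - \<Union>K) l"
  shows "K \<inter> L = {}" "K \<union> L \<in> matchings X (k + l)"
proof -
  show dj: "K \<inter> L = {}"
  proof (rule ccontr)
    assume "K \<inter> L \<noteq> {}"
    then obtain e where "e \<in> K" "e \<in> L" by blast
    moreover have "e \<noteq> {}" "e \<subseteq> X - \<Union>K" 
      using assms(3) \<open>e \<in> L\<close> by (auto simp: matchings_def nsets_def)
    ultimately show False by blast
  qed
  have "L \<subseteq> nsets X 2" using assms(3) nsets_mono[of "X - \<Union>K" X 2] by (auto simp: matchings_def)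
  moreover have "disjoint (K \<union> L)"
    by (rule disjoint_union)
       (use assms(2,3) matchings_Union_subset[OF assms(3)] in \<open>auto simp: matchings_def\<close>)
  moreover have "card (K \<union> L) = k + l"
    using dj assms matchings_finite[OF _ assms(2)] matchings_finite[OF _ assms(3)] 
    by (simp add: card_Un_disjoint matchings_def)
  ultimately show "K \<union> L \<in> matchings X (k + l)"
    using assms(2) by (auto simp: matchings_def)
qed

lemma matchings_Diff:
  assumes "finite X" "N \<in> matchings X e" "K \<subseteq> N"
  shows "K \<in> matchings X (card K)" "N - K \<in> matchings (X - \<Union>K) (e - card K)" "\<Union>(N - K) = \<Union>N - \<Union>K"
proof -
  have finK: "finite K" using assms matchings_finite finite_subset by metis
  have N: "N \<subseteq> nsets X 2" "disjoint N" "card N = e" using assms(2) by (auto simp: matchings_def)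
  show "K \<in> matchings X (card K)" 
    using N(1) assms(3) pairwise_subset[OF N(2) assms(3)] by (auto simp: matchings_def)
  have disj: "f \<inter> \<Union>K = {}" if "f \<in> N - K" for f
    using that assms(3) disjointD[OF N(2), of f] by blast
  have "N - K \<subseteq> nsets (X - \<Union>K) 2"
  proof
    fix f assume f: "f \<in> N - K"
    then have "f \<in> nsets X 2" using N(1) by auto
    then show "f \<in> nsets (X - \<Union>K) 2" using disj[OF f] by (auto simp: nsets_def)
  qed
  moreover have "disjoint (N - K)" using N(2) by (rule pairwise_subset) auto
  moreover have "card (N - K) = e - card K" using assms(3) finK N(3) by (simp add: card_Diff_subset)
  ultimately show "N - K \<in> matchings (X - \<Union>K) (e - card K)" by (simp add: matchings_def)
  have "\<Union>N = \<Union>(N - K) \<union> \<Union>K" using assms(3) by blast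
  moreover have "\<Union>(N - K) \<inter> \<Union>K = {}" using disj by blast
  ultimately show "\<Union>(N - K) = \<Union>N - \<Union>K" by blast
qed

lemma harmonic_link:
  assumes "finite X" "harmonic X d h" "K \<in> matchings X k" 
  shows "harmonic (X - \<Union>K) (d - k) (\<lambda>L. h (K \<union> L))"
  unfolding harmonic_def
proof (intro allI impI)
  fix L i assume L: "Suc (card L) = d - k" "L \<in> matchings (X - \<Union>K) (card L)" "i \<in> X - \<Union>K - \<Union>L"
  have "(\<Sum>j\<in>X - \<Union>(K \<union> L) - {i}. h (insert {i, j} (K \<union> L))) = 0"
    by (rule harmonicD[OF assms(2) matchings_Un(2)[OF assms(1,3) L(2)]]) (use L in auto)
  moreover have "X - \<Union>(K \<union> L) - {i} = X - \<Union>K - \<Union>L - {i}" by auto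
  ultimately show "(\<Sum>j\<in>X - \<Union>K - \<Union>L - {i}. h (K \<union> insert {i, j} L)) = 0" by simp
qed

text \<open>In a perfect matching of \<open>insert j B\<close> the partner \<open>i\<close> of \<open>j\<close> lies in \<open>B\<close>. For a fixed \<open>i\<close> and fixed
remaining edges, the sum over \<open>j\<close> is one of the sums that vanish for a harmonic function.\<close>

lemma harmonic_lowered:
  assumes "finite X" "harmonic X m h" "B \<subseteq> X" "Suc (card B) = 2 * m"
  shows "(\<Sum>j\<in>X - B. \<Sum>L\<in>perfect_matchings (insert j B). h L) = 0"
proof -
  have finB: "finite B" using assms finite_subset by blast
  have "(\<Sum>j\<in>X - B. \<Sum>L\<in>perfect_matchings (insert j B). h L) =
      (\<Sum>j\<in>X - B. \<Sum>i\<in>B. \<Sum>L\<in>perfect_matchings (B - {i}). h (insert {i, j} L))"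
    by (intro sum.cong refl sum_perfect_matchings_insert finB) auto
  also have "\<dots> = (\<Sum>i\<in>B. \<Sum>j\<in>X - B. \<Sum>L\<in>perfect_matchings (B - {i}). h (insert {i, j} L))"
    by (rule sum.swap)
  also have "\<dots> = (\<Sum>i\<in>B. \<Sum>L\<in>perfect_matchings (B - {i}). \<Sum>j\<in>X - B. h (insert {i, j} L))"
    by (rule sum.cong[OF refl], rule sum.swap)
  also have "\<dots> = 0"
  proof (rule sum.neutral, rule ballI, rule sum.neutral, rule ballI)
    fix i L assume i: "i \<in> B" and L: "L \<in> perfect_matchings (B - {i})"
    have U: "\<Union>L = B - {i}" using L by (auto simp: perfect_matchings_def)
    have "L \<in> matchings X (card L)" by (rule perfect_matching_in_matchings[OF L]) (use assms in auto)
    moreover have "Suc (card L) = m" 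
      using perfect_matching_card[OF L] assms(4) i finB by (simp add: card_Diff_singleton)
    ultimately have "(\<Sum>j\<in>X - \<Union>L - {i}. h (insert {i, j} L)) = 0"
      using harmonicD[OF assms(2)] i assms(3) U by blast
    moreover have "X - \<Union>L - {i} = X - B" using U i by auto
    ultimately show "(\<Sum>j\<in>X - B. h (insert {i, j} L)) = 0" by simp
  qed
  finally show ?thesis .
qed

lemma harmonic_avoiding:
  assumes "finite X" "harmonic X m h" "W \<subseteq> X"
  shows "card W < 2 * m \<Longrightarrow> (\<Sum>L\<in>matchings (X - W) m. h L) = 0"
    and "card W = 2 * m \<Longrightarrow> (\<Sum>L\<in>matchings (X - W) m. h L) = (\<Sum>L\<in>perfect_matchings W. h L)"
proof -
  note l = sum_avoiding_lowered[OF assms(1,3), of "2 * m" "\<lambda>B. \<Sum>L\<in>perfect_matchings B. h L",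
      OF harmonic_lowered[OF assms(1,2)]]
  show "card W < 2 * m \<Longrightarrow> (\<Sum>L\<in>matchings (X - W) m. h L) = 0"
    using l(1) assms(1) by (simp add: sum_matchings_perfect)
  show "card W = 2 * m \<Longrightarrow> (\<Sum>L\<in>matchings (X - W) m. h L) = (\<Sum>L\<in>perfect_matchings W. h L)"
    using l(2) assms(1) by (simp add: sum_matchings_perfect)
qed

text \<open>A matching \<open>M\<close> inside \<open>P\<close> splits into \<open>K = M \<inter> N\<close> and a matching \<open>L\<close> on the points outside \<open>N\<close>. The number of
perfect matchings above \<open>N \<union> L\<close> depends only on the number of edges. The truncated subtraction is harmless:
if there is no room for \<open>e + d - card K\<close> edges, then there is no \<open>L\<close> either.\<close>

lemma sum_extensions:
  fixes h :: "'a set set \<Rightarrow> complex"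
  assumes "finite X" "N \<in> matchings X e" "e \<le> d"
  shows "(\<Sum>P\<in>{P \<in> perfect_matchings X. N \<subseteq> P}. \<Sum>M\<in>{M. M \<subseteq> P \<and> card M = d}. h M) =
         (\<Sum>K\<in>Pow N. of_nat (num_perfect (card X - 2 * (e + d - card K))) *
            (\<Sum>L\<in>matchings (X - \<Union>N) (d - card K). h (K \<union> L)))"
proof -
  let ?PN = "{P \<in> perfect_matchings X. N \<subseteq> P}"
  have finN: "finite N" using assms matchings_finite by blast
  have cN: "card N = e" using assms matchings_card by blast
  have split: "(\<Sum>M\<in>{M. M \<subseteq> P \<and> card M = d}. h M) =
      (\<Sum>K\<in>Pow N. \<Sum>L\<in>{L \<in> matchings (X - \<Union>N) (d - card K). L \<subseteq> P}. h (K \<union> L))" if P: "P \<in> ?PN" for P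
  proof -
    have finP: "finite P" and P': "P \<subseteq> nsets X 2" "disjoint P"
      using P assms(1) finite_pairs_subset by (auto simp: perfect_matchings_def)
    have eq: "{L \<in> matchings (X - \<Union>N) (d - card K). L \<subseteq> P} = {L. L \<subseteq> P - N \<and> card L = d - card K}" for K
    proof (intro equalityI subsetI)
      fix L assume "L \<in> {L \<in> matchings (X - \<Union>N) (d - card K). L \<subseteq> P}"
      then show "L \<in> {L. L \<subseteq> P - N \<and> card L = d - card K}"
        using matchings_Un(1)[OF assms(1,2), of L] by (auto simp: matchings_card)
    next
      fix L assume L: "L \<in> {L. L \<subseteq> P - N \<and> card L = d - card K}"
      have "P \<in> matchings X (card P)" using P' by (simp add: matchings_def)
      from matchings_Diff(2)[OF assms(1) this, of N] P 
      have "P - N \<subseteq> nsets (X - \<Union>N) 2" "disjoint (P - N)" by (auto simp: matchings_def)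
      then show "L \<in> {L \<in> matchings (X - \<Union>N) (d - card K). L \<subseteq> P}"
        using L unfolding matchings_def disjoint_def by blast
    qed
    have "(\<Sum>M\<in>{M. M \<subseteq> P \<and> card M = d}. h M) =
        (\<Sum>(K, L)\<in>(SIGMA K:Pow N. {L. L \<subseteq> P - N \<and> card L = d - card K}). h (K \<union> L))"
    proof (rule sum.reindex_bij_witness[where i = "\<lambda>(K, L). K \<union> L" and j = "\<lambda>M. (M \<inter> N, M - N)"])
      fix M assume M: "M \<in> {M. M \<subseteq> P \<and> card M = d}"
      show "(case (M \<inter> N, M - N) of (K, L) \<Rightarrow> K \<union> L) = M" by auto
      have "card (M - N) = d - card (M \<inter> N)"
        using M finN by (metis (mono_tags, lifting) card_Diff_subset_Int finite_Int mem_Collect_eq)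
      then show "(M \<inter> N, M - N) \<in> (SIGMA K:Pow N. {L. L \<subseteq> P - N \<and> card L = d - card K})"
        using M by auto
      show "(case (M \<inter> N, M - N) of (K, L) \<Rightarrow> h (K \<union> L)) = h M"
        by (simp add: Int_Diff_Un)
    next
      fix p assume "p \<in> (SIGMA K:Pow N. {L. L \<subseteq> P - N \<and> card L = d - card K})"
      then obtain K L where p: "p = (K, L)" "K \<subseteq> N" "L \<subseteq> P - N" "card L = d - card K" by auto
      show "((case p of (K, L) \<Rightarrow> K \<union> L) \<inter> N, (case p of (K, L) \<Rightarrow> K \<union> L) - N) = p"
        using p by auto
      have "card K \<le> d" using p(2) finN cN assms(3) card_mono[of N K] by linarith
      then have "card (K \<union> L) = d"
        using p finN finP by (subst card_Un_disjoint) (auto intro: finite_subset)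
      then show "(case p of (K, L) \<Rightarrow> K \<union> L) \<in> {M. M \<subseteq> P \<and> card M = d}"
        using p P by auto
    qed
    also have "\<dots> = (\<Sum>K\<in>Pow N. \<Sum>L\<in>{L. L \<subseteq> P - N \<and> card L = d - card K}. h (K \<union> L))"
      by (subst sum.Sigma) (use finN finP in auto)
    finally show ?thesis by (simp add: eq)
  qed
  have "(\<Sum>P\<in>?PN. \<Sum>M\<in>{M. M \<subseteq> P \<and> card M = d}. h M) =
      (\<Sum>P\<in>?PN. \<Sum>K\<in>Pow N. \<Sum>L\<in>{L \<in> matchings (X - \<Union>N) (d - card K). L \<subseteq> P}. h (K \<union> L))"
    by (rule sum.cong[OF refl split])
  also have "\<dots> = (\<Sum>K\<in>Pow N. \<Sum>P\<in>?PN. \<Sum>L\<in>{L \<in> matchings (X - \<Union>N) (d - card K). L \<subseteq> P}. h (K \<union> L))"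
    by (rule sum.swap)
  also have "\<dots> = (\<Sum>K\<in>Pow N. \<Sum>L\<in>matchings (X - \<Union>N) (d - card K). \<Sum>P\<in>{P \<in> ?PN. L \<subseteq> P}. h (K \<union> L))"
    by (intro sum.cong refl sum.swap_restrict) (use assms(1) in auto)
  also have "\<dots> = (\<Sum>K\<in>Pow N. \<Sum>L\<in>matchings (X - \<Union>N) (d - card K). 
      of_nat (num_perfect (card X - 2 * (e + d - card K))) * h (K \<union> L))"
  proof (intro sum.cong refl)
    fix K L assume K: "K \<in> Pow N" and L: "L \<in> matchings (X - \<Union>N) (d - card K)"
    have "card K \<le> e" using K finN cN card_mono[of N K] by auto
    then have "e + (d - card K) = e + d - card K" using assms(3) by simp
    moreover have "{P \<in> ?PN. L \<subseteq> P} = {P \<in> perfect_matchings X. N \<union> L \<subseteq> P}" by auto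
    ultimately have "card {P \<in> ?PN. L \<subseteq> P} = num_perfect (card X - 2 * (e + d - card K))"
      using card_perfect_matchings_superset[OF assms(1) matchings_Un(2)[OF assms(1,2) L]] by simp
    then show "(\<Sum>P\<in>{P \<in> ?PN. L \<subseteq> P}. h (K \<union> L)) =
        of_nat (num_perfect (card X - 2 * (e + d - card K))) * h (K \<union> L)" by simp
  qed
  finally show ?thesis by (simp add: sum_distrib_left)
qed

text \<open>For a fixed \<open>K\<close> the matchings \<open>L\<close> have to avoid the points of \<open>N\<close> outside \<open>K\<close>. These are \<open>2 (e - card K)\<close>
points against the \<open>2 (d - card K)\<close> points of \<open>L\<close>, so the two cases of \<open>harmonic_avoiding\<close> are \<open>e < d\<close> and
\<open>e = d\<close>.\<close>

lemma
  fixes h :: "'a set set \<Rightarrow> complex"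
  assumes "finite X" "harmonic X d h" "N \<in> matchings X e"
  shows harmonic_sum_extensions_less: "e < d \<Longrightarrow>
     (\<Sum>P\<in>{P \<in> perfect_matchings X. N \<subseteq> P}. \<Sum>M\<in>{M. M \<subseteq> P \<and> card M = d}. h M) = 0"
   and harmonic_sum_extensions_eq: "e = d \<Longrightarrow>
     (\<Sum>P\<in>{P \<in> perfect_matchings X. N \<subseteq> P}. \<Sum>M\<in>{M. M \<subseteq> P \<and> card M = d}. h M) =
     (\<Sum>K\<in>Pow N. of_nat (num_perfect (card X - 2 * (2 * d - card K))) *
        (\<Sum>L\<in>perfect_matchings (\<Union>(N - K)). h (K \<union> L)))"
proof -
  have finN: "finite N" using assms matchings_finite by blast
  have *: "(2 * (e - card K) < 2 * (d - card K) \<longrightarrow> (\<Sum>L\<in>matchings (X - \<Union>N) (d - card K). h (K \<union> L)) = 0) \<and>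
      (e = d \<longrightarrow> (\<Sum>L\<in>matchings (X - \<Union>N) (d - card K). h (K \<union> L)) = (\<Sum>L\<in>perfect_matchings (\<Union>(N - K)). h (K \<union> L)))"
    if "K \<subseteq> N" for K
  proof -
    note D = matchings_Diff[OF assms(1,3) that]
    have X: "X - \<Union>N = X - \<Union>K - \<Union>(N - K)" using that by auto
    have c: "card (\<Union>(N - K)) = 2 * (e - card K)" by (rule card_Union_matching[OF D(2)])
    have f: "finite (X - \<Union>K)" using assms by auto
    note h = harmonic_avoiding[OF f harmonic_link[OF assms(1,2) D(1)] matchings_Union_subset[OF D(2)]]
    show ?thesis unfolding X using h c by simp
  qed
  show "(\<Sum>P\<in>{P \<in> perfect_matchings X. N \<subseteq> P}. \<Sum>M\<in>{M. M \<subseteq> P \<and> card M = d}. h M) = 0" if "e < d"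
  proof -
    have "(\<Sum>L\<in>matchings (X - \<Union>N) (d - card K). h (K \<union> L)) = 0" if "K \<in> Pow N" for K
      using *[of K] that \<open>e < d\<close> card_mono[OF finN, of K] matchings_card[OF assms(3)] by auto
    then show ?thesis using sum_extensions[OF assms(1,3), of d h] that by simp
  qed
  show "(\<Sum>P\<in>{P \<in> perfect_matchings X. N \<subseteq> P}. \<Sum>M\<in>{M. M \<subseteq> P \<and> card M = d}. h M) =
     (\<Sum>K\<in>Pow N. of_nat (num_perfect (card X - 2 * (2 * d - card K))) *
        (\<Sum>L\<in>perfect_matchings (\<Union>(N - K)). h (K \<union> L)))" if "e = d"
    using sum_extensions[OF assms(1,3), of d h] that * by (simp add: mult_2)
qed

definition all_matchings :: "'a set \<Rightarrow> 'a set set set" where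
  "all_matchings X = {M. M \<subseteq> nsets X 2 \<and> disjoint M}"

lemma finite_all_matchings [simp]: "finite X \<Longrightarrow> finite (all_matchings X)"
  unfolding all_matchings_def
  by (rule finite_subset[of _ "Pow (nsets X 2)"]) (auto simp: finite_imp_finite_nsets)

lemma all_matchings_iff: "M \<in> all_matchings X \<longleftrightarrow> M \<in> matchings X (card M)"
  by (auto simp: all_matchings_def matchings_def)

lemma subset_perfect_all_matchings: "P \<in> perfect_matchings X \<Longrightarrow> M \<subseteq> P \<Longrightarrow> M \<in> all_matchings X"
  unfolding all_matchings_def perfect_matchings_def disjoint_def by blast

text \<open>The value at the point \<open>P\<close> of the polynomial that has the coefficient \<open>g M\<close> at the monomial of \<open>M\<close>: this
monomial is \<open>1\<close> at \<open>P\<close> if \<open>M \<subseteq> P\<close>, and \<open>0\<close> otherwise.\<close>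

definition spread :: "('a set set \<Rightarrow> complex) \<Rightarrow> 'a set set \<Rightarrow> complex" where
  "spread g P = (\<Sum>M\<in>Pow P. g M)"

lemma sum_spread_mult:
  assumes "finite X"
  shows "(\<Sum>P\<in>perfect_matchings X. spread g P * f P) =
    (\<Sum>M\<in>all_matchings X. g M * (\<Sum>P\<in>{P \<in> perfect_matchings X. M \<subseteq> P}. f P))"
proof -
  have "(\<Sum>P\<in>perfect_matchings X. spread g P * f P) =
     (\<Sum>P\<in>perfect_matchings X. \<Sum>M\<in>{M \<in> all_matchings X. M \<subseteq> P}. g M * f P)"
  proof (rule sum.cong[OF refl])
    fix P assume "P \<in> perfect_matchings X"
    then have "{M \<in> all_matchings X. M \<subseteq> P} = Pow P" using subset_perfect_all_matchings by blast
    then show "spread g P * f P = (\<Sum>M\<in>{M \<in> all_matchings X. M \<subseteq> P}. g M * f P)"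
      by (simp add: spread_def sum_distrib_right)
  qed
  also have "\<dots> = (\<Sum>M\<in>all_matchings X. \<Sum>P\<in>{P \<in> perfect_matchings X. M \<subseteq> P}. g M * f P)"
    by (rule sum.swap_restrict) (use assms in auto)
  finally show ?thesis by (simp add: sum_distrib_left)
qed

lemma spread_supported:
  assumes "\<And>M. card M \<noteq> d \<Longrightarrow> h M = 0" "finite P"
  shows "spread h P = (\<Sum>M\<in>{M. M \<subseteq> P \<and> card M = d}. h M)"
proof -
  have "spread h P = (\<Sum>M\<in>Pow P. if card M = d then h M else 0)"
    unfolding spread_def by (rule sum.cong) (use assms in auto)
  also have "\<dots> = (\<Sum>M\<in>{M \<in> Pow P. card M = d}. h M)"
    by (rule sum.inter_filter[symmetric]) (use assms in auto)
  finally show ?thesis by simp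
qed

definition harmonics :: "'a set \<Rightarrow> nat \<Rightarrow> ('a set set \<Rightarrow> complex) set" where
  "harmonics X d = {h. harmonic X d h \<and> (\<forall>M. M \<notin> matchings X d \<longrightarrow> h M = 0)}"

lemma harmonics_card: "h \<in> harmonics X d \<Longrightarrow> card M \<noteq> d \<Longrightarrow> h M = 0"
  by (auto simp: harmonics_def matchings_def)

lemma harmonics_spread:
  "finite X \<Longrightarrow> h \<in> harmonics X d \<Longrightarrow> P \<in> perfect_matchings X \<Longrightarrow> spread h P = (\<Sum>M\<in>{M. M \<subseteq> P \<and> card M = d}. h M)"
  by (rule spread_supported) (auto simp: harmonics_card perfect_matchings_def intro: finite_pairs_subset)

lemma harmonics_cnj: "h \<in> harmonics X d \<Longrightarrow> (\<lambda>M. cnj (h M)) \<in> harmonics X d"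
  by (simp add: harmonics_def harmonic_cnj)

lemma harmonics_orthogonal_lower:
  assumes "finite X" "h \<in> harmonics X d" "\<And>M. M \<in> all_matchings X \<Longrightarrow> d \<le> card M \<Longrightarrow> g M = 0"
  shows "(\<Sum>P\<in>perfect_matchings X. spread g P * spread h P) = 0"
  unfolding sum_spread_mult[OF assms(1)]
proof (intro sum.neutral ballI)
  fix M assume M: "M \<in> all_matchings X"
  show "g M * (\<Sum>P\<in>{P \<in> perfect_matchings X. M \<subseteq> P}. spread h P) = 0"
  proof (cases "card M < d")
    case True
    have "(\<Sum>P\<in>{P \<in> perfect_matchings X. M \<subseteq> P}. spread h P) = 
        (\<Sum>P\<in>{P \<in> perfect_matchings X. M \<subseteq> P}. \<Sum>M\<in>{M. M \<subseteq> P \<and> card M = d}. h M)"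
      by (rule sum.cong) (use harmonics_spread[OF assms(1,2)] in auto)
    also have "\<dots> = 0"
      by (rule harmonic_sum_extensions_less[OF assms(1) _ _ True])
         (use assms(2) M in \<open>auto simp: harmonics_def all_matchings_iff\<close>)
    finally show ?thesis by simp
  next
    case False
    then show ?thesis using assms(3) M by simp
  qed
qed

text \<open>By \<open>harmonic_sum_extensions_eq\<close> the left-hand side is a sum over \<open>N\<close> and \<open>K \<subseteq> N\<close> that depends on \<open>N - K\<close>
only through \<open>h N\<close> and the vertex set of \<open>N - K\<close>. Grouping the terms by \<open>K\<close> and this vertex set turns it
into a sum of squares.\<close>

lemma harmonics_gram:
  assumes "finite X" "h \<in> harmonics X d"
  shows "(\<Sum>P\<in>perfect_matchings X. spread (\<lambda>M. cnj (h M)) P * spread h P) =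
    (\<Sum>K\<in>{K \<in> all_matchings X. card K \<le> d}. of_nat (num_perfect (card X - 2 * (2 * d - card K))) *
       (\<Sum>B\<in>nsets (X - \<Union>K) (2 * (d - card K)). of_real ((cmod (\<Sum>L\<in>perfect_matchings B. h (K \<union> L)))\<^sup>2)))"
proof -
  let ?c = "\<lambda>K. of_nat (num_perfect (card X - 2 * (2 * d - card K))) :: complex"
  let ?S = "\<lambda>K B. \<Sum>L\<in>perfect_matchings B. h (K \<union> L)"
  have harm: "harmonic X d h" using assms by (simp add: harmonics_def)
  have "(\<Sum>P\<in>perfect_matchings X. spread (\<lambda>M. cnj (h M)) P * spread h P) =
     (\<Sum>M\<in>all_matchings X. cnj (h M) * (\<Sum>P\<in>{P \<in> perfect_matchings X. M \<subseteq> P}. spread h P))"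
    by (rule sum_spread_mult[OF assms(1)])
  also have "\<dots> = (\<Sum>N\<in>matchings X d. cnj (h N) * (\<Sum>P\<in>{P \<in> perfect_matchings X. N \<subseteq> P}. spread h P))"
    by (rule sum.mono_neutral_right)
       (use assms finite_all_matchings[OF assms(1)] in \<open>auto simp: harmonics_def all_matchings_def matchings_def\<close>)
  also have "\<dots> = (\<Sum>N\<in>matchings X d. \<Sum>K\<in>Pow N. ?c K * cnj (h N) * ?S K (\<Union>(N - K)))"
  proof (rule sum.cong[OF refl])
    fix N assume N: "N \<in> matchings X d"
    have "(\<Sum>P\<in>{P \<in> perfect_matchings X. N \<subseteq> P}. spread h P) =
       (\<Sum>P\<in>{P \<in> perfect_matchings X. N \<subseteq> P}. \<Sum>M\<in>{M. M \<subseteq> P \<and> card M = d}. h M)"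
      by (rule sum.cong) (use harmonics_spread[OF assms(1,2)] in auto)
    also have "\<dots> = (\<Sum>K\<in>Pow N. ?c K * ?S K (\<Union>(N - K)))"
      by (rule harmonic_sum_extensions_eq[OF assms(1) harm N refl])
    finally show "cnj (h N) * (\<Sum>P\<in>{P \<in> perfect_matchings X. N \<subseteq> P}. spread h P) =
        (\<Sum>K\<in>Pow N. ?c K * cnj (h N) * ?S K (\<Union>(N - K)))"
      by (simp add: sum_distrib_left mult_ac)
  qed
  also have "\<dots> = (\<Sum>(N, K)\<in>(SIGMA N:matchings X d. Pow N). ?c K * cnj (h N) * ?S K (\<Union>(N - K)))"
    by (rule sum.Sigma) (use assms(1) matchings_finite[OF assms(1)] in auto)
  also have "\<dots> = (\<Sum>(K, L)\<in>(SIGMA K:{K \<in> all_matchings X. card K \<le> d}. matchings (X - \<Union>K) (d - card K)).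
       ?c K * cnj (h (K \<union> L)) * ?S K (\<Union>L))"
  proof (rule sum.reindex_bij_witness[where i = "\<lambda>(K, L). (K \<union> L, K)" and j = "\<lambda>(N, K). (K, N - K)"])
    fix p assume "p \<in> (SIGMA N:matchings X d. Pow N)"
    then obtain N K where p: "p = (N, K)" "N \<in> matchings X d" "K \<subseteq> N" by auto
    show "(case case p of (N, K) \<Rightarrow> (K, N - K) of (K, L) \<Rightarrow> (K \<union> L, K)) = p" using p by auto
    have "card K \<le> d" using p card_mono[OF matchings_finite[OF assms(1) p(2)] p(3)] matchings_card[OF p(2)] by simp
    then show "(case p of (N, K) \<Rightarrow> (K, N - K)) \<in> (SIGMA K:{K \<in> all_matchings X. card K \<le> d}. matchings (X - \<Union>K) (d - card K))"
      using matchings_Diff[OF assms(1) p(2,3)] by (auto simp: p(1) all_matchings_iff)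
    have "K \<union> (N - K) = N" using p by auto
    then show "(case case p of (N, K) \<Rightarrow> (K, N - K) of (K, L) \<Rightarrow> ?c K * cnj (h (K \<union> L)) * ?S K (\<Union>L)) =
      (case p of (N, K) \<Rightarrow> ?c K * cnj (h N) * ?S K (\<Union>(N - K)))" by (simp add: p(1))
  next
    fix p assume "p \<in> (SIGMA K:{K \<in> all_matchings X. card K \<le> d}. matchings (X - \<Union>K) (d - card K))"
    then obtain K L where p: "p = (K, L)" "K \<in> matchings X (card K)" "card K \<le> d" "L \<in> matchings (X - \<Union>K) (d - card K)"
      by (auto simp: all_matchings_iff)
    note U = matchings_Un[OF assms(1) p(2,4)]
    have "K \<union> L - K = L" using U by auto
    then show "(case case p of (K, L) \<Rightarrow> (K \<union> L, K) of (N, K) \<Rightarrow> (K, N - K)) = p" by (simp add: p(1))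
    show "(case p of (K, L) \<Rightarrow> (K \<union> L, K)) \<in> (SIGMA N:matchings X d. Pow N)"
      using U p by auto
  qed
  also have "\<dots> = (\<Sum>K\<in>{K \<in> all_matchings X. card K \<le> d}. \<Sum>L\<in>matchings (X - \<Union>K) (d - card K).
       ?c K * cnj (h (K \<union> L)) * ?S K (\<Union>L))"
    by (rule sum.Sigma[symmetric]) (use assms(1) in auto)
  also have "\<dots> = (\<Sum>K\<in>{K \<in> all_matchings X. card K \<le> d}. ?c K *
       (\<Sum>B\<in>nsets (X - \<Union>K) (2 * (d - card K)). of_real ((cmod (?S K B))\<^sup>2)))"
  proof (rule sum.cong[OF refl])
    fix K
    have "(\<Sum>L\<in>matchings (X - \<Union>K) (d - card K). ?c K * cnj (h (K \<union> L)) * ?S K (\<Union>L)) =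
       (\<Sum>B\<in>nsets (X - \<Union>K) (2 * (d - card K)). \<Sum>L\<in>perfect_matchings B. ?c K * cnj (h (K \<union> L)) * ?S K (\<Union>L))"
      by (rule sum_matchings_perfect) (use assms(1) in auto)
    also have "\<dots> = (\<Sum>B\<in>nsets (X - \<Union>K) (2 * (d - card K)). ?c K * of_real ((cmod (?S K B))\<^sup>2))"
    proof (rule sum.cong[OF refl])
      fix B
      have "(\<Sum>L\<in>perfect_matchings B. ?c K * cnj (h (K \<union> L)) * ?S K (\<Union>L)) =
          (\<Sum>L\<in>perfect_matchings B. ?c K * cnj (h (K \<union> L)) * ?S K B)"
        by (rule sum.cong) (auto simp: perfect_matchings_def)
      also have "\<dots> = ?c K * (cnj (?S K B) * ?S K B)"
        by (simp only: cnj_sum sum_distrib_left sum_distrib_right mult.assoc) (rule sum.swap)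
      also have "cnj (?S K B) * ?S K B = of_real ((cmod (?S K B))\<^sup>2)"
        by (metis complex_norm_square mult.commute of_real_power)
      finally show "(\<Sum>L\<in>perfect_matchings B. ?c K * cnj (h (K \<union> L)) * ?S K (\<Union>L)) = ?c K * of_real ((cmod (?S K B))\<^sup>2)" .
    qed
    finally show "(\<Sum>L\<in>matchings (X - \<Union>K) (d - card K). ?c K * cnj (h (K \<union> L)) * ?S K (\<Union>L)) =
       ?c K * (\<Sum>B\<in>nsets (X - \<Union>K) (2 * (d - card K)). of_real ((cmod (?S K B))\<^sup>2))"
      by (simp add: sum_distrib_left)
  qed
  finally show ?thesis .
qed

text \<open>The squares with \<open>card K = d\<close> and \<open>B = {}\<close> are the numbers \<open>|h K|\<^sup>2\<close>. Their weight counts the perfect matchings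
of the remaining points, whose number is even, so it is positive.\<close>

lemma harmonics_definite:
  assumes "finite X" "even (card X)" "h \<in> harmonics X d"
    and zero: "(\<Sum>P\<in>perfect_matchings X. spread (\<lambda>M. cnj (h M)) P * spread h P) = 0"
  shows "h M = 0"
proof (cases "M \<in> matchings X d")
  case False
  then show ?thesis using assms(3) by (simp add: harmonics_def)
next
  case True
  let ?c = "\<lambda>K. real (num_perfect (card X - 2 * (2 * d - card K)))"
  let ?S = "\<lambda>K B. \<Sum>L\<in>perfect_matchings B. h (K \<union> L)"
  let ?I = "{K \<in> all_matchings X. card K \<le> d}"
  let ?f = "\<lambda>K. ?c K * (\<Sum>B\<in>nsets (X - \<Union>K) (2 * (d - card K)). (cmod (?S K B))\<^sup>2)"
  have "complex_of_real (\<Sum>K\<in>?I. ?f K) = 0"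
    using zero unfolding harmonics_gram[OF assms(1,3)] by simp
  then have sum0: "(\<Sum>K\<in>?I. ?f K) = 0" by (simp only: of_real_eq_0_iff)
  have "?f M = 0"
  proof (rule sum_nonneg_0[OF _ _ sum0])
    show "M \<in> ?I" using True by (auto simp: all_matchings_iff matchings_card)
    show "0 \<le> ?f K" for K by (intro mult_nonneg_nonneg sum_nonneg) auto
  qed (use assms(1) in auto)
  moreover have "nsets (X - \<Union>M) (2 * (d - card M)) = {{}}" 
    using matchings_card[OF True] by (auto simp: nsets_def)
  moreover have "?c M > 0" 
    using matchings_card[OF True] assms(2) by (auto intro!: num_perfect_pos)
  ultimately show ?thesis by simp
qed

section \<open>Linear algebra of finite families\<close>

text \<open>Gaussian elimination: a vector with a nonzero entry at \<open>z\<close> is used to clear the coordinate \<open>z\<close> of all others.\<close>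

lemma nontrivial_relation:
  fixes A :: "'i \<Rightarrow> 'z \<Rightarrow> complex"
  assumes "finite Z" "finite I" "card Z < card I"
  shows "\<exists>\<alpha>. (\<exists>i\<in>I. \<alpha> i \<noteq> 0) \<and> (\<forall>z\<in>Z. (\<Sum>i\<in>I. \<alpha> i * A i z) = 0)"
  using assms
proof (induction Z arbitrary: I A rule: finite_induct)
  case empty
  then obtain i where "i \<in> I" by (metis card.empty card_gt_0_iff ex_in_conv)
  then show ?case by (intro exI[of _ "\<lambda>_. 1"]) auto
next
  case (insert z Z)
  show ?case
  proof (cases "\<forall>i\<in>I. A i z = 0")
    case True
    obtain \<alpha> where "\<exists>i\<in>I. \<alpha> i \<noteq> 0" "\<forall>z\<in>Z. (\<Sum>i\<in>I. \<alpha> i * A i z) = 0"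
      using insert.IH[OF insert.prems(1), of A] insert.prems insert.hyps by auto
    then show ?thesis using True by (intro exI[of _ \<alpha>]) auto
  next
    case False
    then obtain k where k: "k \<in> I" "A k z \<noteq> 0" by blast
    define I' where "I' = I - {k}"
    have I': "finite I'" "card Z < card I'" "k \<notin> I'" "I = insert k I'"
      using insert k by (auto simp: I'_def card_Diff_singleton)
    obtain \<beta> where \<beta>: "\<exists>i\<in>I'. \<beta> i \<noteq> 0" "\<forall>y\<in>Z. (\<Sum>i\<in>I'. \<beta> i * (A i y - A i z / A k z * A k y)) = 0"
      using insert.IH[OF I'(1,2), of "\<lambda>i y. A i y - A i z / A k z * A k y"] by blast
    define c where "c = - (\<Sum>i\<in>I'. \<beta> i * A i z) / A k z"
    let ?\<alpha> = "\<beta>(k := c)"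
    have sumI: "(\<Sum>i\<in>I. ?\<alpha> i * A i y) = c * A k y + (\<Sum>i\<in>I'. \<beta> i * A i y)" for y
    proof -
      have "(\<Sum>i\<in>I'. ?\<alpha> i * A i y) = (\<Sum>i\<in>I'. \<beta> i * A i y)"
        by (rule sum.cong) (use I' in auto)
      then show ?thesis using I' by simp
    qed
    have "(\<Sum>i\<in>I. ?\<alpha> i * A i y) = 0" if "y \<in> insert z Z" for y
    proof (cases "y = z")
      case True
      then show ?thesis using k(2) unfolding sumI True by (simp add: c_def)
    next
      case False
      then have "0 = (\<Sum>i\<in>I'. \<beta> i * A i y - \<beta> i * A i z / A k z * A k y)"
        using \<beta>(2) that by (simp add: algebra_simps)
      also have "\<dots> = (\<Sum>i\<in>I'. \<beta> i * A i y) - (\<Sum>i\<in>I'. \<beta> i * A i z / A k z * A k y)"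
        by (rule sum_subtractf)
      also have "(\<Sum>i\<in>I'. \<beta> i * A i z / A k z * A k y) = (\<Sum>i\<in>I'. \<beta> i * A i z) / A k z * A k y"
        by (simp add: sum_distrib_right sum_divide_distrib)
      finally show ?thesis unfolding sumI by (simp add: c_def)
    qed
    moreover have "\<exists>i\<in>I. ?\<alpha> i \<noteq> 0" using \<beta>(1) I' by force
    ultimately show ?thesis by blast
  qed
qed

text \<open>Adding \<open>g\<close> to the family (at the index \<open>None\<close>) makes it larger than the number of coordinates, and in the
resulting relation the coefficient of \<open>g\<close> cannot vanish.\<close>

lemma independent_family_spans:
  fixes A :: "'i \<Rightarrow> 'z \<Rightarrow> complex"
  assumes "finite Z" "finite I" "card Z \<le> card I"
    and indep: "\<And>\<alpha>. \<forall>z\<in>Z. (\<Sum>i\<in>I. \<alpha> i * A i z) = 0 \<Longrightarrow> \<forall>i\<in>I. \<alpha> i = 0"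
  shows "\<exists>\<alpha>. \<forall>z\<in>Z. g z = (\<Sum>i\<in>I. \<alpha> i * A i z)"
proof -
  let ?I = "insert None (Some ` I)"
  let ?A = "\<lambda>x. case x of None \<Rightarrow> g | Some i \<Rightarrow> A i"
  have "card ?I = Suc (card I)" using assms(2) by (simp add: card_image)
  then obtain \<beta> where \<beta>: "\<exists>i\<in>?I. \<beta> i \<noteq> 0" "\<forall>z\<in>Z. (\<Sum>i\<in>?I. \<beta> i * ?A i z) = 0"
    using nontrivial_relation[of Z ?I ?A] assms by auto
  have eq: "\<beta> None * g z + (\<Sum>i\<in>I. \<beta> (Some i) * A i z) = 0" if "z \<in> Z" for z
    using \<beta>(2) that assms(2) by (simp add: sum.reindex)
  have nz: "\<beta> None \<noteq> 0"
  proof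
    assume 0: "\<beta> None = 0"
    then have "\<forall>i\<in>I. \<beta> (Some i) = 0" using eq indep[of "\<lambda>i. \<beta> (Some i)"] by simp
    then show False using \<beta>(1) 0 by auto
  qed
  have "g z = (\<Sum>i\<in>I. (- \<beta> (Some i) / \<beta> None) * A i z)" if "z \<in> Z" for z
  proof -
    have "(\<Sum>i\<in>I. (- \<beta> (Some i) / \<beta> None) * A i z) = - (\<Sum>i\<in>I. \<beta> (Some i) * A i z) / \<beta> None"
      by (simp add: sum_divide_distrib sum_negf)
    also have "\<dots> = g z" using eq[OF that] nz by (simp add: field_simps add_eq_0_iff)
    finally show ?thesis by simp
  qed
  then show ?thesis by (intro exI[of _ "\<lambda>i. - \<beta> (Some i) / \<beta> None"]) blast
qed

text \<open>One Gram-Schmidt step per vector: both \<open>g\<close> and the new vector \<open>b k\<close> are first made orthogonal to the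
previous ones.\<close>

lemma orthogonal_decomposition:
  fixes b :: "'i \<Rightarrow> 'z \<Rightarrow> complex"
  assumes "finite Z" "finite I"
  shows "\<exists>h a. (\<forall>z\<in>Z. g z = h z + (\<Sum>i\<in>I. a i * b i z)) \<and> (\<forall>i\<in>I. (\<Sum>z\<in>Z. h z * cnj (b i z)) = 0)"
  using assms(2)
proof (induction I arbitrary: g rule: finite_induct)
  case empty
  then show ?case by (intro exI[of _ g]) auto
next
  case (insert k I)
  obtain v a where v: "\<forall>z\<in>Z. g z = v z + (\<Sum>i\<in>I. a i * b i z)" "\<forall>i\<in>I. (\<Sum>z\<in>Z. v z * cnj (b i z)) = 0"
    using insert.IH by blast
  obtain u c where u: "\<forall>z\<in>Z. b k z = u z + (\<Sum>i\<in>I. c i * b i z)" "\<forall>i\<in>I. (\<Sum>z\<in>Z. u z * cnj (b i z)) = 0"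
    using insert.IH[of "b k"] by blast
  let ?uu = "\<Sum>z\<in>Z. u z * cnj (u z)" and ?vu = "\<Sum>z\<in>Z. v z * cnj (u z)"
  (* If \<open>u\<close> vanishes then so does \<open>?vu\<close>, and the value \<open>t = 0\<close> of the division by zero is the right one. *)
  define t where "t = ?vu / ?uu"
  have tu: "t * ?uu = ?vu"
  proof (cases "?uu = 0")
    case True
    then have "complex_of_real (\<Sum>z\<in>Z. (cmod (u z))\<^sup>2) = 0"
      by (simp only: of_real_sum complex_norm_square)
    then have "(\<Sum>z\<in>Z. (cmod (u z))\<^sup>2) = 0" by (simp only: of_real_eq_0_iff)
    then have "\<forall>z\<in>Z. u z = 0" using assms(1) by (simp add: sum_nonneg_eq_0_iff)
    then show ?thesis by simp
  qed (simp add: t_def)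
  define h where "h = (\<lambda>z. v z - t * u z)"
  define a' where "a' = (\<lambda>i. if i = k then t else a i - t * c i)"
  have hb: "(\<Sum>z\<in>Z. h z * cnj (b i z)) = 0" if "i \<in> I" for i
  proof -
    have "(\<Sum>z\<in>Z. h z * cnj (b i z)) = (\<Sum>z\<in>Z. v z * cnj (b i z)) - t * (\<Sum>z\<in>Z. u z * cnj (b i z))"
      by (simp add: h_def algebra_simps sum_subtractf sum_distrib_left)
    then show ?thesis using v(2) u(2) that by simp
  qed
  have hu: "(\<Sum>z\<in>Z. h z * cnj (u z)) = 0"
  proof -
    have "(\<Sum>z\<in>Z. h z * cnj (u z)) = ?vu - t * ?uu"
      by (simp add: h_def algebra_simps sum_subtractf sum_distrib_left)
    then show ?thesis using tu by simp
  qed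
  have "(\<Sum>z\<in>Z. h z * cnj (b k z)) = (\<Sum>z\<in>Z. h z * cnj (u z) + (\<Sum>i\<in>I. cnj (c i) * (h z * cnj (b i z))))"
    using u(1) by (intro sum.cong) (auto simp: algebra_simps sum_distrib_left)
  also have "\<dots> = (\<Sum>z\<in>Z. h z * cnj (u z)) + (\<Sum>z\<in>Z. \<Sum>i\<in>I. cnj (c i) * (h z * cnj (b i z)))"
    by (rule sum.distrib)
  also have "(\<Sum>z\<in>Z. \<Sum>i\<in>I. cnj (c i) * (h z * cnj (b i z))) = (\<Sum>i\<in>I. \<Sum>z\<in>Z. cnj (c i) * (h z * cnj (b i z)))"
    by (rule sum.swap)
  also have "\<dots> = (\<Sum>i\<in>I. cnj (c i) * (\<Sum>z\<in>Z. h z * cnj (b i z)))"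
    by (simp only: sum_distrib_left)
  finally have hbk: "(\<Sum>z\<in>Z. h z * cnj (b k z)) = 0" using hu hb by simp
  have dec: "g z = h z + (\<Sum>i\<in>insert k I. a' i * b i z)" if z: "z \<in> Z" for z
  proof -
    have "(\<Sum>i\<in>insert k I. a' i * b i z) = t * b k z + (\<Sum>i\<in>I. a' i * b i z)"
      using insert.hyps by (simp add: a'_def)
    also have "(\<Sum>i\<in>I. a' i * b i z) = (\<Sum>i\<in>I. a i * b i z - t * (c i * b i z))"
      using insert.hyps by (intro sum.cong) (auto simp: a'_def algebra_simps)
    also have "\<dots> = (\<Sum>i\<in>I. a i * b i z) - t * (\<Sum>i\<in>I. c i * b i z)"
      by (simp add: sum_subtractf sum_distrib_left)
    finally show ?thesis using v(1) u(1) z by (simp add: h_def algebra_simps)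
  qed
  show ?case using dec hb hbk by (intro exI[of _ h] exI[of _ a']) auto
qed

section \<open>Relations among matchings\<close>

text \<open>The coefficients of \<open>x\<^sub>M \<Sum>\<^sub>j x_{ij}\<close> after the terms in which the edge \<open>{i, j}\<close> meets \<open>M\<close> are dropped.\<close>

definition star_relation :: "'a set \<Rightarrow> 'a set set \<times> 'a \<Rightarrow> 'a set set \<Rightarrow> complex" where
  "star_relation X = (\<lambda>(M, i) N. if \<exists>j\<in>X - \<Union>M - {i}. N = insert {i, j} M then 1 else 0)"

definition stars :: "'a set \<Rightarrow> nat \<Rightarrow> ('a set set \<times> 'a) set" where
  "stars X d = {(M, i). M \<in> all_matchings X \<and> Suc (card M) = d \<and> i \<in> X - \<Union>M}"

lemma finite_stars [simp]: "finite X \<Longrightarrow> finite (stars X d)"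
  by (rule finite_subset[of _ "all_matchings X \<times> X"]) (auto simp: stars_def)

lemma insert_pair_matching:
  assumes "finite X" "M \<in> matchings X m" "i \<in> X - \<Union>M" "j \<in> X - \<Union>M - {i}"
  shows "insert {i, j} M \<in> matchings X (Suc m)" "{i, j} \<notin> M"
proof -
  show nin: "{i, j} \<notin> M" using assms by blast
  have "disjoint (insert {i, j} M)"
    using assms unfolding matchings_def pairwise_insert disjnt_def by blast
  then show "insert {i, j} M \<in> matchings X (Suc m)"
    using assms nin matchings_finite[OF assms(1,2)] by (auto simp: matchings_def)
qed

lemma insert_pair_inj_on:
  assumes "finite X" "M \<in> matchings X m" "i \<in> X - \<Union>M"
  shows "inj_on (\<lambda>j. insert {i, j} M) (X - \<Union>M - {i})"
proof (rule inj_onI)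
  fix j k assume jk: "j \<in> X - \<Union>M - {i}" "k \<in> X - \<Union>M - {i}" "insert {i, j} M = insert {i, k} M"
  have "{i, j} \<in> insert {i, k} M" using jk(3) by blast
  then have "{i, j} = {i, k}" using insert_pair_matching(2)[OF assms jk(1)] by blast
  then show "j = k" using jk by (auto simp: doubleton_eq_iff)
qed

lemma sum_star_relation:
  assumes "finite X" "(M, i) \<in> stars X d"
  shows "(\<Sum>N\<in>matchings X d. h N * star_relation X (M, i) N) = (\<Sum>j\<in>X - \<Union>M - {i}. h (insert {i, j} M))"
proof -
  let ?J = "X - \<Union>M - {i}"
  have M: "M \<in> matchings X (card M)" "Suc (card M) = d" "i \<in> X - \<Union>M"
    using assms by (auto simp: stars_def all_matchings_iff)
  have sub: "(\<lambda>j. insert {i, j} M) ` ?J \<subseteq> matchings X d"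
    using insert_pair_matching(1)[OF assms(1) M(1,3)] M(2) by auto
  have inj: "inj_on (\<lambda>j. insert {i, j} M) ?J"
    by (rule insert_pair_inj_on[OF _ M(1,3)]) (simp add: assms(1))
  have "(\<Sum>N\<in>matchings X d. h N * star_relation X (M, i) N) =
      (\<Sum>N\<in>(\<lambda>j. insert {i, j} M) ` ?J. h N * star_relation X (M, i) N)"
    by (rule sum.mono_neutral_right) (use sub assms(1) in \<open>auto simp: star_relation_def\<close>)
  also have "\<dots> = (\<Sum>j\<in>?J. h (insert {i, j} M) * star_relation X (M, i) (insert {i, j} M))"
    using inj by (simp add: sum.reindex)
  also have "\<dots> = (\<Sum>j\<in>?J. h (insert {i, j} M))"
    by (rule sum.cong) (auto simp: star_relation_def)
  finally show ?thesis .
qed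

text \<open>Exactly one edge of \<open>P\<close> contains \<open>i\<close>, so at the point \<open>P\<close> the star polynomial takes the same value as the
monomial of \<open>M\<close>, which has smaller degree.\<close>

lemma spread_star_relation:
  assumes "finite X" "(M, i) \<in> stars X d" "P \<in> perfect_matchings X"
  shows "spread (star_relation X (M, i)) P = spread (\<lambda>N. if N = M then 1 else 0) P"
proof -
  let ?J = "X - \<Union>M - {i}"
  have M: "M \<in> matchings X (card M)" "i \<in> X - \<Union>M"
    using assms by (auto simp: stars_def all_matchings_iff)
  have P: "P \<subseteq> nsets X 2" "disjoint P" "\<Union>P = X" using assms(3) by (auto simp: perfect_matchings_def)
  have finP: "finite P" using P(1) assms(1) finite_pairs_subset by blast
  have R: "spread (\<lambda>N. if N = M then 1 else 0) P = (if M \<subseteq> P then 1 else 0 :: complex)"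
    using finP by (simp add: spread_def)
  obtain e where e: "e \<in> P" "i \<in> e" using P(3) M(2) by auto
  obtain k where k: "e = {i, k}" "k \<noteq> i" "k \<in> X"
    using P(1) e by (auto simp: nsets_def card_2_iff subset_iff)
  have uniq: "j = k" if "{i, j} \<in> P" for j
  proof -
    have "{i, j} = {i, k}" using disjointD[OF P(2) that e(1)] k(1) by blast
    then show ?thesis by (auto simp: doubleton_eq_iff)
  qed
  show ?thesis
  proof (cases "M \<subseteq> P")
    case True
    have "f \<inter> e = {}" if "f \<in> M" for f
    proof -
      have "f \<noteq> e" using that M(2) k by auto
      then show ?thesis using disjointD[OF P(2) _ e(1)] that True by blast
    qed
    then have kJ: "k \<in> ?J" using k by auto
    have "spread (star_relation X (M, i)) P = (\<Sum>N\<in>Pow P. if N = insert {i, k} M then 1 else 0)"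
      unfolding spread_def
    proof (rule sum.cong[OF refl])
      fix N assume "N \<in> Pow P"
      then have "(\<exists>j\<in>?J. N = insert {i, j} M) = (N = insert {i, k} M)"
        using uniq kJ by auto
      then show "star_relation X (M, i) N = (if N = insert {i, k} M then 1 else 0)"
        by (simp add: star_relation_def)
    qed
    also have "\<dots> = 1" using finP True e k by simp
    finally show ?thesis using R True by simp
  next
    case False
    have "spread (star_relation X (M, i)) P = 0"
      unfolding spread_def by (rule sum.neutral) (use False in \<open>auto simp: star_relation_def\<close>)
    then show ?thesis using R False by simp
  qed
qed

text \<open>A function orthogonal to all star relations is harmonic.\<close>

lemma harmonics_decomposition:
  assumes "finite X"
  shows "\<exists>h a. h \<in> harmonics X d \<and>
     (\<forall>N\<in>matchings X d. g N = h N + (\<Sum>s\<in>stars X d. a s * star_relation X s N))"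
proof -
  obtain h a where h: "\<forall>N\<in>matchings X d. g N = h N + (\<Sum>s\<in>stars X d. a s * star_relation X s N)"
     "\<forall>s\<in>stars X d. (\<Sum>N\<in>matchings X d. h N * cnj (star_relation X s N)) = 0"
    using orthogonal_decomposition[of "matchings X d" "stars X d" g "star_relation X"] assms by auto
  define h' where "h' = (\<lambda>N. if N \<in> matchings X d then h N else 0)"
  have "harmonic X d h'"
    unfolding harmonic_def
  proof (intro allI impI)
    fix M i assume M: "Suc (card M) = d" "M \<in> matchings X (card M)" "i \<in> X - \<Union>M"
    then have s: "(M, i) \<in> stars X d" by (auto simp: stars_def all_matchings_iff)
    have "(\<Sum>j\<in>X - \<Union>M - {i}. h' (insert {i, j} M)) = (\<Sum>N\<in>matchings X d. h' N * star_relation X (M, i) N)"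
      by (rule sum_star_relation[OF assms s, symmetric])
    also have "\<dots> = (\<Sum>N\<in>matchings X d. h N * cnj (star_relation X (M, i) N))"
      by (rule sum.cong) (auto simp: h'_def star_relation_def)
    finally show "(\<Sum>j\<in>X - \<Union>M - {i}. h' (insert {i, j} M)) = 0" using h(2) s by simp
  qed
  then have "h' \<in> harmonics X d" by (auto simp: harmonics_def h'_def)
  moreover have "\<forall>N\<in>matchings X d. g N = h' N + (\<Sum>s\<in>stars X d. a s * star_relation X s N)"
    using h(1) by (simp add: h'_def)
  ultimately show ?thesis by blast
qed

text \<open>The spread of a star relation equals a spread of lower degree. So \<open>spread g = 0\<close> expresses \<open>spread h\<close> through
spreads of lower degree, to which it is orthogonal; hence \<open>spread h = 0\<close>.\<close>

lemma harmonic_top_part_eq_0: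
  assumes "finite X" "even (card X)" "h \<in> harmonics X d"
    and top: "\<And>M. M \<in> matchings X d \<Longrightarrow> g M = h M + (\<Sum>s\<in>stars X d. a s * star_relation X s M)"
    and supp: "\<And>M. M \<in> all_matchings X \<Longrightarrow> d < card M \<Longrightarrow> g M = 0"
    and zero: "\<And>P. P \<in> perfect_matchings X \<Longrightarrow> spread g P = 0"
  shows "h M = 0"
proof -
  let ?h = "\<lambda>M. cnj (h M)"
  let ?l0 = "\<lambda>M. if card M < d then g M else 0"
  (* The terms of degree below \<open>d\<close>, together with the terms that replace the star relations. *)
  let ?low = "\<lambda>M. ?l0 M + (\<Sum>s\<in>stars X d. a s * (if M = fst s then 1 else 0))"
  have hc: "?h \<in> harmonics X d" by (rule harmonics_cnj[OF assms(3)])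
  have dec: "spread g P = spread h P + spread ?low P" if P: "P \<in> perfect_matchings X" for P
  proof -
    have "spread g P = (\<Sum>M\<in>Pow P. h M + (?l0 M + (\<Sum>s\<in>stars X d. a s * star_relation X s M)))"
      unfolding spread_def
    proof (rule sum.cong[OF refl])
      fix M assume "M \<in> Pow P"
      then have M: "M \<in> matchings X (card M)" 
        using subset_perfect_all_matchings[OF P] by (auto simp: all_matchings_iff)
      have rel0: "star_relation X s M = 0" if "card M \<noteq> d" "s \<in> stars X d" for s
      proof (rule ccontr)
        assume "star_relation X s M \<noteq> 0"
        moreover obtain M' i where s: "s = (M', i)" by fastforce
        ultimately obtain j where j: "j \<in> X - \<Union>M' - {i}" "M = insert {i, j} M'"
          by (auto simp: star_relation_def split: if_splits)
        have "M \<in> matchings X d"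
          using insert_pair_matching(1)[OF assms(1) _ _ j(1)] j(2) that(2)
          by (auto simp: stars_def all_matchings_iff s)
        then show False using that(1) matchings_card by blast
      qed
      consider "card M = d" | "card M < d" | "card M > d" by linarith
      then show "g M = h M + (?l0 M + (\<Sum>s\<in>stars X d. a s * star_relation X s M))"
      proof cases
        case 1
        then show ?thesis using top M by simp
      next
        case 2
        then show ?thesis using rel0 harmonics_card[OF assms(3), of M] by simp
      next
        case 3
        then show ?thesis using rel0 harmonics_card[OF assms(3), of M] supp M by (simp add: all_matchings_iff)
      qed
    qed
    also have "\<dots> = spread h P + (\<Sum>M\<in>Pow P. ?l0 M) + (\<Sum>M\<in>Pow P. \<Sum>s\<in>stars X d. a s * star_relation X s M)"
      by (simp add: spread_def sum.distrib)
    also have "(\<Sum>M\<in>Pow P. \<Sum>s\<in>stars X d. a s * star_relation X s M) =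
        (\<Sum>s\<in>stars X d. a s * spread (star_relation X s) P)"
      unfolding spread_def sum_distrib_left by (rule sum.swap)
    also have "\<dots> = (\<Sum>s\<in>stars X d. a s * spread (\<lambda>N. if N = fst s then 1 else 0) P)"
      by (rule sum.cong[OF refl]) (use spread_star_relation[OF assms(1) _ P] in force)
    also have "\<dots> = (\<Sum>M\<in>Pow P. \<Sum>s\<in>stars X d. a s * (if M = fst s then 1 else 0))"
      unfolding spread_def sum_distrib_left by (rule sum.swap)
    finally show ?thesis by (simp add: spread_def sum.distrib)
  qed
  have "(\<Sum>P\<in>perfect_matchings X. spread ?low P * spread ?h P) = 0"
  proof (rule harmonics_orthogonal_lower[OF assms(1) hc])
    fix M :: "'a set set" assume "d \<le> card M"
    then show "?low M = 0" by (auto simp: stars_def intro!: sum.neutral)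
  qed
  moreover have "(\<Sum>P\<in>perfect_matchings X. (spread h P + spread ?low P) * spread ?h P) = 0"
    using zero dec by (intro sum.neutral) auto
  ultimately have "(\<Sum>P\<in>perfect_matchings X. spread h P * spread ?h P) = 0"
    by (simp only: distrib_right sum.distrib add_0_right)
  then have "(\<Sum>P\<in>perfect_matchings X. spread ?h P * spread h P) = 0"
    by (simp only: mult.commute)
  from harmonics_definite[OF assms(1-3) this] show ?thesis .
qed

text \<open>The previous lemma applies to the largest degree \<open>e\<close> in which some \<open>h e\<close> does not vanish.\<close>

lemma graded_harmonics_spread_injective:
  assumes "finite X" "even (card X)" 
    and h: "\<And>d. d \<le> D \<Longrightarrow> h d \<in> harmonics X d"
    and zero: "\<And>P. P \<in> perfect_matchings X \<Longrightarrow> (\<Sum>d\<le>D. spread (h d) P) = 0"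
    and "d \<le> D"
  shows "h d M = 0"
proof (rule ccontr)
  assume "h d M \<noteq> 0"
  define Q where "Q = (\<lambda>d. d \<le> D \<and> (\<exists>M. h d M \<noteq> 0))"
  have Q: "Q d" using \<open>h d M \<noteq> 0\<close> assms(5) by (auto simp: Q_def)
  obtain e where e: "Q e" "\<And>d. Q d \<Longrightarrow> d \<le> e"
    using Q by (metis (no_types, lifting) Q_def GreatestI_nat Greatest_le_nat)
  have eD: "e \<le> D" using e(1) by (simp add: Q_def)
  let ?g = "\<lambda>M. \<Sum>d\<le>D. h d M"
  have "h e M = 0" for M
  proof (rule harmonic_top_part_eq_0[OF assms(1,2) h[OF eD], where a = "\<lambda>_. 0" and g = ?g])
    fix M assume "M \<in> matchings X e"
    then have "?g M = (\<Sum>d\<le>D. if d = e then h e M else 0)"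
      using harmonics_card[OF h, of _ M] matchings_card[of M X e] by (intro sum.cong) auto
    then show "?g M = h e M + (\<Sum>s\<in>stars X e. 0 * star_relation X s M)" using eD by simp
  next
    fix M :: "'a set set" assume "e < card M"
    have "h k M = 0" if "k \<le> D" for k
    proof (rule ccontr)
      assume "h k M \<noteq> 0"
      then have "k \<le> e" "card M = k" using e(2)[of k] that harmonics_card[OF h[OF that]] by (auto simp: Q_def)
      then show False using \<open>e < card M\<close> by simp
    qed
    then show "?g M = 0" by simp
  next
    fix P assume P: "P \<in> perfect_matchings X"
    have "spread ?g P = (\<Sum>d\<le>D. spread (h d) P)" unfolding spread_def by (rule sum.swap)
    then show "spread ?g P = 0" using zero P by simp
  qed
  then show False using e(1) by (simp add: Q_def)
qed

section \<open>Tabloids and column antisymmetrization\<close>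

abbreviation pinv :: "('a \<Rightarrow> 'a) \<Rightarrow> 'a \<Rightarrow> 'a" where
  "pinv \<equiv> inv_into UNIV"

abbreviation (input) move :: "(nat \<Rightarrow> nat) \<Rightarrow> tabloid \<Rightarrow> tabloid" where
  "move w T \<equiv> (\<lambda>i. w ` T i)"

definition column :: "nat list \<Rightarrow> (nat \<times> nat \<Rightarrow> nat) \<Rightarrow> nat \<Rightarrow> nat set" where
  "column \<mu> t j = t ` {(i, j') \<in> cells \<mu>. j' = j}"

text \<open>The linear extension of \<open>f\<close> from basis elements to finite formal combinations.\<close>

definition lin :: "('a \<Rightarrow> complex) \<Rightarrow> ('a \<Rightarrow>\<^sub>0 complex) \<Rightarrow> complex" where
  "lin f v = (\<Sum>T\<in>Poly_Mapping.keys v. Poly_Mapping.lookup v T * f T)"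

lemma poly_mapping_sum_single: "f = (\<Sum>m\<in>Poly_Mapping.keys f. Poly_Mapping.single m (Poly_Mapping.lookup f m))"
  by (rule poly_mapping_eqI) (simp add: lookup_sum lookup_single when_def in_keys_iff)

lemma lin_superset: "finite A \<Longrightarrow> Poly_Mapping.keys v \<subseteq> A \<Longrightarrow> lin f v = (\<Sum>T\<in>A. Poly_Mapping.lookup v T * f T)"
  unfolding lin_def by (rule sum.mono_neutral_left) (auto simp: in_keys_iff)

lemma lin_zero [simp]: "lin f 0 = 0"
  by (simp add: lin_def)

lemma lin_add: "lin f (u + v) = lin f u + lin f v"
proof -
  let ?A = "Poly_Mapping.keys u \<union> Poly_Mapping.keys v"
  have "lin f (u + v) = (\<Sum>T\<in>?A. Poly_Mapping.lookup (u + v) T * f T)"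
    by (rule lin_superset) (auto simp: Poly_Mapping.keys_add)
  also have "\<dots> = lin f u + lin f v"
    by (simp add: lin_superset[of ?A] lookup_add distrib_right sum.distrib)
  finally show ?thesis .
qed

lemma lin_sum: "lin f (sum g A) = (\<Sum>a\<in>A. lin f (g a))"
  by (induction A rule: infinite_finite_induct) (auto simp: lin_add)

lemma lin_single: "lin f (Poly_Mapping.single T c) = c * f T"
  by (cases "c = 0") (auto simp: lin_def)

lemma lookup_scale_tabloids [simp]: "Poly_Mapping.lookup (scale_tabloids c v) T = c * Poly_Mapping.lookup v T"
  by (simp add: scale_tabloids_def Poly_Mapping.map.rep_eq when_def)

lemma lin_scale: "lin f (scale_tabloids c v) = c * lin f v"
proof -
  have "lin f (scale_tabloids c v) = (\<Sum>T\<in>Poly_Mapping.keys v. Poly_Mapping.lookup (scale_tabloids c v) T * f T)"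
    by (rule lin_superset) (auto simp: in_keys_iff)
  then show ?thesis by (simp add: lin_def sum_distrib_left mult.assoc)
qed

interpretation tabloid_space: Modules.module scale_tabloids
  by unfold_locales (auto intro!: poly_mapping_eqI simp: lookup_add algebra_simps)

lemma move_move: "move p (move q T) = move (p \<circ> q) T"
  by (simp add: image_comp)

lemma move_inv: "bij w \<Longrightarrow> move (pinv w) (move w T) = T" "bij w \<Longrightarrow> move w (move (pinv w) T) = T"
  by (simp_all add: image_comp bij_is_inj surj_iff[THEN iffD1, OF bij_is_surj])

lemma move_eq_iff: "bij w \<Longrightarrow> move w S = T \<longleftrightarrow> S = move (pinv w) T"
  using move_inv by metis

lemma lookup_perm_tabloids:
  assumes "bij w"
  shows "Poly_Mapping.lookup (perm_tabloids w v) T = Poly_Mapping.lookup v (move (pinv w) T)"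
proof -
  have "Poly_Mapping.lookup (perm_tabloids w v) T =
      (\<Sum>S\<in>Poly_Mapping.keys v. Poly_Mapping.lookup (Poly_Mapping.single (move w S) (Poly_Mapping.lookup v S)) T)"
    by (simp add: perm_tabloids_def lookup_sum)
  also have "\<dots> = (\<Sum>S\<in>Poly_Mapping.keys v. if S = move (pinv w) T then Poly_Mapping.lookup v S else 0)"
    by (rule sum.cong) (auto simp: lookup_single when_def move_eq_iff[OF assms])
  also have "\<dots> = Poly_Mapping.lookup v (move (pinv w) T)"
    by (simp add: in_keys_iff)
  finally show ?thesis .
qed

lemma perm_tabloids_add: "bij w \<Longrightarrow> perm_tabloids w (u + v) = perm_tabloids w u + perm_tabloids w v"
  by (rule poly_mapping_eqI) (simp add: lookup_perm_tabloids lookup_add)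

lemma perm_tabloids_scale: "bij w \<Longrightarrow> perm_tabloids w (scale_tabloids c v) = scale_tabloids c (perm_tabloids w v)"
  by (rule poly_mapping_eqI) (simp add: lookup_perm_tabloids)

lemma perm_tabloids_0 [simp]: "perm_tabloids w 0 = 0"
  by (simp add: perm_tabloids_def)

lemma perm_tabloids_sum: "bij w \<Longrightarrow> perm_tabloids w (sum g A) = (\<Sum>a\<in>A. perm_tabloids w (g a))"
  by (induction A rule: infinite_finite_induct) (auto simp: perm_tabloids_add)

lemma perm_tabloids_single: "perm_tabloids w (Poly_Mapping.single T c) = Poly_Mapping.single (move w T) c"
  by (cases "c = 0") (auto simp: perm_tabloids_def)

lemma scale_tabloids_single: "scale_tabloids c (Poly_Mapping.single T d) = Poly_Mapping.single T (c * d)"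
  by (rule poly_mapping_eqI) (simp add: lookup_single when_def)

lemma lin_perm_tabloids:
  assumes "bij w"
  shows "lin f (perm_tabloids w v) = lin (\<lambda>T. f (move w T)) v"
proof -
  have "lin f (perm_tabloids w v) = lin f (\<Sum>T\<in>Poly_Mapping.keys v. Poly_Mapping.single (move w T) (Poly_Mapping.lookup v T))"
    by (simp add: perm_tabloids_def)
  then show ?thesis by (simp add: lin_sum lin_single) (simp add: lin_def)
qed

lemma column_stabilizer_iff:
  "q \<in> column_stabilizer \<mu> t \<longleftrightarrow> q permutes {1..sum_list \<mu>} \<and> (\<forall>j. q ` column \<mu> t j = column \<mu> t j)"
  by (simp add: column_stabilizer_def column_def)

lemma finite_column_stabilizer [simp]: "finite (column_stabilizer \<mu> t)"
  by (rule finite_subset[OF _ finite_permutations[of "{1..sum_list \<mu>}"]]) (auto simp: column_stabilizer_iff)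

lemma column_stabilizer_permutes: "q \<in> column_stabilizer \<mu> t \<Longrightarrow> q permutes {1..sum_list \<mu>}"
  by (simp add: column_stabilizer_iff)

lemma column_stabilizer_bij: "q \<in> column_stabilizer \<mu> t \<Longrightarrow> bij q"
  using column_stabilizer_permutes permutes_bij by blast

lemma column_stabilizer_permutation: "q \<in> column_stabilizer \<mu> t \<Longrightarrow> permutation q"
  using column_stabilizer_permutes permutation_permutes by blast

lemma column_stabilizer_id [simp]: "id \<in> column_stabilizer \<mu> t"
  by (simp add: column_stabilizer_iff permutes_id)

lemma column_stabilizer_comp:
  "p \<in> column_stabilizer \<mu> t \<Longrightarrow> q \<in> column_stabilizer \<mu> t \<Longrightarrow> p \<circ> q \<in> column_stabilizer \<mu> t"
  unfolding column_stabilizer_iff image_comp[symmetric] by (simp add: permutes_compose)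

lemma column_stabilizer_inv:
  assumes "q \<in> column_stabilizer \<mu> t"
  shows "pinv q \<in> column_stabilizer \<mu> t"
proof -
  have "inj q" using column_stabilizer_bij[OF assms] bij_is_inj by blast
  then have "pinv q ` column \<mu> t j = column \<mu> t j" for j
    using assms by (metis column_stabilizer_iff inv_f_f image_inv_f_f)
  then show ?thesis using assms by (simp add: column_stabilizer_iff permutes_inv)
qed

lemma column_subset: 
  assumes "is_tableau \<mu> t"
  shows "column \<mu> t j \<subseteq> {1..sum_list \<mu>}"
  using assms by (auto simp: is_tableau_def column_def bij_betw_def)

lemma column_disjoint:
  assumes "is_tableau \<mu> t" "x \<in> column \<mu> t j" "x \<in> column \<mu> t k"
  shows "j = k"
  using assms unfolding is_tableau_def column_def bij_betw_def inj_on_def by fastforce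

lemma transpose_column_stabilizer:
  assumes "is_tableau \<mu> t" "x \<in> column \<mu> t j" "y \<in> column \<mu> t j"
  shows "transpose x y \<in> column_stabilizer \<mu> t"
proof -
  have "transpose x y ` column \<mu> t k = column \<mu> t k" for k
  proof (cases "k = j")
    case True
    then show ?thesis using assms(2,3) by simp
  next
    case False
    then have "x \<notin> column \<mu> t k" "y \<notin> column \<mu> t k" using column_disjoint[OF assms(1)] assms(2,3) by metis+
    then show ?thesis by simp
  qed
  then show ?thesis
    using assms column_subset[OF assms(1), of j] by (auto simp: column_stabilizer_iff intro!: permutes_swap_id)
qed

abbreviation csign :: "(nat \<Rightarrow> nat) \<Rightarrow> complex" where
  "csign q \<equiv> of_int (sign q)"

lemma csign_squared [simp]: "csign q * csign q = 1"
  by (metis of_int_1 of_int_mult sign_idempotent)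

lemma sum_column_inv:
  "(\<Sum>q\<in>column_stabilizer \<mu> t. f (pinv q)) = (\<Sum>q\<in>column_stabilizer \<mu> t. f q)"
  by (rule sum.reindex_bij_witness[where i = pinv and j = pinv])
     (auto simp: column_stabilizer_inv column_stabilizer_bij inv_inv_eq)

text \<open>Composition with the transposition pairs up terms of opposite sign.\<close>

lemma sum_column_sign_left_0:
  assumes "transpose x y \<in> column_stabilizer \<mu> t" "x \<noteq> y"
    and invar: "\<And>q. q \<in> column_stabilizer \<mu> t \<Longrightarrow> f (transpose x y \<circ> q) = f q"
  shows "(\<Sum>q\<in>column_stabilizer \<mu> t. csign q * f q) = 0"
proof -
  let ?Q = "column_stabilizer \<mu> t" and ?\<tau> = "transpose x y"
  have tt: "?\<tau> \<circ> (?\<tau> \<circ> q) = q" for q :: "nat \<Rightarrow> nat" by (simp add: fun_eq_iff)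
  have "(\<Sum>q\<in>?Q. csign q * f q) = (\<Sum>q\<in>?Q. csign (?\<tau> \<circ> q) * f (?\<tau> \<circ> q))"
    by (rule sum.reindex_bij_witness[where i = "\<lambda>q. ?\<tau> \<circ> q" and j = "\<lambda>q. ?\<tau> \<circ> q"])
       (auto simp: tt column_stabilizer_comp assms(1))
  also have "\<dots> = (\<Sum>q\<in>?Q. - (csign q * f q))"
    by (rule sum.cong)
       (use assms in \<open>auto simp: invar sign_compose permutation_swap_id column_stabilizer_permutation sign_swap_id\<close>)
  also have "\<dots> = - (\<Sum>q\<in>?Q. csign q * f q)" by (rule sum_negf)
  finally show ?thesis by simp
qed

lemma sum_column_sign_right_0:
  assumes "transpose x y \<in> column_stabilizer \<mu> t" "x \<noteq> y"
    and invar: "\<And>q. q \<in> column_stabilizer \<mu> t \<Longrightarrow> f (q \<circ> transpose x y) = f q"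
  shows "(\<Sum>q\<in>column_stabilizer \<mu> t. csign q * f q) = 0"
proof -
  let ?Q = "column_stabilizer \<mu> t" and ?\<tau> = "transpose x y"
  have tt: "q \<circ> ?\<tau> \<circ> ?\<tau> = q" for q :: "nat \<Rightarrow> nat" by (simp add: fun_eq_iff)
  have "(\<Sum>q\<in>?Q. csign q * f q) = (\<Sum>q\<in>?Q. csign (q \<circ> ?\<tau>) * f (q \<circ> ?\<tau>))"
    by (rule sum.reindex_bij_witness[where i = "\<lambda>q. q \<circ> ?\<tau>" and j = "\<lambda>q. q \<circ> ?\<tau>"])
       (auto simp: tt column_stabilizer_comp assms(1))
  also have "\<dots> = (\<Sum>q\<in>?Q. - (csign q * f q))"
    by (rule sum.cong)
       (use assms in \<open>auto simp: invar sign_compose permutation_swap_id column_stabilizer_permutation sign_swap_id\<close>)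
  also have "\<dots> = - (\<Sum>q\<in>?Q. csign q * f q)" by (rule sum_negf)
  finally show ?thesis by simp
qed

text \<open>The action of the element \<open>\<Sum>\<^sub>q sign q \<cdot> q\<close> of the group algebra, where \<open>q\<close> runs over the column stabilizer.\<close>

definition column_antisym :: "nat list \<Rightarrow> (nat \<times> nat \<Rightarrow> nat) \<Rightarrow> (tabloid \<Rightarrow>\<^sub>0 complex) \<Rightarrow> tabloid \<Rightarrow>\<^sub>0 complex" where
  "column_antisym \<mu> t v = (\<Sum>q\<in>column_stabilizer \<mu> t. scale_tabloids (csign q) (perm_tabloids q v))"

lemma column_antisym_add: "column_antisym \<mu> t (u + v) = column_antisym \<mu> t u + column_antisym \<mu> t v"
  unfolding column_antisym_def
  by (simp add: perm_tabloids_add column_stabilizer_bij tabloid_space.scale_right_distrib sum.distrib)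

lemma column_antisym_scale: "column_antisym \<mu> t (scale_tabloids c v) = scale_tabloids c (column_antisym \<mu> t v)"
  unfolding column_antisym_def tabloid_space.scale_sum_right
  by (rule sum.cong) (simp_all add: perm_tabloids_scale column_stabilizer_bij mult.commute)

lemma column_antisym_0 [simp]: "column_antisym \<mu> t 0 = 0"
  by (simp add: column_antisym_def)

lemma column_antisym_sum: "column_antisym \<mu> t (sum g A) = (\<Sum>a\<in>A. column_antisym \<mu> t (g a))"
  by (induction A rule: infinite_finite_induct) (auto simp: column_antisym_add)

lemma lookup_antisym:
  "Poly_Mapping.lookup (column_antisym \<mu> t v) T = (\<Sum>q\<in>column_stabilizer \<mu> t. csign q * Poly_Mapping.lookup v (move q T))"
proof -
  have "Poly_Mapping.lookup (column_antisym \<mu> t v) T =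
      (\<Sum>q\<in>column_stabilizer \<mu> t. csign (pinv q) * Poly_Mapping.lookup v (move (pinv q) T))"
    unfolding column_antisym_def lookup_sum
    by (rule sum.cong) (auto simp: lookup_perm_tabloids column_stabilizer_bij sign_inverse column_stabilizer_permutation)
  also have "\<dots> = (\<Sum>q\<in>column_stabilizer \<mu> t. csign q * Poly_Mapping.lookup v (move q T))"
    by (rule sum_column_inv)
  finally show ?thesis .
qed

lemma column_antisym_single:
  "column_antisym \<mu> t (Poly_Mapping.single T c) = (\<Sum>q\<in>column_stabilizer \<mu> t. Poly_Mapping.single (move q T) (csign q * c))"
  by (simp add: column_antisym_def perm_tabloids_single scale_tabloids_single)

lemma tabloid_of_comp: "tabloid_of \<mu> (q \<circ> t) = move q (tabloid_of \<mu> t)"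
  by (simp add: tabloid_of_def image_comp)

lemma polytabloid_eq_antisym: "polytabloid \<mu> t = column_antisym \<mu> t (Poly_Mapping.single (tabloid_of \<mu> t) 1)"
  by (simp add: polytabloid_def column_antisym_single tabloid_of_comp)

lemma column_antisym_move:
  assumes "p \<in> column_stabilizer \<mu> t"
  shows "column_antisym \<mu> t (Poly_Mapping.single (move p T) c) = scale_tabloids (csign p) (column_antisym \<mu> t (Poly_Mapping.single T c))"
proof -
  have "column_antisym \<mu> t (Poly_Mapping.single (move p T) c) =
      (\<Sum>q\<in>column_stabilizer \<mu> t. Poly_Mapping.single (move (q \<circ> p) T) (csign p * (csign (q \<circ> p) * c)))"
    unfolding column_antisym_single move_move
  proof (rule sum.cong[OF refl])
    fix q assume "q \<in> column_stabilizer \<mu> t"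
    then have "csign (q \<circ> p) = csign q * csign p"
      using assms by (simp add: sign_compose column_stabilizer_permutation)
    then have "csign p * (csign (q \<circ> p) * c) = csign q * c"
      by (simp add: algebra_simps)
    then show "Poly_Mapping.single (move (q \<circ> p) T) (csign q * c) = 
        Poly_Mapping.single (move (q \<circ> p) T) (csign p * (csign (q \<circ> p) * c))" by (simp only:)
  qed
  also have "\<dots> = (\<Sum>q\<in>column_stabilizer \<mu> t. Poly_Mapping.single (move q T) (csign p * (csign q * c)))"
  proof (rule sum.reindex_bij_witness[where i = "\<lambda>q. q \<circ> pinv p" and j = "\<lambda>q. q \<circ> p"])
    have p: "bij p" "pinv p \<in> column_stabilizer \<mu> t"
      using assms column_stabilizer_bij column_stabilizer_inv by blast+
    fix q assume q: "q \<in> column_stabilizer \<mu> t"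
    show "q \<circ> p \<circ> pinv p = q" "q \<circ> pinv p \<circ> p = q" 
      using p(1) by (simp_all add: comp_assoc bij_is_inj surj_iff[THEN iffD1, OF bij_is_surj])
    show "q \<circ> p \<in> column_stabilizer \<mu> t" "q \<circ> pinv p \<in> column_stabilizer \<mu> t"
      using q p assms column_stabilizer_comp by blast+
  qed auto
  finally show ?thesis
    by (simp add: column_antisym_single tabloid_space.scale_sum_right scale_tabloids_single)
qed

lemma column_antisym_idem: "column_antisym \<mu> t (column_antisym \<mu> t v) = scale_tabloids (of_nat (card (column_stabilizer \<mu> t))) (column_antisym \<mu> t v)"
proof (rule poly_mapping_eqI)
  fix T
  let ?Q = "column_stabilizer \<mu> t"
  have "Poly_Mapping.lookup (column_antisym \<mu> t (column_antisym \<mu> t v)) T =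
    (\<Sum>q\<in>?Q. csign q * (\<Sum>p\<in>?Q. csign p * Poly_Mapping.lookup v (move (p \<circ> q) T)))"
    by (simp add: lookup_antisym move_move)
  also have "\<dots> = (\<Sum>q\<in>?Q. \<Sum>p\<in>?Q. csign p * Poly_Mapping.lookup v (move p T))"
  proof (rule sum.cong[OF refl])
    fix q assume q: "q \<in> ?Q"
    then have bq: "bij q" "pinv q \<in> ?Q" by (auto intro: column_stabilizer_bij column_stabilizer_inv)
    have "csign q * (\<Sum>p\<in>?Q. csign p * Poly_Mapping.lookup v (move (p \<circ> q) T)) =
        (\<Sum>p\<in>?Q. csign (p \<circ> q) * Poly_Mapping.lookup v (move (p \<circ> q) T))"
      unfolding sum_distrib_left
      by (rule sum.cong) (use q in \<open>auto simp: sign_compose column_stabilizer_permutation\<close>)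
    also have "\<dots> = (\<Sum>p\<in>?Q. csign p * Poly_Mapping.lookup v (move p T))"
    proof (rule sum.reindex_bij_witness[where i = "\<lambda>p. p \<circ> pinv q" and j = "\<lambda>p. p \<circ> q"])
      fix p assume p: "p \<in> ?Q"
      show "p \<circ> q \<circ> pinv q = p" "p \<circ> pinv q \<circ> q = p"
        using bq by (simp_all add: comp_assoc bij_is_inj surj_iff[THEN iffD1, OF bij_is_surj])
      show "p \<circ> q \<in> ?Q" "p \<circ> pinv q \<in> ?Q" using p q bq column_stabilizer_comp by blast+
    qed auto
    finally show "csign q * (\<Sum>p\<in>?Q. csign p * Poly_Mapping.lookup v (move (p \<circ> q) T)) =
      (\<Sum>p\<in>?Q. csign p * Poly_Mapping.lookup v (move p T))" .
  qed
  finally show "Poly_Mapping.lookup (column_antisym \<mu> t (column_antisym \<mu> t v)) T =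
      Poly_Mapping.lookup (scale_tabloids (of_nat (card ?Q)) (column_antisym \<mu> t v)) T"
    by (simp add: lookup_antisym)
qed

lemma lin_antisym: "lin f (column_antisym \<mu> t v) = (\<Sum>q\<in>column_stabilizer \<mu> t. csign q * lin (\<lambda>T. f (move q T)) v)"
  unfolding column_antisym_def by (simp add: lin_sum lin_scale lin_perm_tabloids column_stabilizer_bij)

lemma lin_polytabloid: "lin f (polytabloid \<mu> t) = (\<Sum>q\<in>column_stabilizer \<mu> t. csign q * f (move q (tabloid_of \<mu> t)))"
  by (simp add: polytabloid_eq_antisym lin_antisym lin_single)

text \<open>A row and a column have only one entry in common.\<close>

lemma tabloid_fixed_by_column_stabilizer:
  assumes "is_tableau \<mu> t" "q \<in> column_stabilizer \<mu> t" "move q (tabloid_of \<mu> t) = tabloid_of \<mu> t"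
  shows "q = id"
proof
  fix x
  show "q x = id x"
  proof (cases "x \<in> {1..sum_list \<mu>}")
    case True
    then have "x \<in> t ` cells \<mu>" using assms(1) by (simp add: is_tableau_def bij_betw_def)
    then obtain i j where ij: "(i, j) \<in> cells \<mu>" "x = t (i, j)" by (metis imageE surj_pair)
    have "q x \<in> tabloid_of \<mu> t i"
      using ij assms(3)[THEN fun_cong, of i] by (auto simp: tabloid_of_def)
    then obtain j' where j': "(i, j') \<in> cells \<mu>" "q x = t (i, j')" by (auto simp: tabloid_of_def)
    have "x \<in> column \<mu> t j" using ij by (auto simp: column_def)
    moreover have "q ` column \<mu> t j = column \<mu> t j" using assms(2) by (simp add: column_stabilizer_iff)
    ultimately have "q x \<in> column \<mu> t j" by blast
    then obtain i' where i': "(i', j) \<in> cells \<mu>" "q x = t (i', j)" by (auto simp: column_def)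
    have "(i, j') = (i', j)" using i' j' assms(1) by (auto simp: is_tableau_def bij_betw_def dest: inj_onD)
    then show ?thesis using j' ij by simp
  next
    case False
    then show ?thesis using column_stabilizer_permutes[OF assms(2)] by (simp add: permutes_not_in)
  qed
qed

lemma lookup_polytabloid_self:
  assumes "is_tableau \<mu> t"
  shows "Poly_Mapping.lookup (polytabloid \<mu> t) (tabloid_of \<mu> t) = 1"
proof -
  let ?T = "tabloid_of \<mu> t"
  have "Poly_Mapping.lookup (polytabloid \<mu> t) ?T =
      (\<Sum>q\<in>column_stabilizer \<mu> t. csign q * Poly_Mapping.lookup (Poly_Mapping.single ?T 1) (move q ?T))"
    by (simp add: polytabloid_eq_antisym lookup_antisym)
  also have "\<dots> = (\<Sum>q\<in>column_stabilizer \<mu> t. if q = id then 1 else 0)"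
    by (rule sum.cong) (use tabloid_fixed_by_column_stabilizer[OF assms] in \<open>auto simp: lookup_single when_def\<close>)
  also have "\<dots> = 1" by simp
  finally show ?thesis .
qed

text \<open>The column stabilizer of \<open>w \<circ> t\<close> is conjugate under \<open>w\<close> to that of \<open>t\<close>, and conjugation preserves signs.\<close>

lemma perm_polytabloid:
  assumes "w permutes {1..sum_list \<mu>}"
  shows "perm_tabloids w (polytabloid \<mu> t) = polytabloid \<mu> (w \<circ> t)"
proof -
  have bw: "bij w" using assms permutes_bij by blast
  have pw: "permutation w" using assms permutation_permutes by blast
  have col: "column \<mu> (w \<circ> t) j = w ` column \<mu> t j" for j by (simp add: column_def image_comp)
  have conj: "w \<circ> q \<circ> pinv w \<in> column_stabilizer \<mu> (w \<circ> t)" if "q \<in> column_stabilizer \<mu> t" for q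
  proof -
    have "(w \<circ> q \<circ> pinv w) ` (w ` column \<mu> t j) = w ` column \<mu> t j" for j
    proof -
      have "q ` column \<mu> t j = column \<mu> t j" using that by (simp add: column_stabilizer_iff)
      then show ?thesis unfolding image_comp[symmetric] by (simp only: image_inv_f_f[OF bij_is_inj[OF bw]])
    qed
    then show ?thesis using that assms 
      by (auto simp: column_stabilizer_iff col intro!: permutes_compose permutes_inv)
  qed
  have conj': "pinv w \<circ> q \<circ> w \<in> column_stabilizer \<mu> t" if "q \<in> column_stabilizer \<mu> (w \<circ> t)" for q
  proof -
    have "(pinv w \<circ> q \<circ> w) ` column \<mu> t j = column \<mu> t j" for j
    proof -
      have "q ` w ` column \<mu> t j = w ` column \<mu> t j" using that by (simp add: column_stabilizer_iff col)
      then show ?thesis unfolding image_comp[symmetric] by (simp only: image_inv_f_f[OF bij_is_inj[OF bw]])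
    qed
    then show ?thesis using that assms 
      by (auto simp: column_stabilizer_iff col intro!: permutes_compose permutes_inv)
  qed
  have iw: "pinv w \<circ> w = id" "w \<circ> pinv w = id"
    using bw by (simp_all add: bij_is_inj surj_iff[THEN iffD1, OF bij_is_surj])
  have iw': "pinv w (w x) = x" "w (pinv w x) = x" for x
    using iw by (metis comp_apply id_apply)+
  have "perm_tabloids w (polytabloid \<mu> t) =
     (\<Sum>q\<in>column_stabilizer \<mu> t. Poly_Mapping.single (move w (move q (tabloid_of \<mu> t))) (csign q))"
    by (simp add: polytabloid_def tabloid_of_comp perm_tabloids_sum[OF bw] perm_tabloids_single)
  also have "\<dots> = (\<Sum>q\<in>column_stabilizer \<mu> (w \<circ> t). Poly_Mapping.single (move q (move w (tabloid_of \<mu> t))) (csign q))"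
  proof (rule sum.reindex_bij_witness[where i = "\<lambda>q. pinv w \<circ> q \<circ> w" and j = "\<lambda>q. w \<circ> q \<circ> pinv w"])
    fix q assume q: "q \<in> column_stabilizer \<mu> t"
    show "pinv w \<circ> (w \<circ> q \<circ> pinv w) \<circ> w = q" by (simp add: fun_eq_iff iw')
    show "w \<circ> q \<circ> pinv w \<in> column_stabilizer \<mu> (w \<circ> t)" by (rule conj[OF q])
    have "sign (w \<circ> q \<circ> pinv w) = sign q"
      using pw column_stabilizer_permutation[OF q]
      by (simp add: sign_compose permutation_compose permutation_inverse sign_inverse mult.commute mult.left_commute sign_idempotent)
    moreover have "move (w \<circ> q \<circ> pinv w) (move w (tabloid_of \<mu> t)) = move w (move q (tabloid_of \<mu> t))"
      by (simp add: image_image iw')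
    ultimately show "Poly_Mapping.single (move (w \<circ> q \<circ> pinv w) (move w (tabloid_of \<mu> t))) (csign (w \<circ> q \<circ> pinv w)) =
       Poly_Mapping.single (move w (move q (tabloid_of \<mu> t))) (csign q)" by (simp only:)
  next
    fix q assume q: "q \<in> column_stabilizer \<mu> (w \<circ> t)"
    show "w \<circ> (pinv w \<circ> q \<circ> w) \<circ> pinv w = q" by (simp add: fun_eq_iff iw')
    show "pinv w \<circ> q \<circ> w \<in> column_stabilizer \<mu> t" by (rule conj'[OF q])
  qed
  finally show ?thesis by (simp add: polytabloid_def tabloid_of_comp)
qed

section \<open>Shapes and dominance\<close>

lemma finite_cells [simp]: "finite (cells \<mu>)"
proof -
  have "cells \<mu> = (SIGMA i:{..<length \<mu>}. {..<\<mu> ! i})" by (auto simp: cells_def)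
  then show ?thesis by simp
qed

lemma card_cells: "card (cells \<mu>) = sum_list \<mu>"
proof -
  have "cells \<mu> = (SIGMA i:{..<length \<mu>}. {..<\<mu> ! i})" by (auto simp: cells_def)
  then have "card (cells \<mu>) = (\<Sum>i<length \<mu>. \<mu> ! i)" by simp
  then show ?thesis by (simp add: sum_list_sum_nth lessThan_atLeast0)
qed

lemma is_partition_sum: "is_partition \<mu> n \<Longrightarrow> sum_list \<mu> = n"
  by (simp add: is_partition_def)

lemma cells_down:
  assumes "is_partition \<mu> n" "(i, j) \<in> cells \<mu>" "i' \<le> i" "j' \<le> j"
  shows "(i', j') \<in> cells \<mu>"
proof (cases "i' = i")
  case False
  have "\<mu> ! i \<le> \<mu> ! i'"
    using assms False by (auto simp: is_partition_def cells_def sorted_wrt_iff_nth_less)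
  then show ?thesis using assms by (auto simp: cells_def)
qed (use assms in \<open>auto simp: cells_def\<close>)

lemma tableau_exists: "\<exists>t. is_tableau \<mu> t"
proof -
  obtain h where "bij_betw h {1..card (cells \<mu>)} (cells \<mu>)"
    using ex_bij_betw_nat_finite_1[OF finite_cells] by blast
  then show ?thesis unfolding is_tableau_def card_cells using bij_betw_inv_into by blast
qed

definition column_length :: "nat list \<Rightarrow> nat \<Rightarrow> nat" where
  "column_length \<mu> j = card {i. (i, j) \<in> cells \<mu>}"

lemma column_rows:
  assumes "is_partition \<mu> n"
  shows "{i. (i, j) \<in> cells \<mu>} = {..<column_length \<mu> j}"
proof -
  define m where "m = (LEAST i. (i, j) \<notin> cells \<mu>)"
  have "(length \<mu>, j) \<notin> cells \<mu>" by (simp add: cells_def)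
  then have m: "(m, j) \<notin> cells \<mu>" unfolding m_def by (rule LeastI)
  have "{i. (i, j) \<in> cells \<mu>} = {..<m}"
  proof (intro equalityI subsetI)
    fix i assume "i \<in> {i. (i, j) \<in> cells \<mu>}"
    then show "i \<in> {..<m}" using m cells_down[OF assms, of i j m j] by force
  next
    fix i assume "i \<in> {..<m}"
    then show "i \<in> {i. (i, j) \<in> cells \<mu>}" using not_less_Least unfolding m_def by blast
  qed
  then show ?thesis by (simp add: column_length_def)
qed

lemma cells_iff_column_length: "is_partition \<mu> n \<Longrightarrow> (i, j) \<in> cells \<mu> \<longleftrightarrow> i < column_length \<mu> j"
  using column_rows[of \<mu> n j] by blast

definition top_cells :: "nat list \<Rightarrow> nat \<Rightarrow> (nat \<times> nat) set" where
  "top_cells \<mu> k = {c \<in> cells \<mu>. fst c < k}"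

lemma finite_top_cells [simp]: "finite (top_cells \<mu> k)"
  by (simp add: top_cells_def)

lemma card_top_cells:
  assumes "is_partition \<mu> n"
  shows "card (top_cells \<mu> k) = (\<Sum>j\<in>snd ` cells \<mu>. min k (column_length \<mu> j))"
proof -
  define J where "J = snd ` cells \<mu>"
  have eq: "(i, j) \<in> top_cells \<mu> k \<longleftrightarrow> j \<in> J \<and> i < k \<and> i < column_length \<mu> j" for i j
    using cells_iff_column_length[OF assms] by (force simp: top_cells_def J_def)
  have "card (top_cells \<mu> k) = card (SIGMA j:J. {..<min k (column_length \<mu> j)})"
    by (rule bij_betw_same_card[of prod.swap], rule bij_betwI[where g = prod.swap]) (auto simp: eq)
  moreover have "finite J" by (simp add: J_def)
  ultimately show ?thesis by (simp add: J_def[symmetric])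
qed

text \<open>The dominance order; the number of cells in the first \<open>k\<close> rows is the \<open>k\<close>-th partial sum of the parts.\<close>

definition dominates :: "nat list \<Rightarrow> nat list \<Rightarrow> bool" where
  "dominates \<mu> \<nu> \<longleftrightarrow> (\<forall>k. card (top_cells \<nu> k) \<le> card (top_cells \<mu> k))"

lemma tableau_inj: "is_tableau \<mu> t \<Longrightarrow> inj_on t (cells \<mu>)"
  by (simp add: is_tableau_def bij_betw_def)

lemma tableau_image: "is_tableau \<mu> t \<Longrightarrow> t ` cells \<mu> = {1..sum_list \<mu>}"
  by (simp add: is_tableau_def bij_betw_def)

lemma mem_column: "x \<in> column \<mu> t j \<longleftrightarrow> (\<exists>i. (i, j) \<in> cells \<mu> \<and> x = t (i, j))"
  by (auto simp: column_def)

lemma mem_tabloid_of: "x \<in> tabloid_of \<mu> t i \<longleftrightarrow> (\<exists>j. (i, j) \<in> cells \<mu> \<and> x = t (i, j))"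
  by (auto simp: tabloid_of_def)

lemma tabloid_rows_disjoint:
  "is_tableau \<mu> t \<Longrightarrow> x \<in> tabloid_of \<mu> t i \<Longrightarrow> x \<in> tabloid_of \<mu> t k \<Longrightarrow> i = k"
  using tableau_inj[of \<mu> t] by (auto simp: mem_tabloid_of dest: inj_onD)

lemma tabloid_rows_cover:
  assumes "is_tableau \<mu> t" 
  shows "(\<exists>i. x \<in> tabloid_of \<mu> t i) \<longleftrightarrow> x \<in> {1..sum_list \<mu>}"
  unfolding tableau_image[OF assms, symmetric] by (auto simp: mem_tabloid_of)

lemma columns_cover:
  assumes "is_tableau \<mu> t" 
  shows "(\<Union>j\<in>snd ` cells \<mu>. column \<mu> t j) = {1..sum_list \<mu>}"
  unfolding tableau_image[OF assms, symmetric] by (force simp: mem_column)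

lemma card_column:
  assumes "is_tableau \<mu> t"
  shows "card (column \<mu> t j) = column_length \<mu> j"
proof -
  have "column \<mu> t j = (\<lambda>i. t (i, j)) ` {i. (i, j) \<in> cells \<mu>}" by (auto simp: mem_column)
  moreover have "inj_on (\<lambda>i. t (i, j)) {i. (i, j) \<in> cells \<mu>}"
    using tableau_inj[OF assms] by (auto simp: inj_on_def)
  ultimately show ?thesis by (simp add: column_length_def card_image)
qed

lemma card_by_columns:
  assumes "is_tableau \<mu> t" "A \<subseteq> {1..sum_list \<mu>}"
  shows "card A = (\<Sum>j\<in>snd ` cells \<mu>. card (column \<mu> t j \<inter> A))"
proof -
  have "A = (\<Union>j\<in>snd ` cells \<mu>. column \<mu> t j \<inter> A)"
    using columns_cover[OF assms(1)] assms(2) by blast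
  then have "card A = card (\<Union>j\<in>snd ` cells \<mu>. column \<mu> t j \<inter> A)" by simp
  also have "\<dots> = (\<Sum>j\<in>snd ` cells \<mu>. card (column \<mu> t j \<inter> A))"
  proof (rule card_UN_disjoint)
    show "\<forall>j\<in>snd ` cells \<mu>. finite (column \<mu> t j \<inter> A)"
      using column_subset[OF assms(1)] finite_subset by blast
    show "\<forall>i\<in>snd ` cells \<mu>. \<forall>j\<in>snd ` cells \<mu>. i \<noteq> j \<longrightarrow> column \<mu> t i \<inter> A \<inter> (column \<mu> t j \<inter> A) = {}"
      using column_disjoint[OF assms(1)] by blast
  qed simp
  finally show ?thesis .
qed

lemma card_top_rows:
  assumes "is_tableau \<nu> s"
  shows "card (\<Union>i<k. tabloid_of \<nu> s i) = card (top_cells \<nu> k)"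
proof -
  have "(\<Union>i<k. tabloid_of \<nu> s i) = s ` top_cells \<nu> k"
    by (force simp: mem_tabloid_of top_cells_def)
  moreover have "inj_on s (top_cells \<nu> k)"
    using tableau_inj[OF assms] by (rule inj_on_subset) (auto simp: top_cells_def)
  ultimately show ?thesis by (simp add: card_image)
qed

text \<open>Suppose that no row of the \<open>\<nu>\<close>-tabloid meets a column of \<open>t\<close> twice. Then the first \<open>k\<close> rows meet the \<open>j\<close>-th
column in at most \<open>min k (column_length \<mu> j)\<close> points, while the first \<open>k\<close> rows of \<open>t\<close> meet it in exactly
that many. Summing over the columns gives dominance. If the shapes agree, all these inequalities are
equalities, so each column can be permuted until its entries are in the rows prescribed by the tabloid.\<close>

context
  fixes \<mu> \<nu> :: "nat list" and n :: nat and t s :: "nat \<times> nat \<Rightarrow> nat"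
  assumes mu: "is_partition \<mu> n" and nu: "is_partition \<nu> n"
    and t: "is_tableau \<mu> t" and s: "is_tableau \<nu> s"
    and transversal: "\<And>i j x y. x \<in> column \<mu> t j \<Longrightarrow> y \<in> column \<mu> t j \<Longrightarrow>
      x \<in> tabloid_of \<nu> s i \<Longrightarrow> y \<in> tabloid_of \<nu> s i \<Longrightarrow> x = y"
begin

private abbreviation "rows k \<equiv> (\<Union>i<k. tabloid_of \<nu> s i)"

private lemma rows_subset: "rows k \<subseteq> {1..sum_list \<mu>}"
proof
  fix x assume "x \<in> rows k"
  then have "\<exists>i. x \<in> tabloid_of \<nu> s i" by blast
  then have "x \<in> {1..sum_list \<nu>}" by (simp only: tabloid_rows_cover[OF s])
  then show "x \<in> {1..sum_list \<mu>}" by (simp only: is_partition_sum[OF mu] is_partition_sum[OF nu])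
qed

private lemma card_column_rows_le: "card (column \<mu> t j \<inter> rows k) \<le> min k (column_length \<mu> j)"
proof -
  have fin: "finite (column \<mu> t j)" using column_subset[OF t] finite_subset by blast
  have "card (column \<mu> t j \<inter> rows k) = card (\<Union>i<k. column \<mu> t j \<inter> tabloid_of \<nu> s i)"
    by (rule arg_cong[of _ _ card]) blast
  also have "\<dots> \<le> (\<Sum>i<k. card (column \<mu> t j \<inter> tabloid_of \<nu> s i))"
    by (rule card_UN_le) simp
  also have "\<dots> \<le> (\<Sum>i<k. 1)"
  proof (rule sum_mono)
    fix i
    show "card (column \<mu> t j \<inter> tabloid_of \<nu> s i) \<le> 1"
      using fin transversal by (subst card_le_Suc0_iff_eq[unfolded One_nat_def[symmetric]]) auto
  qed
  finally have "card (column \<mu> t j \<inter> rows k) \<le> k" by simp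
  moreover have "card (column \<mu> t j \<inter> rows k) \<le> column_length \<mu> j"
    unfolding card_column[OF t, symmetric] by (rule card_mono[OF fin]) auto
  ultimately show ?thesis by simp
qed

lemma transversal_dominates: "dominates \<mu> \<nu>"
  unfolding dominates_def
proof
  fix k
  have "card (top_cells \<nu> k) = (\<Sum>j\<in>snd ` cells \<mu>. card (column \<mu> t j \<inter> rows k))"
    unfolding card_top_rows[OF s, symmetric] by (rule card_by_columns[OF t rows_subset])
  also have "\<dots> \<le> (\<Sum>j\<in>snd ` cells \<mu>. min k (column_length \<mu> j))"
    by (rule sum_mono) (rule card_column_rows_le)
  finally show "card (top_cells \<nu> k) \<le> card (top_cells \<mu> k)" by (simp add: card_top_cells[OF mu])
qed

lemma transversal_same_shape:
  assumes "\<nu> = \<mu>"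
  shows "\<exists>q\<in>column_stabilizer \<mu> t. tabloid_of \<nu> s = move q (tabloid_of \<mu> t)"
proof -
  let ?X = "{1..sum_list \<mu>}"
  have eq: "card (column \<mu> t j \<inter> rows k) = min k (column_length \<mu> j)" if "j \<in> snd ` cells \<mu>" for j k
  proof (rule sum_mono_inv[where f = "\<lambda>j. card (column \<mu> t j \<inter> rows k)" and I = "snd ` cells \<mu>"])
    show "(\<Sum>j\<in>snd ` cells \<mu>. card (column \<mu> t j \<inter> rows k)) = (\<Sum>j\<in>snd ` cells \<mu>. min k (column_length \<mu> j))"
      using card_by_columns[OF t rows_subset, of k] card_top_cells[OF mu, of k] card_top_rows[OF s, of k] assms by simp
  qed (use that card_column_rows_le in auto)
  have "\<exists>x. x \<in> column \<mu> t (snd c) \<inter> tabloid_of \<nu> s (fst c)" if c: "c \<in> cells \<mu>" for c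
  proof (rule ccontr)
    obtain i j where ij: "c = (i, j)" by fastforce
    assume "\<not> ?thesis"
    then have "column \<mu> t j \<inter> rows (Suc i) = column \<mu> t j \<inter> rows i" by (auto simp: ij less_Suc_eq)
    moreover have "j \<in> snd ` cells \<mu>" using c ij by force
    ultimately have "min (Suc i) (column_length \<mu> j) = min i (column_length \<mu> j)" using eq by metis
    moreover have "i < column_length \<mu> j" using c cells_iff_column_length[OF mu] ij by simp
    ultimately show False by simp
  qed
  then obtain f where f: "\<And>c. c \<in> cells \<mu> \<Longrightarrow> f c \<in> column \<mu> t (snd c)"
      "\<And>c. c \<in> cells \<mu> \<Longrightarrow> f c \<in> tabloid_of \<nu> s (fst c)"
    by (metis IntE)
  have finj: "inj_on f (cells \<mu>)"
  proof (rule inj_onI)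
    fix c e assume "c \<in> cells \<mu>" "e \<in> cells \<mu>" "f c = f e"
    then show "c = e" 
      using f column_disjoint[OF t] tabloid_rows_disjoint[OF s] by (metis prod_eqI)
  qed
  let ?ti = "inv_into (cells \<mu>) t"
  define q where "q = (\<lambda>x. if x \<in> ?X then f (?ti x) else x)"
  have qt: "q (t c) = f c" if "c \<in> cells \<mu>" for c
    using that tableau_image[OF t] tableau_inj[OF t] by (auto simp: q_def)
  have qX: "q ` ?X = f ` cells \<mu>"
    unfolding tableau_image[OF t, symmetric] image_image by (rule image_cong) (auto simp: qt)
  have sub: "f ` cells \<mu> \<subseteq> ?X" using f(1) column_subset[OF t] by blast
  have "card (f ` cells \<mu>) = card ?X" using finj by (simp add: card_image card_cells)
  then have fX: "f ` cells \<mu> = ?X" by (intro card_subset_eq[OF _ sub]) auto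
  have "bij_betw q ?X ?X"
  proof (rule bij_betw_imageI)
    show "q ` ?X = ?X" using qX fX by simp
    then show "inj_on q ?X" by (simp add: eq_card_imp_inj_on)
  qed
  then have qp: "q permutes ?X" by (rule bij_imp_permutes) (auto simp: q_def)
  have "q ` column \<mu> t j = column \<mu> t j" for j
  proof (rule card_subset_eq)
    show "finite (column \<mu> t j)" using column_subset[OF t] finite_subset by blast
    show "q ` column \<mu> t j \<subseteq> column \<mu> t j" using f(1) by (force simp: mem_column qt)
    show "card (q ` column \<mu> t j) = card (column \<mu> t j)"
      by (rule card_image) (use qp in \<open>auto intro: inj_on_subset[OF permutes_inj]\<close>)
  qed
  then have qQ: "q \<in> column_stabilizer \<mu> t" using qp by (simp add: column_stabilizer_iff)
  have "tabloid_of \<nu> s i = q ` tabloid_of \<mu> t i" for i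
  proof (intro equalityI subsetI)
    fix x assume x: "x \<in> tabloid_of \<nu> s i"
    then have "x \<in> ?X" using tabloid_rows_cover[OF s] assms by blast
    then obtain c where c: "c \<in> cells \<mu>" "x = f c" using fX by blast
    then have "fst c = i" using f(2) x tabloid_rows_disjoint[OF s] by blast
    then have "t c \<in> tabloid_of \<mu> t i" using c by (auto simp: mem_tabloid_of intro: exI[of _ "snd c"])
    then show "x \<in> q ` tabloid_of \<mu> t i" using c qt by (metis imageI)
  next
    fix x assume "x \<in> q ` tabloid_of \<mu> t i"
    then show "x \<in> tabloid_of \<nu> s i" using f(2) by (force simp: mem_tabloid_of qt)
  qed
  then show ?thesis using qQ by blast
qed

end

text \<open>The transposition of \<open>x\<close> and \<open>y\<close> lies in the column stabilizer and fixes the tabloid.\<close>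

lemma column_antisym_single_not_transversal:
  assumes "is_tableau \<mu> t" "is_tableau \<nu> s" "x \<noteq> y"
    and "x \<in> column \<mu> t j" "y \<in> column \<mu> t j" "x \<in> tabloid_of \<nu> s i" "y \<in> tabloid_of \<nu> s i"
  shows "column_antisym \<mu> t (Poly_Mapping.single (tabloid_of \<nu> s) c) = 0"
proof (rule poly_mapping_eqI)
  fix T
  let ?S = "tabloid_of \<nu> s" and ?\<tau> = "transpose x y"
  have "?\<tau> ` ?S k = ?S k" for k
  proof (cases "k = i")
    case True
    then show ?thesis using assms(6,7) by simp
  next
    case False
    then have "x \<notin> ?S k" "y \<notin> ?S k" using tabloid_rows_disjoint[OF assms(2)] assms(6,7) by metis+
    then show ?thesis by simp
  qed
  then have fix_S: "move (q \<circ> ?\<tau>) ?S = move q ?S" for q :: "nat \<Rightarrow> nat"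
    by (simp only: image_comp[symmetric])
  have "Poly_Mapping.lookup (column_antisym \<mu> t (Poly_Mapping.single ?S c)) T =
      (\<Sum>q\<in>column_stabilizer \<mu> t. csign q * (if move q ?S = T then c else 0))"
    unfolding column_antisym_single lookup_sum by (rule sum.cong) (auto simp: lookup_single when_def)
  also have "\<dots> = 0"
    by (rule sum_column_sign_right_0[OF transpose_column_stabilizer[OF assms(1,4,5)] assms(3)]) (simp only: fix_S)
  finally show "Poly_Mapping.lookup (column_antisym \<mu> t (Poly_Mapping.single ?S c)) T = Poly_Mapping.lookup 0 T" by simp
qed

lemma column_antisym_single_dominates:
  assumes "is_partition \<mu> n" "is_partition \<nu> n" "is_tableau \<mu> t" "is_tableau \<nu> s"
    and "column_antisym \<mu> t (Poly_Mapping.single (tabloid_of \<nu> s) c) \<noteq> 0"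
  shows "dominates \<mu> \<nu>"
  using transversal_dominates[OF assms(1-4)] column_antisym_single_not_transversal[OF assms(3,4)] assms(5) by blast

lemma column_antisym_single_same_shape:
  assumes "is_partition \<mu> n" "is_tableau \<mu> t" "is_tableau \<mu> s"
  shows "\<exists>a. column_antisym \<mu> t (Poly_Mapping.single (tabloid_of \<mu> s) c) = scale_tabloids a (polytabloid \<mu> t)"
proof (cases "\<exists>x y i j. x \<noteq> y \<and> x \<in> column \<mu> t j \<and> y \<in> column \<mu> t j \<and> x \<in> tabloid_of \<mu> s i \<and> y \<in> tabloid_of \<mu> s i")
  case True
  then have "column_antisym \<mu> t (Poly_Mapping.single (tabloid_of \<mu> s) c) = 0"
    using column_antisym_single_not_transversal[OF assms(2,3)] by blast
  then show ?thesis by (intro exI[of _ 0]) simp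
next
  case False
  then obtain q where q: "q \<in> column_stabilizer \<mu> t" "tabloid_of \<mu> s = move q (tabloid_of \<mu> t)"
    using transversal_same_shape[OF assms(1,1,2,3)] by blast
  have "column_antisym \<mu> t (Poly_Mapping.single (tabloid_of \<mu> s) c) =
      scale_tabloids (csign q) (column_antisym \<mu> t (Poly_Mapping.single (tabloid_of \<mu> t) c))"
    unfolding q(2) by (rule column_antisym_move[OF q(1)])
  also have "Poly_Mapping.single (tabloid_of \<mu> t) c = scale_tabloids c (Poly_Mapping.single (tabloid_of \<mu> t) 1)"
    by (simp add: scale_tabloids_single)
  finally show ?thesis by (auto simp: column_antisym_scale polytabloid_eq_antisym)
qed

definition tabloid_module :: "nat list \<Rightarrow> (tabloid \<Rightarrow>\<^sub>0 complex) set" where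
  "tabloid_module \<mu> = {v. Poly_Mapping.keys v \<subseteq> {tabloid_of \<mu> s | s. is_tableau \<mu> s}}"

lemma column_antisym_dominates:
  assumes "is_partition \<mu> n" "is_partition \<nu> n" "is_tableau \<mu> t" "v \<in> tabloid_module \<nu>"
    and "column_antisym \<mu> t v \<noteq> 0"
  shows "dominates \<mu> \<nu>"
proof (rule ccontr)
  assume nd: "\<not> dominates \<mu> \<nu>"
  have "column_antisym \<mu> t (Poly_Mapping.single T (Poly_Mapping.lookup v T)) = 0"
    if T: "T \<in> Poly_Mapping.keys v" for T
  proof -
    obtain s where "is_tableau \<nu> s" "T = tabloid_of \<nu> s"
      using T assms(4) unfolding tabloid_module_def by blast
    then show ?thesis using column_antisym_single_dominates[OF assms(1-3)] nd by blast
  qed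
  then have "column_antisym \<mu> t v = 0"
    by (subst poly_mapping_sum_single) (simp add: column_antisym_sum)
  then show False using assms(5) by simp
qed

lemma column_antisym_same_shape:
  assumes "is_partition \<mu> n" "is_tableau \<mu> t" "v \<in> tabloid_module \<mu>"
  shows "column_antisym \<mu> t v = scale_tabloids (Poly_Mapping.lookup (column_antisym \<mu> t v) (tabloid_of \<mu> t)) (polytabloid \<mu> t)"
proof -
  have "\<forall>T\<in>Poly_Mapping.keys v. \<exists>a. column_antisym \<mu> t (Poly_Mapping.single T (Poly_Mapping.lookup v T)) = scale_tabloids a (polytabloid \<mu> t)"
    using column_antisym_single_same_shape[OF assms(1,2)] assms(3) unfolding tabloid_module_def by blast
  then obtain a where a: "\<And>T. T \<in> Poly_Mapping.keys v \<Longrightarrow>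
      column_antisym \<mu> t (Poly_Mapping.single T (Poly_Mapping.lookup v T)) = scale_tabloids (a T) (polytabloid \<mu> t)"
    by metis
  have "column_antisym \<mu> t v = (\<Sum>T\<in>Poly_Mapping.keys v. scale_tabloids (a T) (polytabloid \<mu> t))"
    by (subst poly_mapping_sum_single) (simp add: column_antisym_sum a)
  also have "\<dots> = scale_tabloids (\<Sum>T\<in>Poly_Mapping.keys v. a T) (polytabloid \<mu> t)"
    by (simp add: tabloid_space.scale_sum_left)
  finally have *: "column_antisym \<mu> t v = scale_tabloids (\<Sum>T\<in>Poly_Mapping.keys v. a T) (polytabloid \<mu> t)" .
  show ?thesis by (subst (2) *) (simp add: * lookup_polytabloid_self[OF assms(2)])
qed

lemma specht_carrier: "carrier (specht \<mu>) = tabloid_space.span {polytabloid \<mu> t | t. is_tableau \<mu> t}"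
  by (simp add: specht_def)

lemma tableau_comp:
  assumes "is_tableau \<mu> t" "w permutes {1..sum_list \<mu>}"
  shows "is_tableau \<mu> (w \<circ> t)"
  using assms bij_betw_trans permutes_imp_bij unfolding is_tableau_def by blast

lemma polytabloid_in_specht: "is_tableau \<mu> t \<Longrightarrow> polytabloid \<mu> t \<in> carrier (specht \<mu>)"
  unfolding specht_carrier by (auto intro: tabloid_space.span_base)

lemma specht_subset_tabloid_module: "carrier (specht \<mu>) \<subseteq> tabloid_module \<mu>"
  unfolding specht_carrier
proof (rule tabloid_space.span_minimal)
  show "{polytabloid \<mu> t | t. is_tableau \<mu> t} \<subseteq> tabloid_module \<mu>"
  proof safe
    fix t assume t: "is_tableau \<mu> t"
    have "T \<in> {tabloid_of \<mu> s | s. is_tableau \<mu> s}"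
      if T: "T \<in> Poly_Mapping.keys (polytabloid \<mu> t)" for T
    proof -
      obtain q where "q \<in> column_stabilizer \<mu> t" "T \<in> Poly_Mapping.keys (Poly_Mapping.single (tabloid_of \<mu> (q \<circ> t)) (csign q))"
        using subsetD[OF keys_sum, OF T[unfolded polytabloid_def]] by blast
      then show ?thesis using tableau_comp[OF t] column_stabilizer_permutes
        by (auto split: if_splits)
    qed
    then show "polytabloid \<mu> t \<in> tabloid_module \<mu>" by (auto simp: tabloid_module_def)
  qed
  show "tabloid_space.subspace (tabloid_module \<mu>)"
    unfolding tabloid_space.subspace_def
  proof (intro conjI ballI allI)
    show "u + v \<in> tabloid_module \<mu>" if "u \<in> tabloid_module \<mu>" "v \<in> tabloid_module \<mu>" for u v
      using that Poly_Mapping.keys_add[of u v] by (auto simp: tabloid_module_def)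
    show "scale_tabloids c u \<in> tabloid_module \<mu>" if "u \<in> tabloid_module \<mu>" for u c
      using that by (auto simp: tabloid_module_def in_keys_iff)
  qed (simp add: tabloid_module_def)
qed

text \<open>The coefficient of \<open>column_antisym \<mu> t v\<close> at the tabloid of \<open>t\<close> is the inner product of \<open>v\<close> with the polytabloid
of \<open>t\<close>. So \<open>v\<close> is orthogonal to all generators of the Specht module, in particular to itself.\<close>

lemma specht_eq_0:
  assumes "v \<in> carrier (specht \<mu>)" "\<And>t. is_tableau \<mu> t \<Longrightarrow> column_antisym \<mu> t v = 0"
  shows "v = 0"
proof -
  let ?g = "\<lambda>T. cnj (Poly_Mapping.lookup v T)"
  have "lin ?g u = 0" if "u \<in> carrier (specht \<mu>)" for u
    using that unfolding specht_carrier
  proof (induction rule: tabloid_space.span_induct_alt)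
    case (step c u y)
    then obtain t where t: "is_tableau \<mu> t" "u = polytabloid \<mu> t" by blast
    have "lin ?g u = cnj (\<Sum>q\<in>column_stabilizer \<mu> t. csign q * Poly_Mapping.lookup v (move q (tabloid_of \<mu> t)))"
      unfolding t(2) lin_polytabloid by simp
    also have "\<dots> = cnj (Poly_Mapping.lookup (column_antisym \<mu> t v) (tabloid_of \<mu> t))" by (simp only: lookup_antisym)
    finally have "lin ?g u = 0" using assms(2)[OF t(1)] by simp
    then show ?case using step by (simp add: lin_add lin_scale)
  qed simp
  then have "lin ?g v = 0" using assms(1) by blast
  then have "complex_of_real (\<Sum>T\<in>Poly_Mapping.keys v. (cmod (Poly_Mapping.lookup v T))\<^sup>2) = 0"
    unfolding lin_def of_real_sum complex_norm_square .
  then have "(\<Sum>T\<in>Poly_Mapping.keys v. (cmod (Poly_Mapping.lookup v T))\<^sup>2) = 0" by (simp only: of_real_eq_0_iff)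
  then have "\<forall>T\<in>Poly_Mapping.keys v. Poly_Mapping.lookup v T = 0" by (simp add: sum_nonneg_eq_0_iff)
  then show "v = 0" by (metis in_keys_iff lookup_zero poly_mapping_eqI)
qed

text \<open>A numerical substitute for the dominance order: it is strictly monotone on the partitions of a fixed
number.\<close>

definition weight :: "nat list \<Rightarrow> nat" where
  "weight \<mu> = (\<Sum>k\<le>sum_list \<mu>. card (top_cells \<mu> k))"

lemma length_le_sum_list: "0 \<notin> set \<mu> \<Longrightarrow> length \<mu> \<le> sum_list \<mu>" for \<mu> :: "nat list"
  by (induction \<mu>) auto

lemma top_cells_all:
  assumes "is_partition \<mu> n" "n \<le> k"
  shows "top_cells \<mu> k = cells \<mu>"
  using length_le_sum_list[of \<mu>] assms by (auto simp: top_cells_def cells_def is_partition_def)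

lemma row_card: "card (top_cells \<mu> (Suc i)) = card (top_cells \<mu> i) + (if i < length \<mu> then \<mu> ! i else 0)"
proof -
  have "top_cells \<mu> (Suc i) = top_cells \<mu> i \<union> {c \<in> cells \<mu>. fst c = i}" by (auto simp: top_cells_def)
  moreover have "{c \<in> cells \<mu>. fst c = i} = (if i < length \<mu> then Pair i ` {..<\<mu> ! i} else {})"
    by (auto simp: cells_def)
  moreover have "top_cells \<mu> i \<inter> {c \<in> cells \<mu>. fst c = i} = {}" by (auto simp: top_cells_def)
  ultimately show ?thesis by (simp add: card_Un_disjoint card_image inj_on_def)
qed

lemma partition_eqI:
  assumes "is_partition \<mu> n" "is_partition \<nu> n"
    and eq: "\<And>i. (if i < length \<mu> then \<mu> ! i else 0) = (if i < length \<nu> then \<nu> ! i else 0)"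
  shows "\<mu> = \<nu>"
proof -
  have pos: "0 < \<mu> ! i" if "i < length \<mu>" for i using assms(1) that by (metis is_partition_def nth_mem not_gr_zero)
  have pos': "0 < \<nu> ! i" if "i < length \<nu>" for i using assms(2) that by (metis is_partition_def nth_mem not_gr_zero)
  have "i < length \<mu> \<longleftrightarrow> i < length \<nu>" for i using eq[of i] pos[of i] pos'[of i] by (auto split: if_splits)
  then have "length \<mu> = length \<nu>" by (metis linorder_neqE_nat less_irrefl)
  then show ?thesis using eq by (metis nth_equalityI)
qed

lemma dominates_weight:
  assumes "is_partition \<mu> n" "is_partition \<nu> n" "dominates \<mu> \<nu>" "weight \<mu> \<le> weight \<nu>"
  shows "\<mu> = \<nu>"
proof -
  have le: "card (top_cells \<nu> k) \<le> card (top_cells \<mu> k)" for k using assms(3) by (simp add: dominates_def)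
  have "(\<Sum>k\<le>n. card (top_cells \<nu> k)) = (\<Sum>k\<le>n. card (top_cells \<mu> k))"
    using assms(4) sum_mono[of "{..n}" "\<lambda>k. card (top_cells \<nu> k)", OF le]
    by (simp add: weight_def is_partition_sum[OF assms(1)] is_partition_sum[OF assms(2)])
  then have "card (top_cells \<nu> k) = card (top_cells \<mu> k)" if "k \<le> n" for k
    using sum_mono_inv[of "\<lambda>k. card (top_cells \<nu> k)" "{..n}" "\<lambda>k. card (top_cells \<mu> k)" k] le that by simp
  moreover have "card (top_cells \<nu> k) = card (top_cells \<mu> k)" if "n \<le> k" for k
    using top_cells_all[OF assms(1) that] top_cells_all[OF assms(2) that]
      is_partition_sum[OF assms(1)] is_partition_sum[OF assms(2)] by (simp add: card_cells)
  ultimately have all: "card (top_cells \<nu> k) = card (top_cells \<mu> k)" for k using nat_le_linear by blast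
  show ?thesis
  proof (rule partition_eqI[OF assms(1,2)])
    fix i
    let ?r = "\<lambda>\<mu> :: nat list. if i < length \<mu> then \<mu> ! i else 0"
    have "card (top_cells \<mu> i) + ?r \<mu> = card (top_cells \<mu> i) + ?r \<nu>"
      using row_card[of \<mu> i] row_card[of \<nu> i] all[of i] all[of "Suc i"] by linarith
    then show "?r \<mu> = ?r \<nu>" by (simp only: add_left_cancel)
  qed
qed

lemma column_antisym_specht_eq_0:
  assumes "is_partition \<mu> n" "is_partition \<nu> n" "is_tableau \<mu> t" "v \<in> carrier (specht \<nu>)"
    and "weight \<mu> \<le> weight \<nu>" "\<mu> \<noteq> \<nu>"
  shows "column_antisym \<mu> t v = 0"
  using column_antisym_dominates[OF assms(1-3), of v] dominates_weight[OF assms(1,2)] assms(4-6)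
    specht_subset_tabloid_module by blast

lemma column_antisym_specht:
  assumes "is_partition \<mu> n" "is_tableau \<mu> t" "v \<in> carrier (specht \<mu>)"
  shows "\<exists>a. column_antisym \<mu> t v = scale_tabloids a (polytabloid \<mu> t)"
  using column_antisym_same_shape[OF assms(1,2)] assms(3) specht_subset_tabloid_module by blast

section \<open>From tabloids to matchings\<close>

definition fits :: "nat set set \<Rightarrow> tabloid \<Rightarrow> bool" where
  "fits M T \<longleftrightarrow> M \<in> perfect_matchings (\<Union>i\<in>{1..}. T i) \<and> (\<forall>e\<in>M. \<exists>i\<ge>1. e \<subseteq> T i)"

lemma nsets_image_iff: "inj w \<Longrightarrow> w ` e \<in> nsets (w ` B) k \<longleftrightarrow> e \<in> nsets B k"
  by (auto simp: nsets_def inj_image_subset_iff card_image inj_on_subset finite_image_iff)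

lemma perfect_matchings_image_iff:
  assumes "inj w"
  shows "(`) w ` M \<in> perfect_matchings (w ` B) \<longleftrightarrow> M \<in> perfect_matchings B"
proof -
  have "(`) w ` M \<subseteq> nsets (w ` B) 2 \<longleftrightarrow> M \<subseteq> nsets B 2"
    using nsets_image_iff[OF assms] by (auto simp: image_subset_iff)
  moreover have "disjoint ((`) w ` M) \<longleftrightarrow> disjoint M"
    using assms by (auto simp: disjoint_def image_Int[symmetric] inj_image_eq_iff)
  moreover have "\<Union>((`) w ` M) = w ` B \<longleftrightarrow> \<Union>M = B"
    using inj_image_eq_iff[OF assms, of "\<Union>M" B] by (simp add: image_Union)
  ultimately show ?thesis by (simp add: perfect_matchings_def)
qed

lemma fits_move:
  assumes "inj w"
  shows "fits ((`) w ` M) (move w T) \<longleftrightarrow> fits M T"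
proof -
  have "(\<Union>i\<in>{1..}. w ` T i) = w ` (\<Union>i\<in>{1..}. T i)" by blast
  then show ?thesis
    unfolding fits_def using perfect_matchings_image_iff[OF assms, of M "\<Union>i\<in>{1..}. T i"] 
    by (simp add: inj_image_subset_iff[OF assms])
qed

definition row_pairings :: "(tabloid \<Rightarrow>\<^sub>0 complex) \<Rightarrow> nat set set \<Rightarrow> complex" where
  "row_pairings v M = lin (\<lambda>T. if fits M T then 1 else 0) v"

lemma row_pairings_add: "row_pairings (u + v) M = row_pairings u M + row_pairings v M"
  by (simp add: row_pairings_def lin_add)

lemma row_pairings_scale: "row_pairings (scale_tabloids c v) M = c * row_pairings v M"
  by (simp add: row_pairings_def lin_scale)

lemma row_pairings_0 [simp]: "row_pairings 0 M = 0"
  by (simp add: row_pairings_def)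

lemma row_pairings_sum: "row_pairings (sum g A) M = (\<Sum>a\<in>A. row_pairings (g a) M)"
  by (simp add: row_pairings_def lin_sum)

lemma fits_move':
  assumes "bij w"
  shows "fits M (move w T) \<longleftrightarrow> fits ((`) (pinv w) ` M) T"
proof -
  have "(`) w ` (`) (pinv w) ` M = M"
    using assms by (simp add: image_comp comp_def image_image surj_f_inv_f[OF bij_is_surj])
  then show ?thesis using fits_move[OF bij_is_inj[OF assms], of "(`) (pinv w) ` M" T] by simp
qed

lemma row_pairings_perm:
  "bij w \<Longrightarrow> row_pairings (perm_tabloids w v) M = row_pairings v ((`) (pinv w) ` M)"
  by (simp add: row_pairings_def lin_perm_tabloids fits_move')

lemma row_pairings_column_antisym:
  "row_pairings (column_antisym \<mu> t v) M = (\<Sum>q\<in>column_stabilizer \<mu> t. csign q * row_pairings v ((`) (pinv q) ` M))"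
  unfolding row_pairings_def lin_antisym
  by (rule sum.cong) (auto simp: fits_move' column_stabilizer_bij)

lemma row_pairings_polytabloid:
  "row_pairings (polytabloid \<mu> t) M =
     (\<Sum>q\<in>column_stabilizer \<mu> t. csign q * (if fits M (move q (tabloid_of \<mu> t)) then 1 else 0))"
  by (simp add: row_pairings_def lin_polytabloid)

lemma top_row_card: "\<mu> \<noteq> [] \<Longrightarrow> card (top_cells \<mu> 1) = hd \<mu>"
  using row_card[of \<mu> 0] by (simp add: top_cells_def hd_conv_nth)

lemma fits_tabloid_matching:
  assumes "is_partition \<mu> n" "\<mu> \<noteq> []" "n = hd \<mu> + 2 * d" "is_tableau \<mu> s" "fits M (tabloid_of \<mu> s)"
  shows "M \<in> matchings {1..n} d"
proof -
  let ?B = "\<Union>i\<in>{1..}. tabloid_of \<mu> s i"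
  have n: "sum_list \<mu> = n" using is_partition_sum[OF assms(1)] .
  have B: "?B = s ` (cells \<mu> - top_cells \<mu> 1)"
    by (force simp: mem_tabloid_of top_cells_def)
  have sub: "?B \<subseteq> {1..n}" unfolding B n[symmetric] tableau_image[OF assms(4), symmetric] by blast
  have "card ?B = card (cells \<mu> - top_cells \<mu> 1)"
    unfolding B by (rule card_image) (rule inj_on_subset[OF tableau_inj[OF assms(4)]], blast)
  also have "\<dots> = n - hd \<mu>"
    using top_row_card[OF assms(2)] by (subst card_Diff_subset) (auto simp: card_cells n top_cells_def)
  finally have "card ?B = 2 * d" using assms(3) by simp
  moreover have M: "M \<in> perfect_matchings ?B" using assms(5) by (simp add: fits_def)
  ultimately have "card M = d" using perfect_matching_card[OF M] by simp
  then show ?thesis using perfect_matching_in_matchings[OF M sub] by simp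
qed

lemma row_pairings_polytabloid_support:
  assumes "is_partition \<mu> n" "\<mu> \<noteq> []" "n = hd \<mu> + 2 * d" "is_tableau \<mu> t" "M \<notin> matchings {1..n} d"
  shows "row_pairings (polytabloid \<mu> t) M = 0"
  unfolding row_pairings_polytabloid
proof (rule sum.neutral, rule ballI)
  fix q assume "q \<in> column_stabilizer \<mu> t"
  then have "is_tableau \<mu> (q \<circ> t)" using tableau_comp[OF assms(4)] column_stabilizer_permutes by blast
  then have "\<not> fits M (move q (tabloid_of \<mu> t))"
    using fits_tabloid_matching[OF assms(1-3)] assms(5) by (simp only: tabloid_of_comp[symmetric]) blast
  then show "csign q * (if fits M (move q (tabloid_of \<mu> t)) then 1 else 0) = 0" by simp
qed

text \<open>The points outside \<open>M\<close> other than \<open>i\<close> are one more than the columns of \<open>t\<close>, so two of them, \<open>x\<close> and \<open>y\<close>, lie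
in the same column. The sum over \<open>j\<close> is invariant under their transposition, and antisymmetrization kills it.\<close>

lemma row_pairings_polytabloid_harmonic:
  assumes "is_partition \<mu> n" "\<mu> \<noteq> []" "n = hd \<mu> + 2 * d" "is_tableau \<mu> t"
  shows "harmonic {1..n} d (row_pairings (polytabloid \<mu> t))"
  unfolding harmonic_def
proof (intro allI impI)
  fix M i assume M: "Suc (card M) = d" "M \<in> matchings {1..n} (card M)" "i \<in> {1..n} - \<Union>M"
  let ?J = "{1..n} - \<Union>M - {i}" and ?Q = "column_stabilizer \<mu> t"
  let ?c = "\<lambda>x. snd (inv_into (cells \<mu>) t x)"
  have n: "sum_list \<mu> = n" using is_partition_sum[OF assms(1)] .
  have c: "x \<in> column \<mu> t (?c x) \<and> ?c x < hd \<mu>" if "x \<in> {1..n}" for x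
  proof -
    have x: "x \<in> t ` cells \<mu>" using that tableau_image[OF assms(4)] n by simp
    obtain a b where ab: "inv_into (cells \<mu>) t x = (a, b)" by fastforce
    then have cell: "(a, b) \<in> cells \<mu>" "t (a, b) = x" using inv_into_into[OF x] f_inv_into_f[OF x] by auto
    then have "(0, b) \<in> cells \<mu>" using cells_down[OF assms(1), of a b 0 b] by simp
    then have "b < hd \<mu>" using assms(2) by (auto simp: cells_def hd_conv_nth)
    then show ?thesis using cell ab by (auto simp: mem_column)
  qed
  have "card ({1..n} - \<Union>M) = n - 2 * card M"
    using card_Union_matching[OF M(2)] matchings_Union_subset[OF M(2)]
    by (subst card_Diff_subset) (auto intro: finite_subset)
  then have cJ: "card ?J = Suc (hd \<mu>)" using M assms(3) by simp
  have "?c ` ?J \<subseteq> {..<hd \<mu>}" using c by blast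
  then have "card (?c ` ?J) \<le> hd \<mu>" using card_mono[of "{..<hd \<mu>}" "?c ` ?J"] by simp
  then have "\<not> inj_on ?c ?J" using pigeonhole[of ?c ?J] cJ by simp
  then obtain x y where xy: "x \<in> ?J" "y \<in> ?J" "x \<noteq> y" "?c x = ?c y" unfolding inj_on_def by blast
  let ?\<tau> = "transpose x y"
  have xcol: "x \<in> column \<mu> t (?c x)" "y \<in> column \<mu> t (?c x)" using c[of x] c[of y] xy by auto
  have \<tau>Q: "?\<tau> \<in> ?Q" by (rule transpose_column_stabilizer[OF assms(4) xcol])
  have \<tau>J: "?\<tau> j \<in> ?J" if "j \<in> ?J" for j using that xy by (auto simp: transpose_def)
  let ?F = "\<lambda>q. \<Sum>j\<in>?J. (if fits (insert {i, j} M) (move q (tabloid_of \<mu> t)) then 1 else 0 :: complex)"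
  have "(\<Sum>j\<in>?J. row_pairings (polytabloid \<mu> t) (insert {i, j} M)) = (\<Sum>q\<in>?Q. csign q * ?F q)"
    unfolding row_pairings_polytabloid sum_distrib_left by (rule sum.swap)
  also have "\<dots> = 0"
  proof (rule sum_column_sign_left_0[OF \<tau>Q xy(3)])
    fix q assume "q \<in> ?Q"
    have img: "(`) ?\<tau> ` insert {i, j} M = insert {i, ?\<tau> j} M" for j
    proof -
      have "?\<tau> ` e = e" if "e \<in> M" for e using that xy by (intro transpose_image_eq) auto
      moreover have "?\<tau> i = i" using xy by (auto simp: transpose_def)
      ultimately show ?thesis by simp
    qed
    have "?F (?\<tau> \<circ> q) = (\<Sum>j\<in>?J. if fits (insert {i, ?\<tau> j} M) (move q (tabloid_of \<mu> t)) then 1 else 0)"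
    proof (rule sum.cong[OF refl])
      fix j
      have "fits (insert {i, j} M) (move ?\<tau> (move q (tabloid_of \<mu> t))) \<longleftrightarrow>
          fits ((`) (pinv ?\<tau>) ` insert {i, j} M) (move q (tabloid_of \<mu> t))"
        by (rule fits_move') simp
      then show "(if fits (insert {i, j} M) (move (?\<tau> \<circ> q) (tabloid_of \<mu> t)) then 1 else 0 :: complex) =
         (if fits (insert {i, ?\<tau> j} M) (move q (tabloid_of \<mu> t)) then 1 else 0)"
        by (simp only: inv_transpose_eq img image_comp[symmetric])
    qed
    also have "\<dots> = ?F q"
      by (rule sum.reindex_bij_witness[where i = ?\<tau> and j = ?\<tau>]) (use \<tau>J in auto)
    finally show "?F (?\<tau> \<circ> q) = ?F q" .
  qed
  finally show "(\<Sum>j\<in>?J. row_pairings (polytabloid \<mu> t) (insert {i, j} M)) = 0" .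
qed

lemma harmonics_add: "g \<in> harmonics X d \<Longrightarrow> h \<in> harmonics X d \<Longrightarrow> (\<lambda>M. g M + h M) \<in> harmonics X d"
  by (auto simp: harmonics_def harmonic_def sum.distrib)

lemma harmonics_scale: "h \<in> harmonics X d \<Longrightarrow> (\<lambda>M. c * h M) \<in> harmonics X d"
  by (auto simp: harmonics_def harmonic_def sum_distrib_left[symmetric])

lemma harmonics_0: "(\<lambda>M. 0) \<in> harmonics X d"
  by (auto simp: harmonics_def harmonic_def)

lemma harmonics_sum: "(\<And>a. a \<in> A \<Longrightarrow> g a \<in> harmonics X d) \<Longrightarrow> (\<lambda>M. \<Sum>a\<in>A. g a M) \<in> harmonics X d"
  by (induction A rule: infinite_finite_induct) (auto simp: harmonics_0 harmonics_add)

lemma row_pairings_specht_harmonics: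
  assumes "is_partition \<mu> n" "\<mu> \<noteq> []" "n = hd \<mu> + 2 * d" "v \<in> carrier (specht \<mu>)"
  shows "row_pairings v \<in> harmonics {1..n} d"
  using assms(4) unfolding specht_carrier
proof (induction rule: tabloid_space.span_induct_alt)
  case base
  then show ?case using harmonics_0 by (simp add: row_pairings_def)
next
  case (step c u y)
  then obtain t where t: "is_tableau \<mu> t" "u = polytabloid \<mu> t" by blast
  have "row_pairings u \<in> harmonics {1..n} d"
    unfolding harmonics_def t(2)
    using row_pairings_polytabloid_harmonic[OF assms(1-3) t(1)] row_pairings_polytabloid_support[OF assms(1-3) t(1)] by blast
  then have "(\<lambda>M. c * row_pairings u M + row_pairings y M) \<in> harmonics {1..n} d"
    using step(2) by (intro harmonics_add harmonics_scale) auto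
  moreover have "row_pairings (scale_tabloids c u + y) = (\<lambda>M. c * row_pairings u M + row_pairings y M)"
    by (simp add: fun_eq_iff row_pairings_add row_pairings_scale)
  ultimately show ?case by simp
qed

section \<open>Even shapes\<close>

text \<open>The partner of a column when the columns are grouped into the pairs \<open>2k\<close>, \<open>2k + 1\<close>.\<close>

definition flip :: "nat \<Rightarrow> nat" where
  "flip j = (if even j then Suc j else j - 1)"

lemma flip_flip [simp]: "flip (flip j) = j"
  by (auto simp: flip_def)

lemma flip_ne [simp]: "flip j \<noteq> j"
  by (cases j) (auto simp: flip_def)

lemma even_flip [simp]: "even (flip j) \<longleftrightarrow> odd j"
  by (auto simp: flip_def)

lemma flip_cells:
  assumes "\<forall>p\<in>set \<mu>. even p" "(i, j) \<in> cells \<mu>"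
  shows "(i, flip j) \<in> cells \<mu>"
proof -
  have "even (\<mu> ! i)" "j < \<mu> ! i" using assms by (auto simp: cells_def)
  then have "flip j < \<mu> ! i" unfolding flip_def by (cases "even j") (auto, metis Suc_lessI even_Suc)
  then show ?thesis using assms(2) by (simp add: cells_def)
qed

definition row_pairs :: "nat list \<Rightarrow> (nat \<times> nat \<Rightarrow> nat) \<Rightarrow> nat set set" where
  "row_pairs \<mu> t = {{t (i, j), t (i, flip j)} | i j. (i, j) \<in> cells \<mu> \<and> i \<ge> 1}"

lemma fits_row_pairs:
  assumes "is_tableau \<mu> t" "\<forall>p\<in>set \<mu>. even p"
  shows "fits (row_pairs \<mu> t) (tabloid_of \<mu> t)"
proof -
  let ?B = "\<Union>i\<in>{1..}. tabloid_of \<mu> t i"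
  have inj: "i = i' \<and> j = j'" if "t (i, j) = t (i', j')" "(i, j) \<in> cells \<mu>" "(i', j') \<in> cells \<mu>" for i j i' j'
    using tableau_inj[OF assms(1)] that by (auto dest: inj_onD)
  note fl = flip_cells[OF assms(2)]
  have "row_pairs \<mu> t \<subseteq> nsets ?B 2"
  proof
    fix e assume "e \<in> row_pairs \<mu> t"
    then obtain i j where e: "(i, j) \<in> cells \<mu>" "i \<ge> 1" "e = {t (i, j), t (i, flip j)}"
      by (auto simp: row_pairs_def)
    have "t (i, j) \<noteq> t (i, flip j)" using inj[OF _ e(1) fl[OF e(1)]] by (metis flip_ne)
    moreover have "t (i, j) \<in> ?B" "t (i, flip j) \<in> ?B" using e fl[OF e(1)] by (auto simp: mem_tabloid_of)
    ultimately show "e \<in> nsets ?B 2" using e(3) by simp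
  qed
  moreover have "disjoint (row_pairs \<mu> t)"
  proof (rule disjointI, rule ccontr)
    fix e f assume e: "e \<in> row_pairs \<mu> t" and f: "f \<in> row_pairs \<mu> t" and "e \<noteq> f" "e \<inter> f \<noteq> {}"
    obtain i j where e': "(i, j) \<in> cells \<mu>" "e = {t (i, j), t (i, flip j)}" using e by (auto simp: row_pairs_def)
    obtain k l where f': "(k, l) \<in> cells \<mu>" "f = {t (k, l), t (k, flip l)}" using f by (auto simp: row_pairs_def)
    note c = e'(1) f'(1) fl[OF e'(1)] fl[OF f'(1)]
    have "t (i, j) = t (k, l) \<or> t (i, j) = t (k, flip l) \<or> t (i, flip j) = t (k, l) \<or> t (i, flip j) = t (k, flip l)"
      using \<open>e \<inter> f \<noteq> {}\<close> e' f' by auto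
    then have "i = k \<and> (j = l \<or> j = flip l)" using inj c by (metis flip_flip)
    then have "e = f" using e' f' by auto
    then show False using \<open>e \<noteq> f\<close> by simp
  qed
  moreover have "\<Union>(row_pairs \<mu> t) = ?B"
  proof
    show "\<Union>(row_pairs \<mu> t) \<subseteq> ?B" using fl by (fastforce simp: row_pairs_def mem_tabloid_of)
    show "?B \<subseteq> \<Union>(row_pairs \<mu> t)"
    proof
      fix x assume "x \<in> ?B"
      then obtain i j where "i \<ge> 1" "(i, j) \<in> cells \<mu>" "x = t (i, j)" by (auto simp: mem_tabloid_of)
      then have "{t (i, j), t (i, flip j)} \<in> row_pairs \<mu> t" "x \<in> {t (i, j), t (i, flip j)}"
        by (auto simp: row_pairs_def)
      then show "x \<in> \<Union>(row_pairs \<mu> t)" by (rule UnionI)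
    qed
  qed
  moreover have "\<forall>e\<in>row_pairs \<mu> t. \<exists>i\<ge>1. e \<subseteq> tabloid_of \<mu> t i"
  proof
    fix e assume "e \<in> row_pairs \<mu> t"
    then obtain i j where e: "(i, j) \<in> cells \<mu>" "i \<ge> 1" "e = {t (i, j), t (i, flip j)}"
      by (auto simp: row_pairs_def)
    then have "e \<subseteq> tabloid_of \<mu> t i" using fl[OF e(1)] by (auto simp: mem_tabloid_of)
    then show "\<exists>i\<ge>1. e \<subseteq> tabloid_of \<mu> t i" using e(2) by blast
  qed
  ultimately show ?thesis by (simp add: fits_def perfect_matchings_def)
qed

text \<open>Two paired entries of a lower row end up in a common row, so \<open>q\<close> moves the columns \<open>2k\<close> and \<open>2k + 1\<close> in the
same way. Hence \<open>q\<close> is a product of a permutation of the even columns and a conjugate of it on the odd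
columns, and the two signs cancel.\<close>

lemma sign_of_fitting_column_permutation:
  assumes tab: "is_tableau \<mu> t" and ev: "\<forall>p\<in>set \<mu>. even p" and q: "q \<in> column_stabilizer \<mu> t"
    and fits: "fits (row_pairs \<mu> t) (move q (tabloid_of \<mu> t))"
  shows "sign q = 1"
proof -
  let ?X = "{1..sum_list \<mu>}"
  define p where "p = pinv q"
  note fl = flip_cells[OF ev]
  have pQ: "p \<in> column_stabilizer \<mu> t" unfolding p_def by (rule column_stabilizer_inv[OF q])
  have pp: "p permutes ?X" and injp: "inj p" 
    using pQ column_stabilizer_permutes column_stabilizer_bij bij_is_inj by blast+
  have inj: "c = e" if "t c = t e" "c \<in> cells \<mu>" "e \<in> cells \<mu>" for c e
    using tableau_inj[OF tab] that by (auto dest: inj_onD)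
  have pcol: "\<exists>i'. (i', j) \<in> cells \<mu> \<and> p (t (i, j)) = t (i', j)" if "(i, j) \<in> cells \<mu>" for i j
  proof -
    have "t (i, j) \<in> column \<mu> t j" using that by (auto simp: mem_column)
    then have "p (t (i, j)) \<in> p ` column \<mu> t j" by (rule imageI)
    then have "p (t (i, j)) \<in> column \<mu> t j" using pQ by (simp add: column_stabilizer_iff)
    then show ?thesis by (simp add: mem_column)
  qed
  have lower: "\<exists>i'\<ge>1. (i', j) \<in> cells \<mu> \<and> p (t (i, j)) = t (i', j) \<and> p (t (i, flip j)) = t (i', flip j)"
    if ij: "(i, j) \<in> cells \<mu>" "i \<ge> 1" for i j
  proof -
    have "{t (i, j), t (i, flip j)} \<in> row_pairs \<mu> t" using ij by (auto simp: row_pairs_def)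
    then obtain i' where i': "i' \<ge> 1" "{t (i, j), t (i, flip j)} \<subseteq> q ` tabloid_of \<mu> t i'"
      using fits by (auto simp: fits_def)
    have "p (q x) = x" for x using column_stabilizer_bij[OF q] by (simp add: p_def bij_is_inj)
    then have "p (t (i, j)) \<in> tabloid_of \<mu> t i'" "p (t (i, flip j)) \<in> tabloid_of \<mu> t i'"
      using i'(2) by auto
    then obtain a b where ab: "(i', a) \<in> cells \<mu>" "p (t (i, j)) = t (i', a)" 
        "(i', b) \<in> cells \<mu>" "p (t (i, flip j)) = t (i', b)" by (auto simp: mem_tabloid_of)
    obtain k where k: "(k, j) \<in> cells \<mu>" "p (t (i, j)) = t (k, j)" using pcol[OF ij(1)] by blast
    obtain l where l: "(l, flip j) \<in> cells \<mu>" "p (t (i, flip j)) = t (l, flip j)" using pcol[OF fl[OF ij(1)]] by blast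
    have "(i', a) = (k, j)" using inj[OF _ ab(1) k(1)] ab(2) k(2) by simp
    moreover have "(i', b) = (l, flip j)" using inj[OF _ ab(3) l(1)] ab(4) l(2) by simp
    ultimately show ?thesis using ab i' by auto
  qed
  (* Nothing is known about pairs in the first row, but \<open>p\<close> maps the lower part of the column onto itself. *)
  have first: "p (t (0, j)) = t (0, j)" if j: "(0, j) \<in> cells \<mu>" for j
  proof (rule ccontr)
    assume ne: "p (t (0, j)) \<noteq> t (0, j)"
    let ?A = "{t (i, j) | i. (i, j) \<in> cells \<mu> \<and> i \<ge> 1}"
    have "?A \<subseteq> t ` cells \<mu>" by blast
    then have "finite ?A" using finite_cells finite_subset by blast
    moreover have "p ` ?A \<subseteq> ?A" using lower by blast
    ultimately have "p ` ?A = ?A" using injp by (metis (no_types, lifting) endo_inj_surj inj_on_subset subset_UNIV)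
    moreover obtain i' where i': "(i', j) \<in> cells \<mu>" "p (t (0, j)) = t (i', j)" using pcol[OF j] by blast
    moreover have "i' \<ge> 1" using ne i'(2) by (cases i') auto
    ultimately have "p (t (0, j)) \<in> p ` ?A" by blast
    then have "t (0, j) \<in> ?A" using injp by (auto dest: injD)
    then obtain i where "(i, j) \<in> cells \<mu>" "i \<ge> 1" "t (0, j) = t (i, j)" by blast
    then show False using inj[of "(0, j)" "(i, j)"] j by simp
  qed
  have key: "\<exists>i'. (i', j) \<in> cells \<mu> \<and> p (t (i, j)) = t (i', j) \<and> p (t (i, flip j)) = t (i', flip j)"
    if ij: "(i, j) \<in> cells \<mu>" for i j
  proof (cases i)
    case 0
    then show ?thesis using first ij fl[OF ij] by blast
  next
    case (Suc k)
    then show ?thesis using lower[OF ij] by auto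
  qed
  let ?c = "inv_into (cells \<mu>) t"
  (* \<open>\<sigma>\<close> exchanges paired entries, and \<open>r\<close> is \<open>p\<close> restricted to the even columns. *)
  define \<sigma> where "\<sigma> = (\<lambda>x. if x \<in> ?X then t (fst (?c x), flip (snd (?c x))) else x)"
  define r where "r = (\<lambda>x. if x \<in> ?X \<and> even (snd (?c x)) then p x else x)"
  have \<sigma>_out: "\<sigma> x = x" if "x \<notin> ?X" for x unfolding \<sigma>_def using that by (rule if_not_P)
  have r_out: "r x = x" if "x \<notin> ?X" for x unfolding r_def using that by (simp only: simp_thms if_False)
  have ct: "?c (t c) = c" if "c \<in> cells \<mu>" for c using that tableau_inj[OF tab] by simp
  have tX: "t c \<in> ?X" if "c \<in> cells \<mu>" for c using that tableau_image[OF tab] by blast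
  have \<sigma>t: "\<sigma> (t (i, j)) = t (i, flip j)" if "(i, j) \<in> cells \<mu>" for i j
    using that ct tX[OF that] by (simp add: \<sigma>_def)
  have rt: "r (t (i, j)) = (if even j then p (t (i, j)) else t (i, j))" if "(i, j) \<in> cells \<mu>" for i j
    using that ct tX[OF that] by (simp add: r_def)
  have Xt: "\<exists>i j. (i, j) \<in> cells \<mu> \<and> x = t (i, j)" if "x \<in> ?X" for x
    using that tableau_image[OF tab] by (metis imageE surj_pair)
  have \<sigma>\<sigma>: "\<sigma> (\<sigma> x) = x" for x
  proof (cases "x \<in> ?X")
    case True
    then show ?thesis using Xt[OF True] \<sigma>t fl by (metis flip_flip)
  qed (simp only: \<sigma>_out not_False_eq_True)
  have "\<sigma> permutes ?X"
    unfolding permutes_def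
  proof (intro conjI allI impI)
    show "\<sigma> x = x" if "x \<notin> ?X" for x using that by (rule \<sigma>_out)
    show "\<exists>!x. \<sigma> x = y" for y by (rule ex1I[of _ "\<sigma> y"]) (use \<sigma>\<sigma> in auto)
  qed
  then have perm\<sigma>: "permutation \<sigma>" using permutation_permutes by blast
  have "r permutes ?X"
  proof -
    have "inj_on r ?X"
    proof (rule inj_onI)
      fix x y assume xy: "x \<in> ?X" "y \<in> ?X" "r x = r y"
      obtain i j where x: "(i, j) \<in> cells \<mu>" "x = t (i, j)" using Xt[OF xy(1)] by blast
      obtain k l where y: "(k, l) \<in> cells \<mu>" "y = t (k, l)" using Xt[OF xy(2)] by blast
      obtain i' where i': "(i', j) \<in> cells \<mu>" "r x = t (i', j)" using rt[OF x(1)] x pcol[OF x(1)] by (cases "even j") auto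
      obtain k' where k': "(k', l) \<in> cells \<mu>" "r y = t (k', l)" using rt[OF y(1)] y pcol[OF y(1)] by (cases "even l") auto
      have "j = l" using inj[OF _ i'(1) k'(1)] i'(2) k'(2) xy(3) by auto
      then show "x = y" using xy(3) rt x y injp by (cases "even j") (auto dest: injD)
    qed
    moreover have "r ` ?X \<subseteq> ?X"
    proof
      fix y assume "y \<in> r ` ?X"
      then obtain x where x: "x \<in> ?X" "y = r x" by blast
      have "r x = p x \<or> r x = x" unfolding r_def by (rule if_split[THEN iffD2]) blast
      then show "y \<in> ?X" using x permutes_in_image[OF pp, of x] by metis
    qed
    ultimately have "bij_betw r ?X ?X"
      unfolding bij_betw_def using endo_inj_surj[of ?X r] finite_atLeastAtMost by blast
    then show ?thesis by (rule bij_imp_permutes) (rule r_out)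
  qed
  then have permr: "permutation r" using permutation_permutes by blast
  have "p = r \<circ> (\<sigma> \<circ> (r \<circ> \<sigma>))"
  proof
    fix x
    show "p x = (r \<circ> (\<sigma> \<circ> (r \<circ> \<sigma>))) x"
    proof (cases "x \<in> ?X")
      case False
      then show ?thesis using permutes_not_in[OF pp] \<sigma>_out[of x] r_out[of x] by simp
    next
      case True
      then obtain i j where x: "(i, j) \<in> cells \<mu>" "x = t (i, j)" using Xt by blast
      note fx = fl[OF x(1)]
      obtain i' where i': "(i', j) \<in> cells \<mu>" "p (t (i, j)) = t (i', j)" "p (t (i, flip j)) = t (i', flip j)"
        using key[OF x(1)] by blast
      note fi = fl[OF i'(1)]
      show ?thesis
      proof (cases "even j")
        case True
        then show ?thesis using x i' \<sigma>t[OF x(1)] rt[OF fx] \<sigma>t[OF fx] rt[OF x(1)] by simp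
      next
        case False
        then show ?thesis using x i' \<sigma>t[OF x(1)] rt[OF fx] \<sigma>t[OF fi] rt[OF i'(1)] by simp
      qed
    qed
  qed
  then have "sign p = sign r * (sign \<sigma> * (sign r * sign \<sigma>))"
    using perm\<sigma> permr by (simp add: sign_compose permutation_compose)
  also have "\<dots> = (sign r * sign r) * (sign \<sigma> * sign \<sigma>)" by (simp only: mult_ac)
  also have "\<dots> = 1" by simp
  finally show ?thesis using column_stabilizer_permutation[OF q] by (simp add: p_def sign_inverse)
qed

text \<open>All column permutations that contribute to this coefficient have sign \<open>1\<close>, and the identity is one of them.\<close>

lemma row_pairings_polytabloid_nonzero:
  assumes "is_tableau \<mu> t" "\<forall>p\<in>set \<mu>. even p"
  shows "row_pairings (polytabloid \<mu> t) (row_pairs \<mu> t) \<noteq> 0"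
proof -
  let ?Q = "column_stabilizer \<mu> t"
  let ?F = "{q \<in> ?Q. fits (row_pairs \<mu> t) (move q (tabloid_of \<mu> t))}"
  have "row_pairings (polytabloid \<mu> t) (row_pairs \<mu> t) = (\<Sum>q\<in>?Q. if fits (row_pairs \<mu> t) (move q (tabloid_of \<mu> t)) then 1 else 0)"
    unfolding row_pairings_polytabloid
    by (rule sum.cong[OF refl]) (use sign_of_fitting_column_permutation[OF assms] in force)
  also have "\<dots> = of_nat (card ?F)" by (simp add: sum.If_cases Int_def)
  finally have eq: "row_pairings (polytabloid \<mu> t) (row_pairs \<mu> t) = of_nat (card ?F)" .
  have "id \<in> ?F" using fits_row_pairs[OF assms] by simp
  moreover have "finite ?F" by simp
  ultimately have "card ?F \<noteq> 0" by (metis (lifting) card_0_eq empty_iff)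
  then show ?thesis unfolding eq of_nat_eq_0_iff .
qed

text \<open>Otherwise choose a shape \<open>\<nu>\<close> of least weight with \<open>x \<nu> \<noteq> 0\<close>. A column antisymmetrizer of shape \<open>\<nu>\<close> kills
the components of all other shapes and maps \<open>x \<nu>\<close> to a multiple of a polytabloid, nonzero for a suitable
tableau; but \<open>row_pairings\<close> does not kill polytabloids.\<close>

lemma sum_row_pairings_eq_0:
  assumes "finite \<Lambda>" and part: "\<And>\<mu>. \<mu> \<in> \<Lambda> \<Longrightarrow> is_partition \<mu> n \<and> (\<forall>p\<in>set \<mu>. even p)"
    and x: "\<And>\<mu>. \<mu> \<in> \<Lambda> \<Longrightarrow> x \<mu> \<in> carrier (specht \<mu>)"
    and zero: "\<And>M. (\<Sum>\<mu>\<in>\<Lambda>. row_pairings (x \<mu>) M) = 0"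
    and "\<mu> \<in> \<Lambda>"
  shows "x \<mu> = 0"
proof (rule ccontr)
  assume "x \<mu> \<noteq> 0"
  then obtain \<nu> where \<nu>: "\<nu> \<in> \<Lambda> \<and> x \<nu> \<noteq> 0" "\<forall>\<kappa>. \<kappa> \<in> \<Lambda> \<and> x \<kappa> \<noteq> 0 \<longrightarrow> weight \<nu> \<le> weight \<kappa>"
    using ex_has_least_nat[of "\<lambda>\<nu>. \<nu> \<in> \<Lambda> \<and> x \<nu> \<noteq> 0" \<mu> weight] assms(5) by blast
  have nu: "\<nu> \<in> \<Lambda>" "is_partition \<nu> n" "\<forall>p\<in>set \<nu>. even p" "x \<nu> \<in> carrier (specht \<nu>)" using \<nu> part x by auto
  obtain t where t: "is_tableau \<nu> t" "column_antisym \<nu> t (x \<nu>) \<noteq> 0"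
    using specht_eq_0[OF nu(4)] \<nu>(1) by blast
  obtain a where a: "column_antisym \<nu> t (x \<nu>) = scale_tabloids a (polytabloid \<nu> t)"
    using column_antisym_specht[OF nu(2) t(1) nu(4)] by blast
  have "a \<noteq> 0" using t(2) a by auto
  have others: "column_antisym \<nu> t (x \<kappa>) = 0" if "\<kappa> \<in> \<Lambda> - {\<nu>}" for \<kappa>
  proof (cases "x \<kappa> = 0")
    case False
    then show ?thesis
      using that \<nu>(2) part x by (intro column_antisym_specht_eq_0[OF nu(2) _ t(1)]) auto
  qed simp
  let ?M = "row_pairs \<nu> t"
  have "(\<Sum>\<kappa>\<in>\<Lambda>. row_pairings (column_antisym \<nu> t (x \<kappa>)) ?M) =
     (\<Sum>q\<in>column_stabilizer \<nu> t. csign q * (\<Sum>\<kappa>\<in>\<Lambda>. row_pairings (x \<kappa>) ((`) (pinv q) ` ?M)))"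
    unfolding row_pairings_column_antisym sum_distrib_left by (rule sum.swap)
  also have "\<dots> = 0" by (simp add: zero)
  finally have "(\<Sum>\<kappa>\<in>\<Lambda>. row_pairings (column_antisym \<nu> t (x \<kappa>)) ?M) = 0" .
  moreover have "(\<Sum>\<kappa>\<in>\<Lambda>. row_pairings (column_antisym \<nu> t (x \<kappa>)) ?M) = row_pairings (column_antisym \<nu> t (x \<nu>)) ?M"
    using nu(1) others assms(1) by (simp add: sum.remove)
  ultimately have "a * row_pairings (polytabloid \<nu> t) ?M = 0" by (simp add: a row_pairings_scale)
  then show False using \<open>a \<noteq> 0\<close> row_pairings_polytabloid_nonzero[OF t(1) nu(3)] by simp
qed

section \<open>Counting standard tableaux\<close>

text \<open>Shapes are functions that give the length of each row. A box can be added to the rows in \<open>addable p\<close>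
and removed from the rows in \<open>removable p\<close>.\<close>

definition addable :: "(nat \<Rightarrow> nat) \<Rightarrow> nat set" where
  "addable p = {i. i = 0 \<or> p i < p (i - 1)}"

definition removable :: "(nat \<Rightarrow> nat) \<Rightarrow> nat set" where
  "removable p = {i. p (Suc i) < p i}"

abbreviation inc :: "(nat \<Rightarrow> nat) \<Rightarrow> nat \<Rightarrow> nat \<Rightarrow> nat" where
  "inc p i \<equiv> p(i := Suc (p i))"

abbreviation dec :: "(nat \<Rightarrow> nat) \<Rightarrow> nat \<Rightarrow> nat \<Rightarrow> nat" where
  "dec p i \<equiv> p(i := p i - 1)"

definition diagram :: "(nat \<Rightarrow> nat) \<Rightarrow> bool" where
  "diagram p \<longleftrightarrow> (\<forall>i. p (Suc i) \<le> p i) \<and> finite {i. p i \<noteq> 0}"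

lemma finite_support_upd: "finite {i. p i \<noteq> 0} \<Longrightarrow> finite {i. (p(k := x)) i \<noteq> (0::nat)}"
  by (rule finite_subset[of _ "insert k {i. p i \<noteq> 0}"]) auto

lemma diagram_inc: "diagram p \<Longrightarrow> i \<in> addable p \<Longrightarrow> diagram (inc p i)"
  unfolding diagram_def addable_def
  by (intro conjI allI finite_support_upd) (auto simp: le_Suc_eq)

lemma diagram_dec: "diagram p \<Longrightarrow> i \<in> removable p \<Longrightarrow> diagram (dec p i)"
  unfolding diagram_def removable_def
  by (intro conjI allI finite_support_upd) (auto simp: le_diff_conv less_eq_Suc_le intro: le_trans[OF diff_le_self] le_SucI)

lemma finite_removable: "diagram p \<Longrightarrow> finite (removable p)"
  unfolding diagram_def removable_def by (rule finite_subset[of _ "{i. p i \<noteq> 0}"]) auto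

lemma addable_eq: "addable p = insert 0 (Suc ` removable p)"
proof (intro equalityI subsetI)
  fix i assume "i \<in> addable p"
  then show "i \<in> insert 0 (Suc ` removable p)" by (cases i) (auto simp: addable_def removable_def)
qed (auto simp: addable_def removable_def)

lemma finite_addable: "diagram p \<Longrightarrow> finite (addable p)"
  by (simp add: addable_eq finite_removable)

lemma card_addable: "diagram p \<Longrightarrow> card (addable p) = Suc (card (removable p))"
  by (simp add: addable_eq finite_removable card_image)

lemma addable_removable_swap:
  "i \<in> addable p \<and> j \<in> removable (inc p i) \<and> j \<noteq> i \<longleftrightarrow> j \<in> removable p \<and> i \<in> addable (dec p j) \<and> i \<noteq> j"
proof (cases "i = Suc j")
  case True
  then show ?thesis by (auto simp: addable_def removable_def)
next
  case False
  then have "i = 0 \<or> i - 1 \<noteq> j" by auto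
  then show ?thesis using False by (auto simp: addable_def removable_def)
qed

lemma removable_inc_self: "diagram p \<Longrightarrow> i \<in> removable (inc p i)"
  unfolding removable_def diagram_def by (simp add: less_Suc_eq_le)

lemma addable_dec_self: "diagram p \<Longrightarrow> j \<in> removable p \<Longrightarrow> j \<in> addable (dec p j)"
  unfolding addable_def diagram_def removable_def
  by (cases j) (auto intro: less_le_trans[of _ "p j"])

text \<open>The number of standard tableaux of shape \<open>p\<close> with \<open>n\<close> entries; it is \<open>0\<close> if \<open>p\<close> does not have \<open>n\<close> boxes.\<close>

fun num_syt :: "nat \<Rightarrow> (nat \<Rightarrow> nat) \<Rightarrow> nat" where
  "num_syt 0 p = (if p = (\<lambda>_. 0) then 1 else 0)"
| "num_syt (Suc n) p = (\<Sum>i\<in>removable p. num_syt n (dec p i))"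

text \<open>This is the relation \<open>DU - UD = 1\<close> in Young's lattice: the sequences "add, then remove another box" and
"remove, then add another box" correspond to each other, and one more row is addable than removable.\<close>

lemma num_syt_inc:
  assumes "diagram p"
  shows "(\<Sum>i\<in>addable p. num_syt (Suc n) (inc p i)) = Suc n * num_syt n p"
  using assms
proof (induction n arbitrary: p)
  case (0 p)
  have "num_syt (Suc 0) (inc p i) = num_syt 0 p" if "i \<in> addable p" for i
  proof -
    have fin: "finite (removable (inc p i))" using finite_removable[OF diagram_inc[OF 0 that]] .
    have "num_syt 0 (dec (inc p i) j) = 0" if "j \<noteq> i" for j
      using that by (auto simp: fun_eq_iff intro!: exI[of _ i])
    then have "num_syt (Suc 0) (inc p i) = (\<Sum>j\<in>removable (inc p i). if j = i then num_syt 0 p else 0)"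
      by (auto intro!: sum.cong simp del: num_syt.simps(1) simp: num_syt.simps(2))
    then show ?thesis using fin removable_inc_self[OF 0] by simp
  qed
  then have eq: "(\<Sum>i\<in>addable p. num_syt (Suc 0) (inc p i)) = card (addable p) * num_syt 0 p" by simp
  show ?case
  proof (cases "p = (\<lambda>_. 0)")
    case True
    then have "addable p = {0}" by (auto simp: addable_def)
    then show ?thesis unfolding eq by simp
  next
    case False
    then show ?thesis unfolding eq by simp
  qed
next
  case (Suc m p)
  let ?n = "Suc m" and ?f = "num_syt (Suc m)"
  note fa = finite_addable[OF Suc.prems] and fr = finite_removable[OF Suc.prems]
  let ?S = "\<Sum>i\<in>addable p. \<Sum>j\<in>removable (inc p i) - {i}. ?f (dec (inc p i) j)"
  have one: "num_syt (Suc ?n) (inc p i) = ?f p + (\<Sum>j\<in>removable (inc p i) - {i}. ?f (dec (inc p i) j))"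
    if "i \<in> addable p" for i
  proof -
    have fin: "finite (removable (inc p i))" using finite_removable[OF diagram_inc[OF Suc.prems that]] .
    have "num_syt (Suc ?n) (inc p i) = (\<Sum>j\<in>removable (inc p i). ?f (dec (inc p i) j))" by (rule num_syt.simps(2))
    also have "\<dots> = ?f (dec (inc p i) i) + (\<Sum>j\<in>removable (inc p i) - {i}. ?f (dec (inc p i) j))"
      by (rule sum.remove[OF fin removable_inc_self[OF Suc.prems]])
    also have "dec (inc p i) i = p" by simp
    finally show ?thesis .
  qed
  have total: "(\<Sum>i\<in>addable p. num_syt (Suc ?n) (inc p i)) = card (addable p) * ?f p + ?S"
    using one by (simp add: sum.distrib del: num_syt.simps)
  have two: "?f p + (\<Sum>i\<in>addable (dec p j) - {j}. ?f (inc (dec p j) i)) = Suc m * num_syt m (dec p j)"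
    if j: "j \<in> removable p" for j
  proof -
    have d: "diagram (dec p j)" by (rule diagram_dec[OF Suc.prems j])
    have "p j > 0" using j by (auto simp: removable_def)
    then have 1: "inc (dec p j) j = p" by (simp add: fun_eq_iff)
    show ?thesis
      unfolding Suc.IH[OF d, symmetric] sum.remove[OF finite_addable[OF d] addable_dec_self[OF Suc.prems j]] 1 ..
  qed
  have "?S = (\<Sum>(i, j)\<in>(SIGMA i:addable p. removable (inc p i) - {i}). ?f (dec (inc p i) j))"
    by (rule sum.Sigma) (use fa finite_removable diagram_inc[OF Suc.prems] in auto)
  also have "\<dots> = (\<Sum>(j, i)\<in>(SIGMA j:removable p. addable (dec p j) - {j}). ?f (inc (dec p j) i))"
  proof (rule sum.reindex_bij_witness[where i = prod.swap and j = prod.swap])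
    fix x assume "x \<in> (SIGMA i:addable p. removable (inc p i) - {i})"
    then obtain i j where x: "x = (i, j)" "i \<in> addable p \<and> j \<in> removable (inc p i) \<and> j \<noteq> i" by auto
    from x(2) have "j \<in> removable p \<and> i \<in> addable (dec p j) \<and> i \<noteq> j" unfolding addable_removable_swap .
    then show "prod.swap x \<in> (SIGMA j:removable p. addable (dec p j) - {j})" by (simp add: x)
    have "inc (dec p j) i = dec (inc p i) j" using x(2) by (auto simp: fun_eq_iff)
    then show "(case prod.swap x of (j, i) \<Rightarrow> ?f (inc (dec p j) i)) = (case x of (i, j) \<Rightarrow> ?f (dec (inc p i) j))"
      by (simp add: x del: num_syt.simps)
  next
    fix x assume "x \<in> (SIGMA j:removable p. addable (dec p j) - {j})"
    then obtain i j where x: "x = (j, i)" "j \<in> removable p \<and> i \<in> addable (dec p j) \<and> i \<noteq> j" by auto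
    from x(2) have "i \<in> addable p \<and> j \<in> removable (inc p i) \<and> j \<noteq> i" unfolding addable_removable_swap .
    then show "prod.swap x \<in> (SIGMA i:addable p. removable (inc p i) - {i})" by (simp add: x)
  qed auto
  also have "\<dots> = (\<Sum>j\<in>removable p. \<Sum>i\<in>addable (dec p j) - {j}. ?f (inc (dec p j) i))"
    by (rule sum.Sigma[symmetric]) (use fr finite_addable diagram_dec[OF Suc.prems] in auto)
  finally have S: "?S = \<dots>" .
  have "card (removable p) * ?f p + ?S = (\<Sum>j\<in>removable p. ?f p + (\<Sum>i\<in>addable (dec p j) - {j}. ?f (inc (dec p j) i)))"
    unfolding S by (simp add: sum.distrib del: num_syt.simps)
  also have "\<dots> = (\<Sum>j\<in>removable p. Suc m * num_syt m (dec p j))"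
    by (rule sum.cong[OF refl two])
  also have "\<dots> = Suc m * ?f p" by (simp add: sum_distrib_left)
  finally show ?case unfolding total card_addable[OF Suc.prems] by (simp del: num_syt.simps)
qed

definition psize :: "(nat \<Rightarrow> nat) \<Rightarrow> nat" where
  "psize p = (\<Sum>i | p i \<noteq> 0. p i)"

lemma psize_superset: "finite A \<Longrightarrow> {i. p i \<noteq> 0} \<subseteq> A \<Longrightarrow> psize p = sum p A"
  unfolding psize_def by (rule sum.mono_neutral_left) auto

lemma psize_upd:
  assumes "finite {i. p i \<noteq> 0}"
  shows "psize (p(k := x)) + p k = psize p + x"
proof -
  let ?A = "insert k {i. p i \<noteq> 0}"
  have "psize (p(k := x)) = sum (p(k := x)) ?A" by (rule psize_superset) (use assms in auto)
  also have "\<dots> = x + sum p (?A - {k})" using assms by (subst sum.remove[of _ k]) (auto intro!: sum.cong)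
  finally have 1: "psize (p(k := x)) = x + sum p (?A - {k})" .
  have "psize p = sum p ?A" by (rule psize_superset) (use assms in auto)
  also have "\<dots> = p k + sum p (?A - {k})" using assms by (subst sum.remove[of _ k]) auto
  finally show ?thesis using 1 by simp
qed

definition part :: "nat list \<Rightarrow> nat \<Rightarrow> nat" where
  "part \<mu> i = (if i < length \<mu> then \<mu> ! i else 0)"

definition even_diagrams :: "nat \<Rightarrow> (nat \<Rightarrow> nat) set" where
  "even_diagrams a = {p. diagram p \<and> (\<forall>i. even (p i)) \<and> psize p = 2 * a}"

definition even_partitions :: "nat \<Rightarrow> nat list set" where
  "even_partitions a = {\<mu>. is_partition \<mu> (2 * a) \<and> (\<forall>p\<in>set \<mu>. even p)}"

lemma finite_partitions: "finite {\<mu>. is_partition \<mu> n}"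
proof (rule finite_subset)
  show "{\<mu>. is_partition \<mu> n} \<subseteq> {xs. set xs \<subseteq> {..n} \<and> length xs \<le> n}"
    using length_le_sum_list member_le_sum_list by (fastforce simp: is_partition_def)
qed (rule finite_lists_length_le, simp)

lemma finite_even_partitions: "finite (even_partitions a)"
  by (rule finite_subset[OF _ finite_partitions[of "2 * a"]]) (auto simp: even_partitions_def)

lemma inj_on_part: "inj_on part {\<mu>. is_partition \<mu> n}"
  by (rule inj_onI, rule partition_eqI) (auto simp: part_def fun_eq_iff)

lemma part_diagram:
  assumes "is_partition \<mu> n"
  shows "diagram (part \<mu>)" "psize (part \<mu>) = n"
proof -
  have sub: "{i. part \<mu> i \<noteq> 0} \<subseteq> {..<length \<mu>}" by (auto simp: part_def)
  have "part \<mu> (Suc i) \<le> part \<mu> i" for i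
    using assms by (auto simp: part_def is_partition_def sorted_wrt_iff_nth_less)
  then show "diagram (part \<mu>)" using finite_subset[OF sub] by (simp add: diagram_def)
  have "psize (part \<mu>) = sum (part \<mu>) {..<length \<mu>}" by (rule psize_superset[OF _ sub]) simp
  also have "\<dots> = (\<Sum>i<length \<mu>. \<mu> ! i)" by (rule sum.cong) (auto simp: part_def)
  also have "\<dots> = n" using assms by (simp add: is_partition_def sum_list_sum_nth lessThan_atLeast0)
  finally show "psize (part \<mu>) = n" .
qed

lemma diagram_antimono: "diagram p \<Longrightarrow> i \<le> j \<Longrightarrow> p j \<le> p i"
  unfolding diagram_def by (metis lift_Suc_antimono_le)

lemma diagram_part:
  assumes "diagram p"
  shows "\<exists>\<mu>. is_partition \<mu> (psize p) \<and> part \<mu> = p"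
proof -
  define m where "m = (LEAST i. p i = 0)"
  have "\<exists>i. p i = 0" using assms ex_new_if_finite[of "{i. p i \<noteq> 0}"] by (auto simp: diagram_def)
  then have m: "p m = 0" unfolding m_def by (rule LeastI_ex)
  have iff: "p i \<noteq> 0 \<longleftrightarrow> i < m" for i
  proof
    show "i < m" if "p i \<noteq> 0" using diagram_antimono[OF assms, of m i] m that by (cases "i < m") auto
    show "p i \<noteq> 0" if "i < m" using not_less_Least that unfolding m_def by blast
  qed
  let ?\<mu> = "map p [0..<m]"
  have part: "part ?\<mu> = p"
  proof
    fix i show "part ?\<mu> i = p i" using iff[of i] by (cases "i < m") (auto simp: part_def)
  qed
  have "sorted_wrt (\<ge>) ?\<mu>"
    using diagram_antimono[OF assms] by (auto simp: sorted_wrt_iff_nth_less)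
  moreover have "0 \<notin> set ?\<mu>"
  proof
    assume "0 \<in> set ?\<mu>"
    then obtain x where "x < m" "p x = 0" by auto
    then show False using iff[of x] by simp
  qed
  moreover have "sum_list ?\<mu> = psize p"
    using iff by (simp add: psize_def interv_sum_list_conv_sum_set_nat lessThan_atLeast0[symmetric] lessThan_def)
  ultimately show ?thesis using part unfolding is_partition_def by blast
qed

lemma even_diagrams_eq: "even_diagrams a = part ` even_partitions a"
proof (intro equalityI subsetI)
  fix p assume p: "p \<in> even_diagrams a"
  then have "diagram p" by (simp add: even_diagrams_def)
  then obtain \<mu> where \<mu>: "is_partition \<mu> (psize p)" "part \<mu> = p"
    using diagram_part by blast
  have "even x" if x: "x \<in> set \<mu>" for x
  proof -
    obtain i where i: "i < length \<mu>" "\<mu> ! i = x" using x unfolding in_set_conv_nth by blast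
    have "p i = part \<mu> i" unfolding \<mu>(2) ..
    then have "x = p i" using i by (simp add: part_def)
    then show ?thesis using p by (simp add: even_diagrams_def)
  qed
  then have "\<mu> \<in> even_partitions a" using \<mu> p by (simp add: even_partitions_def even_diagrams_def)
  then show "p \<in> part ` even_partitions a" using \<mu>(2) by blast
next
  fix p assume "p \<in> part ` even_partitions a"
  then obtain \<mu> where "is_partition \<mu> (2 * a)" "\<forall>x\<in>set \<mu>. even x" "p = part \<mu>" by (auto simp: even_partitions_def)
  then show "p \<in> even_diagrams a" using part_diagram by (auto simp: even_diagrams_def part_def)
qed

lemma finite_even_diagrams: "finite (even_diagrams a)"
  by (simp add: even_diagrams_eq finite_even_partitions)

text \<open>Removing a box from an even shape and adding a box to an even shape both give the shapes with exactly
one odd row, each of them once. So \<open>num_syt_inc\<close> applies.\<close>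

lemma sum_even_diagrams_Suc:
  "(\<Sum>p\<in>even_diagrams (Suc a). num_syt (2 * Suc a) p) = Suc (2 * a) * (\<Sum>p\<in>even_diagrams a. num_syt (2 * a) p)"
proof -
  let ?A = "SIGMA p:even_diagrams (Suc a). removable p" and ?B = "SIGMA q:even_diagrams a. addable q"
  have dA: "diagram p" if "p \<in> even_diagrams a" for p a using that by (simp add: even_diagrams_def)
  have "(\<Sum>p\<in>even_diagrams (Suc a). num_syt (2 * Suc a) p) = (\<Sum>p\<in>even_diagrams (Suc a). \<Sum>i\<in>removable p. num_syt (Suc (2 * a)) (dec p i))"
    by simp
  also have "\<dots> = (\<Sum>(p, i)\<in>?A. num_syt (Suc (2 * a)) (dec p i))"
    by (rule sum.Sigma) (auto simp: finite_even_diagrams finite_removable dA)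
  also have "\<dots> = (\<Sum>(q, i)\<in>?B. num_syt (Suc (2 * a)) (inc q i))"
  proof (rule sum.reindex_bij_witness[where i = "\<lambda>(q, i). (q(i := q i + 2), i)" and j = "\<lambda>(p, i). (p(i := p i - 2), i)"])
    fix x assume "x \<in> ?A"
    then obtain p i where x: "x = (p, i)" "p \<in> even_diagrams (Suc a)" "i \<in> removable p" by auto
    have d: "diagram p" and ev: "\<And>k. even (p k)" and sz: "psize p = 2 * Suc a" 
      using x(2) by (auto simp: even_diagrams_def)
    have "p (Suc i) < p i" using x(3) by (simp add: removable_def)
    then have pi: "p (Suc i) + 2 \<le> p i" using ev[of i] ev[of "Suc i"] by presburger
    let ?q = "p(i := p i - 2)"
    show "(case case x of (p, i) \<Rightarrow> (p(i := p i - 2), i) of (q, i) \<Rightarrow> (q(i := q i + 2), i)) = x"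
      using pi by (auto simp: x(1) fun_eq_iff)
    have "diagram ?q"
      unfolding diagram_def
    proof (intro conjI allI)
      fix k show "?q (Suc k) \<le> ?q k"
        using d pi by (auto simp: diagram_def intro: le_trans[OF diff_le_self])
    qed (rule finite_support_upd, use d in \<open>simp add: diagram_def\<close>)
    moreover have "even (?q k)" for k using ev pi by simp
    moreover have "psize ?q = 2 * a" using psize_upd[of p i "p i - 2"] d sz pi by (simp add: diagram_def)
    moreover have "i \<in> addable ?q"
    proof (cases i)
      case (Suc k)
      then have "p i \<le> p k" using d by (simp add: diagram_def)
      then show ?thesis using Suc pi by (auto simp: addable_def)
    qed (simp add: addable_def)
    ultimately show "(case x of (p, i) \<Rightarrow> (p(i := p i - 2), i)) \<in> ?B" by (simp add: x(1) even_diagrams_def)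
    have "inc ?q i = dec p i" using pi by (auto simp: fun_eq_iff)
    then show "(case case x of (p, i) \<Rightarrow> (p(i := p i - 2), i) of (q, i) \<Rightarrow> num_syt (Suc (2 * a)) (inc q i)) =
        (case x of (p, i) \<Rightarrow> num_syt (Suc (2 * a)) (dec p i))" by (simp add: x(1) del: num_syt.simps)
  next
    fix x assume "x \<in> ?B"
    then obtain q i where x: "x = (q, i)" "q \<in> even_diagrams a" "i \<in> addable q" by auto
    have d: "diagram q" and ev: "\<And>k. even (q k)" and sz: "psize q = 2 * a" 
      using x(2) by (auto simp: even_diagrams_def)
    let ?p = "q(i := q i + 2)"
    show "(case case x of (q, i) \<Rightarrow> (q(i := q i + 2), i) of (p, i) \<Rightarrow> (p(i := p i - 2), i)) = x"
      by (auto simp: x(1) fun_eq_iff)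
    have "diagram ?p"
      unfolding diagram_def
    proof (intro conjI allI)
      fix k 
      have "q i + 2 \<le> q k" if "i = Suc k"
      proof -
        have "q i < q k" using x(3) that by (simp add: addable_def)
        then show ?thesis using ev[of i] ev[of k] by presburger
      qed
      then show "?p (Suc k) \<le> ?p k" using d by (auto simp: diagram_def intro: le_trans[of _ "q i"])
    qed (rule finite_support_upd, use d in \<open>simp add: diagram_def\<close>)
    moreover have "psize ?p = 2 * Suc a" using psize_upd[of q i "q i + 2"] d sz by (simp add: diagram_def)
    moreover have "i \<in> removable ?p" using d by (auto simp: removable_def diagram_def less_eq_Suc_le le_SucI)
    ultimately show "(case x of (q, i) \<Rightarrow> (q(i := q i + 2), i)) \<in> ?A" using ev by (simp add: x(1) even_diagrams_def)
  qed
  also have "\<dots> = (\<Sum>q\<in>even_diagrams a. \<Sum>i\<in>addable q. num_syt (Suc (2 * a)) (inc q i))"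
    by (rule sum.Sigma[symmetric]) (auto simp: finite_even_diagrams finite_addable dA)
  also have "\<dots> = (\<Sum>q\<in>even_diagrams a. Suc (2 * a) * num_syt (2 * a) q)"
    by (rule sum.cong[OF refl]) (rule num_syt_inc, rule dA)
  finally show ?thesis by (simp only: sum_distrib_left)
qed

lemma sum_even_diagrams: "(\<Sum>p\<in>even_diagrams a. num_syt (2 * a) p) = num_perfect (2 * a)"
proof (induction a)
  case 0
  have "p = (\<lambda>_. 0)" if "p \<in> even_diagrams 0" for p
    using that by (auto simp: even_diagrams_def diagram_def psize_def fun_eq_iff)
  moreover have "(\<lambda>_. 0) \<in> even_diagrams 0" by (simp add: even_diagrams_def diagram_def psize_def)
  ultimately have "even_diagrams 0 = {\<lambda>_. 0}" by blast
  then show ?case by simp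
next
  case (Suc a)
  have "num_perfect (2 * Suc a) = Suc (2 * a) * num_perfect (2 * a)" by simp
  then show ?case using sum_even_diagrams_Suc[of a] Suc.IH by (simp only:)
qed

section \<open>Standard polytabloids\<close>

definition young_cells :: "(nat \<Rightarrow> nat) \<Rightarrow> (nat \<times> nat) set" where
  "young_cells p = {(i, j). j < p i}"

lemma cells_part: "cells \<mu> = young_cells (part \<mu>)"
  by (auto simp: cells_def young_cells_def part_def split: if_splits)

text \<open>The entry \<open>Suc n\<close> of a standard tableau is at the end of a removable row. Outside the shape the value is \<open>0\<close>.\<close>

fun syt :: "nat \<Rightarrow> (nat \<Rightarrow> nat) \<Rightarrow> (nat \<times> nat \<Rightarrow> nat) set" where
  "syt 0 p = (if p = (\<lambda>_. 0) then {\<lambda>_. 0} else {})"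
| "syt (Suc n) p = (\<Union>i\<in>removable p. (\<lambda>t. t((i, p i - 1) := Suc n)) ` syt n (dec p i))"

lemma young_cells_dec:
  assumes "i \<in> removable p"
  shows "young_cells p = insert (i, p i - 1) (young_cells (dec p i))" "(i, p i - 1) \<notin> young_cells (dec p i)"
  using assms by (auto simp: young_cells_def removable_def split: if_splits)

lemma syt_properties:
  assumes "diagram p" "t \<in> syt n p"
  shows "bij_betw t (young_cells p) {1..n}" "\<And>c. c \<notin> young_cells p \<Longrightarrow> t c = 0"
    "\<And>i j k. i < k \<Longrightarrow> (k, j) \<in> young_cells p \<Longrightarrow> t (i, j) < t (k, j)"
proof -
  have "bij_betw t (young_cells p) {1..n} \<and> (\<forall>c. c \<notin> young_cells p \<longrightarrow> t c = 0) \<and>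
    (\<forall>i j k. i < k \<longrightarrow> (k, j) \<in> young_cells p \<longrightarrow> t (i, j) < t (k, j))"
    using assms
  proof (induction n arbitrary: p t)
    case 0
    then have "p = (\<lambda>_. 0)" "t = (\<lambda>_. 0)" by (auto split: if_splits)
    then show ?case by (auto simp: young_cells_def bij_betw_def)
  next
    case (Suc n)
    then obtain i s where i: "i \<in> removable p" "s \<in> syt n (dec p i)" "t = s((i, p i - 1) := Suc n)" by auto
    note c = young_cells_dec[OF i(1)]
    note IH = Suc.IH[OF diagram_dec[OF Suc.prems(1) i(1)] i(2)]
    have bij: "bij_betw s (young_cells (dec p i)) {1..n}" using IH by blast
    have "bij_betw t (young_cells (dec p i)) {1..n}"
      using bij by (rule bij_betw_cong[THEN iffD1, rotated]) (use c(2) i(3) in auto)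
    from notIn_Un_bij_betw[OF c(2) _ this] have "bij_betw t (young_cells p) (insert (Suc n) {1..n})"
      unfolding c(1) by (simp add: i(3))
    moreover have "insert (Suc n) {1..n} = {1..Suc n}" by auto
    moreover have "t e = 0" if e: "e \<notin> young_cells p" for e
    proof -
      have "e \<noteq> (i, p i - 1)" "e \<notin> young_cells (dec p i)" using e unfolding c(1) by blast+
      moreover have "s e = 0" using IH calculation(2) by blast
      ultimately show ?thesis unfolding i(3) by simp
    qed
    moreover have "t (k, j) < t (l, j)" if kl: "k < l" "(l, j) \<in> young_cells p" for k l j
    proof (cases "(l, j) = (i, p i - 1)")
      case True
      have "j < p l" using kl by (simp add: young_cells_def)
      then have "j < p k" using diagram_antimono[OF Suc.prems(1), of k l] kl by simp
      then have "(k, j) \<in> young_cells (dec p i)" using kl True by (auto simp: young_cells_def)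
      then have "s (k, j) \<le> n" using bij by (auto simp: bij_betw_def)
      moreover have "(k, j) \<noteq> (i, p i - 1)" using True kl by auto
      ultimately show ?thesis using True i(3) by simp
    next
      case False
      then have l: "(l, j) \<in> young_cells (dec p i)" using kl c by auto
      have ne: "(k, j) \<noteq> (i, p i - 1)"
      proof
        assume eq: "(k, j) = (i, p i - 1)"
        have "p l \<le> p (Suc i)" using diagram_antimono[OF Suc.prems(1), of "Suc i" l] kl eq by simp
        moreover have "j < p l" using kl by (simp add: young_cells_def)
        ultimately show False using i(1) eq by (auto simp: removable_def)
      qed
      have "s (k, j) < s (l, j)" using IH l kl(1) by blast
      then show ?thesis unfolding i(3) fun_upd_other[OF False] fun_upd_other[OF ne] .
    qed
    ultimately show ?case by simp
  qed
  then show "bij_betw t (young_cells p) {1..n}" "\<And>c. c \<notin> young_cells p \<Longrightarrow> t c = 0"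
    "\<And>i j k. i < k \<Longrightarrow> (k, j) \<in> young_cells p \<Longrightarrow> t (i, j) < t (k, j)" by blast+
qed

lemma syt_le: "diagram p \<Longrightarrow> t \<in> syt n p \<Longrightarrow> t c \<le> n"
  using syt_properties(1,2)[of p t n] by (cases "c \<in> young_cells p") (auto simp: bij_betw_def)

lemma card_syt:
  assumes "diagram p"
  shows "finite (syt n p) \<and> card (syt n p) = num_syt n p"
  using assms
proof (induction n arbitrary: p)
  case (Suc n)
  let ?g = "\<lambda>i t. t((i, p i - 1) := Suc n)"
  have IH: "finite (syt n (dec p i))" "card (syt n (dec p i)) = num_syt n (dec p i)" if "i \<in> removable p" for i
    using Suc.IH[OF diagram_dec[OF Suc.prems that]] by blast+
  have inj: "inj_on (?g i) (syt n (dec p i))" if i: "i \<in> removable p" for i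
  proof (rule inj_onI)
    fix s s' assume s: "s \<in> syt n (dec p i)" "s' \<in> syt n (dec p i)" "?g i s = ?g i s'"
    note z = syt_properties(2)[OF diagram_dec[OF Suc.prems i] _ young_cells_dec(2)[OF i]]
    show "s = s'"
    proof
      fix c show "s c = s' c"
        using fun_cong[OF s(3), of c] z[OF s(1)] z[OF s(2)] by (cases "c = (i, p i - 1)") auto
    qed
  qed
  have disj: "?g i ` syt n (dec p i) \<inter> ?g k ` syt n (dec p k) = {}"
    if "i \<in> removable p" "k \<in> removable p" "i \<noteq> k" for i k
  proof (rule ccontr)
    assume "\<not> ?thesis"
    then obtain s s' where s: "s \<in> syt n (dec p i)" "s' \<in> syt n (dec p k)" "?g i s = ?g k s'" by auto
    have "Suc n = ?g i s (i, p i - 1)" by simp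
    also have "\<dots> = ?g k s' (i, p i - 1)" by (simp only: s(3))
    also have "\<dots> = s' (i, p i - 1)" using that(3) by simp
    finally have "Suc n = s' (i, p i - 1)" .
    then show False using syt_le[OF diagram_dec[OF Suc.prems that(2)] s(2), of "(i, p i - 1)"] by simp
  qed
  have fin: "finite (removable p)" by (rule finite_removable[OF Suc.prems])
  have "card (syt (Suc n) p) = (\<Sum>i\<in>removable p. card (?g i ` syt n (dec p i)))"
    unfolding syt.simps by (rule card_UN_disjoint) (use fin IH disj in auto)
  also have "\<dots> = (\<Sum>i\<in>removable p. num_syt n (dec p i))"
    by (rule sum.cong) (use inj IH in \<open>auto simp: card_image\<close>)
  finally show ?case using fin IH by simp
qed auto

lemma syt_row_injective:
  assumes "diagram p" "t \<in> syt n p" "t' \<in> syt n p"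
    and "\<And>i. (\<lambda>j. t (i, j)) ` {..<p i} = (\<lambda>j. t' (i, j)) ` {..<p i}"
  shows "t = t'"
  using assms
proof (induction n arbitrary: p t t')
  case 0
  then show ?case by (auto split: if_splits)
next
  case (Suc n)
  obtain i s where i: "i \<in> removable p" "s \<in> syt n (dec p i)" "t = s((i, p i - 1) := Suc n)" using Suc.prems(2) by auto
  obtain k s' where k: "k \<in> removable p" "s' \<in> syt n (dec p k)" "t' = s'((k, p k - 1) := Suc n)" using Suc.prems(3) by auto
  have pos: "p i - 1 < p i" "p k - 1 < p k" using i k by (auto simp: removable_def)
  have inj': "inj_on t' (young_cells p)" using syt_properties(1)[OF Suc.prems(1,3)] by (simp add: bij_betw_def)
  have "t (i, p i - 1) = Suc n" by (simp add: i(3))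
  then have "Suc n \<in> (\<lambda>j. t (i, j)) ` {..<p i}" using pos(1) by (metis imageI lessThan_iff)
  then have "Suc n \<in> (\<lambda>j. t' (i, j)) ` {..<p i}" using Suc.prems(4) by blast
  then obtain j where j: "j < p i" "t' (i, j) = Suc n" by auto
  have "(i, j) = (k, p k - 1)"
    by (rule inj_onD[OF inj']) (use j pos k(3) in \<open>auto simp: young_cells_def\<close>)
  then have ik: "i = k" by simp
  have d: "diagram (dec p i)" by (rule diagram_dec[OF Suc.prems(1) i(1)])
  have rows: "(\<lambda>j. u (l, j)) ` {..<dec p i l} = (\<lambda>j. (u((i, p i - 1) := Suc n)) (l, j)) ` {..<p l} - {Suc n}"
    if u: "u \<in> syt n (dec p i)" for u l
  proof -
    have le: "u c \<noteq> Suc n" for c using syt_le[OF d u, of c] by simp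
    show ?thesis
    proof (cases "l = i")
      case True
      have "{..<p i} = insert (p i - 1) {..<p i - 1}" using pos(1) by auto
      then show ?thesis using True le by (auto simp: image_iff)
    next
      case False
      then show ?thesis using le by (auto simp: image_iff)
    qed
  qed
  have "s = s'"
  proof (rule Suc.IH[OF d i(2)])
    show "s' \<in> syt n (dec p i)" using k(2) ik by simp
    then show "(\<lambda>j. s (l, j)) ` {..<dec p i l} = (\<lambda>j. s' (l, j)) ` {..<dec p i l}" for l
      unfolding rows[OF i(2)] rows[OF \<open>s' \<in> syt n (dec p i)\<close>] using Suc.prems(4)[of l] i(3) k(3) ik by simp
  qed
  then show ?case using i(3) k(3) ik by simp
qed

lemma digit_sum_less:
  fixes a :: "nat \<Rightarrow> nat"
  assumes "\<And>j. a j \<le> n"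
  shows "(\<Sum>j<k. a j * Suc n ^ j) < Suc n ^ k"
proof (induction k)
  case (Suc k)
  have "a k * Suc n ^ k \<le> n * Suc n ^ k" using assms by (rule mult_le_mono1)
  then show ?case unfolding sum.lessThan_Suc power_Suc mult_Suc using Suc by linarith
qed simp

lemma digits_less:
  fixes a b :: "nat \<Rightarrow> nat"
  assumes "\<And>j. a j \<le> n" "k \<le> n" "a k < b k" "\<And>j. k < j \<Longrightarrow> a j = b j"
  shows "(\<Sum>j\<le>n. a j * Suc n ^ j) < (\<Sum>j\<le>n. b j * Suc n ^ j)"
proof -
  have split: "{..n} = {..<k} \<union> insert k {k<..n}" using assms(2) by auto
  have S: "(\<Sum>j\<le>n. c j * Suc n ^ j) = (\<Sum>j<k. c j * Suc n ^ j) + (c k * Suc n ^ k + (\<Sum>j\<in>{k<..n}. c j * Suc n ^ j))" for c :: "nat \<Rightarrow> nat"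
    unfolding split by (subst sum.union_disjoint) auto
  have R: "(\<Sum>j\<in>{k<..n}. a j * Suc n ^ j) = (\<Sum>j\<in>{k<..n}. b j * Suc n ^ j)"
    by (rule sum.cong) (use assms(4) in auto)
  have "(\<Sum>j<k. a j * Suc n ^ j) + a k * Suc n ^ k < Suc n ^ k + a k * Suc n ^ k"
    using digit_sum_less[OF assms(1)] by simp
  also have "\<dots> = Suc (a k) * Suc n ^ k" by simp
  also have "\<dots> \<le> b k * Suc n ^ k" using assms(3) by (intro mult_le_mono1) simp
  finally show ?thesis unfolding S R by linarith
qed

definition row_index :: "nat \<Rightarrow> tabloid \<Rightarrow> nat \<Rightarrow> nat" where
  "row_index n T k = (if k \<in> {1..n} then (THE i. k \<in> T i) else 0)"

text \<open>The rows of the entries \<open>n, n - 1, \<dots>\<close>, compared lexicographically: they are read as the digits of a number in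
base \<open>n + 1\<close>, which suffices because there are at most \<open>n\<close> rows.\<close>

definition tabloid_key :: "nat \<Rightarrow> tabloid \<Rightarrow> nat" where
  "tabloid_key n T = (\<Sum>k\<le>n. row_index n T k * Suc n ^ k)"

lemma row_index_tabloid:
  assumes "is_tableau \<mu> t" "(i, j) \<in> cells \<mu>" "sum_list \<mu> = n"
  shows "row_index n (tabloid_of \<mu> t) (t (i, j)) = i"
proof -
  have "t (i, j) \<in> {1..n}" using assms tableau_image[OF assms(1)] by blast
  moreover have "(THE k. t (i, j) \<in> tabloid_of \<mu> t k) = i"
  proof (rule the_equality)
    show m: "t (i, j) \<in> tabloid_of \<mu> t i" using assms(2) by (auto simp: mem_tabloid_of)
    show "k = i" if "t (i, j) \<in> tabloid_of \<mu> t k" for k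
      by (rule tabloid_rows_disjoint[OF assms(1) that m])
  qed
  ultimately show ?thesis by (simp add: row_index_def)
qed

lemma row_index_move:
  assumes "q permutes {1..n}"
  shows "row_index n (move q T) k = row_index n T (pinv q k)"
proof -
  have bq: "bij q" using assms permutes_bij by blast
  have qk: "q (pinv q k) = k" by (rule surj_f_inv_f[OF bij_is_surj[OF bq]])
  have "k \<in> q ` A \<longleftrightarrow> pinv q k \<in> A" for A
    using inj_image_mem_iff[OF bij_is_inj[OF bq], of "pinv q k" A] unfolding qk .
  moreover have "pinv q k \<in> {1..n} \<longleftrightarrow> k \<in> {1..n}" using permutes_in_image[OF permutes_inv[OF assms]] .
  ultimately show ?thesis by (simp add: row_index_def)
qed

text \<open>The largest entry whose row changes cannot move down, since the entries below it in its column are larger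
and keep their rows.\<close>

lemma tabloid_key_decreases:
  assumes part: "is_partition \<mu> n" and t: "is_tableau \<mu> t"
    and incr: "\<And>i j k. i < k \<Longrightarrow> (k, j) \<in> cells \<mu> \<Longrightarrow> t (i, j) < t (k, j)"
    and q: "q \<in> column_stabilizer \<mu> t" "q \<noteq> id"
  shows "tabloid_key n (move q (tabloid_of \<mu> t)) < tabloid_key n (tabloid_of \<mu> t)"
proof -
  have n: "sum_list \<mu> = n" by (rule is_partition_sum[OF part])
  define p where "p = pinv q"
  have pQ: "p \<in> column_stabilizer \<mu> t" unfolding p_def by (rule column_stabilizer_inv[OF q(1)])
  have pp: "p permutes {1..n}" and qp: "q permutes {1..n}"
    using column_stabilizer_permutes pQ q(1) n by blast+
  have "p \<noteq> id"
  proof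
    assume "p = id"
    then have "pinv (pinv q) = pinv id" by (simp add: p_def)
    then show False using q(2) column_stabilizer_bij[OF q(1)] by (simp add: inv_inv_eq inv_id)
  qed
  then obtain x where x: "p x \<noteq> x" by (auto simp: fun_eq_iff)
  have moved: "y \<in> {1..n}" if "p y \<noteq> y" for y using that permutes_not_in[OF pp] by blast
  define k where "k = Max {y. p y \<noteq> y}"
  have fin: "finite {y. p y \<noteq> y}" by (rule finite_subset[of _ "{1..n}"]) (use moved in auto)
  have k: "p k \<noteq> k" using Max_in[OF fin] x unfolding k_def by blast
  have above: "p y = y" if "k < y" for y using Max_ge[OF fin, of y] that unfolding k_def by fastforce
  have "p k < k"
  proof (rule ccontr)
    assume "\<not> p k < k"
    then have "p (p k) = p k" using above k by simp
    then show False using k column_stabilizer_bij[OF pQ] by (metis bij_is_inj injD)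
  qed
  have "k \<in> t ` cells \<mu>" using moved[OF k] tableau_image[OF t] n by simp
  then obtain i j where ij: "(i, j) \<in> cells \<mu>" "k = t (i, j)" by (metis imageE surj_pair)
  have "k \<in> column \<mu> t j" using ij by (auto simp: mem_column)
  then have "p k \<in> p ` column \<mu> t j" by (rule imageI)
  then have "p k \<in> column \<mu> t j" using pQ by (simp add: column_stabilizer_iff)
  then obtain i' where i': "(i', j) \<in> cells \<mu>" "p k = t (i', j)" by (auto simp: mem_column)
  have "i' < i"
  proof (rule ccontr)
    assume "\<not> i' < i"
    then have "i' = i \<or> t (i, j) < t (i', j)" using incr[of i i' j] i'(1) by (cases "i' = i") auto
    then show False using \<open>p k < k\<close> i' ij by auto
  qed
  let ?T = "tabloid_of \<mu> t"
  show ?thesis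
    unfolding tabloid_key_def
  proof (rule digits_less[where k = k])
    show "k \<le> n" using moved[OF k] by simp
    show "row_index n (move q ?T) k < row_index n ?T k"
      unfolding row_index_move[OF qp] p_def[symmetric] i'(2)
      unfolding ij(2) row_index_tabloid[OF t i'(1) n] row_index_tabloid[OF t ij(1) n] by (rule \<open>i' < i\<close>)
    show "row_index n (move q ?T) y = row_index n ?T y" if "k < y" for y
      unfolding row_index_move[OF qp] p_def[symmetric] above[OF that] ..
    fix y
    show "row_index n (move q ?T) y \<le> n"
    proof (cases "p y \<in> {1..n}")
      case True
      then have "p y \<in> t ` cells \<mu>" using tableau_image[OF t] n by simp
      then obtain a b where ab: "(a, b) \<in> cells \<mu>" "p y = t (a, b)" by (metis imageE surj_pair)
      have "a < length \<mu>" using ab by (simp add: cells_def)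
      then have "a \<le> n" using length_le_sum_list[of \<mu>] part by (auto simp: is_partition_def)
      then show ?thesis unfolding row_index_move[OF qp] p_def[symmetric] ab(2) row_index_tabloid[OF t ab(1) n] .
    next
      case False
      then have "row_index n ?T (p y) = 0" unfolding row_index_def by (rule if_not_P)
      then show ?thesis unfolding row_index_move[OF qp] p_def[symmetric] by simp
    qed
  qed
qed

lemma syt_tableau:
  assumes "is_partition \<mu> n" "t \<in> syt n (part \<mu>)"
  shows "is_tableau \<mu> t" "\<And>i j k. i < k \<Longrightarrow> (k, j) \<in> cells \<mu> \<Longrightarrow> t (i, j) < t (k, j)"
  using syt_properties(1,3)[OF part_diagram(1)[OF assms(1)] assms(2)] is_partition_sum[OF assms(1)]
  by (simp_all add: is_tableau_def cells_part)

lemma tabloid_of_row: "tabloid_of \<mu> t i = (\<lambda>j. t (i, j)) ` {..<part \<mu> i}"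
  by (auto simp: mem_tabloid_of cells_part young_cells_def)

lemma syt_tabloid_injective:
  assumes "is_partition \<mu> n" "t \<in> syt n (part \<mu>)" "t' \<in> syt n (part \<mu>)" "tabloid_of \<mu> t = tabloid_of \<mu> t'"
  shows "t = t'"
  by (rule syt_row_injective[OF part_diagram(1)[OF assms(1)] assms(2,3)])
     (use fun_cong[OF assms(4)] in \<open>simp add: tabloid_of_row\<close>)

text \<open>The tabloid of \<open>t\<close> is the leading term of its polytabloid with respect to the key, and different standard
tableaux have different tabloids.\<close>

lemma standard_polytabloids_independent:
  assumes part: "is_partition \<mu> n"
    and zero: "(\<Sum>t\<in>syt n (part \<mu>). scale_tabloids (a t) (polytabloid \<mu> t)) = 0"
    and "t \<in> syt n (part \<mu>)"
  shows "a t = 0"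
proof (rule ccontr)
  assume "a t \<noteq> 0"
  let ?S = "syt n (part \<mu>)" and ?k = "\<lambda>t. tabloid_key n (tabloid_of \<mu> t)"
  have fin: "finite ?S" using card_syt[OF part_diagram(1)[OF part]] by blast
  define A where "A = {t \<in> ?S. a t \<noteq> 0}"
  have A: "finite A" "A \<noteq> {}" using fin assms(3) \<open>a t \<noteq> 0\<close> by (auto simp: A_def)
  have "Max (?k ` A) \<in> ?k ` A" using A by (intro Max_in) auto
  then obtain s where s: "s \<in> A" "?k s = Max (?k ` A)" by auto
  have max: "?k u \<le> ?k s" if "u \<in> A" for u using s(2) Max_ge[of "?k ` A" "?k u"] A that by simp
  have sS: "s \<in> ?S" "a s \<noteq> 0" using s by (auto simp: A_def)
  note tab = syt_tableau[OF part]
  have other: "a u * Poly_Mapping.lookup (polytabloid \<mu> u) (tabloid_of \<mu> s) = 0" if u: "u \<in> ?S - {s}" for u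
  proof (rule ccontr)
    assume nz: "a u * Poly_Mapping.lookup (polytabloid \<mu> u) (tabloid_of \<mu> s) \<noteq> 0"
    then have uA: "u \<in> A" using u by (auto simp: A_def)
    have "Poly_Mapping.lookup (polytabloid \<mu> u) (tabloid_of \<mu> s) \<noteq> 0" using nz by auto
    then have "\<exists>q\<in>column_stabilizer \<mu> u. Poly_Mapping.lookup (Poly_Mapping.single (move q (tabloid_of \<mu> u)) (csign q)) (tabloid_of \<mu> s) \<noteq> 0"
      unfolding polytabloid_def tabloid_of_comp lookup_sum by (meson sum.not_neutral_contains_not_neutral)
    then obtain q where q: "q \<in> column_stabilizer \<mu> u" "move q (tabloid_of \<mu> u) = tabloid_of \<mu> s"
      by (auto simp: lookup_single when_def split: if_splits)
    show False
    proof (cases "q = id")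
      case True
      then have "tabloid_of \<mu> u = tabloid_of \<mu> s" using q(2) by simp
      then show False using syt_tabloid_injective[OF part, of u s] u sS(1) by blast
    next
      case False
      have "?k s < ?k u"
        using tabloid_key_decreases[OF part tab(1) tab(2) q(1) False] u unfolding q(2) by blast
      then show False using max[OF uA] by simp
    qed
  qed
  have "0 = Poly_Mapping.lookup (\<Sum>t\<in>?S. scale_tabloids (a t) (polytabloid \<mu> t)) (tabloid_of \<mu> s)"
    by (simp add: zero)
  also have "\<dots> = (\<Sum>u\<in>?S. a u * Poly_Mapping.lookup (polytabloid \<mu> u) (tabloid_of \<mu> s))"
    by (simp add: lookup_sum)
  also have "\<dots> = a s * Poly_Mapping.lookup (polytabloid \<mu> s) (tabloid_of \<mu> s)"
  proof -
    have "(\<Sum>u\<in>?S - {s}. a u * Poly_Mapping.lookup (polytabloid \<mu> u) (tabloid_of \<mu> s)) = 0"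
      by (rule sum.neutral) (use other in blast)
    then show ?thesis unfolding sum.remove[OF fin sS(1)] by simp
  qed
  also have "\<dots> = a s" using lookup_polytabloid_self[OF tab(1)[OF sS(1)]] by simp
  finally show False using sS(2) by simp
qed

section \<open>Decomposition of the harmonic functions\<close>

definition shapes :: "nat \<Rightarrow> nat \<Rightarrow> nat list set" where
  "shapes a d = {\<mu> \<in> even_partitions a. hd \<mu> + 2 * d = 2 * a}"

lemma even_partitions_hd:
  assumes "a > 0" "\<mu> \<in> even_partitions a"
  shows "\<mu> \<noteq> []" "hd \<mu> + 2 * ((2 * a - hd \<mu>) div 2) = 2 * a" "(2 * a - hd \<mu>) div 2 \<le> a"
proof -
  have p: "is_partition \<mu> (2 * a)" "\<forall>p\<in>set \<mu>. even p" using assms(2) by (auto simp: even_partitions_def)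
  show ne: "\<mu> \<noteq> []" using p assms(1) by (auto simp: is_partition_def)
  have "hd \<mu> \<le> 2 * a" using ne p(1) member_le_sum_list[of "hd \<mu>" \<mu>] by (simp add: is_partition_def)
  moreover have "even (hd \<mu>)" using ne p(2) by simp
  ultimately show "hd \<mu> + 2 * ((2 * a - hd \<mu>) div 2) = 2 * a" by presburger
  show "(2 * a - hd \<mu>) div 2 \<le> a" by simp
qed

lemma shapes_iff: "a > 0 \<Longrightarrow> \<mu> \<in> shapes a d \<longleftrightarrow> \<mu> \<in> even_partitions a \<and> (2 * a - hd \<mu>) div 2 = d"
  using even_partitions_hd(2)[of a \<mu>] by (auto simp: shapes_def)

lemma finite_shapes [simp]: "finite (shapes a d)"
  by (simp add: shapes_def finite_even_partitions)

lemma sum_shapes: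
  assumes "a > 0"
  shows "(\<Sum>d\<le>a. \<Sum>\<mu>\<in>shapes a d. f \<mu>) = (\<Sum>\<mu>\<in>even_partitions a. f \<mu>)"
proof -
  have "shapes a d = {\<mu> \<in> even_partitions a. (2 * a - hd \<mu>) div 2 = d}" for d
    using shapes_iff[OF assms] by blast
  then show ?thesis
    using sum.group[OF finite_even_partitions finite_atMost, of "\<lambda>\<mu>. (2 * a - hd \<mu>) div 2" a a f] 
      even_partitions_hd(3)[OF assms] by (simp add: image_subset_iff)
qed

lemma spread_sum: "spread (\<lambda>M. \<Sum>k\<in>K. f k M) P = (\<Sum>k\<in>K. spread (f k) P)"
  unfolding spread_def by (rule sum.swap)

lemma spread_diff: "spread (\<lambda>M. g M - h M) P = spread g P - spread h P"
  unfolding spread_def by (rule sum_subtractf)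

lemma spread_scale: "spread (\<lambda>M. c * h M) P = c * spread h P"
  unfolding spread_def by (rule sum_distrib_left[symmetric])

lemma row_pairings_shapes_harmonics:
  assumes "a > 0" "\<And>\<mu>. \<mu> \<in> shapes a d \<Longrightarrow> x \<mu> \<in> carrier (specht \<mu>)"
  shows "(\<lambda>M. \<Sum>\<mu>\<in>shapes a d. row_pairings (x \<mu>) M) \<in> harmonics {1..2 * a} d"
proof (rule harmonics_sum)
  fix \<mu> assume mu: "\<mu> \<in> shapes a d"
  then have "\<mu> \<in> even_partitions a" "2 * a = hd \<mu> + 2 * d" by (auto simp: shapes_def)
  then show "row_pairings (x \<mu>) \<in> harmonics {1..2 * a} d"
    using even_partitions_hd(1)[OF assms(1)] assms(2)[OF mu]
    by (intro row_pairings_specht_harmonics[of \<mu>]) (auto simp: even_partitions_def)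
qed

lemma specht_scale_closed: "v \<in> carrier (specht \<mu>) \<Longrightarrow> scale_tabloids c v \<in> carrier (specht \<mu>)"
  unfolding specht_carrier by (rule tabloid_space.span_scale)

lemma specht_add_closed: "u \<in> carrier (specht \<mu>) \<Longrightarrow> v \<in> carrier (specht \<mu>) \<Longrightarrow> u + v \<in> carrier (specht \<mu>)"
  unfolding specht_carrier by (rule tabloid_space.span_add)

lemma specht_0_closed: "0 \<in> carrier (specht \<mu>)"
  unfolding specht_carrier by (rule tabloid_space.span_zero)

lemma specht_sum_closed: "(\<And>k. k \<in> K \<Longrightarrow> f k \<in> carrier (specht \<mu>)) \<Longrightarrow> sum f K \<in> carrier (specht \<mu>)"
  unfolding specht_carrier by (rule tabloid_space.span_sum)

lemma harmonics_diff: "g \<in> harmonics X d \<Longrightarrow> h \<in> harmonics X d \<Longrightarrow> (\<lambda>M. g M - h M) \<in> harmonics X d"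
  by (auto simp: harmonics_def harmonic_def sum_subtractf)

abbreviation standard_combination :: "nat \<Rightarrow> (nat list \<times> (nat \<times> nat \<Rightarrow> nat) \<Rightarrow> complex) \<Rightarrow> nat list \<Rightarrow> tabloid \<Rightarrow>\<^sub>0 complex" where
  "standard_combination n \<alpha> \<mu> \<equiv> (\<Sum>t\<in>syt n (part \<mu>). scale_tabloids (\<alpha> (\<mu>, t)) (polytabloid \<mu> t))"

lemma standard_combination_specht:
  "is_partition \<mu> n \<Longrightarrow> standard_combination n \<alpha> \<mu> \<in> carrier (specht \<mu>)"
  by (intro specht_sum_closed specht_scale_closed polytabloid_in_specht syt_tableau(1))

lemma sum_spread_standard:
  assumes "a > 0"
  shows "(\<Sum>(\<mu>, t)\<in>(SIGMA \<mu>:even_partitions a. syt (2 * a) (part \<mu>)). \<alpha> (\<mu>, t) * spread (row_pairings (polytabloid \<mu> t)) P) =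
    (\<Sum>d\<le>a. spread (\<lambda>M. \<Sum>\<mu>\<in>shapes a d. row_pairings (standard_combination (2 * a) \<alpha> \<mu>) M) P)"
proof -
  have fin: "finite (syt (2 * a) (part \<mu>))" if "\<mu> \<in> even_partitions a" for \<mu>
    using that card_syt[OF part_diagram(1)] by (auto simp: even_partitions_def)
  have "(\<Sum>d\<le>a. spread (\<lambda>M. \<Sum>\<mu>\<in>shapes a d. row_pairings (standard_combination (2 * a) \<alpha> \<mu>) M) P) =
     (\<Sum>d\<le>a. \<Sum>\<mu>\<in>shapes a d. spread (row_pairings (standard_combination (2 * a) \<alpha> \<mu>)) P)"
    by (simp only: spread_sum)
  also have "\<dots> = (\<Sum>\<mu>\<in>even_partitions a. spread (row_pairings (standard_combination (2 * a) \<alpha> \<mu>)) P)"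
    by (rule sum_shapes[OF assms])
  also have "\<dots> = (\<Sum>\<mu>\<in>even_partitions a. \<Sum>t\<in>syt (2 * a) (part \<mu>). \<alpha> (\<mu>, t) * spread (row_pairings (polytabloid \<mu> t)) P)"
  proof (rule sum.cong[OF refl])
    fix \<mu>
    have "row_pairings (standard_combination (2 * a) \<alpha> \<mu>) =
       (\<lambda>M. \<Sum>t\<in>syt (2 * a) (part \<mu>). \<alpha> (\<mu>, t) * row_pairings (polytabloid \<mu> t) M)"
      by (simp add: fun_eq_iff row_pairings_sum row_pairings_scale)
    then show "spread (row_pairings (standard_combination (2 * a) \<alpha> \<mu>)) P =
       (\<Sum>t\<in>syt (2 * a) (part \<mu>). \<alpha> (\<mu>, t) * spread (row_pairings (polytabloid \<mu> t)) P)"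
      by (simp only: spread_sum spread_scale)
  qed
  also have "\<dots> = (\<Sum>(\<mu>, t)\<in>(SIGMA \<mu>:even_partitions a. syt (2 * a) (part \<mu>)). \<alpha> (\<mu>, t) * spread (row_pairings (polytabloid \<mu> t)) P)"
    by (rule sum.Sigma) (use finite_even_partitions fin in auto)
  finally show ?thesis by simp
qed

text \<open>Both numbers satisfy the recursion of the double factorial.\<close>

lemma card_standard_even:
  "card (SIGMA \<mu>:even_partitions a. syt (2 * a) (part \<mu>)) = card (perfect_matchings {1..2 * a})"
proof -
  have "card (SIGMA \<mu>:even_partitions a. syt (2 * a) (part \<mu>)) = (\<Sum>\<mu>\<in>even_partitions a. card (syt (2 * a) (part \<mu>)))"
    by (rule card_SigmaI) (use finite_even_partitions card_syt[OF part_diagram(1)] in \<open>auto simp: even_partitions_def\<close>)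
  also have "\<dots> = (\<Sum>\<mu>\<in>even_partitions a. num_syt (2 * a) (part \<mu>))"
    by (rule sum.cong) (use card_syt[OF part_diagram(1)] in \<open>auto simp: even_partitions_def\<close>)
  also have "\<dots> = (\<Sum>p\<in>even_diagrams a. num_syt (2 * a) p)"
    unfolding even_diagrams_eq
    by (rule sum.reindex_cong[symmetric, OF _ refl refl])
       (rule inj_on_subset[OF inj_on_part[of "2 * a"]], auto simp: even_partitions_def)
  also have "\<dots> = card (perfect_matchings {1..2 * a})"
    by (simp only: sum_even_diagrams card_perfect_matchings finite_atLeastAtMost card_atLeastAtMost diff_Suc_1)
  finally show ?thesis .
qed

text \<open>A relation among the spreads is a relation in each degree, because \<open>spread\<close> is injective on harmonic functions;
then a relation in each Specht module; then a relation among standard polytabloids.\<close>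

lemma standard_spreads_independent:
  assumes a: "a > 0"
    and zero: "\<And>P. P \<in> perfect_matchings {1..2 * a} \<Longrightarrow>
      (\<Sum>(\<mu>, t)\<in>(SIGMA \<mu>:even_partitions a. syt (2 * a) (part \<mu>)). \<alpha> (\<mu>, t) * spread (row_pairings (polytabloid \<mu> t)) P) = 0"
    and "\<mu> \<in> even_partitions a" "t \<in> syt (2 * a) (part \<mu>)"
  shows "\<alpha> (\<mu>, t) = 0"
proof -
  let ?x = "standard_combination (2 * a) \<alpha>"
  have part: "is_partition \<nu> (2 * a)" "\<forall>p\<in>set \<nu>. even p" if "\<nu> \<in> shapes a d" for \<nu> d
    using that by (auto simp: shapes_def even_partitions_def)
  have x: "?x \<nu> \<in> carrier (specht \<nu>)" if "\<nu> \<in> shapes a d" for \<nu> d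
    by (rule standard_combination_specht[OF part(1)[OF that]])
  obtain d where d: "d \<le> a" "\<mu> \<in> shapes a d"
    using shapes_iff[OF a] even_partitions_hd(3)[OF a assms(3)] assms(3) by blast
  have h0: "(\<Sum>\<nu>\<in>shapes a d. row_pairings (?x \<nu>) M) = 0" for M
  proof (rule graded_harmonics_spread_injective[where h = "\<lambda>d M. \<Sum>\<nu>\<in>shapes a d. row_pairings (?x \<nu>) M" and X = "{1..2 * a}" and D = a])
    show "(\<lambda>M. \<Sum>\<nu>\<in>shapes a e. row_pairings (?x \<nu>) M) \<in> harmonics {1..2 * a} e" for e
      by (rule row_pairings_shapes_harmonics[OF a x])
    show "(\<Sum>e\<le>a. spread (\<lambda>M. \<Sum>\<nu>\<in>shapes a e. row_pairings (?x \<nu>) M) P) = 0" if "P \<in> perfect_matchings {1..2 * a}" for P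
      using zero[OF that] sum_spread_standard[OF a, of \<alpha> P] by simp
  qed (use d in auto)
  have "?x \<mu> = 0"
    by (rule sum_row_pairings_eq_0[OF finite_shapes _ x h0 d(2)]) (use part in blast)
  then show ?thesis
    by (rule standard_polytabloids_independent[OF part(1)[OF d(2)], of "\<lambda>t. \<alpha> (\<mu>, t)", OF _ assms(4)])
qed

text \<open>The spreads of the images of the standard polytabloids of all even shapes are independent and as many as the
perfect matchings, so they span. The spread of \<open>h\<close> is therefore the spread of a combination of such images,
and the injectivity of \<open>spread\<close> transports this equality back, degree by degree.\<close>

theorem harmonics_eq_specht_sum:
  assumes a: "a > 0" and h: "h \<in> harmonics {1..2 * a} d"
  shows "\<exists>x. (\<forall>\<mu>\<in>shapes a d. x \<mu> \<in> carrier (specht \<mu>)) \<and> (\<forall>M. h M = (\<Sum>\<mu>\<in>shapes a d. row_pairings (x \<mu>) M))"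
proof (cases "d \<le> a")
  case False
  have "h M = 0" for M
  proof -
    have "M \<notin> matchings {1..2 * a} d"
    proof
      assume M: "M \<in> matchings {1..2 * a} d"
      have "2 * d \<le> card {1..2 * a}"
        unfolding card_Union_matching[OF M, symmetric] by (rule card_mono[OF _ matchings_Union_subset[OF M]]) simp
      then show False using False by simp
    qed
    then show ?thesis using h by (simp add: harmonics_def)
  qed
  moreover have "shapes a d = {}" using False by (auto simp: shapes_def)
  ultimately show ?thesis by simp
next
  case True
  let ?X = "{1..2 * a}"
  let ?I = "SIGMA \<mu>:even_partitions a. syt (2 * a) (part \<mu>)"
  let ?A = "\<lambda>(\<mu>, t). spread (row_pairings (polytabloid \<mu> t))"
  have finI: "finite ?I"
    using finite_even_partitions card_syt[OF part_diagram(1)] by (auto simp: even_partitions_def)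
  have split: "(\<Sum>i\<in>?I. \<alpha> i * ?A i P) = (\<Sum>(\<mu>, t)\<in>?I. \<alpha> (\<mu>, t) * spread (row_pairings (polytabloid \<mu> t)) P)" for \<alpha> P
    by (rule sum.cong) auto
  have "\<exists>\<alpha>. \<forall>P\<in>perfect_matchings ?X. spread h P = (\<Sum>i\<in>?I. \<alpha> i * ?A i P)"
  proof (rule independent_family_spans[OF _ finI])
    show "card (perfect_matchings ?X) \<le> card ?I" unfolding card_standard_even ..
    fix \<alpha> assume "\<forall>P\<in>perfect_matchings ?X. (\<Sum>i\<in>?I. \<alpha> i * ?A i P) = 0"
    then show "\<forall>i\<in>?I. \<alpha> i = 0" unfolding split using standard_spreads_independent[OF a, of \<alpha>] by blast
  qed simp
  then obtain \<alpha> where \<alpha>: "\<And>P. P \<in> perfect_matchings ?X \<Longrightarrow> spread h P = (\<Sum>i\<in>?I. \<alpha> i * ?A i P)" by blast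
  let ?x = "standard_combination (2 * a) \<alpha>"
  let ?g = "\<lambda>e M. \<Sum>\<nu>\<in>shapes a e. row_pairings (?x \<nu>) M"
  have x: "?x \<nu> \<in> carrier (specht \<nu>)" if "\<nu> \<in> shapes a e" for \<nu> e
    using that by (intro standard_combination_specht) (auto simp: shapes_def even_partitions_def)
  let ?k = "\<lambda>e M. (if e = d then h M else 0) - ?g e M"
  have "?k d M = 0" for M
  proof (rule graded_harmonics_spread_injective[where h = ?k and X = ?X and D = a])
    show "?k e \<in> harmonics ?X e" for e
    proof (rule harmonics_diff)
      show "(\<lambda>M. if e = d then h M else 0) \<in> harmonics ?X e" using h harmonics_0 by (cases "e = d") auto
      show "?g e \<in> harmonics ?X e" by (rule row_pairings_shapes_harmonics[OF a x])
    qed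
    show "(\<Sum>e\<le>a. spread (?k e) P) = 0" if P: "P \<in> perfect_matchings ?X" for P
    proof -
      have "spread (\<lambda>M. if e = d then h M else 0) P = (if e = d then spread h P else 0)" for e
        by (simp add: spread_def)
      then have "(\<Sum>e\<le>a. spread (?k e) P) = (\<Sum>e\<le>a. if e = d then spread h P else 0) - (\<Sum>e\<le>a. spread (?g e) P)"
        by (simp only: spread_diff sum_subtractf)
      also have "(\<Sum>e\<le>a. if e = d then spread h P else 0) = spread h P" using True by simp
      also have "(\<Sum>e\<le>a. spread (?g e) P) = spread h P"
        unfolding \<alpha>[OF P] split sum_spread_standard[OF a] ..
      finally show ?thesis by simp
    qed
  qed (use True in auto)
  then have "\<forall>M. h M = ?g d M" by simp
  then show ?thesis using x by (intro exI[of _ ?x]) blast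
qed

section \<open>Multiplicities of Specht modules\<close>

definition is_module_iso :: "nat \<Rightarrow> ('b \<Rightarrow> 'c) \<Rightarrow> 'b sym_module \<Rightarrow> 'c sym_module \<Rightarrow> bool" where
  "is_module_iso n \<phi> V W \<longleftrightarrow> bij_betw \<phi> (carrier V) (carrier W) \<and>
     (\<forall>x\<in>carrier V. \<forall>y\<in>carrier V. \<phi> (x \<oplus>\<^bsub>V\<^esub> y) = \<phi> x \<oplus>\<^bsub>W\<^esub> \<phi> y) \<and>
     (\<forall>c. \<forall>x\<in>carrier V. \<phi> (c \<odot>\<^bsub>V\<^esub> x) = c \<odot>\<^bsub>W\<^esub> \<phi> x) \<and>
     (\<forall>w. w permutes {1..n} \<longrightarrow> (\<forall>x\<in>carrier V. \<phi> (act V w x) = act W w (\<phi> x)))"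

lemma sym_module_iso_alt: "sym_module_iso n V W \<longleftrightarrow> (\<exists>\<phi>. is_module_iso n \<phi> V W)"
  by (simp add: sym_module_iso_def is_module_iso_def)

definition closed_module :: "nat \<Rightarrow> 'b sym_module \<Rightarrow> bool" where
  "closed_module n V \<longleftrightarrow> (\<forall>x\<in>carrier V. \<forall>y\<in>carrier V. x \<oplus>\<^bsub>V\<^esub> y \<in> carrier V) \<and>
     (\<forall>c. \<forall>x\<in>carrier V. c \<odot>\<^bsub>V\<^esub> x \<in> carrier V) \<and>
     (\<forall>w. w permutes {1..n} \<longrightarrow> (\<forall>x\<in>carrier V. act V w x \<in> carrier V))"

lemma is_module_iso_inverse:
  assumes iso: "is_module_iso n \<phi> V W" and cl: "closed_module n V"
  shows "is_module_iso n (inv_into (carrier V) \<phi>) W V"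
proof -
  let ?\<psi> = "inv_into (carrier V) \<phi>"
  have bij: "bij_betw \<phi> (carrier V) (carrier W)" using iso by (simp add: is_module_iso_def)
  have inv: "?\<psi> (\<phi> a) = a" if "a \<in> carrier V" for a using bij_betw_inv_into_left[OF bij that] .
  have ex: "\<exists>a\<in>carrier V. x = \<phi> a" if "x \<in> carrier W" for x using bij that by (auto simp: bij_betw_def)
  have "?\<psi> (x \<oplus>\<^bsub>W\<^esub> y) = ?\<psi> x \<oplus>\<^bsub>V\<^esub> ?\<psi> y" if xy: "x \<in> carrier W" "y \<in> carrier W" for x y
  proof -
    obtain a b where ab: "a \<in> carrier V" "x = \<phi> a" "b \<in> carrier V" "y = \<phi> b" using ex xy by blast
    have "x \<oplus>\<^bsub>W\<^esub> y = \<phi> (a \<oplus>\<^bsub>V\<^esub> b)" using iso ab by (simp add: is_module_iso_def)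
    moreover have "a \<oplus>\<^bsub>V\<^esub> b \<in> carrier V" using cl ab by (simp add: closed_module_def)
    ultimately show ?thesis using inv ab by simp
  qed
  moreover have "?\<psi> (c \<odot>\<^bsub>W\<^esub> x) = c \<odot>\<^bsub>V\<^esub> ?\<psi> x" if x: "x \<in> carrier W" for c x
  proof -
    obtain a where a: "a \<in> carrier V" "x = \<phi> a" using ex x by blast
    have "c \<odot>\<^bsub>W\<^esub> x = \<phi> (c \<odot>\<^bsub>V\<^esub> a)" using iso a by (simp add: is_module_iso_def)
    moreover have "c \<odot>\<^bsub>V\<^esub> a \<in> carrier V" using cl a by (simp add: closed_module_def)
    ultimately show ?thesis using inv a by simp
  qed
  moreover have "?\<psi> (act W w x) = act V w (?\<psi> x)" if w: "w permutes {1..n}" and x: "x \<in> carrier W" for w x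
  proof -
    obtain a where a: "a \<in> carrier V" "x = \<phi> a" using ex x by blast
    have "act W w x = \<phi> (act V w a)" using iso a w by (simp add: is_module_iso_def)
    moreover have "act V w a \<in> carrier V" using cl a w by (simp add: closed_module_def)
    ultimately show ?thesis using inv a by simp
  qed
  ultimately show ?thesis using bij_betw_inv_into[OF bij] by (simp add: is_module_iso_def)
qed

lemma is_module_iso_trans:
  assumes "is_module_iso n \<phi> V W" "is_module_iso n \<psi> W U"
  shows "is_module_iso n (\<psi> \<circ> \<phi>) V U"
proof -
  have "\<phi> x \<in> carrier W" if "x \<in> carrier V" for x
    using assms(1) that by (auto simp: is_module_iso_def bij_betw_def)
  then show ?thesis using assms bij_betw_trans[of \<phi> "carrier V" "carrier W" \<psi> "carrier U"]
    by (simp add: is_module_iso_def)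
qed

definition specht_sum :: "nat \<Rightarrow> (nat list \<Rightarrow> nat) \<Rightarrow> (nat list \<times> nat \<Rightarrow> tabloid \<Rightarrow>\<^sub>0 complex) sym_module" where
  "specht_sum n c = direct_sum {(\<mu>, k). is_partition \<mu> n \<and> k < c \<mu>} (\<lambda>(\<mu>, k). specht \<mu>)"

definition specht_indices :: "nat \<Rightarrow> (nat list \<Rightarrow> nat) \<Rightarrow> (nat list \<times> nat) set" where
  "specht_indices n c = {(\<mu>, k). is_partition \<mu> n \<and> k < c \<mu>}"

lemma specht_sum_simps:
  "carrier (specht_sum n c) = (\<Pi>\<^sub>E i\<in>specht_indices n c. carrier (specht (fst i)))"
  "x \<oplus>\<^bsub>specht_sum n c\<^esub> y = (\<lambda>i\<in>specht_indices n c. x i + y i)"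
  "a \<odot>\<^bsub>specht_sum n c\<^esub> x = (\<lambda>i\<in>specht_indices n c. scale_tabloids a (x i))"
  "act (specht_sum n c) w x = (\<lambda>i\<in>specht_indices n c. perm_tabloids w (x i))"
  by (auto simp: specht_sum_def specht_indices_def direct_sum_def specht_def case_prod_unfold restrict_def PiE_def)

lemma specht_act_closed:
  assumes "w permutes {1..sum_list \<mu>}" "v \<in> carrier (specht \<mu>)"
  shows "perm_tabloids w v \<in> carrier (specht \<mu>)"
  using assms(2) unfolding specht_carrier
proof (induction rule: tabloid_space.span_induct_alt)
  case base
  then show ?case by (simp add: tabloid_space.span_zero)
next
  case (step a u y)
  then obtain t where t: "is_tableau \<mu> t" "u = polytabloid \<mu> t" by blast
  have bw: "bij w" using assms(1) permutes_bij by blast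
  have "perm_tabloids w u \<in> carrier (specht \<mu>)"
    unfolding t(2) perm_polytabloid[OF assms(1)] by (rule polytabloid_in_specht[OF tableau_comp[OF t(1) assms(1)]])
  then show ?case using step(2)
    by (simp add: perm_tabloids_add[OF bw] perm_tabloids_scale[OF bw] specht_carrier tabloid_space.span_add tabloid_space.span_scale)
qed

lemma specht_indices_partition: "i \<in> specht_indices n c \<Longrightarrow> is_partition (fst i) n"
  by (auto simp: specht_indices_def)

lemma closed_specht_sum: "closed_module n (specht_sum n c)"
  unfolding closed_module_def specht_sum_simps
proof (intro conjI ballI allI impI)
  fix w x assume w: "w permutes {1..n}" and x: "x \<in> (\<Pi>\<^sub>E i\<in>specht_indices n c. carrier (specht (fst i)))"
  show "(\<lambda>i\<in>specht_indices n c. perm_tabloids w (x i)) \<in> (\<Pi>\<^sub>E i\<in>specht_indices n c. carrier (specht (fst i)))"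
  proof (rule restrict_PiE_iff[THEN iffD2], rule ballI)
    fix i assume i: "i \<in> specht_indices n c"
    show "perm_tabloids w (x i) \<in> carrier (specht (fst i))"
      by (rule specht_act_closed) (use w x i is_partition_sum[OF specht_indices_partition[OF i]] in auto)
  qed
qed (unfold restrict_PiE_iff, (blast intro: specht_add_closed specht_scale_closed dest: PiE_mem)+)

text \<open>The maps of sum modules preserve finite linear combinations, hence the action of column antisymmetrizers.\<close>

context
  fixes n :: nat and c c' :: "nat list \<Rightarrow> nat" and \<phi>
  assumes iso: "is_module_iso n \<phi> (specht_sum n c) (specht_sum n c')"
begin

private abbreviation "I \<equiv> specht_indices n c"
private abbreviation "I' \<equiv> specht_indices n c'"
private abbreviation "V \<equiv> carrier (specht_sum n c)"
private abbreviation "W \<equiv> carrier (specht_sum n c')"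

private lemma map_W: "x \<in> V \<Longrightarrow> \<phi> x \<in> W"
  using iso by (auto simp: is_module_iso_def bij_betw_def)

private lemma zero_V: "(\<lambda>i\<in>I. 0) \<in> V"
  by (auto simp: specht_sum_simps specht_0_closed)

private lemma map_add: "x \<in> V \<Longrightarrow> y \<in> V \<Longrightarrow> \<phi> (\<lambda>i\<in>I. x i + y i) = (\<lambda>i\<in>I'. \<phi> x i + \<phi> y i)"
  using iso by (simp add: is_module_iso_def specht_sum_simps)

private lemma map_scale: "x \<in> V \<Longrightarrow> \<phi> (\<lambda>i\<in>I. scale_tabloids a (x i)) = (\<lambda>i\<in>I'. scale_tabloids a (\<phi> x i))"
  using iso by (simp add: is_module_iso_def specht_sum_simps)

private lemma map_act: "w permutes {1..n} \<Longrightarrow> x \<in> V \<Longrightarrow> \<phi> (\<lambda>i\<in>I. perm_tabloids w (x i)) = (\<lambda>i\<in>I'. perm_tabloids w (\<phi> x i))"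
  using iso by (simp add: is_module_iso_def specht_sum_simps)

private lemma V_scale: "x \<in> V \<Longrightarrow> (\<lambda>i\<in>I. scale_tabloids a (x i)) \<in> V"
  using closed_specht_sum[of n c] by (simp add: closed_module_def specht_sum_simps(3))

private lemma V_act: "w permutes {1..n} \<Longrightarrow> x \<in> V \<Longrightarrow> (\<lambda>i\<in>I. perm_tabloids w (x i)) \<in> V"
  using closed_specht_sum[of n c] by (simp add: closed_module_def specht_sum_simps(4))

private lemma V_combination:
  "(\<And>k. k \<in> K \<Longrightarrow> x k \<in> V) \<Longrightarrow> (\<lambda>i\<in>I. \<Sum>k\<in>K. scale_tabloids (a k) (x k i)) \<in> V"
  by (auto simp: specht_sum_simps PiE_mem intro!: specht_sum_closed specht_scale_closed)

private lemma map_zero: "\<phi> (\<lambda>i\<in>I. 0) = (\<lambda>i\<in>I'. 0)"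
  using map_scale[OF zero_V, of 0] unfolding tabloid_space.scale_zero_left .

private lemma map_combination:
  assumes "finite K" "\<And>k. k \<in> K \<Longrightarrow> x k \<in> V"
  shows "\<phi> (\<lambda>i\<in>I. \<Sum>k\<in>K. scale_tabloids (a k) (x k i)) = (\<lambda>i\<in>I'. \<Sum>k\<in>K. scale_tabloids (a k) (\<phi> (x k) i))"
  using assms
proof (induction K rule: finite_induct)
  case empty
  show ?case unfolding sum.empty by (rule map_zero)
next
  case (insert k K)
  let ?r = "\<lambda>i\<in>I. \<Sum>k\<in>K. scale_tabloids (a k) (x k i)"
  have xk: "x k \<in> V" using insert.prems by simp
  have eq: "(\<lambda>i\<in>I. \<Sum>k\<in>insert k K. scale_tabloids (a k) (x k i)) = (\<lambda>i\<in>I. (\<lambda>i\<in>I. scale_tabloids (a k) (x k i)) i + ?r i)"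
    using insert.hyps by (auto simp: fun_eq_iff restrict_def)
  have xK: "\<And>l. l \<in> K \<Longrightarrow> x l \<in> V" using insert.prems by simp
  have "\<phi> (\<lambda>i\<in>I. \<Sum>k\<in>insert k K. scale_tabloids (a k) (x k i)) =
      (\<lambda>i\<in>I'. \<phi> (\<lambda>i\<in>I. scale_tabloids (a k) (x k i)) i + \<phi> ?r i)"
    unfolding eq by (rule map_add[OF V_scale[OF xk] V_combination[OF xK]])
  also have "\<dots> = (\<lambda>i\<in>I'. \<Sum>k\<in>insert k K. scale_tabloids (a k) (\<phi> (x k) i))"
    using map_scale[OF xk, of "a k"] insert.IH[OF xK] by (intro restrict_ext) (simp only: restrict_apply' sum.insert[OF insert.hyps(1,2)])
  finally show ?case .
qed

private lemma map_column_antisym: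
  assumes "is_partition \<mu> n" "x \<in> V"
  shows "\<phi> (\<lambda>i\<in>I. column_antisym \<mu> t (x i)) = (\<lambda>i\<in>I'. column_antisym \<mu> t (\<phi> x i))"
proof -
  let ?Q = "column_stabilizer \<mu> t"
  have perm: "q permutes {1..n}" if "q \<in> ?Q" for q
    using column_stabilizer_permutes[OF that] is_partition_sum[OF assms(1)] by simp
  have "(\<lambda>i\<in>I. column_antisym \<mu> t (x i)) = (\<lambda>i\<in>I. \<Sum>q\<in>?Q. scale_tabloids (csign q) ((\<lambda>i\<in>I. perm_tabloids q (x i)) i))"
    by (auto simp: fun_eq_iff restrict_def column_antisym_def)
  then have "\<phi> (\<lambda>i\<in>I. column_antisym \<mu> t (x i)) =
      (\<lambda>i\<in>I'. \<Sum>q\<in>?Q. scale_tabloids (csign q) (\<phi> (\<lambda>i\<in>I. perm_tabloids q (x i)) i))"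
    using map_combination[of ?Q "\<lambda>q. \<lambda>i\<in>I. perm_tabloids q (x i)" csign] V_act[OF perm assms(2)] by simp
  also have "\<dots> = (\<lambda>i\<in>I'. column_antisym \<mu> t (\<phi> x i))"
    using map_act[OF perm assms(2)] by (auto simp: fun_eq_iff restrict_def column_antisym_def intro!: sum.cong)
  finally show ?thesis .
qed

text \<open>Consider the elements on which the antisymmetrizer of a fixed \<open>\<mu>\<close>-tableau \<open>t\<close> acts as multiplication by the
order of the column stabilizer, while all antisymmetrizers of shapes \<open>\<nu> \<noteq> \<mu>\<close> with \<open>weight \<nu> \<le> weight \<mu>\<close> act as \<open>0\<close>. In
a sum of Specht modules they form the space spanned by the copies of the polytabloid of \<open>t\<close>, whose dimension
is the multiplicity of \<open>\<mu>\<close>. An injective homomorphism maps this space into the corresponding space.\<close>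

lemma specht_multiplicity_le:
  assumes part: "is_partition \<mu> n"
  shows "c \<mu> \<le> c' \<mu>"
proof (rule ccontr)
  assume "\<not> c \<mu> \<le> c' \<mu>"
  then have less: "card {..<c' \<mu>} < card {..<c \<mu>}" by simp
  obtain t where t: "is_tableau \<mu> t" using tableau_exists by blast
  let ?e = "polytabloid \<mu> t" and ?Q = "column_stabilizer \<mu> t"
  let ?N = "of_nat (card ?Q) :: complex"
  have N: "?N \<noteq> 0" using column_stabilizer_id[of \<mu> t] by (metis card_0_eq empty_iff finite_column_stabilizer of_nat_eq_0_iff)
  have eS: "?e \<in> carrier (specht \<mu>)" by (rule polytabloid_in_specht[OF t])
  (* The copies of the polytabloid; \<open>A\<close> below is the matrix of \<open>\<phi>\<close> on them. *)
  define b where "b = (\<lambda>k. \<lambda>i\<in>I. if i = (\<mu>, k) then ?e else 0)"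
  have bV: "b k \<in> V" for k
    using eS by (auto simp: b_def specht_sum_simps specht_0_closed)
  have e_anti: "column_antisym \<mu> t ?e = scale_tabloids ?N ?e"
    by (simp add: polytabloid_eq_antisym column_antisym_idem)
  have e_vanish: "column_antisym \<nu> s ?e = 0" if "is_partition \<nu> n" "is_tableau \<nu> s" "weight \<nu> \<le> weight \<mu>" "\<nu> \<noteq> \<mu>" for \<nu> s
    by (rule column_antisym_specht_eq_0[OF that(1) part that(2) eS that(3,4)])
  let ?y = "\<lambda>k. \<phi> (b k)"
  have yW: "?y k \<in> W" for k by (rule map_W[OF bV])
  have yS: "?y k i \<in> carrier (specht (fst i))" if "i \<in> I'" for k i
    using yW[of k] that by (auto simp: specht_sum_simps)
  have y_anti: "column_antisym \<mu> t (?y k i) = scale_tabloids ?N (?y k i)" if i: "i \<in> I'" for k i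
  proof -
    have eq: "(\<lambda>i\<in>I. column_antisym \<mu> t (b k i)) = (\<lambda>i\<in>I. scale_tabloids ?N (b k i))"
      by (auto simp: fun_eq_iff restrict_def b_def e_anti)
    have "(\<lambda>i\<in>I'. column_antisym \<mu> t (?y k i)) = (\<lambda>i\<in>I'. scale_tabloids ?N (?y k i))"
      unfolding map_column_antisym[OF part bV, symmetric] eq by (rule map_scale[OF bV])
    from fun_cong[OF this, of i] show ?thesis unfolding restrict_apply'[OF i] .
  qed
  have y_vanish: "column_antisym \<nu> s (?y k i) = 0"
    if i: "i \<in> I'" and nu: "is_partition \<nu> n" "is_tableau \<nu> s" "weight \<nu> \<le> weight \<mu>" "\<nu> \<noteq> \<mu>" for k i \<nu> s
  proof -
    have eq: "(\<lambda>i\<in>I. column_antisym \<nu> s (b k i)) = (\<lambda>i\<in>I. 0)"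
      by (auto simp: fun_eq_iff restrict_def b_def e_vanish[OF nu])
    have "(\<lambda>i\<in>I'. column_antisym \<nu> s (?y k i)) = (\<lambda>i\<in>I'. 0)"
      unfolding map_column_antisym[OF nu(1) bV, symmetric] eq by (rule map_zero)
    from fun_cong[OF this, of i] show ?thesis unfolding restrict_apply'[OF i] .
  qed
  have y_other: "?y k i = 0" if i: "i \<in> I'" and ne: "fst i \<noteq> \<mu>" for k i
  proof (cases "weight \<mu> \<le> weight (fst i)")
    case True
    have "column_antisym \<mu> t (?y k i) = 0"
      by (rule column_antisym_specht_eq_0[OF part specht_indices_partition[OF i] t yS[OF i] True]) (use ne in auto)
    then have "scale_tabloids ?N (?y k i) = 0" using y_anti[OF i] by simp
    then have "?N * Poly_Mapping.lookup (?y k i) T = 0" for T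
      by (metis lookup_scale_tabloids lookup_zero)
    then show ?thesis using N by (intro poly_mapping_eqI) simp
  next
    case False
    show ?thesis
      by (rule specht_eq_0[OF yS[OF i]]) (use y_vanish[OF i specht_indices_partition[OF i]] False ne in auto)
  qed
  define A where "A = (\<lambda>k k'. Poly_Mapping.lookup (?y k (\<mu>, k')) (tabloid_of \<mu> t))"
  have y_self: "?y k (\<mu>, k') = scale_tabloids (A k k') ?e" if k': "k' < c' \<mu>" for k k'
  proof -
    have i: "(\<mu>, k') \<in> I'" using k' part by (simp add: specht_indices_def)
    obtain d where "column_antisym \<mu> t (?y k (\<mu>, k')) = scale_tabloids d ?e"
      using column_antisym_specht[OF part t] yS[OF i] by auto
    then have Nd: "scale_tabloids ?N (?y k (\<mu>, k')) = scale_tabloids d ?e" using y_anti[OF i] by simp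
    have d: "?y k (\<mu>, k') = scale_tabloids (d / ?N) ?e"
    proof (rule poly_mapping_eqI)
      fix T
      have "?N * Poly_Mapping.lookup (?y k (\<mu>, k')) T = d * Poly_Mapping.lookup ?e T"
        using Nd by (metis lookup_scale_tabloids)
      then show "Poly_Mapping.lookup (?y k (\<mu>, k')) T = Poly_Mapping.lookup (scale_tabloids (d / ?N) ?e) T"
        using N by (simp add: field_simps)
    qed
    then have "A k k' = d / ?N" by (simp add: A_def lookup_polytabloid_self[OF t])
    then show ?thesis using d by simp
  qed
  obtain \<alpha> where \<alpha>: "\<exists>k\<in>{..<c \<mu>}. \<alpha> k \<noteq> 0" "\<forall>k'\<in>{..<c' \<mu>}. (\<Sum>k<c \<mu>. \<alpha> k * A k k') = 0"
    using nontrivial_relation[OF _ _ less, of A] by auto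
  let ?B = "\<lambda>i\<in>I. \<Sum>k<c \<mu>. scale_tabloids (\<alpha> k) (b k i)"
  have BV: "?B \<in> V" by (rule V_combination) (rule bV)
  have "\<phi> ?B = (\<lambda>i\<in>I'. \<Sum>k<c \<mu>. scale_tabloids (\<alpha> k) (?y k i))"
    by (rule map_combination) (auto simp: bV)
  also have "\<dots> = (\<lambda>i\<in>I'. 0)"
  proof (rule restrict_ext)
    fix i assume i: "i \<in> I'"
    show "(\<Sum>k<c \<mu>. scale_tabloids (\<alpha> k) (?y k i)) = 0"
    proof (cases "fst i = \<mu>")
      case False
      then show ?thesis using y_other[OF i] by simp
    next
      case True
      then obtain k' where k': "i = (\<mu>, k')" "k' < c' \<mu>" using i by (cases i) (auto simp: specht_indices_def)
      have "(\<Sum>k<c \<mu>. scale_tabloids (\<alpha> k) (?y k i)) = scale_tabloids (\<Sum>k<c \<mu>. \<alpha> k * A k k') ?e"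
        by (simp add: k'(1) y_self[OF k'(2)] tabloid_space.scale_sum_left)
      then show ?thesis using \<alpha>(2) k'(2) by simp
    qed
  qed
  finally have "\<phi> ?B = \<phi> (\<lambda>i\<in>I. 0)" using map_zero by simp
  moreover have "inj_on \<phi> V" using iso by (simp add: is_module_iso_def bij_betw_def)
  ultimately have B0: "?B = (\<lambda>i\<in>I. 0)" using BV zero_V by (simp add: inj_on_def)
  obtain k where k: "k < c \<mu>" "\<alpha> k \<noteq> 0" using \<alpha>(1) by auto
  then have i: "(\<mu>, k) \<in> I" using part by (simp add: specht_indices_def)
  have "0 = ?B (\<mu>, k)" unfolding B0 restrict_apply'[OF i] ..
  also have "\<dots> = (\<Sum>l<c \<mu>. scale_tabloids (\<alpha> l) (b l (\<mu>, k)))" by (rule restrict_apply'[OF i])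
  also have "\<dots> = (\<Sum>l<c \<mu>. if l = k then scale_tabloids (\<alpha> l) ?e else 0)"
    using i by (intro sum.cong) (auto simp: b_def)
  also have "\<dots> = scale_tabloids (\<alpha> k) ?e" using k(1) by simp
  finally have "Poly_Mapping.lookup (scale_tabloids (\<alpha> k) ?e) (tabloid_of \<mu> t) = 0" by (metis lookup_zero)
  then show False using k(2) lookup_polytabloid_self[OF t] by simp
qed

end

lemma Frob_eq:
  assumes "is_module_iso n \<phi> (specht_sum n c) V"
  shows "Frob n V = (\<Sum>\<mu> | is_partition \<mu> n. (\<lambda>\<alpha>. int (c \<mu>) * schur \<mu> \<alpha>))"
  unfolding Frob_def specht_sum_def[symmetric] sym_module_iso_alt
proof (rule the_equality)
  show "\<exists>d. (\<exists>\<phi>. is_module_iso n \<phi> V (specht_sum n d)) \<and>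
      (\<Sum>\<mu> | is_partition \<mu> n. (\<lambda>\<alpha>. int (c \<mu>) * schur \<mu> \<alpha>)) = (\<Sum>\<mu> | is_partition \<mu> n. (\<lambda>\<alpha>. int (d \<mu>) * schur \<mu> \<alpha>))"
    using is_module_iso_inverse[OF assms closed_specht_sum] by blast
next
  fix F assume "\<exists>d. (\<exists>\<phi>. is_module_iso n \<phi> V (specht_sum n d)) \<and>
      F = (\<Sum>\<mu> | is_partition \<mu> n. (\<lambda>\<alpha>. int (d \<mu>) * schur \<mu> \<alpha>))"
  then obtain d \<psi> where d: "is_module_iso n \<psi> V (specht_sum n d)"
      "F = (\<Sum>\<mu> | is_partition \<mu> n. (\<lambda>\<alpha>. int (d \<mu>) * schur \<mu> \<alpha>))" by blast
  note cd = is_module_iso_trans[OF assms d(1)]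
  note dc = is_module_iso_inverse[OF cd closed_specht_sum]
  have "d \<mu> = c \<mu>" if "is_partition \<mu> n" for \<mu>
    using specht_multiplicity_le[OF cd that] specht_multiplicity_le[OF dc that] by simp
  then show "F = (\<Sum>\<mu> | is_partition \<mu> n. (\<lambda>\<alpha>. int (c \<mu>) * schur \<mu> \<alpha>))"
    unfolding d(2) by (intro sum.cong) auto
qed

section \<open>Squarefree monomials and the ideal of relations\<close>

lemma pair_poly_ring_simps:
  "carrier (pair_poly_ring n) = {f. \<forall>m\<in>Poly_Mapping.keys f. Poly_Mapping.keys m \<subseteq> pairs n}"
  "f \<otimes>\<^bsub>pair_poly_ring n\<^esub> g = f * g" "f \<oplus>\<^bsub>pair_poly_ring n\<^esub> g = f + g"
  "\<zero>\<^bsub>pair_poly_ring n\<^esub> = 0" "\<one>\<^bsub>pair_poly_ring n\<^esub> = 1"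
  by (simp_all add: pair_poly_ring_def)

lemma ring_pair_poly_ring: "ring (pair_poly_ring n)"
  using cring_pair_poly_ring by (rule cring.axioms(1))

lemma a_inv_pair_poly_ring:
  assumes "f \<in> carrier (pair_poly_ring n)"
  shows "\<ominus>\<^bsub>pair_poly_ring n\<^esub> f = - f"
proof -
  interpret ring "pair_poly_ring n" by (rule ring_pair_poly_ring)
  have "- f \<in> carrier (pair_poly_ring n)" using assms by (simp add: pair_poly_ring_simps)
  then show ?thesis using assms by (intro minus_equality) (simp_all add: pair_poly_ring_simps)
qed

lemma pair_poly_ring_closed:
  "0 \<in> carrier (pair_poly_ring n)"
  "f \<in> carrier (pair_poly_ring n) \<Longrightarrow> g \<in> carrier (pair_poly_ring n) \<Longrightarrow> f + g \<in> carrier (pair_poly_ring n)"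
  "f \<in> carrier (pair_poly_ring n) \<Longrightarrow> g \<in> carrier (pair_poly_ring n) \<Longrightarrow> f * g \<in> carrier (pair_poly_ring n)"
proof -
  interpret ring "pair_poly_ring n" by (rule ring_pair_poly_ring)
  show "0 \<in> carrier (pair_poly_ring n)" by (simp add: pair_poly_ring_simps)
  show "f + g \<in> carrier (pair_poly_ring n)" if "f \<in> carrier (pair_poly_ring n)" "g \<in> carrier (pair_poly_ring n)"
    using add.m_closed[OF that] by (simp only: pair_poly_ring_simps(3))
  show "f * g \<in> carrier (pair_poly_ring n)" if "f \<in> carrier (pair_poly_ring n)" "g \<in> carrier (pair_poly_ring n)"
    using m_closed[OF that] by (simp only: pair_poly_ring_simps(2))
qed

lemma pair_poly_ring_sum_closed:
  "(\<And>a. a \<in> A \<Longrightarrow> f a \<in> carrier (pair_poly_ring n)) \<Longrightarrow> sum f A \<in> carrier (pair_poly_ring n)"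
  by (induction A rule: infinite_finite_induct) (auto simp: pair_poly_ring_closed)

lemma single_carrier: "Poly_Mapping.keys m \<subseteq> pairs n \<Longrightarrow> Poly_Mapping.single m c \<in> carrier (pair_poly_ring n)"
  by (simp add: pair_poly_ring_simps)

lemma ideal_pair_poly_ring:
  assumes "A \<subseteq> carrier (pair_poly_ring n)" "0 \<in> A" "\<And>f g. f \<in> A \<Longrightarrow> g \<in> A \<Longrightarrow> f + g \<in> A"
    and mult: "\<And>r f. r \<in> carrier (pair_poly_ring n) \<Longrightarrow> f \<in> A \<Longrightarrow> r * f \<in> A"
  shows "ideal A (pair_poly_ring n)"
proof (rule idealI)
  interpret R: ring "pair_poly_ring n" by (rule ring_pair_poly_ring)
  show "ring (pair_poly_ring n)" by (rule ring_pair_poly_ring)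
  show "subgroup A (add_monoid (pair_poly_ring n))"
  proof (rule R.add.subgroupI)
    show "A \<subseteq> carrier (pair_poly_ring n)" by (rule assms(1))
    show "A \<noteq> {}" using assms(2) by blast
    show "\<ominus>\<^bsub>pair_poly_ring n\<^esub> f \<in> A" if "f \<in> A" for f
    proof -
      have f: "f \<in> carrier (pair_poly_ring n)" using that assms(1) by blast
      have "(- 1) * f \<in> A" by (rule mult[OF _ that]) (simp add: pair_poly_ring_simps)
      then show ?thesis by (simp add: a_inv_pair_poly_ring[OF f])
    qed
    show "f \<oplus>\<^bsub>pair_poly_ring n\<^esub> g \<in> A" if "f \<in> A" "g \<in> A" for f g
      using assms(3)[OF that] by (simp add: pair_poly_ring_simps)
  qed
  show "r \<otimes>\<^bsub>pair_poly_ring n\<^esub> f \<in> A" if "f \<in> A" "r \<in> carrier (pair_poly_ring n)" for f r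
    using mult[OF that(2,1)] by (simp add: pair_poly_ring_simps)
  then show "f \<otimes>\<^bsub>pair_poly_ring n\<^esub> r \<in> A" if "f \<in> A" "r \<in> carrier (pair_poly_ring n)" for f r
    using that by (simp add: pair_poly_ring_simps mult.commute)
qed

lemma ideal_closed:
  assumes "ideal A (pair_poly_ring n)"
  shows "A \<subseteq> carrier (pair_poly_ring n)" "0 \<in> A" "f \<in> A \<Longrightarrow> g \<in> A \<Longrightarrow> f + g \<in> A"
    "r \<in> carrier (pair_poly_ring n) \<Longrightarrow> f \<in> A \<Longrightarrow> r * f \<in> A"
proof -
  interpret ideal A "pair_poly_ring n" by (rule assms)
  show "A \<subseteq> carrier (pair_poly_ring n)" by (rule a_subset)
  show "0 \<in> A"
    using additive_subgroup.zero_closed[OF ideal.axioms(1)[OF assms]] by (simp add: pair_poly_ring_simps)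
  show "f \<in> A \<Longrightarrow> g \<in> A \<Longrightarrow> f + g \<in> A" using additive_subgroup.a_closed[OF ideal.axioms(1)[OF assms]] by (simp add: pair_poly_ring_simps)
  show "r \<in> carrier (pair_poly_ring n) \<Longrightarrow> f \<in> A \<Longrightarrow> r * f \<in> A" using I_l_closed[of f r] by (simp add: pair_poly_ring_simps)
qed

lemma ideal_sum: "ideal A (pair_poly_ring n) \<Longrightarrow> (\<And>k. k \<in> K \<Longrightarrow> f k \<in> A) \<Longrightarrow> sum f K \<in> A"
  by (induction K rule: infinite_finite_induct) (auto intro: ideal_closed)

lemma ideal_diff:
  assumes "ideal A (pair_poly_ring n)" "f \<in> A" "g \<in> A"
  shows "f - g \<in> A"
proof -
  have "(- 1) * g \<in> A" by (rule ideal_closed(4)[OF assms(1) _ assms(3)]) (simp add: pair_poly_ring_simps)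
  then show ?thesis using ideal_closed(3)[OF assms(1,2)] by fastforce
qed

lemma coset_eq_iff:
  assumes "ideal A (pair_poly_ring n)" "f \<in> carrier (pair_poly_ring n)" "g \<in> carrier (pair_poly_ring n)"
  shows "A +>\<^bsub>pair_poly_ring n\<^esub> f = A +>\<^bsub>pair_poly_ring n\<^esub> g \<longleftrightarrow> f - g \<in> A"
proof -
  interpret R: ring "pair_poly_ring n" by (rule ring_pair_poly_ring)
  have "f \<ominus>\<^bsub>pair_poly_ring n\<^esub> g = f - g"
    using assms(3) by (simp add: a_minus_def a_inv_pair_poly_ring pair_poly_ring_simps(3))
  then show ?thesis using R.quotient_eq_iff_same_a_r_cos[OF assms] by simp
qed

definition mono_of :: "nat set set \<Rightarrow> mono" where
  "mono_of M = (\<Sum>S\<in>M. Poly_Mapping.single S 1)"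

lemma lookup_mono_of: "finite M \<Longrightarrow> Poly_Mapping.lookup (mono_of M) S = (if S \<in> M then 1 else 0)"
  by (simp add: mono_of_def lookup_sum lookup_single when_def)

lemma keys_mono_of [simp]: "finite M \<Longrightarrow> Poly_Mapping.keys (mono_of M) = M"
  by (auto simp: in_keys_iff lookup_mono_of split: if_splits)

lemma mono_degree_mono_of: "finite M \<Longrightarrow> mono_degree (mono_of M) = card M"
  by (simp add: mono_degree_def lookup_mono_of)

lemma mono_of_insert: "finite M \<Longrightarrow> S \<notin> M \<Longrightarrow> mono_of (insert S M) = mono_of M + Poly_Mapping.single S 1"
  by (simp add: mono_of_def add.commute)

lemma mono_of_Un: "finite M \<Longrightarrow> finite N \<Longrightarrow> M \<inter> N = {} \<Longrightarrow> mono_of (M \<union> N) = mono_of M + mono_of N"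
  by (simp add: mono_of_def sum.union_disjoint)

lemma all_matchings_finite: "M \<in> all_matchings {1..n :: nat} \<Longrightarrow> finite M"
  unfolding all_matchings_def using finite_pairs_subset[of "{1..n}" M] by simp

definition matching_poly :: "nat \<Rightarrow> nat \<Rightarrow> (nat set set \<Rightarrow> complex) \<Rightarrow> cpoly" where
  "matching_poly n d g = (\<Sum>M\<in>matchings {1..n} d. Poly_Mapping.single (mono_of M) (g M))"

lemma interval_matching_finite: "M \<in> matchings {1..n :: nat} d \<Longrightarrow> finite M"
  by (rule matchings_finite) auto

lemma matching_poly_carrier: "matching_poly n d g \<in> carrier (pair_poly_ring n)"
  unfolding matching_poly_def
proof (rule pair_poly_ring_sum_closed)
  fix M assume "M \<in> matchings {1..n} d"
  then show "Poly_Mapping.single (mono_of M) (g M) \<in> carrier (pair_poly_ring n)"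
    using interval_matching_finite[of M n d] by (intro single_carrier) (simp add: matchings_def)
qed

lemma matching_poly_add: "matching_poly n d (\<lambda>M. g M + h M) = matching_poly n d g + matching_poly n d h"
  by (simp add: matching_poly_def single_add sum.distrib)

lemma matching_poly_diff: "matching_poly n d (\<lambda>M. g M - h M) = matching_poly n d g - matching_poly n d h"
  by (simp add: matching_poly_def single_diff sum_subtractf)

lemma matching_poly_scale: "matching_poly n d (\<lambda>M. c * g M) = Const c * matching_poly n d g"
  by (simp add: matching_poly_def Const_def sum_distrib_left mult_single)

lemma matching_poly_sum: "matching_poly n d (\<lambda>M. \<Sum>k\<in>K. g k M) = (\<Sum>k\<in>K. matching_poly n d (g k))"
proof (induction K rule: infinite_finite_induct)
  case (insert k K)
  then show ?case by (simp add: matching_poly_add)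
qed (simp_all add: matching_poly_def)

lemma matching_poly_cong: "(\<And>M. M \<in> matchings {1..n} d \<Longrightarrow> g M = h M) \<Longrightarrow> matching_poly n d g = matching_poly n d h"
  by (simp add: matching_poly_def)

lemma mono_of_inj: "finite M \<Longrightarrow> finite N \<Longrightarrow> mono_of M = mono_of N \<Longrightarrow> M = N"
  by (metis keys_mono_of)

lemma lookup_matching_poly:
  assumes "M \<in> matchings {1..n} d"
  shows "Poly_Mapping.lookup (matching_poly n d g) (mono_of M) = g M"
proof -
  have "Poly_Mapping.lookup (matching_poly n d g) (mono_of M) = (\<Sum>N\<in>matchings {1..n} d. if N = M then g N else 0)"
    unfolding matching_poly_def lookup_sum
  proof (rule sum.cong[OF refl])
    fix N assume N: "N \<in> matchings {1..n} d"
    have "mono_of N = mono_of M \<longleftrightarrow> N = M"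
      using mono_of_inj[OF interval_matching_finite[OF N] interval_matching_finite[OF assms]] by blast
    then show "Poly_Mapping.lookup (Poly_Mapping.single (mono_of N) (g N)) (mono_of M) = (if N = M then g N else 0)"
      by (simp add: lookup_single when_def)
  qed
  then show ?thesis using assms by simp
qed

lemma matching_poly_homogeneous: "homogeneous d (matching_poly n d g)"
  unfolding homogeneous_def
proof
  fix m assume m: "m \<in> Poly_Mapping.keys (matching_poly n d g)"
  obtain M where M: "M \<in> matchings {1..n} d" "m \<in> Poly_Mapping.keys (Poly_Mapping.single (mono_of M) (g M))"
    using subsetD[OF keys_sum m[unfolded matching_poly_def]] by blast
  then show "mono_degree m = d"
    using mono_degree_mono_of interval_matching_finite[OF M(1)] matchings_card[OF M(1)] by (auto split: if_splits)
qed

definition relations :: "nat \<Rightarrow> cpoly set" where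
  "relations n = {Var S * Var T | S T. S \<in> pairs n \<and> T \<in> pairs n \<and> S \<inter> T \<noteq> {}} \<union>
     {\<Sum>j\<in>{1..n} - {i}. Var {i, j} | i. i \<in> {1..n}}"

definition relation_ideal :: "nat \<Rightarrow> cpoly set" where
  "relation_ideal n = Idl\<^bsub>pair_poly_ring n\<^esub> (relations n)"

lemma Var_carrier: "S \<in> pairs n \<Longrightarrow> Var S \<in> carrier (pair_poly_ring n)"
  unfolding Var_def by (rule single_carrier) simp

lemma relations_carrier: "relations n \<subseteq> carrier (pair_poly_ring n)"
  unfolding relations_def by (auto intro!: pair_poly_ring_closed pair_poly_ring_sum_closed Var_carrier)

lemma ideal_relation_ideal: "ideal (relation_ideal n) (pair_poly_ring n)"
  unfolding relation_ideal_def by (rule ring.genideal_ideal[OF ring_pair_poly_ring relations_carrier])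

lemma relations_subset: "relations n \<subseteq> relation_ideal n"
  unfolding relation_ideal_def by (rule ring.genideal_self[OF ring_pair_poly_ring relations_carrier])

lemma relation_ideal_minimal: "ideal A (pair_poly_ring n) \<Longrightarrow> relations n \<subseteq> A \<Longrightarrow> relation_ideal n \<subseteq> A"
  unfolding relation_ideal_def by (rule ring.genideal_minimal[OF ring_pair_poly_ring])

lemma overlapping_in_relation_ideal:
  assumes "Poly_Mapping.keys m \<subseteq> pairs n" "S \<in> pairs n" "T \<in> pairs n" "S \<inter> T \<noteq> {}"
  shows "Poly_Mapping.single (m + (Poly_Mapping.single S 1 + Poly_Mapping.single T 1)) c \<in> relation_ideal n"
proof -
  have "Var S * Var T \<in> relations n"
    unfolding relations_def using assms(2-4) by blast
  then have "Var S * Var T \<in> relation_ideal n" by (rule subsetD[OF relations_subset])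
  then have "Poly_Mapping.single m c * (Var S * Var T) \<in> relation_ideal n"
    by (rule ideal_closed(4)[OF ideal_relation_ideal single_carrier[OF assms(1)]])
  then show ?thesis by (simp add: Var_def mult_single)
qed

text \<open>Such a monomial is divisible by \<open>x\<^sub>S x\<^sub>T\<close> for two overlapping edges, or by a square.\<close>

lemma non_matching_in_relation_ideal:
  assumes keys: "Poly_Mapping.keys m \<subseteq> pairs n" and non: "\<And>M. M \<in> all_matchings {1..n} \<Longrightarrow> m \<noteq> mono_of M"
  shows "Poly_Mapping.single m c \<in> relation_ideal n"
proof -
  have "\<exists>S T. S \<in> Poly_Mapping.keys m \<and> T \<in> Poly_Mapping.keys m \<and> S \<inter> T \<noteq> {} \<and> (S = T \<longrightarrow> Poly_Mapping.lookup m S \<ge> 2)"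
  proof (rule ccontr)
    assume neg: "\<not> ?thesis"
    have ne: "S \<noteq> {}" if "S \<in> pairs n" for S using that by (auto simp: nsets_def)
    have one: "Poly_Mapping.lookup m S = (if S \<in> Poly_Mapping.keys m then 1 else 0)" for S
    proof (cases "S \<in> Poly_Mapping.keys m")
      case True
      then have "S \<noteq> {}" using ne keys by blast
      then have "\<not> Poly_Mapping.lookup m S \<ge> 2"
        using neg[unfolded not_ex, rule_format, of S S] True by simp
      moreover have "Poly_Mapping.lookup m S \<noteq> 0" using True by (simp add: in_keys_iff)
      ultimately show ?thesis using True by simp
    qed (simp add: in_keys_iff)
    have "disjoint (Poly_Mapping.keys m)"
    proof (rule disjointI, rule ccontr)
      fix S T assume "S \<in> Poly_Mapping.keys m" "T \<in> Poly_Mapping.keys m" "S \<noteq> T" "S \<inter> T \<noteq> {}"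
      then show False using neg[unfolded not_ex, rule_format, of S T] by simp
    qed
    then have "Poly_Mapping.keys m \<in> all_matchings {1..n}" using keys by (simp add: all_matchings_def)
    moreover have "m = mono_of (Poly_Mapping.keys m)"
    proof (rule poly_mapping_eqI)
      show "Poly_Mapping.lookup m S = Poly_Mapping.lookup (mono_of (Poly_Mapping.keys m)) S" for S
        unfolding lookup_mono_of[OF finite_keys] by (rule one)
    qed
    ultimately show False using non by blast
  qed
  then obtain S T where ST: "S \<in> Poly_Mapping.keys m" "T \<in> Poly_Mapping.keys m" "S \<inter> T \<noteq> {}"
      "S = T \<longrightarrow> Poly_Mapping.lookup m S \<ge> 2" by blast
  let ?s = "Poly_Mapping.single S 1 + Poly_Mapping.single T 1 :: mono"
  have "m = (m - ?s) + ?s"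
  proof (rule poly_mapping_eqI)
    fix U
    have "Poly_Mapping.lookup m S \<noteq> 0" "Poly_Mapping.lookup m T \<noteq> 0" using ST by (simp_all add: in_keys_iff)
    then show "Poly_Mapping.lookup m U = Poly_Mapping.lookup (m - ?s + ?s) U"
      using ST(4) by (auto simp: lookup_add lookup_minus lookup_single when_def)
  qed
  moreover have "Poly_Mapping.keys (m - ?s) \<subseteq> pairs n"
    using keys by (auto simp: in_keys_iff lookup_minus)
  ultimately show ?thesis
    using overlapping_in_relation_ideal[of "m - ?s" n S T c] ST(3)
      subsetD[OF keys ST(1)] subsetD[OF keys ST(2)] by (simp only: not_False_eq_True)
qed

text \<open>It differs from the product of \<open>x\<^sub>M\<close> with a generator by monomials in which two edges overlap.\<close>

lemma star_poly_in_relation_ideal: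
  assumes "s \<in> stars {1..n} d"
  shows "matching_poly n d (star_relation {1..n} s) \<in> relation_ideal n"
proof -
  let ?X = "{1..n}"
  obtain M i where s: "s = (M, i)" by fastforce
  have M: "M \<in> matchings ?X (card M)" "Suc (card M) = d" "i \<in> ?X - \<Union>M"
    using assms by (auto simp: s stars_def all_matchings_iff)
  have finM: "finite M" using M(1) interval_matching_finite by blast
  let ?J = "?X - \<Union>M - {i}"
  let ?m = "mono_of M"
  let ?t = "\<lambda>j. Poly_Mapping.single (?m + Poly_Mapping.single {i, j} 1) (1::complex)"
  have keysM: "Poly_Mapping.keys ?m \<subseteq> pairs n" using M(1) finM by (simp add: matchings_def)
  have inj: "inj_on (\<lambda>j. insert {i, j} M) ?J"
    by (rule insert_pair_inj_on[OF _ M(1,3)]) simp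
  have "matching_poly n d (star_relation ?X s) =
      (\<Sum>N\<in>(\<lambda>j. insert {i, j} M) ` ?J. Poly_Mapping.single (mono_of N) (star_relation ?X s N))"
    unfolding matching_poly_def
  proof (rule sum.mono_neutral_right)
    show "(\<lambda>j. insert {i, j} M) ` ?J \<subseteq> matchings ?X d"
    proof
      fix N assume "N \<in> (\<lambda>j. insert {i, j} M) ` ?J"
      then obtain j where j: "j \<in> ?J" "N = insert {i, j} M" by blast
      show "N \<in> matchings ?X d"
        unfolding j(2) M(2)[symmetric] by (rule insert_pair_matching(1)[OF _ M(1,3) j(1)]) simp
    qed
  qed (auto simp: star_relation_def s)
  also have "\<dots> = (\<Sum>j\<in>?J. Poly_Mapping.single (mono_of (insert {i, j} M)) (star_relation ?X s (insert {i, j} M)))"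
    using inj by (simp add: sum.reindex)
  also have "\<dots> = (\<Sum>j\<in>?J. ?t j)"
  proof (rule sum.cong[OF refl])
    fix j assume j: "j \<in> ?J"
    then have "star_relation ?X s (insert {i, j} M) = 1" by (auto simp: star_relation_def s)
    then show "Poly_Mapping.single (mono_of (insert {i, j} M)) (star_relation ?X s (insert {i, j} M)) = ?t j"
      using mono_of_insert[OF finM insert_pair_matching(2)[OF _ M(1,3) j]] by simp
  qed
  finally have 1: "matching_poly n d (star_relation ?X s) = (\<Sum>j\<in>?J. ?t j)" .
  have "Poly_Mapping.single ?m 1 * (\<Sum>j\<in>?X - {i}. Var {i, j}) = (\<Sum>j\<in>?X - {i}. ?t j)"
    by (simp add: sum_distrib_left Var_def mult_single)
  also have "\<dots> = (\<Sum>j\<in>?J \<union> (?X \<inter> \<Union>M). ?t j)"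
    by (rule sum.cong) (use M(3) in auto)
  also have "\<dots> = (\<Sum>j\<in>?J. ?t j) + (\<Sum>j\<in>?X \<inter> \<Union>M. ?t j)"
    by (rule sum.union_disjoint) auto
  finally have 2: "matching_poly n d (star_relation ?X s) =
      Poly_Mapping.single ?m 1 * (\<Sum>j\<in>?X - {i}. Var {i, j}) - (\<Sum>j\<in>?X \<inter> \<Union>M. ?t j)"
    unfolding 1 by (simp only: add_diff_cancel_right')
  have "(\<Sum>j\<in>?X - {i}. Var {i, j}) \<in> relations n"
    unfolding relations_def using M(3) by blast
  then have "(\<Sum>j\<in>?X - {i}. Var {i, j}) \<in> relation_ideal n" by (rule subsetD[OF relations_subset])
  then have 3: "Poly_Mapping.single ?m 1 * (\<Sum>j\<in>?X - {i}. Var {i, j}) \<in> relation_ideal n"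
    by (rule ideal_closed(4)[OF ideal_relation_ideal single_carrier[OF keysM]])
  have 4: "(\<Sum>j\<in>?X \<inter> \<Union>M. ?t j) \<in> relation_ideal n"
  proof (rule ideal_sum[OF ideal_relation_ideal])
    fix j assume j: "j \<in> ?X \<inter> \<Union>M"
    then obtain S where S: "S \<in> M" "j \<in> S" by blast
    have "?m = mono_of (M - {S}) + Poly_Mapping.single S 1"
      using mono_of_insert[of "M - {S}" S] finM S(1) by (simp add: insert_absorb)
    then have eq: "?m + Poly_Mapping.single {i, j} 1 = mono_of (M - {S}) + (Poly_Mapping.single S 1 + Poly_Mapping.single {i, j} 1)"
      by (simp add: add.assoc)
    show "?t j \<in> relation_ideal n"
      unfolding eq
    proof (rule overlapping_in_relation_ideal)
      show "Poly_Mapping.keys (mono_of (M - {S})) \<subseteq> pairs n" using finM M(1) by (auto simp: matchings_def)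
      show "S \<in> pairs n" using S M(1) by (auto simp: matchings_def)
      have "j \<noteq> i" using M(3) S by blast
      then show "{i, j} \<in> pairs n" using j M(3) by auto
    qed (use S in auto)
  qed
  show ?thesis unfolding 2 by (rule ideal_diff[OF ideal_relation_ideal 3 4])
qed

text \<open>A monomial of degree \<open>d\<close> that is not among those of the matchings with \<open>d\<close> edges lies in the ideal.\<close>

lemma homogeneous_reduces_to_matchings:
  assumes f: "f \<in> carrier (pair_poly_ring n)" "homogeneous d f"
  shows "f - matching_poly n d (\<lambda>M. Poly_Mapping.lookup f (mono_of M)) \<in> relation_ideal n"
proof -
  let ?L = "Poly_Mapping.lookup f" and ?K = "Poly_Mapping.keys f"
  let ?I = "mono_of ` matchings {1..n} d"
  have inj: "inj_on mono_of (matchings {1..n} d)"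
    using mono_of_inj interval_matching_finite by (meson inj_onI)
  have "matching_poly n d (\<lambda>M. ?L (mono_of M)) = (\<Sum>m\<in>?I. Poly_Mapping.single m (?L m))"
    unfolding matching_poly_def using inj by (simp add: sum.reindex)
  also have "\<dots> = (\<Sum>m\<in>?I \<inter> ?K. Poly_Mapping.single m (?L m))"
    by (rule sum.mono_neutral_right) (auto simp: in_keys_iff)
  finally have "f - matching_poly n d (\<lambda>M. ?L (mono_of M)) =
      (\<Sum>m\<in>?K. Poly_Mapping.single m (?L m)) - (\<Sum>m\<in>?I \<inter> ?K. Poly_Mapping.single m (?L m))"
    using poly_mapping_sum_single[of f] by simp
  also have "\<dots> = (\<Sum>m\<in>?K - ?I \<inter> ?K. Poly_Mapping.single m (?L m))"
    by (rule sum_diff[symmetric]) auto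
  also have "\<dots> \<in> relation_ideal n"
  proof (rule ideal_sum[OF ideal_relation_ideal], rule non_matching_in_relation_ideal)
    fix m assume m: "m \<in> ?K - ?I \<inter> ?K"
    then show "Poly_Mapping.keys m \<subseteq> pairs n" using f(1) by (auto simp: pair_poly_ring_simps)
    fix M assume M: "M \<in> all_matchings {1..n}"
    show "m \<noteq> mono_of M"
    proof
      assume eq: "m = mono_of M"
      have "mono_degree m = d" using f(2) m by (auto simp: homogeneous_def)
      then have "card M = d" using eq mono_degree_mono_of all_matchings_finite[OF M] by simp
      then have "M \<in> matchings {1..n} d" using M by (simp add: all_matchings_iff)
      then show False using m eq by blast
    qed
  qed
  finally show ?thesis .
qed

lemma harmonic_representative:
  assumes g: "\<And>M. M \<in> matchings {1..n} d \<Longrightarrow> g M = h M + (\<Sum>s\<in>stars {1..n} d. a s * star_relation {1..n} s M)"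
  shows "matching_poly n d g - matching_poly n d h \<in> relation_ideal n"
proof -
  have "matching_poly n d g = matching_poly n d (\<lambda>M. h M + (\<Sum>s\<in>stars {1..n} d. a s * star_relation {1..n} s M))"
    by (rule matching_poly_cong) (rule g)
  then have "matching_poly n d g - matching_poly n d h =
      (\<Sum>s\<in>stars {1..n} d. Const (a s) * matching_poly n d (star_relation {1..n} s))"
    by (simp add: matching_poly_add matching_poly_sum matching_poly_scale)
  also have "\<dots> \<in> relation_ideal n"
    by (intro ideal_sum[OF ideal_relation_ideal] ideal_closed(4)[OF ideal_relation_ideal] star_poly_in_relation_ideal)
       (auto simp: Const_def intro: single_carrier)
  finally show ?thesis .
qed

lemma homogeneous_reduces_to_harmonic:
  assumes f: "f \<in> carrier (pair_poly_ring n)" "homogeneous d f"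
  shows "\<exists>h\<in>harmonics {1..n} d. f - matching_poly n d h \<in> relation_ideal n"
proof -
  let ?g = "\<lambda>M. Poly_Mapping.lookup f (mono_of M)"
  obtain h a where h: "h \<in> harmonics {1..n} d"
     "\<forall>M\<in>matchings {1..n} d. ?g M = h M + (\<Sum>s\<in>stars {1..n} d. a s * star_relation {1..n} s M)"
    using harmonics_decomposition[of "{1..n}" d ?g] by auto
  have "matching_poly n d ?g - matching_poly n d h \<in> relation_ideal n"
    by (rule harmonic_representative[where a = a]) (use h(2) in blast)
  from ideal_closed(3)[OF ideal_relation_ideal homogeneous_reduces_to_matchings[OF f] this]
  show ?thesis using h(1) by (intro bexI[of _ h]) simp_all
qed

section \<open>The associated graded ideal\<close>

lemma eval_at_eq_lin: "eval_at z f = lin (\<lambda>m. \<Prod>S\<in>Poly_Mapping.keys m. z S ^ Poly_Mapping.lookup m S) f"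
  by (simp add: eval_at_def poly_hom_def lin_def)

text \<open>The value of a monomial at the point of the perfect matching \<open>P\<close>.\<close>

definition supported_on :: "nat set set \<Rightarrow> mono \<Rightarrow> complex" where
  "supported_on P m = (if Poly_Mapping.keys m \<subseteq> P then 1 else 0)"

lemma set_partition_point_perfect_matching:
  assumes "P \<in> perfect_matchings {1..n}" "S \<in> pairs n"
  shows "set_partition_point n P S = (if S \<in> P then 1 else 0)"
proof -
  have "(\<exists>B\<in>P. S \<subseteq> B) \<longleftrightarrow> S \<in> P"
  proof
    assume "\<exists>B\<in>P. S \<subseteq> B"
    then obtain B where B: "B \<in> P" "S \<subseteq> B" by blast
    then have "B \<in> pairs n" using assms(1) by (auto simp: perfect_matchings_def)
    then have "S = B" using assms(2) B(2) by (intro card_subset_eq) (auto simp: nsets_def)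
    then show "S \<in> P" using B by simp
  qed blast
  then show ?thesis using assms(2) by (simp add: set_partition_point_def)
qed

lemma eval_at_perfect_matching:
  assumes P: "P \<in> perfect_matchings {1..n}" and f: "f \<in> carrier (pair_poly_ring n)"
  shows "eval_at (set_partition_point n P) f = lin (supported_on P) f"
  unfolding eval_at_eq_lin lin_def
proof (rule sum.cong[OF refl])
  fix m assume m: "m \<in> Poly_Mapping.keys f"
  have "(\<Prod>S\<in>Poly_Mapping.keys m. set_partition_point n P S ^ Poly_Mapping.lookup m S) =
      (\<Prod>S\<in>Poly_Mapping.keys m. if S \<in> P then 1 else 0)"
  proof (rule prod.cong[OF refl])
    fix S assume S: "S \<in> Poly_Mapping.keys m"
    have "S \<in> pairs n" using S m f by (auto simp: pair_poly_ring_simps(1))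
    then show "set_partition_point n P S ^ Poly_Mapping.lookup m S = (if S \<in> P then 1 else 0)"
      using S set_partition_point_perfect_matching[OF P] by (simp add: in_keys_iff)
  qed
  also have "\<dots> = supported_on P m"
    by (cases "Poly_Mapping.keys m \<subseteq> P") (auto simp: supported_on_def intro!: prod.neutral)
  finally show "Poly_Mapping.lookup f m * (\<Prod>S\<in>Poly_Mapping.keys m. set_partition_point n P S ^ Poly_Mapping.lookup m S) =
      Poly_Mapping.lookup f m * supported_on P m" by simp
qed

lemma partition_locus_pairs:
  "partition_locus (2 * a) (replicate a 2) = set_partition_point (2 * a) ` perfect_matchings {1..2 * a}"
proof -
  have "(partition_on {1..2 * a} \<pi> \<and> image_mset card (mset_set \<pi>) = mset (replicate a 2)) \<longleftrightarrow> \<pi> \<in> perfect_matchings {1..2 * a}" for \<pi>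
  proof
    assume "partition_on {1..2 * a} \<pi> \<and> image_mset card (mset_set \<pi>) = mset (replicate a 2)"
    then have p: "partition_on {1..2 * a} \<pi>" and c: "image_mset card (mset_set \<pi>) = mset (replicate a 2)" by blast+
    have fin: "finite \<pi>" using p finite_elements by blast
    have "card B = 2" if B: "B \<in> \<pi>" for B
    proof -
      have "B \<in># mset_set \<pi>" using B fin by simp
      then have "card B \<in># image_mset card (mset_set \<pi>)" by simp
      then show ?thesis unfolding c by (simp split: if_splits)
    qed
    moreover have "B \<subseteq> {1..2 * a}" if "B \<in> \<pi>" for B using p that by (auto simp: partition_on_def)
    moreover have "finite B" if "B \<in> \<pi>" for B using calculation(2)[OF that] finite_subset by blast
    ultimately have "\<pi> \<subseteq> pairs (2 * a)" unfolding nsets_def by blast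
    then show "\<pi> \<in> perfect_matchings {1..2 * a}"
      using p by (simp add: perfect_matchings_def partition_on_def)
  next
    assume P: "\<pi> \<in> perfect_matchings {1..2 * a}"
    then have sub: "\<pi> \<subseteq> pairs (2 * a)" by (simp add: perfect_matchings_def)
    then have fin: "finite \<pi>" using finite_pairs_subset by blast
    have "card \<pi> = a" using perfect_matching_card[OF P] by simp
    have "image_mset card (mset_set \<pi>) = image_mset (\<lambda>_. 2) (mset_set \<pi>)"
      by (rule image_mset_cong) (use sub fin in \<open>auto simp: nsets_def\<close>)
    also have "\<dots> = replicate_mset a 2" using \<open>card \<pi> = a\<close> by (simp add: image_mset_const_eq)
    also have "\<dots> = mset (replicate a 2)" by simp
    finally have "image_mset card (mset_set \<pi>) = mset (replicate a 2)" .
    moreover have "partition_on {1..2 * a} \<pi>"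
      using P sub by (auto simp: partition_on_def perfect_matchings_def nsets_def)
    ultimately show "partition_on {1..2 * a} \<pi> \<and> image_mset card (mset_set \<pi>) = mset (replicate a 2)" by blast
  qed
  then show ?thesis by (auto simp: partition_locus_def)
qed

lemma lookup_hom_component:
  "Poly_Mapping.lookup (hom_component d f) m = (if mono_degree m = d then Poly_Mapping.lookup f m else 0)"
proof -
  let ?K = "{m \<in> Poly_Mapping.keys f. mono_degree m = d}"
  have "Poly_Mapping.lookup (hom_component d f) m = (\<Sum>k\<in>?K. if k = m then Poly_Mapping.lookup f m else 0)"
    unfolding hom_component_def lookup_sum by (rule sum.cong) (auto simp: lookup_single when_def)
  then show ?thesis by (simp add: in_keys_iff)
qed

lemma hom_component_homogeneous: "homogeneous d (hom_component d f)"
  by (auto simp: homogeneous_def in_keys_iff lookup_hom_component split: if_splits)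

lemma hom_component_carrier: "f \<in> carrier (pair_poly_ring n) \<Longrightarrow> hom_component d f \<in> carrier (pair_poly_ring n)"
  by (auto simp: pair_poly_ring_simps(1) in_keys_iff lookup_hom_component split: if_splits)

lemma card_keys_le_mono_degree: "card (Poly_Mapping.keys m) \<le> mono_degree m"
proof -
  have "(\<Sum>S\<in>Poly_Mapping.keys m. 1) \<le> mono_degree m"
    unfolding mono_degree_def by (rule sum_mono) (simp add: in_keys_iff Suc_le_eq)
  then show ?thesis by simp
qed

lemma mono_degree_eq_card:
  assumes "mono_degree m \<le> card (Poly_Mapping.keys m)"
  shows "m = mono_of (Poly_Mapping.keys m)"
proof (rule poly_mapping_eqI)
  fix S
  have "(\<Sum>S\<in>Poly_Mapping.keys m. 1) = (\<Sum>S\<in>Poly_Mapping.keys m. Poly_Mapping.lookup m S)"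
    using assms card_keys_le_mono_degree[of m] by (simp add: mono_degree_def)
  then have "1 = Poly_Mapping.lookup m S" if "S \<in> Poly_Mapping.keys m"
    by (rule sum_mono_inv) (use that in \<open>auto simp: in_keys_iff Suc_le_eq\<close>)
  then show "Poly_Mapping.lookup m S = Poly_Mapping.lookup (mono_of (Poly_Mapping.keys m)) S"
    by (auto simp: lookup_mono_of in_keys_iff)
qed

text \<open>At the points of the locus each monomial has the same value as its squarefree part. Collecting the
coefficients of \<open>F\<close> accordingly gives a function \<open>g\<close> on matchings with \<open>spread g = 0\<close>, which in the top degree
has the same coefficients as \<open>F\<close>, because there only squarefree monomials have a support of full size.
By \<open>harmonic_top_part_eq_0\<close> the top part of \<open>g\<close> is a combination of star relations.\<close>

lemma top_component_in_relation_ideal: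
  assumes even: "even n" and F: "F \<in> carrier (pair_poly_ring n)" "F \<noteq> 0"
    and van: "\<And>P. P \<in> perfect_matchings {1..n} \<Longrightarrow> eval_at (set_partition_point n P) F = 0"
  shows "top_component F \<in> relation_ideal n"
proof -
  let ?X = "{1..n}"
  let ?K = "Poly_Mapping.keys F"
  define D where "D = Max (mono_degree ` ?K)"
  have deg: "mono_degree m \<le> D" if "m \<in> ?K" for m unfolding D_def using that by simp
  define g where "g = (\<lambda>M. \<Sum>m\<in>{m \<in> ?K. Poly_Mapping.keys m = M}. Poly_Mapping.lookup F m)"
  have spread0: "spread g P = 0" if P: "P \<in> perfect_matchings ?X" for P
  proof -
    let ?S = "{m \<in> ?K. Poly_Mapping.keys m \<subseteq> P}"
    have finP: "finite P" using P finite_pairs_subset[of ?X P] by (simp add: perfect_matchings_def)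
    have "spread g P = (\<Sum>M\<in>Pow P. \<Sum>m\<in>{m \<in> ?S. Poly_Mapping.keys m = M}. Poly_Mapping.lookup F m)"
      unfolding spread_def g_def by (intro sum.cong) auto
    also have "\<dots> = (\<Sum>m\<in>?S. Poly_Mapping.lookup F m)"
      by (rule sum.group) (use finP in auto)
    also have "\<dots> = (\<Sum>m\<in>?K. if Poly_Mapping.keys m \<subseteq> P then Poly_Mapping.lookup F m else 0)"
      by (rule sum.inter_filter) simp
    also have "\<dots> = lin (supported_on P) F"
      unfolding lin_def by (rule sum.cong) (auto simp: supported_on_def)
    also have "\<dots> = 0" using van[OF P] eval_at_perfect_matching[OF P F(1)] by simp
    finally show ?thesis .
  qed
  have gbig: "g M = 0" if "D < card M" for M
  proof -
    have "{m \<in> ?K. Poly_Mapping.keys m = M} = {}"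
      using that deg card_keys_le_mono_degree by (fastforce dest: le_trans)
    then show ?thesis by (simp only: g_def sum.empty)
  qed
  let ?top = "top_component F"
  have top: "?top = hom_component D F" by (simp add: top_component_def D_def)
  have topc: "?top \<in> carrier (pair_poly_ring n)" "homogeneous D ?top"
    unfolding top using hom_component_carrier[OF F(1)] hom_component_homogeneous by blast+
  have gtop: "Poly_Mapping.lookup ?top (mono_of M) = g M" if M: "M \<in> matchings ?X D" for M
  proof -
    note finM = interval_matching_finite[OF M] and cM = matchings_card[OF M]
    have sub: "{m \<in> ?K. Poly_Mapping.keys m = M} \<subseteq> {mono_of M}"
      using deg mono_degree_eq_card cM by auto
    have "g M = (\<Sum>m\<in>{mono_of M}. Poly_Mapping.lookup F m)"
      unfolding g_def by (rule sum.mono_neutral_left) (use sub finM in \<open>auto simp: in_keys_iff\<close>)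
    then show ?thesis using cM by (simp add: top lookup_hom_component mono_degree_mono_of[OF finM])
  qed
  obtain h a where h: "h \<in> harmonics ?X D"
     "\<forall>M\<in>matchings ?X D. g M = h M + (\<Sum>s\<in>stars ?X D. a s * star_relation ?X s M)"
    using harmonics_decomposition[of ?X D g] by auto
  have h0: "h M = 0" for M
    by (rule harmonic_top_part_eq_0[where g = g and a = a, OF _ _ h(1)]) (use h(2) gbig spread0 even in auto)
  have "matching_poly n D g - matching_poly n D h \<in> relation_ideal n"
    by (rule harmonic_representative[where a = a]) (use h(2) in blast)
  moreover have "matching_poly n D h = 0" by (simp add: matching_poly_def h0)
  ultimately have 1: "matching_poly n D g \<in> relation_ideal n" by simp
  have "matching_poly n D (\<lambda>M. Poly_Mapping.lookup ?top (mono_of M)) = matching_poly n D g"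
    by (rule matching_poly_cong) (rule gtop)
  then have "?top - matching_poly n D g \<in> relation_ideal n"
    using homogeneous_reduces_to_matchings[OF topc] by simp
  from ideal_closed(3)[OF ideal_relation_ideal this 1] show ?thesis by simp
qed

lemma top_component_add:
  assumes p: "homogeneous d p" "p \<noteq> 0" and q: "\<And>m. m \<in> Poly_Mapping.keys q \<Longrightarrow> mono_degree m < d"
  shows "p + q \<noteq> 0" "top_component (p + q) = p"
proof -
  obtain m where m: "m \<in> Poly_Mapping.keys p" using p(2) by (metis keys_eq_empty ex_in_conv)
  have q0: "Poly_Mapping.lookup q k = 0" if "mono_degree k = d" for k
    using q[of k] that by (auto simp: in_keys_iff)
  have p0: "Poly_Mapping.lookup p k = 0" if "mono_degree k \<noteq> d" for k
    using p(1) that by (auto simp: homogeneous_def in_keys_iff)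
  have dm: "mono_degree m = d" using p(1) m by (simp add: homogeneous_def)
  then have mk: "m \<in> Poly_Mapping.keys (p + q)" using m q0 by (simp add: in_keys_iff lookup_add)
  then show "p + q \<noteq> 0" by auto
  have "Max (mono_degree ` Poly_Mapping.keys (p + q)) = d"
  proof (rule Max_eqI)
    show "d \<in> mono_degree ` Poly_Mapping.keys (p + q)" using mk dm by blast
    fix k assume "k \<in> mono_degree ` Poly_Mapping.keys (p + q)"
    then obtain l where l: "l \<in> Poly_Mapping.keys (p + q)" "k = mono_degree l" by blast
    then have "l \<in> Poly_Mapping.keys p \<or> l \<in> Poly_Mapping.keys q" by (auto simp: in_keys_iff lookup_add)
    then show "k \<le> d" using l(2) p(1) q by (auto simp: homogeneous_def less_imp_le)
  qed simp
  then have "top_component (p + q) = hom_component d (p + q)" by (simp add: top_component_def)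
  also have "\<dots> = p"
    by (rule poly_mapping_eqI) (use p0 q0 in \<open>simp add: lookup_hom_component lookup_add\<close>)
  finally show "top_component (p + q) = p" .
qed

lemma mono_degree_single [simp]: "mono_degree (Poly_Mapping.single S c) = c"
  by (cases "c = 0") (simp_all add: mono_degree_def)

lemma mono_degree_0 [simp]: "mono_degree 0 = 0"
  by (simp add: mono_degree_def)

lemma mono_degree_pair: "mono_degree (Poly_Mapping.single S 1 + Poly_Mapping.single T 1) = 2"
proof (cases "S = T")
  case True
  then have "Poly_Mapping.single S 1 + Poly_Mapping.single T 1 = (Poly_Mapping.single S 2 :: mono)"
    by (simp add: single_add[symmetric] numeral_2_eq_2)
  then show ?thesis by simp
next
  case False
  then have "Poly_Mapping.single S 1 + Poly_Mapping.single T 1 = mono_of {S, T}" by (simp add: mono_of_def)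
  then show ?thesis using False by (simp add: mono_degree_mono_of)
qed

lemma keys_pair: "Poly_Mapping.keys (Poly_Mapping.single S 1 + Poly_Mapping.single T 1 :: mono) = {S, T}"
  by (auto simp: in_keys_iff lookup_add lookup_single when_def split: if_splits)

text \<open>The generators are the top components of polynomials that vanish on the locus: of \<open>x\<^sub>S x\<^sub>T\<close> itself for different
overlapping edges, of \<open>x\<^sub>S\<^sup>2 - x\<^sub>S\<close>, and of \<open>\<Sum>\<^sub>j x_{ij} - 1\<close>.\<close>

lemma relations_subset_gr_ideal:
  assumes "n \<ge> 2"
  shows "relations n \<subseteq> gr_ideal n (set_partition_point n ` perfect_matchings {1..n})"
proof
  let ?Z = "set_partition_point n ` perfect_matchings {1..n}"
  let ?tops = "{top_component f | f. f \<in> vanishing_ideal n ?Z \<and> f \<noteq> 0}"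
  have "?tops \<subseteq> carrier (pair_poly_ring n)"
    by (auto simp: vanishing_ideal_def top_component_def hom_component_carrier)
  then have tops: "?tops \<subseteq> gr_ideal n ?Z"
    unfolding gr_ideal_def by (rule ring.genideal_self[OF ring_pair_poly_ring])
  have crit: "p \<in> gr_ideal n ?Z"
    if "p \<in> carrier (pair_poly_ring n)" "q \<in> carrier (pair_poly_ring n)" "homogeneous d p" "p \<noteq> 0"
      "\<And>m. m \<in> Poly_Mapping.keys q \<Longrightarrow> mono_degree m < d"
      and van: "\<And>P. P \<in> perfect_matchings {1..n} \<Longrightarrow> lin (supported_on P) p + lin (supported_on P) q = 0" for p q d
  proof -
    note t = top_component_add[OF that(3,4,5)]
    have c: "p + q \<in> carrier (pair_poly_ring n)" using that(1,2) by (rule pair_poly_ring_closed)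
    have "p + q \<in> vanishing_ideal n ?Z"
      using c van by (auto simp: vanishing_ideal_def eval_at_perfect_matching[OF _ c] lin_add)
    then have "top_component (p + q) \<in> ?tops" using t(1) by blast
    then show ?thesis using tops t(2) by auto
  qed
  fix f assume "f \<in> relations n"
  then consider (overlap) S T where "f = Var S * Var T" "S \<in> pairs n" "T \<in> pairs n" "S \<inter> T \<noteq> {}"
    | (star) i where "f = (\<Sum>j\<in>{1..n} - {i}. Var {i, j})" "i \<in> {1..n}"
    unfolding relations_def by blast
  then show "f \<in> gr_ideal n ?Z"
  proof cases
    case overlap
    let ?m = "Poly_Mapping.single S 1 + Poly_Mapping.single T 1 :: mono"
    have f: "f = Poly_Mapping.single ?m 1" using overlap(1) by (simp add: Var_def mult_single)
    have hom: "homogeneous 2 f" by (simp add: f homogeneous_def mono_degree_pair[unfolded One_nat_def])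
    have car: "f \<in> carrier (pair_poly_ring n)" unfolding f
      by (rule single_carrier) (use overlap keys_pair in auto)
    have nz: "f \<noteq> 0" unfolding f by (metis keys_single keys_zero one_neq_zero insert_not_empty)
    show ?thesis
    proof (cases "S = T")
      case True
      let ?q = "Poly_Mapping.single (Poly_Mapping.single S 1) (-1) :: cpoly"
      show ?thesis
      proof (rule crit[OF car _ hom nz, of ?q])
        show "?q \<in> carrier (pair_poly_ring n)" by (rule single_carrier) (use overlap in auto)
        show "mono_degree m < 2" if "m \<in> Poly_Mapping.keys ?q" for m using that by simp
        show "lin (supported_on P) f + lin (supported_on P) ?q = 0" for P
          unfolding f lin_single supported_on_def keys_pair by (simp add: True)
      qed
    next
      case False
      show ?thesis
      proof (rule crit[OF car pair_poly_ring_closed(1) hom nz])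
        fix P assume P: "P \<in> perfect_matchings {1..n}"
        have "\<not> {S, T} \<subseteq> P"
        proof -
          have "disjoint P" using P by (simp add: perfect_matchings_def)
          then show ?thesis using disjointD[of P S T] False overlap(4) by blast
        qed
        then show "lin (supported_on P) f + lin (supported_on P) 0 = 0"
          unfolding f lin_single supported_on_def keys_pair by simp
      qed simp
    qed
  next
    case star
    let ?q = "Poly_Mapping.single 0 (-1) :: cpoly"
    let ?J = "{1..n} - {i}"
    have f: "f = (\<Sum>j\<in>?J. Poly_Mapping.single (Poly_Mapping.single {i, j} 1) 1)" by (simp add: star(1) Var_def)
    have car: "f \<in> carrier (pair_poly_ring n)"
      unfolding star(1) by (rule pair_poly_ring_sum_closed, rule Var_carrier) (use star(2) in auto)
    have hom: "homogeneous 1 f"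
      unfolding homogeneous_def
    proof
      fix m assume m: "m \<in> Poly_Mapping.keys f"
      obtain j where "m \<in> Poly_Mapping.keys (Poly_Mapping.single (Poly_Mapping.single {i, j} 1) (1::complex))"
        using subsetD[OF keys_sum m[unfolded f]] by blast
      then show "mono_degree m = 1" by simp
    qed
    have one: "lin (supported_on P) f = 1" if P: "P \<in> perfect_matchings {1..n}" for P
    proof -
      have P': "P \<subseteq> pairs n" "disjoint P" "\<Union>P = {1..n}" using P by (auto simp: perfect_matchings_def)
      obtain e where e: "e \<in> P" "i \<in> e" using P'(3) star(2) by blast
      have "e \<in> pairs n" using P'(1) e(1) by blast
      then obtain x y where xy: "e = {x, y}" "x \<noteq> y" "x \<in> {1..n}" "y \<in> {1..n}" by (rule nsets2_E)
      obtain k where k: "e = {i, k}" "k \<noteq> i" "k \<in> {1..n}"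
      proof (cases "i = x")
        case True
        then show ?thesis using xy that[of y] by simp
      next
        case False
        then show ?thesis using xy e(2) that[of x] by (simp add: insert_commute)
      qed
      have uniq: "{i, j} \<in> P \<longleftrightarrow> j = k" for j
      proof
        assume "{i, j} \<in> P"
        then have "{i, j} = {i, k}" using disjointD[OF P'(2) _ e(1), of "{i, j}"] k(1) by blast
        then show "j = k" by (auto simp: doubleton_eq_iff)
      qed (use e k in simp)
      have "lin (supported_on P) f = (\<Sum>j\<in>?J. if j = k then 1 else 0)"
        unfolding f lin_sum lin_single by (rule sum.cong) (auto simp: supported_on_def uniq)
      then show ?thesis using k by simp
    qed
    have "\<exists>j. j \<in> ?J"
    proof (cases "i = 1")
      case True
      then show ?thesis using assms by (intro exI[of _ 2]) auto
    next
      case False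
      then show ?thesis using star(2) by (intro exI[of _ 1]) auto
    qed
    then obtain j where j: "j \<in> ?J" by blast
    have "Poly_Mapping.lookup f (Poly_Mapping.single {i, j} 1) = (\<Sum>l\<in>?J. if l = j then 1 else 0)"
      unfolding f lookup_sum
    proof (rule sum.cong[OF refl])
      fix l
      have "(Poly_Mapping.single {i, l} 1 = (Poly_Mapping.single {i, j} 1 :: mono)) = ({i, l} = {i, j})"
        by (metis keys_single one_neq_zero singleton_insert_inj_eq')
      also have "\<dots> = (l = j)" by (auto simp: doubleton_eq_iff)
      finally have iff: "(Poly_Mapping.single {i, l} 1 = (Poly_Mapping.single {i, j} 1 :: mono)) = (l = j)" .
      show "Poly_Mapping.lookup (Poly_Mapping.single (Poly_Mapping.single {i, l} 1) 1) (Poly_Mapping.single {i, j} 1 :: mono) =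
         (if l = j then 1 else 0 :: complex)"
        unfolding lookup_single when_def iff ..
    qed
    then have "Poly_Mapping.lookup f (Poly_Mapping.single {i, j} 1) = 1" using j by simp
    then have nz: "f \<noteq> 0" by auto
    show ?thesis
    proof (rule crit[OF car _ hom nz, of ?q])
      show "?q \<in> carrier (pair_poly_ring n)" by (rule single_carrier) simp
      show "mono_degree m < 1" if "m \<in> Poly_Mapping.keys ?q" for m using that by simp
      show "lin (supported_on P) f + lin (supported_on P) ?q = 0" if "P \<in> perfect_matchings {1..n}" for P
        unfolding one[OF that] lin_single supported_on_def by simp
    qed
  qed
qed

lemma gr_ideal_eq_relation_ideal:
  assumes "a > 0"
  shows "gr_ideal (2 * a) (partition_locus (2 * a) (replicate a 2)) = relation_ideal (2 * a)"
proof
  let ?n = "2 * a"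
  let ?Z = "set_partition_point ?n ` perfect_matchings {1..?n}"
  let ?tops = "{top_component f | f. f \<in> vanishing_ideal ?n ?Z \<and> f \<noteq> 0}"
  have "?tops \<subseteq> relation_ideal ?n"
    using top_component_in_relation_ideal[of ?n] by (auto simp: vanishing_ideal_def)
  then show "gr_ideal ?n (partition_locus ?n (replicate a 2)) \<subseteq> relation_ideal ?n"
    unfolding partition_locus_pairs gr_ideal_def
    by (rule ring.genideal_minimal[OF ring_pair_poly_ring ideal_relation_ideal])
  have "?tops \<subseteq> carrier (pair_poly_ring ?n)"
    by (auto simp: vanishing_ideal_def top_component_def hom_component_carrier)
  then have "ideal (gr_ideal ?n ?Z) (pair_poly_ring ?n)"
    unfolding gr_ideal_def by (rule ring.genideal_ideal[OF ring_pair_poly_ring])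
  then show "relation_ideal ?n \<subseteq> gr_ideal ?n (partition_locus ?n (replicate a 2))"
    unfolding partition_locus_pairs
    by (rule relation_ideal_minimal) (rule relations_subset_gr_ideal, use assms in simp)
qed

section \<open>Harmonic functions embed in the quotient\<close>

definition matching_pairing :: "nat \<Rightarrow> nat \<Rightarrow> (nat set set \<Rightarrow> complex) \<Rightarrow> cpoly \<Rightarrow> complex" where
  "matching_pairing n d h F = (\<Sum>M\<in>matchings {1..n} d. Poly_Mapping.lookup F (mono_of M) * h M)"

lemma matching_pairing_add: "matching_pairing n d h (F + G) = matching_pairing n d h F + matching_pairing n d h G"
  by (simp add: matching_pairing_def lookup_add distrib_right sum.distrib)

lemma matching_pairing_0 [simp]: "matching_pairing n d h 0 = 0"
  by (simp add: matching_pairing_def)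

lemma matching_pairing_sum: "matching_pairing n d h (sum F A) = (\<Sum>a\<in>A. matching_pairing n d h (F a))"
  by (induction A rule: infinite_finite_induct) (auto simp: matching_pairing_add)

lemma lookup_single_mult:
  "Poly_Mapping.lookup (Poly_Mapping.single m c * F) k =
     (\<Sum>l\<in>Poly_Mapping.keys F. if m + l = k then c * Poly_Mapping.lookup F l else 0)"
proof -
  have "Poly_Mapping.single m c * F = (\<Sum>l\<in>Poly_Mapping.keys F. Poly_Mapping.single (m + l) (c * Poly_Mapping.lookup F l))"
    by (subst poly_mapping_sum_single[of F]) (simp add: sum_distrib_left mult_single)
  then show ?thesis by (simp add: lookup_sum lookup_single when_def)
qed

lemma harmonics_link:
  assumes "finite X" "h \<in> harmonics X d" "K \<in> matchings X k"
  shows "(\<lambda>L. if L \<in> matchings (X - \<Union>K) (d - k) then h (K \<union> L) else 0) \<in> harmonics X (d - k)"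
    (is "?h \<in> _")
proof -
  let ?Y = "X - \<Union>K"
  have "harmonic X (d - k) ?h"
    unfolding harmonic_def
  proof (intro allI impI)
    fix M i assume M: "Suc (card M) = d - k" "M \<in> matchings X (card M)" "i \<in> X - \<Union>M"
    show "(\<Sum>j\<in>X - \<Union>M - {i}. ?h (insert {i, j} M)) = 0"
    proof (cases "M \<in> matchings ?Y (card M) \<and> i \<in> ?Y")
      case True
      have "(\<Sum>j\<in>X - \<Union>M - {i}. ?h (insert {i, j} M)) = (\<Sum>j\<in>?Y - \<Union>M - {i}. ?h (insert {i, j} M))"
      proof (rule sum.mono_neutral_right)
        show "\<forall>j\<in>X - \<Union>M - {i} - (?Y - \<Union>M - {i}). ?h (insert {i, j} M) = 0"
        proof
          fix j assume "j \<in> X - \<Union>M - {i} - (?Y - \<Union>M - {i})"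
          then have "j \<in> \<Union>K" by blast
          then have "insert {i, j} M \<notin> matchings ?Y (d - k)" using matchings_Union_subset[of "insert {i, j} M" ?Y] by blast
          then show "?h (insert {i, j} M) = 0" by simp
        qed
      qed (use assms(1) in auto)
      also have "\<dots> = (\<Sum>j\<in>?Y - \<Union>M - {i}. h (K \<union> insert {i, j} M))"
      proof (rule sum.cong[OF refl])
        fix j assume j: "j \<in> ?Y - \<Union>M - {i}"
        have "insert {i, j} M \<in> matchings ?Y (d - k)"
          unfolding M(1)[symmetric] by (rule insert_pair_matching(1)) (use assms(1) True M j in auto)
        then show "?h (insert {i, j} M) = h (K \<union> insert {i, j} M)" by simp
      qed
      also have "\<dots> = 0"
      proof -
        have "harmonic ?Y (d - k) (\<lambda>L. h (K \<union> L))"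
          by (rule harmonic_link[OF assms(1) _ assms(3)]) (use assms(2) in \<open>simp add: harmonics_def\<close>)
        from harmonicD[OF this _ M(1)] show ?thesis using True M(3) by simp
      qed
      finally show ?thesis .
    next
      case False
      have "?h (insert {i, j} M) = 0" for j
      proof -
        have "insert {i, j} M \<notin> matchings ?Y (d - k)"
        proof
          assume ins: "insert {i, j} M \<in> matchings ?Y (d - k)"
          then have "M \<in> matchings ?Y (card M)" by (auto simp: matchings_def pairwise_insert)
          moreover have "i \<in> ?Y" using matchings_Union_subset[OF ins] by blast
          ultimately show False using False by blast
        qed
        then show ?thesis by simp
      qed
      then show ?thesis by simp
    qed
  qed
  moreover have "?h L = 0" if "L \<notin> matchings X (d - k)" for L
    using that nsets_mono[of ?Y X 2] by (auto simp: matchings_def)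
  ultimately show ?thesis by (simp add: harmonics_def)
qed

text \<open>The adjoint of multiplication by the monomial of a matching \<open>K\<close> sends \<open>h\<close> to \<open>L \<mapsto> h (K \<union> L)\<close>, which is
harmonic again; multiplication by any other monomial contributes nothing to the pairing.\<close>

lemma matching_pairing_single_mult:
  assumes h: "h \<in> harmonics {1..n} d"
  shows "\<exists>e. \<exists>h'\<in>harmonics {1..n} e. \<forall>F. matching_pairing n d h (Poly_Mapping.single m c * F) = c * matching_pairing n e h' F"
proof (cases "\<exists>K M. K \<subseteq> M \<and> M \<in> matchings {1..n} d \<and> m = mono_of K")
  case False
  have "matching_pairing n d h (Poly_Mapping.single m c * F) = 0" for F
    unfolding matching_pairing_def
  proof (rule sum.neutral, rule ballI)
    fix M assume M: "M \<in> matchings {1..n} d"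
    note finM = interval_matching_finite[OF M]
    have "m + l \<noteq> mono_of M" for l
    proof
      assume eq: "m + l = mono_of M"
      have le: "Poly_Mapping.lookup m S + Poly_Mapping.lookup l S = (if S \<in> M then 1 else 0)" for S
        using arg_cong[OF eq, of "\<lambda>m. Poly_Mapping.lookup m S"] by (simp add: lookup_add lookup_mono_of[OF finM])
      have sub: "Poly_Mapping.keys m \<subseteq> M"
      proof
        fix S assume "S \<in> Poly_Mapping.keys m"
        then show "S \<in> M" using le[of S] by (auto simp: in_keys_iff split: if_splits)
      qed
      have "m = mono_of (Poly_Mapping.keys m)"
      proof (rule poly_mapping_eqI)
        fix S
        show "Poly_Mapping.lookup m S = Poly_Mapping.lookup (mono_of (Poly_Mapping.keys m)) S"
          using le[of S] by (auto simp: lookup_mono_of in_keys_iff split: if_splits)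
      qed
      then show False using False sub M by blast
    qed
    then show "Poly_Mapping.lookup (Poly_Mapping.single m c * F) (mono_of M) * h M = 0"
      by (simp add: lookup_single_mult)
  qed
  moreover have "matching_pairing n 0 (\<lambda>M. 0) F = 0" for F by (simp add: matching_pairing_def)
  ultimately show ?thesis using harmonics_0 by (intro exI[of _ 0] bexI[of _ "\<lambda>M. 0"]) auto
next
  case True
  then obtain K M where KM: "K \<subseteq> M" "M \<in> matchings {1..n} d" "m = mono_of K" by blast
  let ?X = "{1..n}" and ?k = "card K"
  let ?Y = "?X - \<Union>K"
  have finX: "finite ?X" by simp
  have finK: "finite K" using interval_matching_finite[OF KM(2)] KM(1) finite_subset by blast
  have K: "K \<in> matchings ?X ?k" by (rule matchings_Diff(1)[OF finX KM(2,1)])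
  have kd: "?k \<le> d" using card_mono[OF interval_matching_finite[OF KM(2)] KM(1)] matchings_card[OF KM(2)] by simp
  let ?h = "\<lambda>L. if L \<in> matchings ?Y (d - ?k) then h (K \<union> L) else 0"
  have "matching_pairing n d h (Poly_Mapping.single m c * F) = c * matching_pairing n (d - ?k) ?h F" for F
  proof -
    let ?L = "Poly_Mapping.lookup F"
    have look: "Poly_Mapping.lookup (Poly_Mapping.single m c * F) (mono_of N) = (if K \<subseteq> N then c * ?L (mono_of (N - K)) else 0)"
      if N: "N \<in> matchings ?X d" for N
    proof -
      note finN = interval_matching_finite[OF N]
      have eq: "m + l = mono_of N \<longleftrightarrow> K \<subseteq> N \<and> l = mono_of (N - K)" for l
      proof
        assume e: "m + l = mono_of N"
        have "K \<subseteq> N"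
        proof
          fix S assume "S \<in> K"
          then show "S \<in> N"
            using arg_cong[OF e, of "\<lambda>m. Poly_Mapping.lookup m S"]
            by (auto simp: lookup_add lookup_mono_of[OF finN] lookup_mono_of[OF finK] KM(3) split: if_splits)
        qed
        moreover have "m + l = m + mono_of (N - K)"
          using e mono_of_Un[OF finK, of "N - K"] finN \<open>K \<subseteq> N\<close> by (simp add: KM(3) Un_absorb1)
        ultimately show "K \<subseteq> N \<and> l = mono_of (N - K)" by simp
      next
        assume "K \<subseteq> N \<and> l = mono_of (N - K)"
        then show "m + l = mono_of N"
          using mono_of_Un[OF finK, of "N - K"] finN by (simp add: KM(3) Un_absorb1)
      qed
      show ?thesis
        unfolding lookup_single_mult eq by (cases "K \<subseteq> N") (auto simp: in_keys_iff)
    qed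
    have "matching_pairing n d h (Poly_Mapping.single m c * F) =
        (\<Sum>N\<in>matchings ?X d. if K \<subseteq> N then c * ?L (mono_of (N - K)) * h N else 0)"
      unfolding matching_pairing_def by (rule sum.cong[OF refl]) (simp add: look)
    also have "\<dots> = (\<Sum>N\<in>{N \<in> matchings ?X d. K \<subseteq> N}. c * ?L (mono_of (N - K)) * h N)"
      by (rule sum.inter_filter[symmetric]) simp
    also have "\<dots> = (\<Sum>L\<in>matchings ?Y (d - ?k). c * ?L (mono_of L) * h (K \<union> L))"
    proof (rule sum.reindex_bij_witness[where i = "\<lambda>L. K \<union> L" and j = "\<lambda>N. N - K"])
      fix N assume N: "N \<in> {N \<in> matchings ?X d. K \<subseteq> N}"
      show "K \<union> (N - K) = N" using N by blast
      show "N - K \<in> matchings ?Y (d - ?k)" using matchings_Diff(2)[OF finX, of N d K] N by blast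
      show "c * ?L (mono_of (N - K)) * h (K \<union> (N - K)) = c * ?L (mono_of (N - K)) * h N"
        using \<open>K \<union> (N - K) = N\<close> by simp
    next
      fix L assume L: "L \<in> matchings ?Y (d - ?k)"
      note U = matchings_Un[OF finX K L]
      show "K \<union> L - K = L" using U(1) by blast
      show "K \<union> L \<in> {N \<in> matchings ?X d. K \<subseteq> N}" using U(2) kd by simp
    qed
    also have "\<dots> = (\<Sum>L\<in>matchings ?X (d - ?k). c * (?L (mono_of L) * ?h L))"
    proof (rule sum.mono_neutral_cong_left)
      show "matchings ?Y (d - ?k) \<subseteq> matchings ?X (d - ?k)" using nsets_mono[of ?Y ?X 2] by (auto simp: matchings_def)
    qed auto
    finally show ?thesis by (simp add: matching_pairing_def sum_distrib_left)
  qed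
  then show ?thesis using harmonics_link[OF finX h K] by blast
qed

text \<open>This is an ideal that contains the generators, hence the whole relation ideal, and the polynomial of
a nonzero harmonic function does not lie in it.\<close>

definition harmonic_annihilator :: "nat \<Rightarrow> cpoly set" where
  "harmonic_annihilator n = {F \<in> carrier (pair_poly_ring n). \<forall>d. \<forall>h\<in>harmonics {1..n} d. matching_pairing n d h F = 0}"

lemma ideal_harmonic_annihilator: "ideal (harmonic_annihilator n) (pair_poly_ring n)"
proof (rule ideal_pair_poly_ring)
  show "r * F \<in> harmonic_annihilator n" if r: "r \<in> carrier (pair_poly_ring n)" and F: "F \<in> harmonic_annihilator n" for r F
    unfolding harmonic_annihilator_def
  proof (intro CollectI conjI allI ballI)
    show "r * F \<in> carrier (pair_poly_ring n)"
      using r F by (auto simp: harmonic_annihilator_def intro: pair_poly_ring_closed)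
    fix d h assume h: "h \<in> harmonics {1..n} d"
    have "matching_pairing n d h (Poly_Mapping.single m c * F) = 0" for m c
      using matching_pairing_single_mult[OF h, of m c] F by (auto simp: harmonic_annihilator_def)
    moreover have "r * F = (\<Sum>m\<in>Poly_Mapping.keys r. Poly_Mapping.single m (Poly_Mapping.lookup r m) * F)"
      by (subst poly_mapping_sum_single[of r]) (simp add: sum_distrib_right)
    ultimately show "matching_pairing n d h (r * F) = 0" by (simp add: matching_pairing_sum)
  qed
qed (auto simp: harmonic_annihilator_def matching_pairing_add pair_poly_ring_closed)

lemma relation_ideal_subset_annihilator: "relation_ideal n \<subseteq> harmonic_annihilator n"
proof (rule relation_ideal_minimal[OF ideal_harmonic_annihilator])
  show "relations n \<subseteq> harmonic_annihilator n"
  proof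
    fix f assume f: "f \<in> relations n"
    then consider (overlap) S T where "f = Var S * Var T" "S \<in> pairs n" "T \<in> pairs n" "S \<inter> T \<noteq> {}"
      | (star) i where "f = (\<Sum>j\<in>{1..n} - {i}. Var {i, j})" "i \<in> {1..n}"
      unfolding relations_def by blast
    then have "matching_pairing n d h f = 0" if h: "h \<in> harmonics {1..n} d" for d h
    proof cases
      case overlap
      have "Poly_Mapping.lookup f (mono_of M) = 0" if M: "M \<in> matchings {1..n} d" for M
      proof (rule ccontr)
        assume "Poly_Mapping.lookup f (mono_of M) \<noteq> 0"
        then have eq: "Poly_Mapping.single S 1 + Poly_Mapping.single T 1 = mono_of M"
          by (simp add: overlap(1) Var_def mult_single lookup_single when_def split: if_splits)
        have MST: "M = {S, T}" using arg_cong[OF eq, of Poly_Mapping.keys] keys_pair[of S T] interval_matching_finite[OF M] by simp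
        have "S = T"
        proof (rule ccontr)
          assume "S \<noteq> T"
          then show False using M MST overlap(4) by (auto simp: matchings_def disjoint_def)
        qed
        then show False
          using arg_cong[OF eq, of "\<lambda>m. Poly_Mapping.lookup m S"] interval_matching_finite[OF M]
          by (simp add: lookup_add lookup_mono_of split: if_splits)
      qed
      then show ?thesis by (simp add: matching_pairing_def)
    next
      case star
      have look: "Poly_Mapping.lookup f (mono_of M) = (\<Sum>j\<in>{1..n} - {i}. if M = {{i, j}} then 1 else 0)"
        if M: "M \<in> matchings {1..n} d" for M
        unfolding star(1) Var_def lookup_sum
      proof (rule sum.cong[OF refl])
        fix j
        have "mono_of {{i, j}} = Poly_Mapping.single {i, j} 1" by (simp add: mono_of_def)
        then have "(Poly_Mapping.single {i, j} 1 = mono_of M) \<longleftrightarrow> M = {{i, j}}"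
          using mono_of_inj[OF interval_matching_finite[OF M], of "{{i, j}}"] by auto
        then show "Poly_Mapping.lookup (Poly_Mapping.single (Poly_Mapping.single {i, j} 1) 1) (mono_of M) =
            (if M = {{i, j}} then 1 else 0 :: complex)" by (simp add: lookup_single when_def)
      qed
      show ?thesis
      proof (cases "d = 1")
        case True
        have s: "({}, i) \<in> stars {1..n} d" using star(2) True by (simp add: stars_def all_matchings_def)
        have "matching_pairing n d h f = (\<Sum>M\<in>matchings {1..n} d. h M * star_relation {1..n} ({}, i) M)"
          unfolding matching_pairing_def
        proof (rule sum.cong[OF refl])
          fix M assume M: "M \<in> matchings {1..n} d"
          have "(\<Sum>j\<in>{1..n} - {i}. if M = {{i, j}} then 1 else 0 :: complex) = star_relation {1..n} ({}, i) M"
          proof (cases "\<exists>k\<in>{1..n} - {i}. M = {{i, k}}")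
            case True
            then obtain k where k: "k \<in> {1..n} - {i}" "M = {{i, k}}" by blast
            have "(\<Sum>j\<in>{1..n} - {i}. if M = {{i, j}} then 1 else 0 :: complex) = (\<Sum>j\<in>{1..n} - {i}. if j = k then 1 else 0)"
              by (rule sum.cong) (auto simp: k(2) doubleton_eq_iff)
            then show ?thesis using k by (auto simp: star_relation_def)
          next
            case False
            then have "(\<Sum>j\<in>{1..n} - {i}. if M = {{i, j}} then 1 else 0 :: complex) = 0" by (intro sum.neutral) auto
            then show ?thesis using False by (auto simp: star_relation_def)
          qed
          then show "Poly_Mapping.lookup f (mono_of M) * h M = h M * star_relation {1..n} ({}, i) M"
            by (simp add: look[OF M])
        qed
        also have "\<dots> = (\<Sum>j\<in>{1..n} - \<Union>{} - {i}. h (insert {i, j} {}))"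
          by (rule sum_star_relation[OF _ s]) simp
        also have "\<dots> = 0"
          by (rule harmonicD[of _ d _ _ 0]) (use h True star(2) in \<open>auto simp: harmonics_def matchings_def\<close>)
        finally show ?thesis .
      next
        case False
        have "Poly_Mapping.lookup f (mono_of M) = 0" if M: "M \<in> matchings {1..n} d" for M
          unfolding look[OF M] by (rule sum.neutral) (use matchings_card[OF M] False in auto)
        then show ?thesis by (simp add: matching_pairing_def)
      qed
    qed
    then show "f \<in> harmonic_annihilator n"
      using f relations_carrier by (auto simp: harmonic_annihilator_def)
  qed
qed

lemma matching_poly_harmonic_injective:
  assumes h: "h \<in> harmonics {1..n} d" and "matching_poly n d h \<in> relation_ideal n"
  shows "h M = 0"
proof -
  let ?M = "matchings {1..n} d"
  have "matching_pairing n d (\<lambda>M. cnj (h M)) (matching_poly n d h) = 0"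
    using assms(2) relation_ideal_subset_annihilator harmonics_cnj[OF h] by (auto simp: harmonic_annihilator_def)
  moreover have "matching_pairing n d (\<lambda>M. cnj (h M)) (matching_poly n d h) = (\<Sum>M\<in>?M. of_real ((cmod (h M))\<^sup>2))"
    unfolding matching_pairing_def complex_norm_square by (rule sum.cong[OF refl]) (simp add: lookup_matching_poly)
  ultimately have "complex_of_real (\<Sum>M\<in>?M. (cmod (h M))\<^sup>2) = 0" by (simp only: of_real_sum)
  then have "(\<Sum>M\<in>?M. (cmod (h M))\<^sup>2) = 0" by (simp only: of_real_eq_0_iff)
  then have "\<forall>M\<in>?M. h M = 0" by (simp add: sum_nonneg_eq_0_iff)
  then show ?thesis using h by (auto simp: harmonics_def)
qed

section \<open>The action on polynomials\<close>

definition perm_mono :: "(nat \<Rightarrow> nat) \<Rightarrow> mono \<Rightarrow> mono" where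
  "perm_mono w m = (\<Sum>S\<in>Poly_Mapping.keys m. Poly_Mapping.single (w ` S) (Poly_Mapping.lookup m S))"

lemma Var_power: "Var T ^ k = Poly_Mapping.single (Poly_Mapping.single T k) 1"
proof (induction k)
  case (Suc k)
  show ?case
    unfolding power_Suc Suc
    unfolding Var_def mult_single by (simp add: single_add[symmetric])
qed simp

lemma prod_single_1: "(\<Prod>S\<in>A. Poly_Mapping.single (f S) (1::complex)) = (Poly_Mapping.single (\<Sum>S\<in>A. f S) 1 :: cpoly)"
  by (induction A rule: infinite_finite_induct) (auto simp: mult_single)

lemma perm_poly_eq:
  "perm_poly w f = (\<Sum>m\<in>Poly_Mapping.keys f. Poly_Mapping.single (perm_mono w m) (Poly_Mapping.lookup f m))"
  unfolding perm_poly_def poly_hom_def Var_power prod_single_1 perm_mono_def Const_def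
  by (simp add: mult_single)

lemma perm_poly_superset:
  assumes "finite A" "Poly_Mapping.keys f \<subseteq> A"
  shows "perm_poly w f = (\<Sum>m\<in>A. Poly_Mapping.single (perm_mono w m) (Poly_Mapping.lookup f m))"
  unfolding perm_poly_eq by (rule sum.mono_neutral_left) (use assms in \<open>auto simp: in_keys_iff\<close>)

lemma perm_poly_0 [simp]: "perm_poly w 0 = 0"
  by (simp add: perm_poly_eq)

lemma perm_poly_add: "perm_poly w (f + g) = perm_poly w f + perm_poly w g"
proof -
  let ?A = "Poly_Mapping.keys f \<union> Poly_Mapping.keys g"
  have "perm_poly w (f + g) = (\<Sum>m\<in>?A. Poly_Mapping.single (perm_mono w m) (Poly_Mapping.lookup (f + g) m))"
    by (rule perm_poly_superset) (auto simp: Poly_Mapping.keys_add)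
  also have "\<dots> = perm_poly w f + perm_poly w g"
    by (simp add: perm_poly_superset[of ?A] lookup_add single_add sum.distrib)
  finally show ?thesis .
qed

lemma perm_poly_sum: "perm_poly w (sum f A) = (\<Sum>a\<in>A. perm_poly w (f a))"
  by (induction A rule: infinite_finite_induct) (auto simp: perm_poly_add)

lemma perm_poly_single: "perm_poly w (Poly_Mapping.single m c) = Poly_Mapping.single (perm_mono w m) c"
  by (cases "c = 0") (auto simp: perm_poly_eq)

lemma lookup_perm_mono:
  assumes "bij w"
  shows "Poly_Mapping.lookup (perm_mono w m) T = Poly_Mapping.lookup m (pinv w ` T)"
proof -
  have iff: "w ` S = T \<longleftrightarrow> S = pinv w ` T" for S
    using assms by (metis bij_is_inj bij_is_surj image_f_inv_f image_inv_f_f)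
  have "Poly_Mapping.lookup (perm_mono w m) T =
      (\<Sum>S\<in>Poly_Mapping.keys m. if S = pinv w ` T then Poly_Mapping.lookup m S else 0)"
    unfolding perm_mono_def lookup_sum by (rule sum.cong) (auto simp: lookup_single when_def iff)
  then show ?thesis by (simp add: in_keys_iff)
qed

lemma perm_mono_add: "bij w \<Longrightarrow> perm_mono w (m + l) = perm_mono w m + perm_mono w l"
  by (rule poly_mapping_eqI) (simp add: lookup_perm_mono lookup_add)

lemma perm_mono_inverse: "bij w \<Longrightarrow> perm_mono w (perm_mono (pinv w) m) = m"
  by (rule poly_mapping_eqI)
     (simp add: lookup_perm_mono bij_imp_bij_inv inv_inv_eq image_f_inv_f bij_is_surj)

lemma perm_poly_mult:
  assumes "bij w"
  shows "perm_poly w (f * g) = perm_poly w f * perm_poly w g"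
proof -
  let ?F = "Poly_Mapping.lookup f" and ?G = "Poly_Mapping.lookup g"
  have "f * g = (\<Sum>m\<in>Poly_Mapping.keys f. Poly_Mapping.single m (?F m)) * (\<Sum>l\<in>Poly_Mapping.keys g. Poly_Mapping.single l (?G l))"
    using poly_mapping_sum_single[of f] poly_mapping_sum_single[of g] by simp
  also have "\<dots> = (\<Sum>m\<in>Poly_Mapping.keys f. \<Sum>l\<in>Poly_Mapping.keys g. Poly_Mapping.single (m + l) (?F m * ?G l))"
    by (simp add: sum_product mult_single)
  finally have "perm_poly w (f * g) = (\<Sum>m\<in>Poly_Mapping.keys f. \<Sum>l\<in>Poly_Mapping.keys g.
      Poly_Mapping.single (perm_mono w m) (?F m) * Poly_Mapping.single (perm_mono w l) (?G l))"
    by (simp add: perm_poly_sum perm_poly_single perm_mono_add[OF assms] mult_single)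
  then show ?thesis by (simp add: perm_poly_eq sum_product)
qed

lemma perm_poly_Var: "perm_poly w (Var S) = Var (w ` S)"
  by (simp add: Var_def perm_poly_single perm_mono_def)

lemma permutes_nsets_iff:
  assumes "w permutes X"
  shows "w ` S \<in> nsets X k \<longleftrightarrow> S \<in> nsets X k"
  using nsets_image_iff[OF permutes_inj[OF assms], of S X k] by (simp add: permutes_image[OF assms])

lemma perm_poly_carrier:
  assumes "w permutes {1..n}" "f \<in> carrier (pair_poly_ring n)"
  shows "perm_poly w f \<in> carrier (pair_poly_ring n)"
  unfolding perm_poly_eq
proof (rule pair_poly_ring_sum_closed, rule single_carrier)
  fix m assume m: "m \<in> Poly_Mapping.keys f"
  show "Poly_Mapping.keys (perm_mono w m) \<subseteq> pairs n"
  proof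
    fix T assume T: "T \<in> Poly_Mapping.keys (perm_mono w m)"
    obtain S where "S \<in> Poly_Mapping.keys m" "T = w ` S"
      using subsetD[OF keys_sum T[unfolded perm_mono_def]] by (auto split: if_splits)
    then show "T \<in> pairs n"
      using assms(2) m permutes_nsets_iff[OF assms(1)] by (auto simp: pair_poly_ring_simps(1))
  qed
qed

lemma perm_poly_inverse:
  assumes "bij w"
  shows "perm_poly w (perm_poly (pinv w) f) = f"
proof -
  have "perm_poly w (perm_poly (pinv w) f) = (\<Sum>m\<in>Poly_Mapping.keys f. Poly_Mapping.single m (Poly_Mapping.lookup f m))"
    by (simp add: perm_poly_eq[of "pinv w" f] perm_poly_sum perm_poly_single perm_mono_inverse[OF assms])
  then show ?thesis using poly_mapping_sum_single[of f] by simp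
qed

lemma perm_poly_relation_ideal:
  assumes w: "w permutes {1..n}" and f: "f \<in> relation_ideal n"
  shows "perm_poly w f \<in> relation_ideal n"
proof -
  let ?A = "{f \<in> carrier (pair_poly_ring n). perm_poly w f \<in> relation_ideal n}"
  note I = ideal_closed[OF ideal_relation_ideal[of n]]
  have bw: "bij w" using permutes_bij[OF w] .
  have "ideal ?A (pair_poly_ring n)"
  proof (rule ideal_pair_poly_ring)
    show "0 \<in> ?A" using I(2) by (simp add: pair_poly_ring_closed(1))
    show "g + h \<in> ?A" if "g \<in> ?A" "h \<in> ?A" for g h
      using that I(3) by (simp add: pair_poly_ring_closed(2) perm_poly_add)
    show "r * g \<in> ?A" if "r \<in> carrier (pair_poly_ring n)" "g \<in> ?A" for r g
      using that I(4)[OF perm_poly_carrier[OF w that(1)]] by (simp add: pair_poly_ring_closed(3) perm_poly_mult[OF bw])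
  qed blast
  moreover have "relations n \<subseteq> ?A"
  proof
    fix g assume g: "g \<in> relations n"
    then consider (overlap) S T where "g = Var S * Var T" "S \<in> pairs n" "T \<in> pairs n" "S \<inter> T \<noteq> {}"
      | (star) i where "g = (\<Sum>j\<in>{1..n} - {i}. Var {i, j})" "i \<in> {1..n}"
      unfolding relations_def by blast
    then have "perm_poly w g \<in> relations n"
    proof cases
      case overlap
      have "w ` S \<in> pairs n" "w ` T \<in> pairs n" using overlap permutes_nsets_iff[OF w] by blast+
      moreover have "w ` S \<inter> w ` T \<noteq> {}" using overlap(4) by blast
      moreover have "perm_poly w g = Var (w ` S) * Var (w ` T)"
        by (simp add: overlap(1) perm_poly_mult[OF bw] perm_poly_Var)
      ultimately show ?thesis unfolding relations_def by blast
    next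
      case star
      have "perm_poly w g = (\<Sum>j\<in>{1..n} - {i}. Var {w i, w j})"
        by (simp add: star(1) perm_poly_sum perm_poly_Var)
      also have "\<dots> = (\<Sum>j\<in>w ` ({1..n} - {i}). Var {w i, j})"
        by (subst sum.reindex) (auto intro: inj_on_subset[OF bij_is_inj[OF bw]])
      also have "w ` ({1..n} - {i}) = {1..n} - {w i}"
        unfolding image_set_diff[OF bij_is_inj[OF bw]] permutes_image[OF w] by simp
      finally have "perm_poly w g = (\<Sum>j\<in>{1..n} - {w i}. Var {w i, j})" .
      moreover have "w i \<in> {1..n}" using permutes_in_image[OF w] star(2) by blast
      ultimately show ?thesis unfolding relations_def by blast
    qed
    then show "g \<in> ?A" using g relations_carrier relations_subset by blast
  qed
  ultimately have "relation_ideal n \<subseteq> ?A" by (rule relation_ideal_minimal)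
  then show ?thesis using f by blast
qed

lemma coset_eq: "J +>\<^bsub>pair_poly_ring n\<^esub> f = {h + f | h. h \<in> J}"
  by (auto simp: a_r_coset_def' pair_poly_ring_simps)

text \<open>The relation ideal is mapped into itself by \<open>w\<close> and by the inverse of \<open>w\<close>, hence onto itself.\<close>

lemma perm_poly_coset:
  assumes w: "w permutes {1..n}"
  shows "perm_poly w ` (relation_ideal n +>\<^bsub>pair_poly_ring n\<^esub> f) = relation_ideal n +>\<^bsub>pair_poly_ring n\<^esub> perm_poly w f"
proof
  have bw: "bij w" using permutes_bij[OF w] .
  show "perm_poly w ` (relation_ideal n +>\<^bsub>pair_poly_ring n\<^esub> f) \<subseteq> relation_ideal n +>\<^bsub>pair_poly_ring n\<^esub> perm_poly w f"
    unfolding coset_eq using perm_poly_relation_ideal[OF w] by (auto simp: perm_poly_add)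
  show "relation_ideal n +>\<^bsub>pair_poly_ring n\<^esub> perm_poly w f \<subseteq> perm_poly w ` (relation_ideal n +>\<^bsub>pair_poly_ring n\<^esub> f)"
  proof
    fix g assume "g \<in> relation_ideal n +>\<^bsub>pair_poly_ring n\<^esub> perm_poly w f"
    then obtain h where h: "h \<in> relation_ideal n" "g = h + perm_poly w f" unfolding coset_eq by blast
    have "perm_poly (pinv w) h \<in> relation_ideal n" by (rule perm_poly_relation_ideal[OF permutes_inv[OF w] h(1)])
    moreover have "g = perm_poly w (perm_poly (pinv w) h + f)"
      by (simp add: h(2) perm_poly_add perm_poly_inverse[OF bw])
    ultimately show "g \<in> perm_poly w ` (relation_ideal n +>\<^bsub>pair_poly_ring n\<^esub> f)" unfolding coset_eq by blast
  qed
qed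

lemma perm_mono_mono_of:
  assumes "bij w" "finite M"
  shows "perm_mono w (mono_of M) = mono_of ((`) w ` M)"
proof -
  have "inj_on ((`) w) M" using bij_is_inj[OF assms(1)] by (simp add: inj_on_def inj_image_eq_iff)
  then show ?thesis using assms(2) by (simp add: perm_mono_def mono_of_def[of "(`) w ` M"] sum.reindex lookup_mono_of)
qed

lemma matchings_image:
  assumes w: "w permutes X" and M: "M \<in> matchings X d"
  shows "(`) w ` M \<in> matchings X d"
proof -
  have inj: "inj w" using permutes_inj[OF w] .
  have "(`) w ` M \<subseteq> nsets X 2" using M permutes_nsets_iff[OF w] by (auto simp: matchings_def)
  moreover have "disjoint ((`) w ` M)"
    using M inj_on_subset[OF inj] by (intro disjoint_image) (auto simp: matchings_def)
  moreover have "card ((`) w ` M) = d"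
    using M inj by (subst card_image) (auto simp: inj_on_def inj_image_eq_iff matchings_def)
  ultimately show ?thesis by (simp add: matchings_def)
qed

lemma perm_matching_poly:
  assumes w: "w permutes {1..n}"
  shows "perm_poly w (matching_poly n d g) = matching_poly n d (\<lambda>M. g ((`) (pinv w) ` M))"
proof -
  have bw: "bij w" using permutes_bij[OF w] .
  have iw: "pinv w (w x) = x" "w (pinv w x) = x" for x
    using bw by (simp_all add: bij_is_inj surj_f_inv_f[OF bij_is_surj])
  have "perm_poly w (matching_poly n d g) = (\<Sum>M\<in>matchings {1..n} d. Poly_Mapping.single (mono_of ((`) w ` M)) (g M))"
    unfolding matching_poly_def perm_poly_sum perm_poly_single
    by (rule sum.cong[OF refl]) (simp only: perm_mono_mono_of[OF bw interval_matching_finite])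
  also have "\<dots> = (\<Sum>M\<in>matchings {1..n} d. Poly_Mapping.single (mono_of M) (g ((`) (pinv w) ` M)))"
  proof (rule sum.reindex_bij_witness[where i = "\<lambda>M. (`) (pinv w) ` M" and j = "\<lambda>M. (`) w ` M"])
    fix M assume M: "M \<in> matchings {1..n} d"
    show "(`) w ` M \<in> matchings {1..n} d" by (rule matchings_image[OF w M])
    show "(`) (pinv w) ` M \<in> matchings {1..n} d" by (rule matchings_image[OF permutes_inv[OF w] M])
  qed (simp_all add: image_image iw)
  finally show ?thesis by (simp add: matching_poly_def)
qed

section \<open>Graded components\<close>

lemma row_pairings_diff: "row_pairings (u - v) M = row_pairings u M - row_pairings v M"
  using row_pairings_add[of "u - v" v M] by simp

lemma specht_diff_closed: "u \<in> carrier (specht \<mu>) \<Longrightarrow> v \<in> carrier (specht \<mu>) \<Longrightarrow> u - v \<in> carrier (specht \<mu>)"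
  unfolding specht_carrier by (rule tabloid_space.span_diff)

definition shape_multiplicity :: "nat \<Rightarrow> nat \<Rightarrow> nat list \<Rightarrow> nat" where
  "shape_multiplicity a d \<mu> = (if \<mu> \<in> shapes a d then 1 else 0)"

lemma specht_indices_shapes: "specht_indices (2 * a) (shape_multiplicity a d) = shapes a d \<times> {0}"
  by (auto simp: specht_indices_def shape_multiplicity_def shapes_def even_partitions_def split: if_splits)

definition component_function :: "nat \<Rightarrow> nat \<Rightarrow> (nat list \<times> nat \<Rightarrow> tabloid \<Rightarrow>\<^sub>0 complex) \<Rightarrow> nat set set \<Rightarrow> complex" where
  "component_function a d x M = (\<Sum>\<mu>\<in>shapes a d. row_pairings (x (\<mu>, 0)) M)"

definition component_map :: "nat \<Rightarrow> nat \<Rightarrow> (nat list \<times> nat \<Rightarrow> tabloid \<Rightarrow>\<^sub>0 complex) \<Rightarrow> cpoly set" where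
  "component_map a d x = relation_ideal (2 * a) +>\<^bsub>pair_poly_ring (2 * a)\<^esub> matching_poly (2 * a) d (component_function a d x)"

text \<open>Injectivity combines \<open>matching_poly_harmonic_injective\<close> with \<open>sum_row_pairings_eq_0\<close>; surjectivity combines
\<open>homogeneous_reduces_to_harmonic\<close> with \<open>harmonics_eq_specht_sum\<close>.\<close>

lemma component_map_iso:
  assumes a: "a > 0"
  shows "is_module_iso (2 * a) (component_map a d) (specht_sum (2 * a) (shape_multiplicity a d))
    (orbit_component (2 * a) (partition_locus (2 * a) (replicate a 2)) d)"
proof -
  let ?n = "2 * a" 
  let ?P = "pair_poly_ring ?n" and ?J = "relation_ideal ?n" and ?X = "{1..?n}" and ?S = "shapes a d"
  let ?W = "specht_sum ?n (shape_multiplicity a d)"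
  let ?V = "orbit_component ?n (partition_locus ?n (replicate a 2)) d"
  let ?f = "component_function a d" and ?mp = "matching_poly ?n d"
  have W: "carrier ?W = (\<Pi>\<^sub>E i\<in>?S \<times> {0}. carrier (specht (fst i)))"
    by (simp add: specht_sum_simps specht_indices_shapes)
  have V: "carrier ?V = {?J +>\<^bsub>?P\<^esub> f | f. f \<in> carrier ?P \<and> homogeneous d f}"
    "\<And>X Y. X \<oplus>\<^bsub>?V\<^esub> Y = X <+>\<^bsub>?P\<^esub> Y"
    "\<And>c X. c \<odot>\<^bsub>?V\<^esub> X = [mod ?J:] (?J +>\<^bsub>?P\<^esub> Const c) \<Otimes>\<^bsub>?P\<^esub> X"
    "\<And>w X. act ?V w X = perm_poly w ` X"
    by (simp_all add: orbit_component_def orbit_ring_def FactRing_def gr_ideal_eq_relation_ideal[OF a])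
  interpret J: ideal ?J ?P by (rule ideal_relation_ideal)
  have mem: "x (\<mu>, 0) \<in> carrier (specht \<mu>)" if "x \<in> carrier ?W" "\<mu> \<in> ?S" for x \<mu>
    using PiE_mem[OF that(1)[unfolded W], of "(\<mu>, 0)"] that(2) by simp
  have harm: "?f x \<in> harmonics ?X d" if "x \<in> carrier ?W" for x
    using row_pairings_shapes_harmonics[OF a, of d "\<lambda>\<mu>. x (\<mu>, 0)"] mem[OF that]
    by (simp add: component_function_def[abs_def])
  have closed: "?mp g \<in> carrier ?P" "homogeneous d (?mp g)" for g
    by (rule matching_poly_carrier matching_poly_homogeneous)+
  have part: "is_partition \<mu> ?n \<and> (\<forall>p\<in>set \<mu>. even p)" if "\<mu> \<in> ?S" for \<mu>
    using that by (simp add: shapes_def even_partitions_def)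
  have "inj_on (component_map a d) (carrier ?W)"
  proof (rule inj_onI)
    fix x y assume x: "x \<in> carrier ?W" and y: "y \<in> carrier ?W" and eq: "component_map a d x = component_map a d y"
    have "?mp (?f x) - ?mp (?f y) \<in> ?J"
      using eq coset_eq_iff[OF ideal_relation_ideal closed(1) closed(1)] by (simp add: component_map_def)
    then have "?mp (\<lambda>M. ?f x M - ?f y M) \<in> ?J" by (simp add: matching_poly_diff)
    then have "?f x M - ?f y M = 0" for M
      by (rule matching_poly_harmonic_injective[OF harmonics_diff[OF harm[OF x] harm[OF y]]])
    then have zero: "(\<Sum>\<mu>\<in>?S. row_pairings (x (\<mu>, 0) - y (\<mu>, 0)) M) = 0" for M
      by (simp only: row_pairings_diff sum_subtractf component_function_def)
    have "x (\<mu>, 0) = y (\<mu>, 0)" if mu: "\<mu> \<in> ?S" for \<mu>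
    proof -
      have "x (\<mu>, 0) - y (\<mu>, 0) = 0"
      proof (rule sum_row_pairings_eq_0[OF finite_shapes part _ zero mu])
        show "x (\<nu>, 0) - y (\<nu>, 0) \<in> carrier (specht \<nu>)" if "\<nu> \<in> ?S" for \<nu>
          by (intro specht_diff_closed mem[OF x that] mem[OF y that])
      qed
      then show ?thesis by simp
    qed
    then show "x = y"
      using x y unfolding W by (intro PiE_ext[of x _ _ y]) auto
  qed
  moreover have "component_map a d ` carrier ?W = carrier ?V"
  proof
    show "component_map a d ` carrier ?W \<subseteq> carrier ?V"
      unfolding V component_map_def using closed by blast
    show "carrier ?V \<subseteq> component_map a d ` carrier ?W"
    proof
      fix Y assume "Y \<in> carrier ?V"
      then obtain f where f: "f \<in> carrier ?P" "homogeneous d f" "Y = ?J +>\<^bsub>?P\<^esub> f" unfolding V by blast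
      obtain h where h: "h \<in> harmonics ?X d" "f - ?mp h \<in> ?J"
        using homogeneous_reduces_to_harmonic[OF f(1,2)] by blast
      obtain y where y: "\<forall>\<mu>\<in>?S. y \<mu> \<in> carrier (specht \<mu>)" "\<forall>M. h M = (\<Sum>\<mu>\<in>?S. row_pairings (y \<mu>) M)"
        using harmonics_eq_specht_sum[OF a h(1)] by blast
      let ?x = "\<lambda>i\<in>?S \<times> {0}. y (fst i)"
      have "?x \<in> carrier ?W" unfolding W using y(1) by auto
      moreover have "?f ?x = h" using y(2) by (auto simp: component_function_def fun_eq_iff)
      moreover have "Y = ?J +>\<^bsub>?P\<^esub> ?mp h"
        unfolding f(3) using coset_eq_iff[OF ideal_relation_ideal f(1) closed(1)] h(2) by blast
      ultimately show "Y \<in> component_map a d ` carrier ?W" by (force simp: component_map_def)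
    qed
  qed
  moreover have "component_map a d (x \<oplus>\<^bsub>?W\<^esub> y) = component_map a d x \<oplus>\<^bsub>?V\<^esub> component_map a d y"
    if "x \<in> carrier ?W" "y \<in> carrier ?W" for x y
  proof -
    have "?f (x \<oplus>\<^bsub>?W\<^esub> y) = (\<lambda>M. ?f x M + ?f y M)"
      by (auto simp: fun_eq_iff component_function_def specht_sum_simps specht_indices_shapes row_pairings_add sum.distrib)
    then have "component_map a d (x \<oplus>\<^bsub>?W\<^esub> y) = ?J +>\<^bsub>?P\<^esub> (?mp (?f x) \<oplus>\<^bsub>?P\<^esub> ?mp (?f y))"
      by (simp add: component_map_def matching_poly_add pair_poly_ring_simps)
    also have "\<dots> = component_map a d x \<oplus>\<^bsub>?V\<^esub> component_map a d y"
      unfolding V component_map_def by (rule J.a_rcos_sum[OF closed(1) closed(1), symmetric])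
    finally show ?thesis .
  qed
  moreover have "component_map a d (c \<odot>\<^bsub>?W\<^esub> x) = c \<odot>\<^bsub>?V\<^esub> component_map a d x" if "x \<in> carrier ?W" for c x
  proof -
    have "?f (c \<odot>\<^bsub>?W\<^esub> x) = (\<lambda>M. c * ?f x M)"
      by (auto simp: fun_eq_iff component_function_def specht_sum_simps specht_indices_shapes row_pairings_scale sum_distrib_left)
    then have "component_map a d (c \<odot>\<^bsub>?W\<^esub> x) = ?J +>\<^bsub>?P\<^esub> (Const c \<otimes>\<^bsub>?P\<^esub> ?mp (?f x))"
      by (simp add: component_map_def matching_poly_scale pair_poly_ring_simps)
    also have "\<dots> = c \<odot>\<^bsub>?V\<^esub> component_map a d x"
      unfolding V component_map_def
      by (rule J.rcoset_mult_add[OF _ closed(1), symmetric]) (simp add: Const_def single_carrier)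
    finally show ?thesis .
  qed
  moreover have "component_map a d (act ?W w x) = act ?V w (component_map a d x)"
    if w: "w permutes {1..?n}" and "x \<in> carrier ?W" for w x
  proof -
    have "?f (act ?W w x) = (\<lambda>M. ?f x ((`) (pinv w) ` M))"
      by (auto simp: fun_eq_iff component_function_def specht_sum_simps specht_indices_shapes row_pairings_perm[OF permutes_bij[OF w]])
    then show ?thesis
      by (simp add: component_map_def V(4) perm_poly_coset[OF w] perm_matching_poly[OF w])
  qed
  ultimately show ?thesis by (simp add: is_module_iso_def bij_betw_def)
qed

lemma Frob_component:
  assumes "a > 0"
  shows "Frob (2 * a) (orbit_component (2 * a) (partition_locus (2 * a) (replicate a 2)) d) = (\<Sum>\<mu>\<in>shapes a d. schur \<mu>)"
proof -
  have "(\<Sum>\<mu> | is_partition \<mu> (2 * a). (\<lambda>\<alpha>. int (shape_multiplicity a d \<mu>) * schur \<mu> \<alpha>)) =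
     (\<Sum>\<mu>\<in>shapes a d. (\<lambda>\<alpha>. int (shape_multiplicity a d \<mu>) * schur \<mu> \<alpha>))"
    by (rule sum.mono_neutral_right)
       (auto simp: finite_partitions shapes_def even_partitions_def shape_multiplicity_def fun_eq_iff)
  also have "\<dots> = (\<Sum>\<mu>\<in>shapes a d. schur \<mu>)"
    by (rule sum.cong) (auto simp: shape_multiplicity_def)
  finally show ?thesis using Frob_eq[OF component_map_iso[OF assms, of d]] by simp
qed

lemma component_nonzero_iff:
  assumes a: "a > 0"
  shows "carrier (orbit_component (2 * a) (partition_locus (2 * a) (replicate a 2)) d) \<noteq>
      {\<zero>\<^bsub>orbit_component (2 * a) (partition_locus (2 * a) (replicate a 2)) d\<^esub>} \<longleftrightarrow> shapes a d \<noteq> {}"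
proof -
  let ?n = "2 * a"
  let ?W = "specht_sum ?n (shape_multiplicity a d)"
  let ?V = "orbit_component ?n (partition_locus ?n (replicate a 2)) d"
  have W: "carrier ?W = (\<Pi>\<^sub>E i\<in>shapes a d \<times> {0}. carrier (specht (fst i)))"
    by (simp add: specht_sum_simps specht_indices_shapes)
  have bij: "bij_betw (component_map a d) (carrier ?W) (carrier ?V)"
    using component_map_iso[OF a] by (simp add: is_module_iso_def)
  have "relation_ideal ?n +>\<^bsub>pair_poly_ring ?n\<^esub> 0 = relation_ideal ?n"
    by (simp add: coset_eq)
  then have zero: "\<zero>\<^bsub>?V\<^esub> \<in> carrier ?V"
    using pair_poly_ring_closed(1)[of ?n]
    by (auto simp: orbit_component_def orbit_ring_def FactRing_def gr_ideal_eq_relation_ideal[OF a] homogeneous_def intro!: exI[of _ 0])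
  show ?thesis
  proof
    assume ne: "carrier ?V \<noteq> {\<zero>\<^bsub>?V\<^esub>}"
    show "shapes a d \<noteq> {}"
    proof
      assume "shapes a d = {}"
      then have "card (carrier ?W) = 1" by (simp add: W)
      then have "card (carrier ?V) = 1" using bij_betw_same_card[OF bij] by simp
      then show False using ne zero by (auto simp: card_1_singleton_iff)
    qed
  next
    assume "shapes a d \<noteq> {}"
    then obtain \<mu> where mu: "\<mu> \<in> shapes a d" by blast
    obtain t where t: "is_tableau \<mu> t" using tableau_exists by blast
    have e: "polytabloid \<mu> t \<noteq> 0" using lookup_polytabloid_self[OF t] by auto
    let ?x = "\<lambda>i\<in>shapes a d \<times> {0}. 0" and ?y = "\<lambda>i\<in>shapes a d \<times> {0}. if i = (\<mu>, 0) then polytabloid \<mu> t else 0"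
    have xW: "?x \<in> carrier ?W" and yW: "?y \<in> carrier ?W"
      unfolding W using polytabloid_in_specht[OF t] by (auto simp: specht_0_closed)
    have "?y (\<mu>, 0) = polytabloid \<mu> t" "?x (\<mu>, 0) = 0" using mu by simp_all
    then have "?x \<noteq> ?y" using e by metis
    then have "component_map a d ?x \<noteq> component_map a d ?y"
      using bij xW yW by (auto simp: bij_betw_def dest: inj_onD)
    moreover have "component_map a d ?x \<in> carrier ?V" "component_map a d ?y \<in> carrier ?V"
      using bij xW yW by (auto simp: bij_betw_def)
    ultimately show "carrier ?V \<noteq> {\<zero>\<^bsub>?V\<^esub>}" by blast
  qed
qed

lemma monom_sum: "monom (\<Sum>\<mu>\<in>A. f \<mu>) d = (\<Sum>\<mu>\<in>A. monom (f \<mu>) d)"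
proof (induction A rule: infinite_finite_induct)
  case (insert \<mu> A)
  have "monom (f \<mu> + sum f A) d = monom (f \<mu>) d + monom (sum f A) d" by (rule add_monom[symmetric])
  then show ?case by (simp only: sum.insert[OF insert.hyps] insert.IH)
qed simp_all

theorem theorem3p3:
  fixes a :: nat
  assumes "a > 0"
  shows "grFrob (2 * a) (orbit_component (2 * a) (partition_locus (2 * a) (replicate a 2))) =
           (\<Sum>\<mu> | is_partition \<mu> (2 * a) \<and> (\<forall>p \<in> set \<mu>. even p).
              monom (schur \<mu>) ((2 * a - hd \<mu>) div 2))
       \<and> gr_ideal (2 * a) (partition_locus (2 * a) (replicate a 2)) =
           Idl\<^bsub>pair_poly_ring (2 * a)\<^esub>
             ({Var S * Var T | S T. S \<in> pairs (2 * a) \<and> T \<in> pairs (2 * a) \<and> S \<inter> T \<noteq> {}} \<union>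
              {\<Sum>j \<in> {1..2 * a} - {i}. Var {i, j} | i. i \<in> {1..2 * a}})"
proof
  let ?V = "orbit_component (2 * a) (partition_locus (2 * a) (replicate a 2))"
  have "grFrob (2 * a) ?V = (\<Sum>d | shapes a d \<noteq> {}. \<Sum>\<mu>\<in>shapes a d. monom (schur \<mu>) d)"
    by (simp add: grFrob_def component_nonzero_iff[OF assms] Frob_component[OF assms] monom_sum)
  also have "\<dots> = (\<Sum>d\<le>a. \<Sum>\<mu>\<in>shapes a d. monom (schur \<mu>) d)"
  proof (rule sum.mono_neutral_left)
    show "{d. shapes a d \<noteq> {}} \<subseteq> {..a}" by (auto simp: shapes_def)
  qed simp_all
  also have "\<dots> = (\<Sum>d\<le>a. \<Sum>\<mu>\<in>shapes a d. monom (schur \<mu>) ((2 * a - hd \<mu>) div 2))"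
    by (intro sum.cong refl) (auto simp: shapes_iff[OF assms])
  also have "\<dots> = (\<Sum>\<mu>\<in>even_partitions a. monom (schur \<mu>) ((2 * a - hd \<mu>) div 2))"
    by (rule sum_shapes[OF assms])
  finally show "grFrob (2 * a) ?V = (\<Sum>\<mu> | is_partition \<mu> (2 * a) \<and> (\<forall>p\<in>set \<mu>. even p). monom (schur \<mu>) ((2 * a - hd \<mu>) div 2))"
    by (simp add: even_partitions_def)
  show "gr_ideal (2 * a) (partition_locus (2 * a) (replicate a 2)) =
           Idl\<^bsub>pair_poly_ring (2 * a)\<^esub>
             ({Var S * Var T | S T. S \<in> pairs (2 * a) \<and> T \<in> pairs (2 * a) \<and> S \<inter> T \<noteq> {}} \<union>
              {\<Sum>j \<in> {1..2 * a} - {i}. Var {i, j} | i. i \<in> {1..2 * a}})"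
    using gr_ideal_eq_relation_ideal[OF assms] unfolding relation_ideal_def relations_def .
qed

end
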